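(* White dwarf stars $\rho_\mu(|x|)$ are linearly stable for any center density $\mu>0$. Here white dwarf stars are the non-rotating stars with equation of state $P=P_{\mathrm w}$, $P_{\mathrm w}(\rho)=Af(x)$, $\rho=Bx^3$, where $A,B>0$ are constants and $$f(x)=x(x^2+1)^{\frac12}(2x^2-3)+3\ln\big(x+\sqrt{1+x^2}\big)=8\int_0^x\frac{u^4\,du}{\sqrt{1+u^2}}.$$
   Context: Non-rotating stars: define the enthalpy $\Phi$ by $\Phi(0)=\Phi'(0)=0$, $\Phi''(\rho)=P'(\rho)/\rho$. Let $F=(\Phi')^{-1}$ on $(0,s_{\max})$, $s_{\max}=\int_0^\infty \frac{P'(\rho)}{\rho}d\rho$, and let $F_+$ be its extension by zero to $(-\infty,0]$. For $\mu>0$ let $y_\mu$ be the (global, strictly decreasing) solution of $y''+\frac2r y'=-4\pi F_+(y)$, $y(0)=\Phi'(\mu)$, $y'(0)=0$. For the white dwarf equation of state (for which $\lim_{s\to0+}s^{1-\gamma_0}P'(s)>0$ with $\gamma_0=\frac53$), for every $\mu\in(0,\infty)$ there is a finite $R_\mu>0$ with $y_\mu(R_\mu)=0$; put $\rho_\mu(|x|)=F(y_\mu(|x|))$ for $|x|<R_\mu$ and $0$ otherwise, a static solution of the 3D Euler-Poisson system with center density $\mu$. Let $S_\mu=\{|x|<R_\mu\}$. Linear stability of $\rho_\mu$ means $n^u(\mu)=0$, where $n^u(\mu)$ is the total algebraic multiplicity of the unstable eigenvalues (positive real part) of the linearized Euler-Poisson operator $\mathcal J_\mu\mathcal L_\mu$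 on $\mathbf X=X_\mu\times Y_\mu$, $X_\mu=L^2_{\Phi''(\rho_\mu)}(S_\mu)$, $Y_\mu=(L^2_{\rho_\mu}(S_\mu))^3$, with $\mathcal J_\mu=\begin{pmatrix}0&B_\mu\\-B_\mu'&0\end{pmatrix}$, $\mathcal L_\mu=\begin{pmatrix}L_\mu&0\\0&A_\mu\end{pmatrix}$, $L_\mu=\Phi''(\rho_\mu)-4\pi(-\Delta)^{-1}$, $(-\Delta)^{-1}\sigma=\int_{S_\mu}\frac{\sigma(y)}{4\pi|x-y|}dy|_{S_\mu}$, $A_\mu=\rho_\mu$ (multiplication), $B_\mu=-\nabla\cdot:Y_\mu^*\to X_\mu$, $B'_\mu=\nabla:X_\mu^*\to Y_\mu$ (maximal distributional domains; duals identified via the $L^2(S_\mu)$ pairing). *)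

theory Defs
  imports "HOL-Analysis.Analysis" "HOL-Library.Extended_Nat"
begin

section \<open>The white dwarf equation of state\<close>

definition white_dwarf_f :: "real \<Rightarrow> real" where
  "white_dwarf_f x = x * sqrt (x^2 + 1) * (2 * x^2 - 3) + 3 * ln (x + sqrt (1 + x^2))"

definition white_dwarf_pressure :: "real \<Rightarrow> real \<Rightarrow> real \<Rightarrow> real" where
  "white_dwarf_pressure A B \<rho> = A * white_dwarf_f (root 3 (\<rho> / B))"

lemma white_dwarf_f_has_derivative:
  "(white_dwarf_f has_real_derivative 8 * x^4 / sqrt (1 + x^2)) (at x within T)"
proof -
  define s where "s = sqrt (x^2 + 1)"
  have s: "s > 0" "s^2 = x^2 + 1" by (auto simp: s_def add_nonneg_pos)
  have eq: "white_dwarf_f = (\<lambda>x. x * sqrt (x^2 + 1) * (2 * x^2 - 3) + 3 * arsinh x)"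
    by (auto simp: white_dwarf_f_def arsinh_real_def add.commute)
  have "(white_dwarf_f has_real_derivative
      (s + x * (x / s)) * (2 * x^2 - 3) + x * s * (4 * x) + 3 * (1 / s)) (at x within T)"
  proof -
    have r: "((\<lambda>x. sqrt (x^2 + 1)) has_real_derivative x / s) (at x within T)"
    proof -
      have p: "x^2 + 1 > 0" by (simp add: add_nonneg_pos)
      have "((\<lambda>x. x^2 + 1) has_real_derivative 2 * x) (at x within T)"
        by (auto intro!: derivative_eq_intros)
      from DERIV_chain2[where f = sqrt and g = "\<lambda>x. x^2 + 1", OF DERIV_real_sqrt[OF p] this]
      have "((\<lambda>x. sqrt (x^2 + 1)) has_real_derivative inverse s / 2 * (2 * x)) (at x within T)"
        unfolding s_def .
      also have "inverse s / 2 * (2 * x) = x / s" using s(1) by (simp add: field_simps)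
      finally show ?thesis .
    qed
    have a: "(arsinh has_real_derivative 1 / s) (at x within T)"
      unfolding s_def by (rule arsinh_real_has_field_derivative)
    have q: "((\<lambda>x. 2 * x^2 - 3) has_real_derivative 4 * x) (at x within T)"
      by (auto intro!: derivative_eq_intros)
    show ?thesis unfolding eq
      using DERIV_add[OF DERIV_mult[OF DERIV_mult[OF DERIV_ident r] q] DERIV_cmult[OF a, of 3]]
      by (simp add: s_def ac_simps)
  qed
  also have "(s + x * (x / s)) * (2 * x^2 - 3) + x * s * (4 * x) + 3 * (1 / s) = 8 * x^4 / s"
  proof -
    have "((s + x * (x / s)) * (2 * x^2 - 3) + x * s * (4 * x) + 3 * (1 / s)) * s
        = (s^2 + x^2) * (2 * x^2 - 3) + 4 * x^2 * s^2 + 3"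
      using s(1) by (simp add: field_simps power2_eq_square)
    also have "\<dots> = 8 * x^4" unfolding s(2) by algebra
    finally show ?thesis using s(1) by (metis less_irrefl nonzero_eq_divide_eq)
  qed
  finally show ?thesis by (simp add: s_def add.commute)
qed

lemma white_dwarf_f_eq_integral:
  assumes "0 \<le> x"
  shows "white_dwarf_f x = 8 * integral {0..x} (\<lambda>u. u^4 / sqrt (1 + u^2))"
proof -
  have "((\<lambda>u. 8 * u^4 / sqrt (1 + u^2)) has_integral (white_dwarf_f x - white_dwarf_f 0)) {0..x}"
    using assms white_dwarf_f_has_derivative
    by (intro fundamental_theorem_of_calculus)
       (auto simp: has_real_derivative_iff_has_vector_derivative)
  then have "integral {0..x} (\<lambda>u. 8 * (u^4 / sqrt (1 + u^2))) = white_dwarf_f x"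
    by (simp add: integral_unique white_dwarf_f_def)
  then show ?thesis by (simp only: integral_mult_right)
qed


section \<open>Non-rotating stars\<close>

text \<open>
  The enthalpy \<open>\<Phi>\<close> with \<open>\<Phi>(0) = \<Phi>'(0) = 0\<close> and \<open>\<Phi>''(\<rho>) = P'(\<rho>)/\<rho>\<close> enters only
  through its first two derivatives.
\<close>

definition enthalpy_deriv :: "(real \<Rightarrow> real) \<Rightarrow> real \<Rightarrow> real" where
  "enthalpy_deriv P \<rho> = integral {0..\<rho>} (\<lambda>s. deriv P s / s)"

definition enthalpy_deriv2 :: "(real \<Rightarrow> real) \<Rightarrow> real \<Rightarrow> real" where
  "enthalpy_deriv2 P \<rho> = deriv P \<rho> / \<rho>"

text \<open>
  This is \<open>F\<^sub>+\<close>. Its values on \<open>[s\<^sub>m\<^sub>a\<^sub>x, \<infinity>)\<close>, where \<open>F\<close> is undefined, are unspecified; in the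
  white dwarf case \<open>s\<^sub>m\<^sub>a\<^sub>x = \<infinity>\<close>, so the issue does not arise.
\<close>

definition enthalpy_inv :: "(real \<Rightarrow> real) \<Rightarrow> real \<Rightarrow> real" where
  "enthalpy_inv P s = (if s \<le> 0 then 0 else inv_into {0<..} (enthalpy_deriv P) s)"

text \<open>
  Only the restriction of \<open>y\<close> to \<open>[0, \<infinity>)\<close> matters. The derivative at \<open>r = 0\<close> is one-sided, and
  the differential equation, singular at the origin, is imposed for \<open>r > 0\<close>.
\<close>

definition stellar_profile :: "(real \<Rightarrow> real) \<Rightarrow> real \<Rightarrow> (real \<Rightarrow> real) \<Rightarrow> bool" where
  "stellar_profile P \<mu> y \<longleftrightarrow>
     y 0 = enthalpy_deriv P \<mu> \<and>
     (\<exists>y' y''.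
        (\<forall>r\<ge>0. (y has_real_derivative y' r) (at r within {0..})) \<and>
        y' 0 = 0 \<and>
        (\<forall>r>0. (y' has_real_derivative y'' r) (at r) \<and>
               y'' r + 2 / r * y' r = - 4 * pi * enthalpy_inv P (y r)))"

definition stellar_density ::
    "(real \<Rightarrow> real) \<Rightarrow> (real \<Rightarrow> real) \<Rightarrow> real \<Rightarrow> real^3 \<Rightarrow> real" where
  "stellar_density P y R x = (if norm x < R then enthalpy_inv P (y (norm x)) else 0)"


section \<open>Weighted spaces and distributional derivatives\<close>

text \<open>
  Spectra require complexified spaces, so all fields are complex-valued. Elements of the
  \<open>L\<^sup>2\<close> spaces are represented by functions; equality in these spaces is \<open>ae_zero\<close> of the
  difference.
\<close>

definition weighted_L2 ::
    "(real^3) set \<Rightarrow> (real^3 \<Rightarrow> real) \<Rightarrow> (real^3 \<Rightarrow> 'b::euclidean_space) set" where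
  "weighted_L2 S w =
     {u. set_borel_measurable lborel S u \<and>
         set_integrable lborel S (\<lambda>x. w x * (norm (u x))\<^sup>2)}"

primrec Ck :: "nat \<Rightarrow> (real^3 \<Rightarrow> real) \<Rightarrow> bool" where
  "Ck 0 f \<longleftrightarrow> continuous_on UNIV f"
| "Ck (Suc k) f \<longleftrightarrow>
     (\<exists>g :: real^3 \<Rightarrow> real^3.
        (\<forall>x. (f has_derivative (\<lambda>h. g x \<bullet> h)) (at x)) \<and> (\<forall>i. Ck k (\<lambda>x. g x $ i)))"

definition test_functions :: "(real^3) set \<Rightarrow> (real^3 \<Rightarrow> real) set" where
  "test_functions S =
     {\<phi>. (\<forall>k. Ck k \<phi>) \<and> compact (closure {x. \<phi> x \<noteq> 0}) \<and> closure {x. \<phi> x \<noteq> 0} \<subseteq> S}"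

definition partial :: "3 \<Rightarrow> (real^3 \<Rightarrow> real) \<Rightarrow> real^3 \<Rightarrow> real" where
  "partial i \<phi> x = frechet_derivative \<phi> (at x) (axis i 1)"

definition locally_integrable :: "(real^3) set \<Rightarrow> (real^3 \<Rightarrow> 'b::euclidean_space) \<Rightarrow> bool" where
  "locally_integrable S u \<longleftrightarrow> (\<forall>K. compact K \<and> K \<subseteq> S \<longrightarrow> set_integrable lborel K u)"

definition has_weak_gradient ::
    "(real^3) set \<Rightarrow> (real^3 \<Rightarrow> complex) \<Rightarrow> (real^3 \<Rightarrow> complex^3) \<Rightarrow> bool" where
  "has_weak_gradient S h v \<longleftrightarrow>
     locally_integrable S h \<and> locally_integrable S v \<and>
     (\<forall>\<phi>\<in>test_functions S. \<forall>i.
        (LINT x:S|lborel. h x * complex_of_real (partial i \<phi> x)) =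
        - (LINT x:S|lborel. v x $ i * complex_of_real (\<phi> x)))"

definition has_weak_divergence ::
    "(real^3) set \<Rightarrow> (real^3 \<Rightarrow> complex^3) \<Rightarrow> (real^3 \<Rightarrow> complex) \<Rightarrow> bool" where
  "has_weak_divergence S v d \<longleftrightarrow>
     locally_integrable S v \<and> locally_integrable S d \<and>
     (\<forall>\<phi>\<in>test_functions S.
        (LINT x:S|lborel. (\<Sum>i\<in>UNIV. v x $ i * complex_of_real (partial i \<phi> x))) =
        - (LINT x:S|lborel. d x * complex_of_real (\<phi> x)))"


section \<open>The linearized Euler-Poisson operator\<close>

text \<open>
  With duals identified through the \<open>L\<^sup>2(S)\<close> pairing, the dual of a weighted space carries the
  reciprocal weight.
\<close>

definition X_space :: "(real \<Rightarrow> real) \<Rightarrow> (real^3) set \<Rightarrow> (real^3 \<Rightarrow> real) \<Rightarrow> (real^3 \<Rightarrow> complex) set" where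
  "X_space P S \<rho> = weighted_L2 S (\<lambda>x. enthalpy_deriv2 P (\<rho> x))"

definition X_dual :: "(real \<Rightarrow> real) \<Rightarrow> (real^3) set \<Rightarrow> (real^3 \<Rightarrow> real) \<Rightarrow> (real^3 \<Rightarrow> complex) set" where
  "X_dual P S \<rho> = weighted_L2 S (\<lambda>x. 1 / enthalpy_deriv2 P (\<rho> x))"

definition Y_space :: "(real^3) set \<Rightarrow> (real^3 \<Rightarrow> real) \<Rightarrow> (real^3 \<Rightarrow> complex^3) set" where
  "Y_space S \<rho> = weighted_L2 S \<rho>"

definition Y_dual :: "(real^3) set \<Rightarrow> (real^3 \<Rightarrow> real) \<Rightarrow> (real^3 \<Rightarrow> complex^3) set" where
  "Y_dual S \<rho> = weighted_L2 S (\<lambda>x. 1 / \<rho> x)"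

type_synonym state = "(real^3 \<Rightarrow> complex) \<times> (real^3 \<Rightarrow> complex^3)"

text \<open>
  Unbounded operators are given by their graphs, a pair of arguments of \<open>B_graph\<close>,
  \<open>B'_graph\<close>, \<open>J_graph\<close>, \<open>JL_graph\<close> being an element of the domain and (a representative of)
  its image.
\<close>

definition B_graph ::
    "(real \<Rightarrow> real) \<Rightarrow> (real^3) set \<Rightarrow> (real^3 \<Rightarrow> real) \<Rightarrow>
     (real^3 \<Rightarrow> complex^3) \<Rightarrow> (real^3 \<Rightarrow> complex) \<Rightarrow> bool" where
  "B_graph P S \<rho> w \<tau> \<longleftrightarrow>
     w \<in> Y_dual S \<rho> \<and> \<tau> \<in> X_space P S \<rho> \<and> has_weak_divergence S w (\<lambda>x. - \<tau> x)"

definition B'_graph ::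
    "(real \<Rightarrow> real) \<Rightarrow> (real^3) set \<Rightarrow> (real^3 \<Rightarrow> real) \<Rightarrow>
     (real^3 \<Rightarrow> complex) \<Rightarrow> (real^3 \<Rightarrow> complex^3) \<Rightarrow> bool" where
  "B'_graph P S \<rho> h v \<longleftrightarrow>
     h \<in> X_dual P S \<rho> \<and> v \<in> Y_space S \<rho> \<and> has_weak_gradient S h v"

definition J_graph ::
    "(real \<Rightarrow> real) \<Rightarrow> (real^3) set \<Rightarrow> (real^3 \<Rightarrow> real) \<Rightarrow> state \<Rightarrow> state \<Rightarrow> bool" where
  "J_graph P S \<rho> p q \<longleftrightarrow>
     B_graph P S \<rho> (snd p) (fst q) \<and> B'_graph P S \<rho> (fst p) (\<lambda>x. - snd q x)"

definition inv_laplacian :: "(real^3) set \<Rightarrow> (real^3 \<Rightarrow> complex) \<Rightarrow> real^3 \<Rightarrow> complex" where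
  "inv_laplacian S \<sigma> x = (LINT z:S|lborel. \<sigma> z / complex_of_real (4 * pi * norm (x - z)))"

definition L_op ::
    "(real \<Rightarrow> real) \<Rightarrow> (real^3) set \<Rightarrow> (real^3 \<Rightarrow> real) \<Rightarrow> (real^3 \<Rightarrow> complex) \<Rightarrow> real^3 \<Rightarrow> complex" where
  "L_op P S \<rho> \<sigma> x =
     complex_of_real (enthalpy_deriv2 P (\<rho> x)) * \<sigma> x
     - complex_of_real (4 * pi) * inv_laplacian S \<sigma> x"

definition A_op :: "(real^3 \<Rightarrow> real) \<Rightarrow> (real^3 \<Rightarrow> complex^3) \<Rightarrow> real^3 \<Rightarrow> complex^3" where
  "A_op \<rho> v x = \<rho> x *\<^sub>R v x"

definition JL_graph ::
    "(real \<Rightarrow> real) \<Rightarrow> (real^3) set \<Rightarrow> (real^3 \<Rightarrow> real) \<Rightarrow> state \<Rightarrow> state \<Rightarrow> bool" where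
  "JL_graph P S \<rho> p q \<longleftrightarrow>
     fst p \<in> X_space P S \<rho> \<and> snd p \<in> Y_space S \<rho> \<and>
     J_graph P S \<rho> (L_op P S \<rho> (fst p), A_op \<rho> (snd p)) q"


section \<open>Unstable eigenvalues and linear stability\<close>

definition ae_zero :: "(real^3) set \<Rightarrow> state \<Rightarrow> bool" where
  "ae_zero S p \<longleftrightarrow> (AE x in lborel. x \<in> S \<longrightarrow> fst p x = 0 \<and> snd p x = 0)"

definition state_scale :: "complex \<Rightarrow> state \<Rightarrow> state" where
  "state_scale c p = ((\<lambda>x. c * fst p x), (\<lambda>x. c *s snd p x))"

definition state_diff :: "state \<Rightarrow> state \<Rightarrow> state" where
  "state_diff p q = ((\<lambda>x. fst p x - fst q x), (\<lambda>x. snd p x - snd q x))"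

definition state_lincomb :: "state set \<Rightarrow> (state \<Rightarrow> complex) \<Rightarrow> state" where
  "state_lincomb E c = ((\<lambda>x. \<Sum>p\<in>E. c p * fst p x), (\<lambda>x. \<Sum>p\<in>E. c p *s snd p x))"

definition ae_independent :: "(real^3) set \<Rightarrow> state set \<Rightarrow> bool" where
  "ae_independent S E \<longleftrightarrow>
     finite E \<and> (\<forall>c. ae_zero S (state_lincomb E c) \<longrightarrow> (\<forall>p\<in>E. c p = 0))"

text \<open>
  The complex dimension of a subspace modulo almost everywhere equality, \<open>\<infinity>\<close> if it is not
  finite-dimensional.
\<close>

definition ae_dim :: "(real^3) set \<Rightarrow> state set \<Rightarrow> enat" where
  "ae_dim S V = (SUP E\<in>{E. E \<subseteq> V \<and> ae_independent S E}. enat (card E))"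

primrec power_kernel ::
    "(real \<Rightarrow> real) \<Rightarrow> (real^3) set \<Rightarrow> (real^3 \<Rightarrow> real) \<Rightarrow> complex \<Rightarrow> nat \<Rightarrow> state set" where
  "power_kernel P S \<rho> z 0 =
     {p. fst p \<in> X_space P S \<rho> \<and> snd p \<in> Y_space S \<rho> \<and> ae_zero S p}"
| "power_kernel P S \<rho> z (Suc k) =
     {p. \<exists>q. JL_graph P S \<rho> p q \<and> state_diff (state_scale z p) q \<in> power_kernel P S \<rho> z k}"

definition algebraic_multiplicity ::
    "(real \<Rightarrow> real) \<Rightarrow> (real^3) set \<Rightarrow> (real^3 \<Rightarrow> real) \<Rightarrow> complex \<Rightarrow> enat" where
  "algebraic_multiplicity P S \<rho> z = ae_dim S (\<Union>k. power_kernel P S \<rho> z k)"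

definition unstable_eigenvalues ::
    "(real \<Rightarrow> real) \<Rightarrow> (real^3) set \<Rightarrow> (real^3 \<Rightarrow> real) \<Rightarrow> complex set" where
  "unstable_eigenvalues P S \<rho> =
     {z. Re z > 0 \<and> (\<exists>p. JL_graph P S \<rho> p (state_scale z p) \<and> \<not> ae_zero S p)}"

text \<open>The supremum of the finite partial sums is the (possibly infinite) total multiplicity.\<close>

definition unstable_dimension ::
    "(real \<Rightarrow> real) \<Rightarrow> (real^3) set \<Rightarrow> (real^3 \<Rightarrow> real) \<Rightarrow> enat" where
  "unstable_dimension P S \<rho> =
     (SUP Z\<in>{Z. finite Z \<and> Z \<subseteq> unstable_eigenvalues P S \<rho>}.
        \<Sum>z\<in>Z. algebraic_multiplicity P S \<rho> z)"

definition linearly_stable :: "(real \<Rightarrow> real) \<Rightarrow> (real \<Rightarrow> real) \<Rightarrow> real \<Rightarrow> bool" where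
  "linearly_stable P y R \<longleftrightarrow> unstable_dimension P (ball 0 R) (stellar_density P y R) = 0"

end

theory Submission
  imports Defs
begin

text \<open>
  Let \<open>(\<sigma>, v)\<close> be an eigenvector for an eigenvalue \<open>z\<close> with positive real part. Pairing the equations with
  \<open>L \<sigma>\<close> (a Hardy inequality near the boundary makes the divergence and the gradient adjoint to each other)
  gives \<open>z \<langle>\<sigma>, L \<sigma>\<rangle> = - cnj z \<integral>\<rho>\<bar>v\<bar>\<^sup>2\<close>, so an eigenvector with \<open>\<langle>\<sigma>, L \<sigma>\<rangle> >= 0\<close> vanishes. The part of the eigenvector
  that is odd under the reflection in a plane through the centre is again an eigenvector; its energy is nonnegative by a
  Schur test against \<open>\<partial>\<^sub>e \<rho>\<close>, which is annihilated by \<open>L\<close>. Hence \<open>\<sigma>\<close> is invariant under all reflections, so it is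
  radial, and it has mean zero because it is a divergence. On radial functions of mean zero the energy is nonnegative by a
  weighted Hardy inequality whose supersolution \<open>4\<pi>r\<^sup>3\<rho>\<close> comes from homologous contractions; this is where the
  white dwarf equation of state enters.
\<close>

section \<open>Smooth functions\<close>

text \<open>The density vanishes at the surface like the power 3/2 of the boundary distance, the
  inverse weight 1 / \<alpha> like the power 1/2. With maximal distributional domains nothing is
  known about an eigenvector at the boundary beyond weighted integrability, so integration by parts
  passes through interior cutoffs. Their error has size \<rho> |h|^2 / \<delta>^2, about |h|^2 /
  \<surd>\<delta>, which is what Hardy's inequality makes integrable.

  Reflections take the place of spherical harmonics. The Newtonian kernel folded over a mirror has a
  known sign, as a Schur test demands, and reflections act transitively on spheres, so that removing
  all odd parts leaves radial functions only.

  The equation of state enters through the logarithmic slope of 4\<pi>r^3\<rho>, which has the sign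
  of \<theta> = 3F / F' + r y'. In \<theta>' the enthalpy contributes y' (1 + 1 / c^2) and the
  Poisson equation - y' - 4\<pi>rF; the remainder y' / c^2 is negative. For a pressure exponent 4/3,
  the limit of large c, this margin would be zero.\<close>

definition smooth :: "(real^3 => real) => bool" where
  "smooth f \<longleftrightarrow> (\<forall>k. Ck k f)"

lemma has_derivative_inner_axis:
  "(f has_derivative (%h. g \<bullet> h)) (at x) ==> partial i f x = g $ i" for g :: "real^3"
  unfolding partial_def by (subst frechet_derivative_at[symmetric], assumption) (simp add: inner_axis)

lemma Ck_Suc_imp: "Ck (Suc k) f ==> Ck k f"
proof (induction k arbitrary: f)
  case 0
  then obtain g where g: "!!x. (f has_derivative (%h. g x \<bullet> h)) (at x)" by auto
  then show ?case
    by (auto intro!: has_derivative_continuous continuous_at_imp_continuous_on)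
next
  case (Suc k)
  then obtain g where g: "!!x. (f has_derivative (%h. g x \<bullet> h)) (at x)" "!!i. Ck (Suc k) (%x. g x $ i)"
    by (subst (asm) Ck.simps) auto
  then show ?case using Suc.IH[OF g(2)] by auto
qed

lemma Ck_const: "Ck k (%x. c)"
proof (induction k arbitrary: c)
  case (Suc k)
  have "(\<bullet>) (0::real^3) = (%h. 0)" by auto
  then show ?case using Suc[of 0] by (auto intro!: exI[of _ "%x. 0"])
qed simp

lemma Ck_nth: "Ck k (%x. x $ i)"
proof (cases k)
  case 0
  then show ?thesis by (auto intro!: continuous_intros)
next
  case (Suc k)
  have "((%x. x $ i) has_derivative (%h. axis i 1 \<bullet> h)) (at x)" for x :: "real^3"
    by (simp add: inner_axis' bounded_linear_imp_has_derivative bounded_linear_vec_nth)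
  then show ?thesis unfolding Suc by (auto simp: Ck_const intro!: exI[of _ "%x. axis i 1"])
qed

lemma Ck_add: "Ck k f ==> Ck k g ==> Ck k (%x. f x + g x)"
proof (induction k arbitrary: f g)
  case (Suc k)
  obtain f' where f: "!!x. (f has_derivative (%h. f' x \<bullet> h)) (at x)" "!!i. Ck k (%x. f' x $ i)"
    using Suc.prems by auto
  obtain g' where g: "!!x. (g has_derivative (%h. g' x \<bullet> h)) (at x)" "!!i. Ck k (%x. g' x $ i)"
    using Suc.prems by auto
  have "((%x. f x + g x) has_derivative (%h. (f' x + g' x) \<bullet> h)) (at x)" for x
    using f(1)[of x] g(1)[of x] by (auto intro!: derivative_eq_intros simp: inner_add_left)
  then show ?case using Suc.IH f(2) g(2) by (auto intro!: exI[of _ "%x. f' x + g' x"])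
qed (auto intro!: continuous_intros)

lemma Ck_mult: "Ck k f ==> Ck k g ==> Ck k (%x. f x * g x)"
proof (induction k arbitrary: f g)
  case (Suc k)
  obtain f' where f: "!!x. (f has_derivative (%h. f' x \<bullet> h)) (at x)" "!!i. Ck k (%x. f' x $ i)"
    using Suc.prems by auto
  obtain g' where g: "!!x. (g has_derivative (%h. g' x \<bullet> h)) (at x)" "!!i. Ck k (%x. g' x $ i)"
    using Suc.prems by auto
  have "((%x. f x * g x) has_derivative (%h. (f x *\<^sub>R g' x + g x *\<^sub>R f' x) \<bullet> h)) (at x)" for x
    using f(1)[of x] g(1)[of x] by (auto intro!: derivative_eq_intros simp: inner_add_left algebra_simps)
  moreover have "Ck k (%x. (f x *\<^sub>R g' x + g x *\<^sub>R f' x) $ i)" for i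
    using Suc.IH[OF Ck_Suc_imp[OF Suc.prems(1)] g(2)] Suc.IH[OF Ck_Suc_imp[OF Suc.prems(2)] f(2)]
    by (auto intro!: Ck_add)
  ultimately show ?case by (auto intro!: exI[of _ "%x. f x *\<^sub>R g' x + g x *\<^sub>R f' x"])
qed (auto intro!: continuous_intros)

lemma smooth_const [intro, simp]: "smooth (%x. c)" by (simp add: smooth_def Ck_const)
lemma smooth_nth [intro, simp]: "smooth (%x. x $ i)" by (simp add: smooth_def Ck_nth)
lemma smooth_add [intro]: "smooth f ==> smooth g ==> smooth (%x. f x + g x)" by (simp add: smooth_def Ck_add)
lemma smooth_mult [intro]: "smooth f ==> smooth g ==> smooth (%x. f x * g x)" by (simp add: smooth_def Ck_mult)

lemma smooth_diff [intro]: "smooth f ==> smooth g ==> smooth (%x. f x - g x)"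
  using smooth_add[of f "%x. -1 * g x"] smooth_mult[of "%x. -1" g] by simp

lemma smooth_sum: "(!!i. i \<in> A ==> smooth (f i)) ==> smooth (%x. \<Sum>i\<in>A. f i x)"
  by (induction A rule: infinite_finite_induct) auto

lemma smooth_norm_sq [intro, simp]: "smooth (%x. (norm (x - y))\<^sup>2)"
proof -
  have eq: "(%x. (norm (x - y))\<^sup>2) = (%x. \<Sum>i\<in>UNIV. (x $ i - y $ i) * (x $ i - y $ i))"
    by (simp add: power2_norm_eq_inner inner_vec_def)
  show ?thesis unfolding eq by (rule smooth_sum) (rule smooth_mult; rule smooth_diff[OF smooth_nth smooth_const])
qed

text \<open>Each order k supplies its own gradient. Uniqueness of derivatives identifies all of them
  with the vector of partial derivatives, so one gradient serves every order.\<close>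

lemma smooth_gradient:
  assumes "smooth f"
  obtains g where "!!x. (f has_derivative (%h. g x \<bullet> h)) (at x)" "!!i. smooth (%x. g x $ i)"
    "!!i. partial i f = (%x. g x $ i)"
proof -
  have "\<exists>g. (\<forall>x. (f has_derivative (%h. g x \<bullet> h)) (at x)) & (\<forall>i. Ck k (%x. g x $ i))" for k
  proof -
    have "Ck (Suc k) f" using assms by (simp only: smooth_def)
    then show ?thesis by (simp only: Ck.simps)
  qed
  then obtain G where G: "!!k. (\<forall>x. (f has_derivative (%h. G k x \<bullet> h)) (at x)) & (\<forall>i. Ck k (%x. G k x $ i))"
    by (rule that[OF someI_ex])
  have p: "partial i f = (%x. G k x $ i)" for i k
    using has_derivative_inner_axis[OF spec[OF conjunct1[OF G]]] by (intro ext)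
  show ?thesis
  proof
    show "(f has_derivative (%h. G 0 x \<bullet> h)) (at x)" for x using G[of 0] by (elim conjE allE)
    show "partial i f = (%x. G 0 x $ i)" for i by (rule p)
    have "Ck k (%x. G 0 x $ i)" for i k
      using conjunct2[OF G[of k]] unfolding p[of _ k, symmetric] p[of _ 0, symmetric] by (rule spec)
    then show "smooth (%x. G 0 x $ i)" for i unfolding smooth_def by (rule allI)
  qed
qed

lemma smooth_has_derivative:
  assumes "smooth f"
  shows "(f has_derivative (%h. (\<chi> i. partial i f x) \<bullet> h)) (at x)"
proof -
  obtain g where g: "!!x. (f has_derivative (%h. g x \<bullet> h)) (at x)"
      "!!i. smooth (%x. g x $ i)" "!!i. partial i f = (%x. g x $ i)"
    by (rule smooth_gradient[OF assms]) (rule that)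
  have "(\<chi> i. partial i f x) = g x" unfolding g(3) by (rule vec_nth_inverse)
  then show ?thesis using g(1) by (simp only:)
qed

lemma smooth_partial: "smooth f ==> smooth (partial i f)"
  by (erule smooth_gradient) simp

lemma smooth_continuous: "smooth f ==> continuous_on UNIV f"
  unfolding smooth_def using Ck.simps(1) by blast

lemma partial_mult:
  assumes "smooth f" "smooth g"
  shows "partial i (%x. f x * g x) x = partial i f x * g x + f x * partial i g x"
proof -
  note d = has_derivative_mult[OF smooth_has_derivative[OF assms(1)] smooth_has_derivative[OF assms(2)]]
  have "((%x. f x * g x) has_derivative
      (%h. (f x *\<^sub>R (\<chi> i. partial i g x) + g x *\<^sub>R (\<chi> i. partial i f x)) \<bullet> h)) (at x)"
    using d[of x] by (simp add: inner_add_left algebra_simps)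
  from has_derivative_inner_axis[OF this] show ?thesis by simp
qed

lemma partial_chain:
  assumes "smooth f" "(p has_real_derivative p') (at (f x))"
  shows "partial i (%x. p (f x)) x = p' * partial i f x"
proof -
  have "((%x. p (f x)) has_derivative (%h. (\<chi> i. partial i f x) \<bullet> h * p')) (at x)"
    using DERIV_compose_FDERIV[OF assms(2) smooth_has_derivative[OF assms(1)]] by simp
  then have "((%x. p (f x)) has_derivative (%h. (p' *\<^sub>R (\<chi> i. partial i f x)) \<bullet> h)) (at x)"
    by (simp add: mult.commute)
  from has_derivative_inner_axis[OF this] show ?thesis by simp
qed

text \<open>The derivative \<open>p'\<close> is given as a function of the point x, already composed
  with f, so that an induction on k can feed its hypothesis for the differentiated function directly
  into the last premise.\<close>

lemma Ck_Suc_chain: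
  assumes "smooth f" "!!x. (p has_real_derivative p' x) (at (f x))" "Ck k p'"
  shows "Ck (Suc k) (%x. p (f x))"
proof -
  have "((%x. p (f x)) has_derivative (%h. (p' x *\<^sub>R (\<chi> i. partial i f x)) \<bullet> h)) (at x)" for x
    using DERIV_compose_FDERIV[OF assms(2) smooth_has_derivative[OF assms(1)]] by (simp add: mult.commute)
  moreover have "Ck k (%x. (p' x *\<^sub>R (\<chi> i. partial i f x)) $ i)" for i
    using Ck_mult[OF assms(3)] smooth_partial[OF assms(1), of i] by (simp add: smooth_def)
  ultimately show ?thesis unfolding Ck.simps
    by (intro exI[where x = "%x. p' x *\<^sub>R (\<chi> i. partial i f x)"] conjI allI)
qed

lemma smooth_powr:
  assumes "smooth f" "!!x. f x > 0"
  shows "smooth (%x. f x powr a)"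
proof -
  have "Ck k (%x. f x powr a)" for k
  proof (induction k arbitrary: a)
    case 0
    then show ?case using smooth_continuous[OF assms(1)] assms(2)
      by (auto intro!: continuous_intros simp: less_imp_neq[symmetric] order.strict_iff_not)
  next
    case (Suc k)
    show ?case
    proof (rule Ck_Suc_chain[OF assms(1)])
      show "((%t. t powr a) has_real_derivative a * f x powr (a - 1)) (at (f x))" for x
        using assms(2)[of x] by (rule has_real_derivative_powr)
      show "Ck k (%x. a * f x powr (a - 1))" by (intro Ck_mult Ck_const Suc)
    qed
  qed
  then show ?thesis by (simp add: smooth_def)
qed

section \<open>A flat function and its derivatives\<close>

definition exp_flat :: "nat => real => real" where
  "exp_flat j t = (if t > 0 then exp (- 1 / t) / t ^ j else 0)"

lemma exp_flat_nonneg: "exp_flat j t >= 0" by (simp add: exp_flat_def)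

lemma exp_flat_pos: "t > 0 ==> exp_flat j t > 0" by (simp add: exp_flat_def)

text \<open>A single term of the exponential series, (1/t)^(j+1) / (j+1)!, is at most exp
  (1/t).\<close>

lemma exp_flat_bound: "exp_flat j t <= fact (Suc j) * \<bar>t\<bar>"
proof (cases "t > 0")
  case True
  have "(1 / t) ^ Suc j / fact (Suc j) <= exp (1 / t)"
  proof -
    have "(\<Sum>k\<in>{Suc j}. (1/t) ^ k /\<^sub>R fact k) <= (\<Sum>k. (1/t) ^ k /\<^sub>R fact k)"
      using True by (intro sum_le_suminf summable_exp_generic) auto
    then show ?thesis unfolding exp_def by (simp add: divide_inverse mult.commute)
  qed
  then have "(1 / t) ^ Suc j <= fact (Suc j) * exp (1 / t)"
    by (simp only: divide_le_eq fact_gt_zero if_True mult.commute)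
  then have "exp (- 1 / t) * (1 / t) ^ Suc j <= exp (- 1 / t) * (fact (Suc j) * exp (1 / t))"
    by (rule mult_left_mono) simp
  also have "\<dots> = fact (Suc j) * (exp (- 1 / t) * exp (1 / t))" by (simp only: ac_simps)
  also have "exp (- 1 / t) * exp (1 / t) = 1" by (simp flip: exp_add)
  finally have "exp (- 1 / t) / t ^ j / t <= fact (Suc j)"
    by (simp add: power_divide mult.commute mult.left_commute del: fact_Suc)
  then show ?thesis using True by (simp add: exp_flat_def divide_le_eq mult_ac del: fact_Suc)
qed (simp only: exp_flat_def if_False mult_nonneg_nonneg fact_ge_zero abs_ge_zero)

text \<open>The index j makes the family closed under differentiation up to linear combinations, so
  smoothness follows by one induction over all j at once.\<close>

lemma exp_flat_deriv:
  "(exp_flat j has_real_derivative exp_flat (j + 2) t - j * exp_flat (j + 1) t) (at t)"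
proof -
  consider "t > 0" | "t < 0" | "t = 0" by linarith
  then show ?thesis
  proof cases
    case 1
    have "((%t. exp (- 1 / t) * inverse (t ^ j)) has_real_derivative
        exp (- 1 / t) * (1 / t\<^sup>2) * inverse (t ^ j) + exp (- 1 / t) * (- (j * t ^ (j - 1) * inverse (t ^ j) * inverse (t ^ j)))) (at t)"
      using 1 by (auto intro!: derivative_eq_intros simp: power2_eq_square)
    moreover have "exp (- 1 / t) * (1 / t\<^sup>2) * inverse (t ^ j) = exp_flat (j + 2) t"
      using 1 by (simp add: exp_flat_def power_add divide_inverse power2_eq_square)
    moreover have "exp (- 1 / t) * (- (j * t ^ (j - 1) * inverse (t ^ j) * inverse (t ^ j))) = - (j * exp_flat (j + 1) t)"
      using 1 by (cases j) (simp_all add: exp_flat_def divide_inverse)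
    ultimately have "((%t. exp (- 1 / t) * inverse (t ^ j)) has_real_derivative exp_flat (j + 2) t - j * exp_flat (j + 1) t) (at t)"
      by (simp only: diff_conv_add_uminus)
    then have "((%t. exp (- 1 / t) / t ^ j) has_real_derivative exp_flat (j + 2) t - j * exp_flat (j + 1) t) (at t)"
      by (simp only: divide_inverse)
    moreover have "\<forall>\<^sub>F s in nhds t. exp_flat j s = exp (- 1 / s) / s ^ j"
      using eventually_nhds_in_open[of "{0<..}" t] 1 by (auto elim!: eventually_mono simp: exp_flat_def)
    ultimately show ?thesis by (subst DERIV_cong_ev[OF refl _ refl])
  next
    case 2
    have "\<forall>\<^sub>F s in nhds t. exp_flat j s = 0"
      using eventually_nhds_in_open[of "{..<0}" t] 2 by (auto elim!: eventually_mono simp: exp_flat_def)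
    then show ?thesis using 2 by (subst DERIV_cong_ev[OF refl _ refl]) (auto simp: exp_flat_def)
  next
    case 3
    \<comment> \<open>For h > 0 the difference quotient at the origin is
      \<open>exp_flat (Suc j)\<close>, which the linear bound sends to 0.\<close>
    have "((%h. exp_flat j h / h) \<longlongrightarrow> 0) (at 0)"
    proof (rule Lim_null_comparison)
      have "norm (exp_flat j h / h) <= fact (Suc (Suc j)) * \<bar>h\<bar>" for h
      proof (cases "h > 0")
        case True
        then have "norm (exp_flat j h / h) = exp_flat (Suc j) h" by (simp add: exp_flat_def)
        then show ?thesis using exp_flat_bound[of "Suc j" h] by simp
      next
        case False
        then show ?thesis by (simp only: exp_flat_def if_False div_0 norm_zero mult_nonneg_nonneg fact_ge_zero abs_ge_zero)
      qed
      then show "\<forall>\<^sub>F h in at 0. norm (exp_flat j h / h) <= fact (Suc (Suc j)) * \<bar>h\<bar>" by simp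
      show "((%h::real. fact (Suc (Suc j)) * \<bar>h\<bar>) \<longlongrightarrow> 0) (at 0)"
        by (auto intro!: tendsto_eq_intros)
    qed
    then show ?thesis unfolding 3 by (simp add: DERIV_def exp_flat_def)
  qed
qed

lemma smooth_exp_flat:
  assumes "smooth f"
  shows "smooth (%x. exp_flat j (f x))"
proof -
  have "Ck k (%x. exp_flat j (f x))" for k
  proof (induction k arbitrary: j)
    case 0
    have "continuous_on UNIV (exp_flat j)"
      using exp_flat_deriv DERIV_isCont by (blast intro: continuous_at_imp_continuous_on)
    then show ?case using smooth_continuous[OF assms]
      by (auto intro: continuous_on_compose2)
  next
    case (Suc k)
    have "Ck k (%x. exp_flat (j + 2) (f x) + (- real j) * exp_flat (j + 1) (f x))"
      by (intro Ck_add Ck_mult Ck_const Suc)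
    then have "Ck k (%x. exp_flat (j + 2) (f x) - real j * exp_flat (j + 1) (f x))"
      by (simp only: diff_conv_add_uminus minus_mult_left)
    then show ?case by (rule Ck_Suc_chain[OF assms exp_flat_deriv])
  qed
  then show ?thesis by (simp add: smooth_def)
qed

section \<open>Test functions\<close>

lemma test_functionsI:
  assumes "smooth \<phi>" "compact K" "K \<subseteq> S" "!!x. x \<notin> K ==> \<phi> x = 0"
  shows "\<phi> \<in> test_functions S"
proof -
  have sub: "{x. \<phi> x ~= 0} \<subseteq> K" using assms(4) by auto
  then have "closure {x. \<phi> x ~= 0} \<subseteq> K"
    by (rule closure_minimal) (rule compact_imp_closed[OF assms(2)])
  moreover have "compact (closure {x. \<phi> x ~= 0})"
    using bounded_subset[OF compact_imp_bounded[OF assms(2)] sub] by (simp add: compact_closure)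
  ultimately show ?thesis
    using assms(1,3) unfolding test_functions_def smooth_def by (intro CollectI conjI) (assumption, auto)
qed

lemma test_functionsE:
  assumes "\<phi> \<in> test_functions S"
  obtains K where "smooth \<phi>" "compact K" "K \<subseteq> S" "!!x. x \<notin> K ==> \<phi> x = 0"
    "!!x i. x \<notin> K ==> partial i \<phi> x = 0"
proof -
  define K where "K = closure {x. \<phi> x ~= 0}"
  have K: "smooth \<phi>" "compact K" "K \<subseteq> S"
    using assms by (simp_all add: test_functions_def smooth_def K_def)
  have out: "\<phi> x = 0" if "x \<notin> K" for x
    using closure_subset[of "{x. \<phi> x ~= 0}"] that unfolding K_def[symmetric] by (auto simp: subset_iff)
  have "partial i \<phi> x = 0" if "x \<notin> K" for x i
  proof -
    have "((%x. 0) has_derivative (%h. 0)) (at x)" by (rule has_derivative_const)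
    moreover have "open (- K)" using compact_imp_closed[OF K(2)] by (rule open_Compl)
    moreover have "x \<in> - K" using that by simp
    moreover have "0 = \<phi> y" if "y \<in> - K" for y using out[of y] that by simp
    ultimately have "(\<phi> has_derivative (%h. 0)) (at x)"
      by (rule has_derivative_transform_within_open)
    then have "(\<phi> has_derivative (%h. 0 \<bullet> h)) (at x)" by (simp only: inner_zero_left)
    then show ?thesis using has_derivative_inner_axis[of \<phi> 0 x i] by simp
  qed
  from that[OF K out this] show ?thesis .
qed

lemma test_functions_mult:
  assumes "\<phi> \<in> test_functions S" "smooth f"
  shows "(%x. \<phi> x * f x) \<in> test_functions S"
proof -
  obtain K where K: "smooth \<phi>" "compact K" "K \<subseteq> S" "!!x. x \<notin> K ==> \<phi> x = 0"
    by (rule test_functionsE[OF assms(1)]) (rule that)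
  show ?thesis by (rule test_functionsI[OF smooth_mult[OF K(1) assms(2)] K(2,3)]) (simp add: K(4))
qed

section \<open>Continuity of translations and mollification\<close>

lemma integrable_translate:
  fixes f :: "'a::euclidean_space => 'b::{banach, second_countable_topology}"
  assumes "integrable lborel f"
  shows "integrable lborel (%x. f (t + x))"
  using integrable_distr[of "(+) t" lborel borel f] assms by (simp add: lborel_distr_plus)

lemma integral_translate:
  fixes f :: "'a::euclidean_space => 'b::{banach, second_countable_topology}"
  assumes "f \<in> borel_measurable borel"
  shows "(\<integral>x. f (t + x) \<partial>lborel) = (\<integral>x. f x \<partial>lborel)"
  using integral_distr[of "(+) t" lborel borel f] assms by (simp add: lborel_distr_plus)

text \<open>Continuity at 0 of the translation action in L1, phrased with sequences so that
  dominated convergence applies.\<close>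

definition translation_continuous :: "('a::euclidean_space => 'b::{banach, second_countable_topology}) => bool" where
  "translation_continuous f \<longleftrightarrow>
     (\<forall>t. t \<longlonglongrightarrow> 0 --> (%n. \<integral>x. norm (f (t n + x) - f x) \<partial>lborel) \<longlonglongrightarrow> 0)"

text \<open>The property is closed in L1: translations preserve the L1 norm, so an approximant
  within e / 3 serves the shifted and the unshifted function alike.\<close>

lemma translation_continuous_approx:
  fixes f :: "'a::euclidean_space => 'b::{banach, second_countable_topology}"
  assumes f: "integrable lborel f"
    and approx: "!!e. e > 0 ==> \<exists>g. integrable lborel g & translation_continuous g & (\<integral>x. norm (f x - g x) \<partial>lborel) < e"
  shows "translation_continuous f"
  unfolding translation_continuous_def
proof (intro allI impI LIMSEQ_I)
  fix t :: "nat => 'a" and e :: real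
  assume t: "t \<longlonglongrightarrow> 0" and e: "0 < e"
  obtain g where g: "integrable lborel g" "translation_continuous g" "(\<integral>x. norm (f x - g x) \<partial>lborel) < e / 3"
    using approx[of "e / 3"] e by auto
  from g(2) t have "(%n. \<integral>x. norm (g (t n + x) - g x) \<partial>lborel) \<longlonglongrightarrow> 0"
    by (simp add: translation_continuous_def)
  from LIMSEQ_D[OF this, of "e / 3"] e obtain N
    where N: "!!n. n >= N ==> (\<integral>x. norm (g (t n + x) - g x) \<partial>lborel) < e / 3" by auto
  show "\<exists>no. \<forall>n\<ge>no. norm ((\<integral>x. norm (f (t n + x) - f x) \<partial>lborel) - 0) < e"
  proof (intro exI allI impI)
    fix n assume n: "n >= N"
    note ft = integrable_translate[OF f, of "t n"] and gt = integrable_translate[OF g(1), of "t n"]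
    have i1: "integrable lborel (%x. norm (f (t n + x) - g (t n + x)))"
      using ft gt by auto
    have i2: "integrable lborel (%x. norm (f x - g x))" using f g(1) by auto
    have i3: "integrable lborel (%x. norm (g (t n + x) - g x))" using gt g(1) by auto
    have "(\<integral>x. norm (f (t n + x) - f x) \<partial>lborel)
       <= (\<integral>x. norm (f (t n + x) - g (t n + x)) + norm (g (t n + x) - g x) + norm (f x - g x) \<partial>lborel)"
    proof (rule integral_mono)
      show "integrable lborel (%x. norm (f (t n + x) - f x))" using ft f by auto
      show "integrable lborel (%x. norm (f (t n + x) - g (t n + x)) + norm (g (t n + x) - g x) + norm (f x - g x))"
        using i1 i2 i3 by auto
      show "norm (f (t n + x) - f x) <= norm (f (t n + x) - g (t n + x)) + norm (g (t n + x) - g x) + norm (f x - g x)" for x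
        by norm
    qed
    also have "\<dots> = (\<integral>x. norm (f (t n + x) - g (t n + x)) \<partial>lborel)
        + (\<integral>x. norm (g (t n + x) - g x) \<partial>lborel) + (\<integral>x. norm (f x - g x) \<partial>lborel)"
      using i1 i2 i3 by simp
    also have "(\<integral>x. norm (f (t n + x) - g (t n + x)) \<partial>lborel) = (\<integral>x. norm (f x - g x) \<partial>lborel)"
      using f g(1) by (intro integral_translate[where f = "%x. norm (f x - g x)"]) auto
    finally show "norm ((\<integral>x. norm (f (t n + x) - f x) \<partial>lborel) - 0) < e"
      using g(3) N[OF n] by (simp add: integral_nonneg_AE)
  qed
qed

text \<open>Openness keeps x + t n in U for each x in U and large n, so the overlap of U with its
  translate converges to U by dominated convergence. The symmetric difference is expressed through
  this overlap.\<close>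

lemma translation_continuous_open:
  fixes U :: "'a::euclidean_space set" and c :: "'b::{banach, second_countable_topology}"
  assumes U: "open U" "emeasure lborel U < \<infinity>"
  shows "translation_continuous (%x. indicator U x *\<^sub>R c)"
  unfolding translation_continuous_def
proof (intro allI impI)
  fix t :: "nat => 'a" assume t: "t \<longlonglongrightarrow> 0"
  let ?u = "indicator U :: 'a => real"
  have [measurable]: "U \<in> sets borel" using U by auto
  have iU: "integrable lborel ?u" using U by auto
  note iUt = integrable_translate[OF iU]
  have ip: "integrable lborel (%x. ?u x * ?u (t n + x))" for n
    using iU by (rule Bochner_Integration.integrable_bound) (auto simp: indicator_def)
  have "(%n. \<integral>x. ?u x * ?u (t n + x) \<partial>lborel) \<longlonglongrightarrow> (\<integral>x. ?u x \<partial>lborel)"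
  proof (rule integral_dominated_convergence[where w = ?u])
    show "AE x in lborel. (%n. ?u x * ?u (t n + x)) \<longlonglongrightarrow> ?u x"
    proof (intro AE_I2)
      fix x show "(%n. ?u x * ?u (t n + x)) \<longlonglongrightarrow> ?u x"
      proof (cases "x \<in> U")
        case True
        have "(%n. t n + x) \<longlonglongrightarrow> 0 + x" by (intro tendsto_intros t)
        then have "\<forall>\<^sub>F n in sequentially. t n + x \<in> U"
          using U(1) True by (auto dest: topological_tendstoD)
        then show ?thesis using True by (intro tendsto_eventually) (auto elim: eventually_mono)
      qed auto
    qed
  qed (use iU in \<open>auto simp: indicator_def\<close>)
  then have "(%n. (2 * (\<integral>x. ?u x \<partial>lborel) - 2 * (\<integral>x. ?u x * ?u (t n + x) \<partial>lborel)) * norm c)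
     \<longlonglongrightarrow> (2 * (\<integral>x. ?u x \<partial>lborel) - 2 * (\<integral>x. ?u x \<partial>lborel)) * norm c"
    by (intro tendsto_intros)
  moreover have "(\<integral>x. norm (?u (t n + x) *\<^sub>R c - ?u x *\<^sub>R c) \<partial>lborel)
      = (2 * (\<integral>x. ?u x \<partial>lborel) - 2 * (\<integral>x. ?u x * ?u (t n + x) \<partial>lborel)) * norm c" for n
  proof -
    have "norm (?u (t n + x) *\<^sub>R c - ?u x *\<^sub>R c) = (?u (t n + x) + ?u x - 2 * (?u x * ?u (t n + x))) * norm c" for x
      by (auto simp: indicator_def)
    moreover have "(\<integral>x. ?u (t n + x) \<partial>lborel) = (\<integral>x. ?u x \<partial>lborel)"
      by (rule integral_translate) auto
    ultimately show ?thesis using iU iUt ip by simp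
  qed
  ultimately show "(%n. \<integral>x. norm (?u (t n + x) *\<^sub>R c - ?u x *\<^sub>R c) \<partial>lborel) \<longlonglongrightarrow> 0" by simp
qed

lemma translation_continuous_add:
  fixes f g :: "'a::euclidean_space => 'b::{banach, second_countable_topology}"
  assumes "integrable lborel f" "integrable lborel g" "translation_continuous f" "translation_continuous g"
  shows "translation_continuous (%x. f x + g x)"
  unfolding translation_continuous_def
proof (intro allI impI)
  fix t :: "nat => 'a" assume t: "t \<longlonglongrightarrow> 0"
  let ?I = "%h n. \<integral>x. norm (h (t n + x) - h x) \<partial>lborel"
  have lim: "(%n. ?I f n + ?I g n) \<longlonglongrightarrow> 0 + 0"
    using assms(3,4) t by (intro tendsto_add) (auto simp: translation_continuous_def)
  have le: "?I (%x. f x + g x) n <= ?I f n + ?I g n" for n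
  proof -
    have i: "integrable lborel (%x. norm (f (t n + x) - f x))" "integrable lborel (%x. norm (g (t n + x) - g x))"
      by (intro integrable_norm Bochner_Integration.integrable_diff integrable_translate assms)+
    have "?I (%x. f x + g x) n <= (\<integral>x. norm (f (t n + x) - f x) + norm (g (t n + x) - g x) \<partial>lborel)"
    proof (rule integral_mono)
      show "integrable lborel (%x. norm (f (t n + x) + g (t n + x) - (f x + g x)))"
        by (intro integrable_norm Bochner_Integration.integrable_diff Bochner_Integration.integrable_add integrable_translate assms)
      show "integrable lborel (%x. norm (f (t n + x) - f x) + norm (g (t n + x) - g x))"
        by (intro Bochner_Integration.integrable_add i)
      show "norm (f (t n + x) + g (t n + x) - (f x + g x)) <= norm (f (t n + x) - f x) + norm (g (t n + x) - g x)" for x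
        by norm
    qed
    then show ?thesis using i by simp
  qed
  show "?I (%x. f x + g x) \<longlonglongrightarrow> 0"
    by (rule tendsto_sandwich[OF _ _ tendsto_const lim[simplified]]) (auto intro!: le always_eventually)
qed

text \<open>Borel sets of finite measure are approximated from outside by open sets; sums and
  dominated limits are then covered by closedness in L1.\<close>

theorem translation_continuous_L1:
  fixes f :: "'a::euclidean_space => 'b::{banach, second_countable_topology}"
  assumes "integrable lborel f"
  shows "translation_continuous f"
  using assms
proof (induction rule: integrable_induct)
  case (base A c)
  show ?case
  proof (rule translation_continuous_approx)
    have [measurable]: "A \<in> sets borel" using base by simp
    show "integrable lborel (%x. indicator A x *\<^sub>R c)" using base by simp
    fix e :: real assume "e > 0"
    \<comment> \<open>The summand 1 avoids a division by zero when c = 0.\<close>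
    then have "e / (norm c + 1) > 0" by (simp add: add_nonneg_pos)
    then obtain U where U: "open U" "A \<subseteq> U" "emeasure lborel (U - A) < e / (norm c + 1)"
      using outer_regular_lborel[of A] base by auto
    have [measurable]: "U \<in> sets borel" using U by auto
    have "emeasure lborel U = emeasure lborel A + emeasure lborel (U - A)"
      using U(2) by (subst plus_emeasure) (auto intro!: arg_cong[where f = "emeasure lborel"])
    also have "\<dots> < \<infinity>" using base(2) U(3) by (auto simp: less_top[symmetric])
    finally have fU: "emeasure lborel U < \<infinity>" .
    have "(\<integral>x. norm (indicator A x *\<^sub>R c - indicator U x *\<^sub>R c) \<partial>lborel) = (\<integral>x. indicator (U - A) x * norm c \<partial>lborel)"
      using U(2) by (intro Bochner_Integration.integral_cong) (auto simp: indicator_def)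
    also have "\<dots> = measure lborel (U - A) * norm c" by simp
    also have "\<dots> <= e / (norm c + 1) * norm c"
      using U(3) \<open>e > 0\<close> by (intro mult_right_mono) (auto simp: measure_def enn2real_leI less_imp_le)
    also have "\<dots> < e"
    proof -
      have "norm c + 1 > 0" by (simp add: add_nonneg_pos)
      moreover have "e * norm c < e * (norm c + 1)" using \<open>e > 0\<close> by simp
      ultimately show ?thesis by (simp add: divide_less_eq)
    qed
    finally show "\<exists>g. integrable lborel g & translation_continuous g \<and>
        (\<integral>x. norm (indicator A x *\<^sub>R c - g x) \<partial>lborel) < e"
      using translation_continuous_open[OF U(1) fU, of c] fU
      by (intro exI[of _ "%x. indicator U x *\<^sub>R c"]) auto
  qed
next
  case (add f g)
  then show ?case by (intro translation_continuous_add)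
next
  case (lim f s)
  show ?case
  proof (rule translation_continuous_approx[OF \<open>integrable lborel f\<close>])
    fix e :: real assume "e > 0"
    have "(%i. \<integral>x. norm (f x - s i x) \<partial>lborel) \<longlonglongrightarrow> (\<integral>x. 0 \<partial>(lborel :: 'a measure))"
    proof (rule integral_dominated_convergence[where w = "%x. 3 * norm (f x)"])
      show "AE x in lborel. (%i. norm (f x - s i x)) \<longlonglongrightarrow> 0"
        using \<open>!!x. x \<in> space lborel ==> (%i. s i x) \<longlonglongrightarrow> f x\<close> by (auto intro!: tendsto_eq_intros AE_I2 simp: tendsto_norm_zero_iff)
      show "AE x in lborel. norm (norm (f x - s i x)) <= 3 * norm (f x)" for i
      proof (intro AE_I2)
        fix x :: 'a
        show "norm (norm (f x - s i x)) <= 3 * norm (f x)"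
          using \<open>!!i x. x \<in> space lborel ==> norm (s i x) <= 2 * norm (f x)\<close>[of x i] norm_triangle_ineq4[of "f x" "s i x"] by simp
      qed
    qed (use \<open>integrable lborel f\<close> \<open>!!i. integrable lborel (s i)\<close> in auto)
    from LIMSEQ_D[OF this \<open>e > 0\<close>] obtain i where "(\<integral>x. norm (f x - s i x) \<partial>lborel) < e"
      by (auto simp: integral_nonneg_AE dest: spec[of _ "_::nat"])
    then show "\<exists>g. integrable lborel g & translation_continuous g & (\<integral>x. norm (f x - g x) \<partial>lborel) < e"
      using \<open>!!i. integrable lborel (s i)\<close> \<open>!!i. translation_continuous (s i)\<close> by blast
  qed
qed

lemma translation_continuousD:
  fixes f :: "'a::euclidean_space => 'b::{banach, second_countable_topology}"
  assumes "integrable lborel f" "e > 0"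
  obtains d where "d > 0" "!!t. norm t < d ==> (\<integral>x. norm (f (t + x) - f x) \<partial>lborel) < e"
proof -
  have "\<exists>d>0. \<forall>t. norm t < d --> (\<integral>x. norm (f (t + x) - f x) \<partial>lborel) < e"
  proof (rule ccontr)
    assume "\<not> ?thesis"
    then have "\<exists>t. norm t < inverse (real (Suc n)) & \<not> (\<integral>x. norm (f (t + x) - f x) \<partial>lborel) < e" for n
      by (metis inverse_positive_iff_positive of_nat_0_less_iff zero_less_Suc)
    then obtain t where t: "!!n. norm (t n) < inverse (real (Suc n))"
      "!!n. \<not> (\<integral>x. norm (f (t n + x) - f x) \<partial>lborel) < e" by metis
    have "t \<longlonglongrightarrow> 0"
      using LIMSEQ_inverse_real_of_nat by (rule Lim_null_comparison[rotated]) (intro always_eventually allI less_imp_le t)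
    with translation_continuous_L1[OF assms(1)]
    have "(%n. \<integral>x. norm (f (t n + x) - f x) \<partial>lborel) \<longlonglongrightarrow> 0" by (simp add: translation_continuous_def)
    from LIMSEQ_D[OF this assms(2)] show False using t(2) by (auto simp: abs_less_iff)
  qed
  then show ?thesis using that by blast
qed

section \<open>Square-integrable functions and weak convergence of approximate identities\<close>

definition square_integrable :: "('a::euclidean_space => 'b::euclidean_space) => bool" where
  "square_integrable f \<longleftrightarrow> f \<in> borel_measurable borel & integrable lborel (%x. (norm (f x))\<^sup>2)"

lemma norm_mult_le_squares:
  fixes a b :: "'b::real_normed_algebra"
  shows "norm (a * b) <= (norm a)\<^sup>2 + (norm b)\<^sup>2"
proof -
  have "norm (a * b) <= norm a * norm b" by (rule norm_mult_ineq)
  also have "\<dots> <= (norm a)\<^sup>2 + (norm b)\<^sup>2"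
    using sum_squares_bound[of "norm a" "norm b"] mult_nonneg_nonneg[OF norm_ge_zero norm_ge_zero, of a b] by linarith
  finally show ?thesis .
qed

lemma square_integrable_mult:
  fixes f g :: "'a::euclidean_space => complex"
  assumes "square_integrable f" "square_integrable g"
  shows "integrable lborel (%x. f x * g x)"
proof (rule Bochner_Integration.integrable_bound)
  show "integrable lborel (%x. (norm (f x))\<^sup>2 + (norm (g x))\<^sup>2)"
    using assms by (auto simp: square_integrable_def)
  show "(%x. f x * g x) \<in> borel_measurable lborel" using assms by (auto simp: square_integrable_def)
  show "AE x in lborel. norm (f x * g x) <= norm ((norm (f x))\<^sup>2 + (norm (g x))\<^sup>2)"
    using norm_mult_le_squares[of "f _" "g _"] by simp
qed

lemma square_integrable_translate:
  assumes "square_integrable f"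
  shows "square_integrable (%x. f (t + x))"
proof -
  have [measurable]: "f \<in> borel_measurable borel" using assms by (simp add: square_integrable_def)
  show ?thesis using assms integrable_translate[of "%x. (norm (f x))\<^sup>2" t]
    by (auto simp: square_integrable_def)
qed

text \<open>The correlation of f with translates of g is continuous at 0. The function f is
  truncated at height n: the bounded part is paired with the L1 modulus of continuity of g, and the
  remainder, small in L2, is controlled by a weighted Young inequality.\<close>

lemma translation_continuous_L2:
  fixes f g :: "'a::euclidean_space => complex"
  assumes f: "square_integrable f" and g: "square_integrable g" "integrable lborel g" and e: "e > 0"
  obtains d where "d > 0" "!!t. norm t < d ==> norm ((\<integral>x. f x * g (t + x) \<partial>lborel) - (\<integral>x. f x * g x \<partial>lborel)) < e"
proof -
  have [measurable]: "f \<in> borel_measurable borel" "g \<in> borel_measurable borel"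
    using f g by (auto simp: square_integrable_def)
  define G where "G = (\<integral>x. (norm (g x))\<^sup>2 \<partial>lborel)"
  have G0: "G >= 0" by (simp add: G_def)
  \<comment> \<open>This weight makes 2 G / l smaller than e / 3, also when G = 0; the truncation
    height n is chosen afterwards, depending on l.\<close>
  define l where "l = (6 * G + 1) / e"
  have l: "l > 0" "2 * G / l < e / 3" using e G0 by (auto simp: l_def field_simps add_pos_nonneg)
  define F where "F n x = (if norm (f x) <= real n then f x else 0)" for n x
  have [measurable]: "F n \<in> borel_measurable borel" for n unfolding F_def by measurable
  have bF: "(norm (f x - F n x))\<^sup>2 <= (norm (f x))\<^sup>2" for n x by (simp add: F_def)
  have sf: "integrable lborel (%x. (norm (f x))\<^sup>2)" using f by (simp add: square_integrable_def)
  have sF: "integrable lborel (%x. (norm (f x - F n x))\<^sup>2)" for n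
  proof (rule Bochner_Integration.integrable_bound[OF sf])
    show "AE x in lborel. norm ((norm (f x - F n x))\<^sup>2) <= norm ((norm (f x))\<^sup>2)"
      using bF by simp
  qed measurable
  have "(%n. \<integral>x. (norm (f x - F n x))\<^sup>2 \<partial>lborel) \<longlonglongrightarrow> (\<integral>x. 0 \<partial>(lborel :: 'a measure))"
  proof (rule integral_dominated_convergence[where w = "%x. (norm (f x))\<^sup>2"])
    show "AE x in lborel. (%n. (norm (f x - F n x))\<^sup>2) \<longlonglongrightarrow> 0"
    proof (intro AE_I2 tendsto_eventually)
      fix x
      obtain n0 where "norm (f x) <= real n0" using real_arch_simple by blast
      have "(norm (f x - F n x))\<^sup>2 = 0" if "n >= n0" for n
      proof -
        have "norm (f x) <= real n" using \<open>norm (f x) <= real n0\<close> that by linarith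
        then show ?thesis by (simp add: F_def)
      qed
      then show "\<forall>\<^sub>F n in sequentially. (norm (f x - F n x))\<^sup>2 = 0"
        by (rule eventually_sequentiallyI)
    qed
    show "AE x in lborel. norm ((norm (f x - F n x))\<^sup>2) <= (norm (f x))\<^sup>2" for n
      using bF by simp
  qed (use sf in measurable)
  then have "\<forall>\<^sub>F n in sequentially. (\<integral>x. (norm (f x - F n x))\<^sup>2 \<partial>lborel) < e / (3 * l)"
    by (rule order_tendstoD(2)) (use e l in simp)
  then obtain n where n: "(\<integral>x. (norm (f x - F n x))\<^sup>2 \<partial>lborel) < e / (3 * l)"
    by (auto simp: eventually_sequentially)
  obtain d where d: "d > 0"
    "!!t. norm t < d ==> (\<integral>x. norm (g (t + x) - g x) \<partial>lborel) < e / (3 * (real n + 1))"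
    using translation_continuousD[OF g(2), of "e / (3 * (real n + 1))"] e by (auto simp: add_nonneg_pos)
  show ?thesis
  proof
    show "d > 0" by fact
    fix t :: 'a assume t: "norm t < d"
    note gt = square_integrable_translate[OF g(1), of t]
    have fi: "integrable lborel (%x. f x * g (t + x))" "integrable lborel (%x. f x * g x)"
      using square_integrable_mult f g gt by auto
    have it: "integrable lborel (%x. norm (g (t + x) - g x))"
      using g(2) integrable_translate[OF g(2)] by auto
    have i2: "integrable lborel (%x. (norm (g (t + x)))\<^sup>2)" "integrable lborel (%x. (norm (g x))\<^sup>2)"
      using g gt by (auto simp: square_integrable_def)
    let ?b = "%x. l * (norm (f x - F n x))\<^sup>2 + ((norm (g (t + x)))\<^sup>2 + (norm (g x))\<^sup>2) / l + n * norm (g (t + x) - g x)"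
    have "norm ((\<integral>x. f x * g (t + x) \<partial>lborel) - (\<integral>x. f x * g x \<partial>lborel))
        = norm (\<integral>x. f x * (g (t + x) - g x) \<partial>lborel)"
      using fi by (simp add: right_diff_distrib)
    also have "\<dots> <= (\<integral>x. ?b x \<partial>lborel)"
    proof (rule Bochner_Integration.integral_norm_bound_integral)
      show "integrable lborel (%x. f x * (g (t + x) - g x))" using fi by (simp add: right_diff_distrib)
      show "integrable lborel ?b" using sF[of n] it i2 by auto
      fix x
      define p where "p = norm (f x - F n x)"
      define q where "q = norm (g (t + x) - g x)"
      \<comment> \<open>Young's inequality in the form (l p - q / 2)^2 >= 0, divided by l.\<close>
      have pq: "p * q <= l * p\<^sup>2 + ((norm (g (t + x)))\<^sup>2 + (norm (g x))\<^sup>2) / l"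
      proof -
        have "q <= norm (g (t + x)) + norm (g x)" unfolding q_def by (rule norm_triangle_ineq4)
        then have "q\<^sup>2 <= (norm (g (t + x)) + norm (g x))\<^sup>2" by (intro power_mono) (auto simp: q_def)
        also have "\<dots> <= 2 * ((norm (g (t + x)))\<^sup>2 + (norm (g x))\<^sup>2)"
          using zero_le_power2[of "norm (g (t + x)) - norm (g x)"] by (simp add: power2_diff power2_sum)
        finally have q2: "q\<^sup>2 <= 2 * ((norm (g (t + x)))\<^sup>2 + (norm (g x))\<^sup>2)" .
        define A where "A = (norm (g (t + x)))\<^sup>2 + (norm (g x))\<^sup>2"
        have A: "A >= 0" "q\<^sup>2 <= 2 * A" using q2 by (simp_all add: A_def)
        have "0 <= (l * p - q / 2)\<^sup>2" by simp
        then have "l * (p * q) <= l\<^sup>2 * p\<^sup>2 + q\<^sup>2 / 4" by (simp add: power2_eq_square algebra_simps)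
        also have "\<dots> <= l\<^sup>2 * p\<^sup>2 + A" using A by simp
        also have "\<dots> = l * (l * p\<^sup>2 + A / l)" using l(1) by (simp add: power2_eq_square distrib_left)
        finally have "l * (p * q) <= l * (l * p\<^sup>2 + ((norm (g (t + x)))\<^sup>2 + (norm (g x))\<^sup>2) / l)"
          by (simp only: A_def)
        then show ?thesis using l(1) by (simp only: mult_le_cancel_left_pos)
      qed
      have "norm (f x) <= p + real n"
        unfolding p_def F_def by auto
      then have "norm (f x) * q <= (p + n) * q" by (intro mult_right_mono) (auto simp: q_def)
      then show "norm (f x * (g (t + x) - g x)) <= ?b x"
        using pq by (simp add: norm_mult p_def q_def distrib_right)
    qed
    also have "\<dots> = l * (\<integral>x. (norm (f x - F n x))\<^sup>2 \<partial>lborel) + 2 * G / l + n * (\<integral>x. norm (g (t + x) - g x) \<partial>lborel)"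
    proof -
      have "(\<integral>x. (norm (g (t + x)))\<^sup>2 \<partial>lborel) = G"
        unfolding G_def by (rule integral_translate) auto
      then show ?thesis using sF[of n] it i2 by (simp add: G_def)
    qed
    also have "\<dots> < e / 3 + e / 3 + e / 3"
    proof -
      have "l * (\<integral>x. (norm (f x - F n x))\<^sup>2 \<partial>lborel) < e / 3"
        using n l by (simp add: field_simps)
      moreover have "n * (\<integral>x. norm (g (t + x) - g x) \<partial>lborel) <= (real n + 1) * (\<integral>x. norm (g (t + x) - g x) \<partial>lborel)"
        by (intro mult_right_mono) (auto simp: integral_nonneg_AE)
      moreover have "(real n + 1) * (\<integral>x. norm (g (t + x) - g x) \<partial>lborel) < e / 3"
        using d(2)[OF t] by (simp add: field_simps)
      ultimately show ?thesis using l(2) by linarith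
    qed
    finally show "norm ((\<integral>x. f x * g (t + x) \<partial>lborel) - (\<integral>x. f x * g x \<partial>lborel)) < e" by simp
  qed
qed

lemma convolution_kernel_integrable:
  fixes f g :: "'a::euclidean_space => complex" and k :: "'a => real"
  assumes f: "integrable lborel f" and g: "integrable lborel g"
    and k: "k \<in> borel_measurable borel" "!!z. \<bar>k z\<bar> <= M"
  shows "integrable (lborel \<Otimes>\<^sub>M lborel) (%(x, y). f x * (g y * complex_of_real (k (x - y))))"
proof -
  have [measurable]: "f \<in> borel_measurable borel" "g \<in> borel_measurable borel" "k \<in> borel_measurable borel"
    using f g k by auto
  have inn: "integrable lborel (%y. g y * complex_of_real (k (x - y)))" for x
  proof (rule Bochner_Integration.integrable_bound)
    show "integrable lborel (%y. M * norm (g y))" using g by auto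
    show "AE y in lborel. norm (g y * complex_of_real (k (x - y))) <= norm (M * norm (g y))"
    proof (rule AE_I2)
      fix y
      have "norm (g y * complex_of_real (k (x - y))) <= M * norm (g y)"
        using mult_left_mono[OF k(2) norm_ge_zero] by (simp add: norm_mult mult.commute)
      then show "norm (g y * complex_of_real (k (x - y))) <= norm (M * norm (g y))" by simp
    qed
  qed measurable
  show ?thesis
  proof (rule lborel_pair.Fubini_integrable)
    show "integrable lborel (%x. \<integral>y. norm (case (x, y) of (x, y) => f x * (g y * complex_of_real (k (x - y)))) \<partial>lborel)"
    proof (rule Bochner_Integration.integrable_bound)
      show "integrable lborel (%x. norm (f x) * (M * (\<integral>y. norm (g y) \<partial>lborel)))" using f by auto
      show "AE x in lborel. norm (\<integral>y. norm (case (x, y) of (x, y) => f x * (g y * complex_of_real (k (x - y)))) \<partial>lborel)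
           <= norm (norm (f x) * (M * (\<integral>y. norm (g y) \<partial>lborel)))"
      proof (intro AE_I2)
        fix x
        have "(\<integral>y. norm (f x * (g y * complex_of_real (k (x - y)))) \<partial>lborel)
           = norm (f x) * (\<integral>y. norm (g y * complex_of_real (k (x - y))) \<partial>lborel)"
          by (simp add: norm_mult)
        also have "\<dots> <= norm (f x) * (\<integral>y. M * norm (g y) \<partial>lborel)"
        proof (intro mult_left_mono integral_mono)
          show "norm (g y * complex_of_real (k (x - y))) <= M * norm (g y)" for y
            using mult_left_mono[OF k(2) norm_ge_zero] by (simp add: norm_mult mult.commute)
        qed (use inn[of x] g in auto)
        also have "\<dots> = norm (f x) * (M * (\<integral>y. norm (g y) \<partial>lborel))" by simp
        finally have *: "(\<integral>y. norm (f x * (g y * complex_of_real (k (x - y)))) \<partial>lborel) <= norm (f x) * (M * (\<integral>y. norm (g y) \<partial>lborel))" .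
        have "0 <= (\<integral>y. norm (f x * (g y * complex_of_real (k (x - y)))) \<partial>lborel)" by (simp add: integral_nonneg_AE)
        with * show "norm (\<integral>y. norm (case (x, y) of (x, y) => f x * (g y * complex_of_real (k (x - y)))) \<partial>lborel)
           <= norm (norm (f x) * (M * (\<integral>y. norm (g y) \<partial>lborel)))"
          by (simp only: prod.case real_norm_def abs_of_nonneg)
      qed
    qed measurable
    show "AE x in lborel. integrable lborel (%y. case (x, y) of (x, y) => f x * (g y * complex_of_real (k (x - y))))"
      using inn by auto
  qed measurable
qed

lemma convolution_kernel_swap:
  fixes f g :: "'a::euclidean_space => complex" and k :: "'a => real"
  assumes "integrable lborel f" "integrable lborel g" "k \<in> borel_measurable borel" "!!z. \<bar>k z\<bar> <= M"
  shows "(\<integral>y. g y * (\<integral>x. f x * complex_of_real (k (x - y)) \<partial>lborel) \<partial>lborel)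
       = (\<integral>x. f x * (\<integral>y. g y * complex_of_real (k (x - y)) \<partial>lborel) \<partial>lborel)"
proof -
  have "(\<integral>y. (\<integral>x. f x * (g y * complex_of_real (k (x - y))) \<partial>lborel) \<partial>lborel)
      = (\<integral>x. (\<integral>y. f x * (g y * complex_of_real (k (x - y))) \<partial>lborel) \<partial>lborel)"
    by (rule lborel_pair.Fubini_integral[OF convolution_kernel_integrable[OF assms]])
  moreover have "(\<integral>x. f x * (g y * complex_of_real (k (x - y))) \<partial>lborel)
      = g y * (\<integral>x. f x * complex_of_real (k (x - y)) \<partial>lborel)" for y
  proof -
    have "(%x. f x * (g y * complex_of_real (k (x - y)))) = (%x. g y * (f x * complex_of_real (k (x - y))))"
      by (simp only: mult.left_commute)
    then show ?thesis by simp
  qed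
  ultimately show ?thesis by simp
qed

text \<open>By Fubini the pairing of f with the mollified g equals the integral of the correlation C
  t against the kernel k n. Since C is continuous at 0 and the kernels concentrate there, the limit
  is C 0. Evenness of the kernel absorbs the sign in x - y = - t.\<close>

lemma approximate_identity:
  fixes f g :: "'a::euclidean_space => complex"
  assumes f: "square_integrable f" "integrable lborel f" and g: "square_integrable g" "integrable lborel g"
    and k: "!!n. k n \<in> borel_measurable borel" "!!n z. k n z >= 0" "!!n. (\<integral>z. k n z \<partial>lborel) = 1"
      "!!n z. norm z >= r n ==> k n z = 0" "!!n z. \<bar>k n z\<bar> <= M n" "!!n z. k n (- z) = k n z"
    and r: "r \<longlonglongrightarrow> 0"
  shows "(%n. \<integral>x. f x * (\<integral>y. g y * complex_of_real (k n (x - y)) \<partial>lborel) \<partial>lborel) \<longlonglongrightarrow> (\<integral>x. f x * g x \<partial>lborel)"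
proof (rule LIMSEQ_I)
  fix e :: real assume e: "e > 0"
  have [measurable]: "f \<in> borel_measurable borel" "g \<in> borel_measurable borel" "k n \<in> borel_measurable borel" for n
    using f g k by (auto simp: square_integrable_def)
  define C where "C t = (\<integral>x. f x * g (t + x) \<partial>lborel)" for t
  have [measurable]: "C \<in> borel_measurable borel" unfolding C_def by measurable
  obtain d where d: "d > 0" "!!t. norm t < d ==> norm (C t - C 0) < e / 2"
    using translation_continuous_L2[OF f(1) g, of "e / 2"] e by (auto simp: C_def)
  have rd: "\<forall>\<^sub>F n in sequentially. r n < d" using order_tendstoD(2)[OF r d(1)] .
  have ik: "integrable lborel (k n)" for n using k(3)[of n] not_integrable_integral_eq by fastforce
  have eq: "(\<integral>x. f x * (\<integral>y. g y * complex_of_real (k n (x - y)) \<partial>lborel) \<partial>lborel) = (\<integral>t. C t * k n t \<partial>lborel)"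
    and iC: "integrable lborel (%t. C t * k n t)" for n
  proof -
    have "(\<integral>y. g y * complex_of_real (k n (x - y)) \<partial>lborel) = (\<integral>t. g (t + x) * complex_of_real (k n t) \<partial>lborel)" for x
      using integral_translate[of "%y. g y * complex_of_real (k n (x - y))" x] k(6)[of n]
      by (simp add: add.commute)
    then have "(\<integral>x. f x * (\<integral>y. g y * complex_of_real (k n (x - y)) \<partial>lborel) \<partial>lborel)
        = (\<integral>x. (\<integral>t. f x * (g (t + x) * complex_of_real (k n t)) \<partial>lborel) \<partial>lborel)" by simp
    moreover have int: "integrable (lborel \<Otimes>\<^sub>M lborel) (%(t, x). f x * (g (t + x) * complex_of_real (k n t)))"
    proof (rule lborel_pair.Fubini_integrable)
      let ?B = "(\<integral>x. (norm (f x))\<^sup>2 \<partial>lborel) + (\<integral>x. (norm (g x))\<^sup>2 \<partial>lborel)"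
      have fg: "integrable lborel (%x. f x * (g (t + x) * complex_of_real (k n t)))" for t
        using integrable_mult_left[OF square_integrable_mult[OF f(1) square_integrable_translate[OF g(1), of t]], of "complex_of_real (k n t)"]
        by (simp add: mult.assoc)
      show "AE t in lborel. integrable lborel (%x. case (t, x) of (t, x) => f x * (g (t + x) * complex_of_real (k n t)))"
        using fg by simp
      show "integrable lborel (%t. \<integral>x. norm (case (t, x) of (t, x) => f x * (g (t + x) * complex_of_real (k n t))) \<partial>lborel)"
      proof (rule Bochner_Integration.integrable_bound)
        show "integrable lborel (%t. ?B * k n t)" using ik by simp
        show "AE t in lborel. norm (\<integral>x. norm (case (t, x) of (t, x) => f x * (g (t + x) * complex_of_real (k n t))) \<partial>lborel)
            <= norm (?B * k n t)"
        proof (intro AE_I2)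
          fix t
          have sq: "integrable lborel (%x. (norm (f x))\<^sup>2)" "integrable lborel (%x. (norm (g (t + x)))\<^sup>2)"
            using f(1) square_integrable_translate[OF g(1), of t] by (auto simp: square_integrable_def)
          have "(\<integral>x. norm (f x * (g (t + x) * complex_of_real (k n t))) \<partial>lborel)
             <= (\<integral>x. ((norm (f x))\<^sup>2 + (norm (g (t + x)))\<^sup>2) * k n t \<partial>lborel)"
          proof (rule integral_mono)
            show "norm (f x * (g (t + x) * complex_of_real (k n t))) <= ((norm (f x))\<^sup>2 + (norm (g (t + x)))\<^sup>2) * k n t" for x
              using mult_right_mono[OF norm_mult_le_squares[of "f x" "g (t + x)"] k(2)[of n t]] k(2)[of n t]
              by (simp add: norm_mult mult.assoc)
          qed (use fg[of t] sq in auto)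
          also have "\<dots> = ?B * k n t"
            using sq integral_translate[of "%x. (norm (g x))\<^sup>2" t] by simp
          finally show "norm (\<integral>x. norm (case (t, x) of (t, x) => f x * (g (t + x) * complex_of_real (k n t))) \<partial>lborel)
            <= norm (?B * k n t)" by (auto simp: integral_nonneg_AE)
        qed
      qed measurable
    qed measurable
    moreover have "(\<integral>x. f x * (g (t + x) * complex_of_real (k n t)) \<partial>lborel) = C t * k n t" for t
      by (simp add: C_def mult.assoc[symmetric])
    ultimately show "(\<integral>x. f x * (\<integral>y. g y * complex_of_real (k n (x - y)) \<partial>lborel) \<partial>lborel) = (\<integral>t. C t * k n t \<partial>lborel)"
      "integrable lborel (%t. C t * k n t)"
      using lborel_pair.Fubini_integral[OF int] lborel_pair.integrable_fst'[OF int] by auto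
  qed
  show "\<exists>n0. \<forall>n\<ge>n0. norm ((\<integral>x. f x * (\<integral>y. g y * complex_of_real (k n (x - y)) \<partial>lborel) \<partial>lborel) - (\<integral>x. f x * g x \<partial>lborel)) < e"
    unfolding eventually_sequentially[symmetric]
    using rd
  proof eventually_elim
    case (elim n)
    have "(\<integral>x. f x * g x \<partial>lborel) = (\<integral>t. C 0 * k n t \<partial>lborel)"
      using k(3)[of n] by (simp add: C_def[of 0])
    moreover have i0: "integrable lborel (%t. C 0 * complex_of_real (k n t))"
      by (intro integrable_mult_right integrable_of_real ik)
    ultimately have eq2: "(\<integral>t. C t * k n t \<partial>lborel) - (\<integral>x. f x * g x \<partial>lborel) = (\<integral>t. (C t - C 0) * k n t \<partial>lborel)"
      unfolding left_diff_distrib by (subst Bochner_Integration.integral_diff[OF iC i0]) simp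
    have bound: "norm ((C t - C 0) * complex_of_real (k n t)) <= e / 2 * k n t" for t
    proof (cases "norm t < d")
      case True
      then have "norm (C t - C 0) <= e / 2" using d(2) by (simp add: less_imp_le)
      from mult_right_mono[OF this k(2)[of n t]] show ?thesis by (simp only: norm_mult norm_of_real abs_of_nonneg k(2))
    next
      case False
      then have "r n <= norm t" using elim by linarith
      then have "k n t = 0" by (rule k(4))
      then show ?thesis by simp
    qed
    have i1: "integrable lborel (%t. (C t - C 0) * complex_of_real (k n t))"
      unfolding left_diff_distrib by (rule Bochner_Integration.integrable_diff[OF iC i0])
    have "norm (\<integral>t. (C t - C 0) * complex_of_real (k n t) \<partial>lborel)
        <= (\<integral>t. norm ((C t - C 0) * complex_of_real (k n t)) \<partial>lborel)"
      by (rule integral_norm_bound)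
    also have "\<dots> <= (\<integral>t. e / 2 * k n t \<partial>lborel)"
      by (rule integral_mono[OF integrable_norm[OF i1] integrable_mult_right[OF ik] bound])
    also have "\<dots> = e / 2" using k(3)[of n] by simp
    finally show ?case using e unfolding eq eq2 by simp
  qed
qed

lemma test_functions_partial: "\<phi> \<in> test_functions S ==> partial i \<phi> \<in> test_functions S"
proof (erule test_functionsE)
  fix K assume K: "smooth \<phi>" "compact K" "K \<subseteq> S" "!!x i. x \<notin> K ==> partial i \<phi> x = 0"
  show "partial i \<phi> \<in> test_functions S"
    by (rule test_functionsI[OF smooth_partial[OF K(1)] K(2,3)]) (rule K(4))
qed

lemma test_functions_continuous: "\<phi> \<in> test_functions S ==> continuous_on UNIV \<phi>"
  by (erule test_functionsE) (rule smooth_continuous)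

lemma test_functions_measurable: "\<phi> \<in> test_functions S ==> \<phi> \<in> borel_measurable borel"
  using test_functions_continuous by (rule borel_measurable_continuous_onI)

lemma test_functions_bounded:
  assumes "\<phi> \<in> test_functions S"
  obtains M where "!!x. \<bar>\<phi> x\<bar> <= M"
proof -
  obtain K where K: "smooth \<phi>" "compact K" "!!x. x \<notin> K ==> \<phi> x = 0"
    by (rule test_functionsE[OF assms]) (rule that)
  have "compact (\<phi> ` K)"
    by (rule compact_continuous_image[OF continuous_on_subset[OF smooth_continuous[OF K(1)] subset_UNIV] K(2)])
  then obtain M where "!!x. x \<in> K ==> norm (\<phi> x) <= M"
    using compact_imp_bounded bounded_iff by (metis imageI)
  then have "\<bar>\<phi> x\<bar> <= max M 0" for x
    by (cases "x \<in> K") (force simp: K(3))+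
  then show ?thesis by (rule that)
qed

section \<open>Radial mollifiers\<close>

definition bump :: "real => real^3 => real" where
  "bump r z = exp_flat 0 (r\<^sup>2 - (norm z)\<^sup>2)"

definition mollifier :: "real => real^3 => real" where
  "mollifier r z = bump r z / (\<integral>z. bump r z \<partial>lborel)"

lemma bump_nonneg: "bump r z >= 0" by (simp add: bump_def exp_flat_nonneg)

lemma bump_outside: "norm z >= r ==> r > 0 ==> bump r z = 0"
proof -
  assume "norm z >= r" "r > 0"
  then have "r\<^sup>2 <= (norm z)\<^sup>2" by (intro power_mono) auto
  then show ?thesis by (simp add: bump_def exp_flat_def)
qed

lemma smooth_bump: "smooth (%x. bump r (x - y))"
  unfolding bump_def by (intro smooth_exp_flat smooth_diff smooth_const smooth_norm_sq)

lemma test_bump: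
  assumes "r > 0" "cball y r \<subseteq> S"
  shows "(%x. bump r (x - y)) \<in> test_functions S"
proof (rule test_functionsI[OF smooth_bump compact_cball assms(2)])
  show "bump r (x - y) = 0" if "x \<notin> cball y r" for x
    using that assms(1) by (intro bump_outside) (auto simp: dist_norm norm_minus_commute)
qed

lemma
  assumes "r > 0"
  shows integrable_bump: "integrable lborel (bump r)"
    and integral_bump_pos: "(\<integral>z. bump r z \<partial>lborel) > 0"
proof -
  have t: "bump r \<in> test_functions UNIV" using test_bump[OF assms, of 0 UNIV] by simp
  note [measurable] = test_functions_measurable[OF t]
  obtain M where M: "!!x. \<bar>bump r x\<bar> <= M" by (rule test_functions_bounded[OF t]) (rule that)
  show i: "integrable lborel (bump r)"
  proof (rule Bochner_Integration.integrable_bound)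
    show "integrable lborel (%x. indicator (cball 0 r) x * M :: real)"
      by (intro integrable_mult_left integrable_real_indicator) (use emeasure_lborel_cball_finite[of 0 r] in \<open>auto simp: infinity_ennreal_def\<close>)
    have "\<bar>bump r x\<bar> <= indicator (cball 0 r) x * M" for x
      using M[of x] bump_outside[of r x] assms by (auto simp: indicator_def)
    then show "AE x in lborel. norm (bump r x) <= norm (indicator (cball 0 r) x * M)"
      by (smt (verit) AE_I2 real_norm_def)
  qed measurable
  have "(\<integral>z. bump r z \<partial>lborel) ~= 0"
  proof
    assume "(\<integral>z. bump r z \<partial>lborel) = 0"
    then have "AE z in lborel. bump r z = 0"
      using integral_nonneg_eq_0_iff_AE[OF i AE_I2[OF bump_nonneg]] by simp
    moreover have "z \<notin> ball 0 r" if "bump r z = 0" for z :: "real^3"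
    proof
      assume "z \<in> ball 0 r"
      then have "(norm z)\<^sup>2 < r\<^sup>2" by (intro power_strict_mono) auto
      with that exp_flat_pos[of "r\<^sup>2 - (norm z)\<^sup>2" 0] show False by (simp add: bump_def)
    qed
    ultimately have "AE z in lborel. z \<notin> ball (0::real^3) r" by auto
    then have "emeasure lborel (ball (0::real^3) r) = 0"
      by (subst (asm) AE_iff_measurable[OF _ refl]) (auto simp: ball_def)
    moreover have "unit_ball_vol 3 * r ^ 3 > (0::real)" using assms by (intro mult_pos_pos unit_ball_vol_pos) auto
    ultimately show False using assms by (simp add: emeasure_ball ennreal_eq_0_iff not_le)
  qed
  moreover have "(\<integral>z. bump r z \<partial>lborel) >= 0" by (simp add: integral_nonneg_AE bump_def exp_flat_nonneg)
  ultimately show "(\<integral>z. bump r z \<partial>lborel) > 0" by simp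
qed

lemma mollifier_outside: "norm z >= r ==> r > 0 ==> mollifier r z = 0"
  by (simp add: mollifier_def bump_outside)

lemma mollifier_minus: "mollifier r (- z) = mollifier r z"
  by (simp add: mollifier_def bump_def)

lemma mollifier_nonneg: "r > 0 ==> mollifier r z >= 0"
  using integral_bump_pos[of r] by (simp add: mollifier_def bump_def exp_flat_nonneg)

lemma integral_mollifier: "r > 0 ==> (\<integral>z. mollifier r z \<partial>lborel) = 1"
  using integral_bump_pos[of r] by (simp add: mollifier_def)

lemma test_mollifier:
  assumes "r > 0" "cball y r \<subseteq> S"
  shows "(%x. mollifier r (x - y)) \<in> test_functions S"
  using test_functions_mult[OF test_bump[OF assms] smooth_const, of "1 / (\<integral>z. bump r z \<partial>lborel)"]
  by (simp add: mollifier_def)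

lemma partial_shift:
  assumes "smooth f"
  shows "partial i (%x. f (x - y)) x = partial i f (x - y)"
proof -
  have "((%x. f (x - y)) has_derivative (%h. (\<chi> i. partial i f (x - y)) \<bullet> h)) (at x)"
    by (rule has_derivative_compose[where f = "%x. x - y" and f' = "%h. h", OF _ smooth_has_derivative[OF assms]])
       (auto intro!: derivative_eq_intros)
  from has_derivative_inner_axis[OF this] show ?thesis by simp
qed

text \<open>The minus sign allows a derivative that falls on the kernel in x to be read as a
  derivative in y, and so to be moved onto a weakly differentiable function of y.\<close>

lemma partial_mollifier_reflect:
  assumes "r > 0"
  shows "partial i (%y. mollifier r (x - y)) y = - partial i (mollifier r) (x - y)"
proof -
  have s: "smooth (mollifier r)" using test_mollifier[OF assms, of 0 UNIV] by (auto elim: test_functionsE)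
  have "((%y. mollifier r (x - y)) has_derivative (%h. (\<chi> i. partial i (mollifier r) (x - y)) \<bullet> (- h))) (at y)"
    by (rule has_derivative_compose[where f = "%y. x - y" and f' = "%h. - h", OF _ smooth_has_derivative[OF s]])
       (auto intro!: derivative_eq_intros)
  then have "((%y. mollifier r (x - y)) has_derivative (%h. (- (\<chi> i. partial i (mollifier r) (x - y))) \<bullet> h)) (at y)"
    by simp
  from has_derivative_inner_axis[OF this] show ?thesis by simp
qed

lemma approximate_identity_mollifier:
  fixes f g :: "real^3 => complex"
  assumes f: "square_integrable f" "integrable lborel f" and g: "square_integrable g" "integrable lborel g"
    and r: "!!n. r n > 0" "r \<longlonglongrightarrow> 0"
  shows "(%n. \<integral>x. f x * (\<integral>y. g y * complex_of_real (mollifier (r n) (x - y)) \<partial>lborel) \<partial>lborel)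
    \<longlonglongrightarrow> (\<integral>x. f x * g x \<partial>lborel)"
proof -
  have t: "mollifier (r n) \<in> test_functions UNIV" for n using test_mollifier[OF r(1)[of n], of 0 UNIV] by simp
  have "\<exists>M. \<forall>x. \<bar>mollifier (r n) x\<bar> <= M" for n using test_functions_bounded[OF t] by metis
  then obtain M where M: "!!n x. \<bar>mollifier (r n) x\<bar> <= M n" by metis
  from approximate_identity[where k = "%n. mollifier (r n)" and r = r, OF f g test_functions_measurable[OF t]
      mollifier_nonneg[OF r(1)] integral_mollifier[OF r(1)] mollifier_outside[OF _ r(1)] M mollifier_minus r(2)]
  show ?thesis by simp
qed

section \<open>Integration by parts for weak derivatives\<close>

definition locally_L2 :: "(real^3) set => (real^3 => complex) => bool" where
  "locally_L2 S u \<longleftrightarrow> set_borel_measurable lborel S u \<and>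
     (\<forall>K. compact K & K \<subseteq> S --> set_integrable lborel K (%x. (norm (u x))\<^sup>2))"

text \<open>A compact set has finite measure, so the cut-off function is integrable as well as
  square-integrable; \<open>approximate_identity_mollifier\<close> asks for both.\<close>

lemma locally_L2_cutoff:
  assumes u: "locally_L2 S u" and K: "compact K" "K \<subseteq> S"
    and q: "q \<in> borel_measurable borel" "!!x. \<bar>q x\<bar> <= M"
  shows "square_integrable (%x. indicator K x *\<^sub>R (u x * complex_of_real (q x)))"
    and "integrable lborel (%x. indicator K x *\<^sub>R (u x * complex_of_real (q x)))"
proof -
  have [measurable]: "K \<in> sets borel" using K(1) by (simp add: borel_compact)
  have "(%x. indicator K x *\<^sub>R u x) = (%x. indicator K x *\<^sub>R (indicator S x *\<^sub>R u x))"
  proof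
    fix x show "indicator K x *\<^sub>R u x = indicator K x *\<^sub>R (indicator S x *\<^sub>R u x)"
      using K(2) by (cases "x \<in> K") auto
  qed
  moreover have "(%x. indicator S x *\<^sub>R u x) \<in> borel_measurable borel"
    using u by (simp add: locally_L2_def set_borel_measurable_def)
  then have "(%x. indicator K x *\<^sub>R (indicator S x *\<^sub>R u x)) \<in> borel_measurable borel"
    by measurable
  ultimately have [measurable]: "(%x. indicator K x *\<^sub>R u x) \<in> borel_measurable borel" by simp
  note [measurable] = q(1)
  let ?f = "%x. indicator K x *\<^sub>R (u x * complex_of_real (q x))"
  have eq: "?f = (%x. (indicator K x *\<^sub>R u x) * complex_of_real (q x))" by (auto simp: indicator_def)
  have m: "?f \<in> borel_measurable borel" unfolding eq by measurable
  have i: "integrable lborel (%x. indicator K x * (norm (u x))\<^sup>2)"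
    using u K by (auto simp: locally_L2_def set_integrable_def)
  have "M >= 0" using q(2)[of 0] by linarith
  have "emeasure lborel K < \<infinity>" using K(1) by (rule emeasure_compact_finite)
  then have iK: "integrable lborel (indicator K :: _ => real)" by (auto simp: infinity_ennreal_def)
  have sq: "integrable lborel (%x. (norm (?f x))\<^sup>2)"
  proof (rule Bochner_Integration.integrable_bound[OF integrable_mult_right[OF i, of "M\<^sup>2"]])
    show "AE x in lborel. norm ((norm (?f x))\<^sup>2) <= norm (M\<^sup>2 * (indicator K x * (norm (u x))\<^sup>2))"
    proof (rule AE_I2)
      fix x
      have "(q x)\<^sup>2 <= M\<^sup>2" using q(2)[of x] by (simp add: abs_le_square_iff[symmetric] \<open>M >= 0\<close>)
      then have "(norm (u x))\<^sup>2 * (q x)\<^sup>2 <= (norm (u x))\<^sup>2 * M\<^sup>2" by (rule mult_left_mono) simp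
      then show "norm ((norm (?f x))\<^sup>2) <= norm (M\<^sup>2 * (indicator K x * (norm (u x))\<^sup>2))"
        by (auto simp: indicator_def norm_mult power_mult_distrib mult.commute)
    qed
  qed (use m in measurable)
  then show "square_integrable ?f" using m by (simp add: square_integrable_def)
  show "integrable lborel ?f"
  proof (rule Bochner_Integration.integrable_bound[OF Bochner_Integration.integrable_add[OF iK sq]])
    show "AE x in lborel. norm (?f x) <= norm (indicator K x + (norm (?f x))\<^sup>2)"
    proof (rule AE_I2)
      fix x
      have "t <= 1 + t\<^sup>2" for t :: real
      proof -
        have "2 * t <= 1 + t\<^sup>2" using zero_le_power2[of "t - 1"] by (simp add: power2_diff)
        moreover have "0 <= t\<^sup>2" by simp
        ultimately show ?thesis by linarith
      qed
      from this[of "norm (?f x)"] show "norm (?f x) <= norm (indicator K x + (norm (?f x))\<^sup>2)"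
        by (auto simp: indicator_def)
    qed
  qed (use m in simp)
qed

text \<open>The product rule for div (h u) when h and u are both only weakly differentiable, so that
  h \<eta> is no admissible test function. The divergence of u is tested with \<eta> x times a
  mollifier centred at y, the result is multiplied by h y and integrated over y. The derivative on
  the mollifier is turned into a y-derivative and moved onto h; then the mollification radius tends
  to 0.\<close>

theorem weak_derivative_pairing:
  assumes S: "open S"
    and div: "has_weak_divergence S u d" and grad: "has_weak_gradient S h g"
    and u: "!!i. locally_L2 S (%x. u x $ i)" and d: "locally_L2 S d"
    and h: "locally_L2 S h" and g: "!!i. locally_L2 S (%x. g x $ i)"
    and \<eta>: "\<eta> \<in> test_functions S"
  shows "(LINT x:S|lborel. h x * (\<Sum>i\<in>UNIV. u x $ i * complex_of_real (partial i \<eta> x)))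
       = - (LINT x:S|lborel. ((\<Sum>i\<in>UNIV. u x $ i * g x $ i) + d x * h x) * complex_of_real (\<eta> x))"
proof -
  obtain K where K: "smooth \<eta>" "compact K" "K \<subseteq> S" "!!x. x \<notin> K ==> \<eta> x = 0"
    "!!x i. x \<notin> K ==> partial i \<eta> x = 0"
    by (rule test_functionsE[OF \<eta>]) (rule that)
  obtain e where e: "e > 0" "(\<Union>x\<in>K. cball x e) \<subseteq> S"
    using compact_subset_open_imp_cball_epsilon_subset[OF K(2) S K(3)] by blast
  \<comment> \<open>The support of \<eta> is enlarged by the largest mollification radius but stays
    compact inside S; only the values of h and its gradient on this set matter.\<close>
  define K' where "K' = {x + y | x y. x \<in> K & y \<in> cball 0 e}"
  have K': "compact K'" unfolding K'_def by (intro compact_sums K compact_cball)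
  have cb: "cball x e \<subseteq> K'" if "x \<in> K" for x
  proof
    fix y assume "y \<in> cball x e"
    then have "y = x + (y - x)" "y - x \<in> cball 0 e" by (auto simp: dist_norm norm_minus_commute)
    then show "y \<in> K'" unfolding K'_def using that by blast
  qed
  have K'S: "K' \<subseteq> S"
  proof
    fix z assume "z \<in> K'"
    then obtain x y where "z = x + y" "x \<in> K" "y \<in> cball 0 e" by (auto simp: K'_def)
    then have "z \<in> (\<Union>x\<in>K. cball x e)" by (auto simp: dist_norm intro!: bexI[of _ x])
    then show "z \<in> S" using e(2) by blast
  qed
  define r where "r n = e * inverse (real (Suc n))" for n
  have r0: "r n > 0" "r n <= e" for n using e(1) by (auto simp: r_def field_simps)
  have rlim: "r \<longlonglongrightarrow> 0" unfolding r_def by (rule tendsto_mult_right_zero[OF LIMSEQ_inverse_real_of_nat])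
  define k where "k n = mollifier (r n)" for n
  define kd where "kd n i = partial i (mollifier (r n))" for n i
  have tk: "k n \<in> test_functions UNIV" for n using test_mollifier[OF r0(1)[of n], of 0 UNIV] by (simp add: k_def)
  have sk: "smooth (k n)" for n by (rule test_functionsE[OF tk])
  have tkd: "kd n i \<in> test_functions UNIV" for n i
    using test_functions_partial[OF tk] by (simp add: kd_def k_def)
  \<comment> \<open>The functions p, q, s carry the terms with the derivative on \<eta>, with the
    derivative on the mollifier, and with the divergence of u.\<close>
  define p where "p i x = indicator K x *\<^sub>R (u x $ i * complex_of_real (partial i \<eta> x))" for i x
  define q where "q i x = indicator K x *\<^sub>R (u x $ i * complex_of_real (\<eta> x))" for i x
  define s where "s x = indicator K x *\<^sub>R (d x * complex_of_real (\<eta> x))" for x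
  define H where "H x = indicator K' x *\<^sub>R (h x * complex_of_real 1)" for x
  define G where "G i x = indicator K' x *\<^sub>R (g x $ i * complex_of_real 1)" for i x
  obtain M0 where M0: "!!x. \<bar>\<eta> x\<bar> <= M0" by (rule test_functions_bounded[OF \<eta>]) (rule that)
  note pp = locally_L2_cutoff[OF u K(2,3) test_functions_measurable[OF test_functions_partial[OF \<eta>]]]
  have P: "square_integrable (p i)" "integrable lborel (p i)" for i
  proof -
    obtain M where "!!x. \<bar>partial i \<eta> x\<bar> <= M"
      by (rule test_functions_bounded[OF test_functions_partial[OF \<eta>]]) (rule that)
    then show "square_integrable (p i)" "integrable lborel (p i)" unfolding p_def using pp by blast+
  qed
  have Q: "square_integrable (q i)" "integrable lborel (q i)" for i
    unfolding q_def using locally_L2_cutoff[OF u K(2,3) test_functions_measurable[OF \<eta>] M0] by blast+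
  have Sf: "square_integrable s" "integrable lborel s"
    unfolding s_def using locally_L2_cutoff[OF d K(2,3) test_functions_measurable[OF \<eta>] M0] by blast+
  have Hf: "square_integrable H" "integrable lborel H"
    unfolding H_def using locally_L2_cutoff[OF h K' K'S, of "%x. 1" 1] by simp_all
  have Gf: "square_integrable (G i)" "integrable lborel (G i)" for i
    unfolding G_def using locally_L2_cutoff[OF g K' K'S, of "%x. 1" 1] by simp_all
  have ki: "integrable lborel (%x. f x * complex_of_real (\<kappa> (x - y)))"
    "integrable lborel (%y. a y * (\<integral>x. f x * complex_of_real (\<kappa> (x - y)) \<partial>lborel))"
    "(\<integral>y. a y * (\<integral>x. f x * complex_of_real (\<kappa> (x - y)) \<partial>lborel) \<partial>lborel)
       = (\<integral>x. f x * (\<integral>y. a y * complex_of_real (\<kappa> (x - y)) \<partial>lborel) \<partial>lborel)"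
    if f: "integrable lborel f" and a: "integrable lborel a" and \<kappa>: "\<kappa> \<in> test_functions UNIV" for f a :: "real^3 => complex" and \<kappa> y
  proof -
    obtain M where M: "!!x. \<bar>\<kappa> x\<bar> <= M" by (rule test_functions_bounded[OF \<kappa>]) (rule that)
    note [measurable] = test_functions_measurable[OF \<kappa>]
    have [measurable]: "f \<in> borel_measurable borel" using f by simp
    show "integrable lborel (%x. f x * complex_of_real (\<kappa> (x - y)))"
    proof (rule Bochner_Integration.integrable_bound[OF integrable_mult_right[OF integrable_norm[OF f], of M]])
      show "AE x in lborel. norm (f x * complex_of_real (\<kappa> (x - y))) <= norm (M * norm (f x))"
      proof (rule AE_I2)
        fix x
        have "norm (f x * complex_of_real (\<kappa> (x - y))) <= M * norm (f x)"
          using mult_left_mono[OF M norm_ge_zero] by (simp add: norm_mult mult.commute)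
        then show "norm (f x * complex_of_real (\<kappa> (x - y))) <= norm (M * norm (f x))" by simp
      qed
    qed measurable
    have "integrable lborel (%y. \<integral>x. f x * (a y * complex_of_real (\<kappa> (x - y))) \<partial>lborel)"
      by (rule lborel_pair.integrable_snd[OF convolution_kernel_integrable[OF f a test_functions_measurable[OF \<kappa>] M]])
    moreover have "(\<integral>x. f x * (a y * complex_of_real (\<kappa> (x - y))) \<partial>lborel)
        = a y * (\<integral>x. f x * complex_of_real (\<kappa> (x - y)) \<partial>lborel)" for y
    proof -
      have "(%x. f x * (a y * complex_of_real (\<kappa> (x - y)))) = (%x. a y * (f x * complex_of_real (\<kappa> (x - y))))"
        by (simp only: mult.left_commute)
      then show ?thesis by simp
    qed
    ultimately show "integrable lborel (%y. a y * (\<integral>x. f x * complex_of_real (\<kappa> (x - y)) \<partial>lborel))" by simp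
    show "(\<integral>y. a y * (\<integral>x. f x * complex_of_real (\<kappa> (x - y)) \<partial>lborel) \<partial>lborel)
       = (\<integral>x. f x * (\<integral>y. a y * complex_of_real (\<kappa> (x - y)) \<partial>lborel) \<partial>lborel)"
      by (rule convolution_kernel_swap[OF f a test_functions_measurable[OF \<kappa>] M])
  qed
  let ?I = "%f a \<kappa>. \<integral>x. f x * (\<integral>y. a y * complex_of_real (\<kappa> (x - y)) \<partial>lborel) \<partial>lborel"
  \<comment> \<open>The product rule holds exactly at every mollification level; only its passage to
    the limit uses convergence.\<close>
  have identity: "(\<Sum>i\<in>UNIV. ?I (p i) H (k n)) + (\<Sum>i\<in>UNIV. ?I (q i) (G i) (k n)) + ?I s H (k n) = 0" for n
  proof -
    have step1: "(\<Sum>i\<in>UNIV. \<integral>x. p i x * complex_of_real (k n (x - y)) \<partial>lborel)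
        + (\<Sum>i\<in>UNIV. \<integral>x. q i x * complex_of_real (kd n i (x - y)) \<partial>lborel)
        + (\<integral>x. s x * complex_of_real (k n (x - y)) \<partial>lborel) = 0" for y
    proof -
      have smk: "smooth (%x. k n (x - y))"
        using test_mollifier[OF r0(1)[of n], of y UNIV] by (auto simp: k_def elim: test_functionsE)
      let ?\<phi> = "%x. \<eta> x * k n (x - y)"
      have "?\<phi> \<in> test_functions S" by (rule test_functions_mult[OF \<eta> smk])
      with div have "(LINT x:S|lborel. (\<Sum>i\<in>UNIV. u x $ i * complex_of_real (partial i ?\<phi> x)))
          = - (LINT x:S|lborel. d x * complex_of_real (?\<phi> x))"
        unfolding has_weak_divergence_def by blast
      moreover have "(LINT x:S|lborel. d x * complex_of_real (?\<phi> x)) = (\<integral>x. s x * complex_of_real (k n (x - y)) \<partial>lborel)"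
        unfolding set_lebesgue_integral_def s_def using K(3,4)
        by (intro Bochner_Integration.integral_cong) (auto simp: indicator_def)
      moreover have "(LINT x:S|lborel. (\<Sum>i\<in>UNIV. u x $ i * complex_of_real (partial i ?\<phi> x)))
         = (\<integral>x. (\<Sum>i\<in>UNIV. p i x * complex_of_real (k n (x - y)) + q i x * complex_of_real (kd n i (x - y))) \<partial>lborel)"
        unfolding set_lebesgue_integral_def
      proof (intro Bochner_Integration.integral_cong refl)
        fix x
        have pd: "partial i ?\<phi> x = partial i \<eta> x * k n (x - y) + \<eta> x * kd n i (x - y)" for i
          using partial_mult[OF K(1) smk] partial_shift[OF sk] by (simp add: kd_def k_def)
        show "indicator S x *\<^sub>R (\<Sum>i\<in>UNIV. u x $ i * complex_of_real (partial i ?\<phi> x))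
          = (\<Sum>i\<in>UNIV. p i x * complex_of_real (k n (x - y)) + q i x * complex_of_real (kd n i (x - y)))"
        proof (cases "x \<in> K")
          case True
          then have "x \<in> S" using K(3) by blast
          with True show ?thesis by (simp add: pd p_def q_def algebra_simps)
        next
          case False
          then show ?thesis by (simp add: pd K(4,5) p_def q_def)
        qed
      qed
      moreover have "(\<integral>x. (\<Sum>i\<in>UNIV. p i x * complex_of_real (k n (x - y)) + q i x * complex_of_real (kd n i (x - y))) \<partial>lborel)
        = (\<Sum>i\<in>UNIV. (\<integral>x. p i x * complex_of_real (k n (x - y)) \<partial>lborel) + (\<integral>x. q i x * complex_of_real (kd n i (x - y)) \<partial>lborel))"
        using ki(1)[OF P(2) P(2) tk] ki(1)[OF Q(2) Q(2) tkd] by simp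
      ultimately have "(\<Sum>i\<in>UNIV. \<integral>x. p i x * complex_of_real (k n (x - y)) \<partial>lborel)
        + (\<Sum>i\<in>UNIV. \<integral>x. q i x * complex_of_real (kd n i (x - y)) \<partial>lborel)
        = - (\<integral>x. s x * complex_of_real (k n (x - y)) \<partial>lborel)" by (simp add: sum.distrib)
      then show ?thesis by (simp only: eq_neg_iff_add_eq_0)
    qed
    have "0 = (\<integral>y. H y * ((\<Sum>i\<in>UNIV. \<integral>x. p i x * complex_of_real (k n (x - y)) \<partial>lborel)
        + (\<Sum>i\<in>UNIV. \<integral>x. q i x * complex_of_real (kd n i (x - y)) \<partial>lborel)
        + (\<integral>x. s x * complex_of_real (k n (x - y)) \<partial>lborel)) \<partial>lborel)"
      unfolding step1 by simp
    also have "\<dots> = (\<integral>y. (\<Sum>i\<in>UNIV. H y * (\<integral>x. p i x * complex_of_real (k n (x - y)) \<partial>lborel))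
        + (\<Sum>i\<in>UNIV. H y * (\<integral>x. q i x * complex_of_real (kd n i (x - y)) \<partial>lborel))
        + H y * (\<integral>x. s x * complex_of_real (k n (x - y)) \<partial>lborel) \<partial>lborel)"
      by (simp only: distrib_left sum_distrib_left)
    also have "\<dots> = (\<Sum>i\<in>UNIV. \<integral>y. H y * (\<integral>x. p i x * complex_of_real (k n (x - y)) \<partial>lborel) \<partial>lborel)
        + (\<Sum>i\<in>UNIV. \<integral>y. H y * (\<integral>x. q i x * complex_of_real (kd n i (x - y)) \<partial>lborel) \<partial>lborel)
        + (\<integral>y. H y * (\<integral>x. s x * complex_of_real (k n (x - y)) \<partial>lborel) \<partial>lborel)"
      using ki(2)[OF P(2) Hf(2) tk] ki(2)[OF Q(2) Hf(2) tkd] ki(2)[OF Sf(2) Hf(2) tk] by simp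
    also have "\<dots> = (\<Sum>i\<in>UNIV. ?I (p i) H (k n)) + (\<Sum>i\<in>UNIV. ?I (q i) H (kd n i)) + ?I s H (k n)"
      by (simp only: ki(3)[OF P(2) Hf(2) tk] ki(3)[OF Q(2) Hf(2) tkd] ki(3)[OF Sf(2) Hf(2) tk])
    finally have eq0: "0 = (\<Sum>i\<in>UNIV. ?I (p i) H (k n)) + (\<Sum>i\<in>UNIV. ?I (q i) H (kd n i)) + ?I s H (k n)" .
    have "?I (q i) H (kd n i) = ?I (q i) (G i) (k n)" for i
    proof (intro Bochner_Integration.integral_cong refl)
      fix x
      show "q i x * (\<integral>y. H y * complex_of_real (kd n i (x - y)) \<partial>lborel)
          = q i x * (\<integral>y. G i y * complex_of_real (k n (x - y)) \<partial>lborel)"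
      proof (cases "x \<in> K")
        case True
        let ?\<phi> = "%y. k n (x - y)"
        \<comment> \<open>For x in the support of \<eta> the kernel, as a function of y, is
          supported in K', hence a test function for the weak gradient of h.\<close>
        have cbn: "cball x (r n) \<subseteq> K'" using cb[OF True] r0(2)[of n] by (auto intro: order_trans)
        have eq: "?\<phi> = (%y. mollifier (r n) (y - x))"
          using mollifier_minus[of "r n" "x - _"] by (simp add: k_def)
        have t: "?\<phi> \<in> test_functions S"
          unfolding eq by (rule test_mollifier[OF r0(1)]) (use cbn K'S in blast)
        have pd: "partial i ?\<phi> y = - kd n i (x - y)" for y
          unfolding k_def kd_def by (rule partial_mollifier_reflect[OF r0(1)])
        have out: "k n (x - y) = 0" "kd n i (x - y) = 0" if "y \<notin> K'" for y
        proof -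
          have t': "?\<phi> \<in> test_functions K'" unfolding eq by (rule test_mollifier[OF r0(1) cbn])
          have "?\<phi> y = 0 & partial i ?\<phi> y = 0" by (rule test_functionsE[OF t']) (use that in blast)
          then show "k n (x - y) = 0" "kd n i (x - y) = 0" unfolding pd by auto
        qed
        have "(LINT y:S|lborel. h y * complex_of_real (partial i ?\<phi> y)) = - (LINT y:S|lborel. g y $ i * complex_of_real (?\<phi> y))"
          using grad t unfolding has_weak_gradient_def by blast
        moreover have "(LINT y:S|lborel. h y * complex_of_real (partial i ?\<phi> y)) = (\<integral>y. - (H y * complex_of_real (kd n i (x - y))) \<partial>lborel)"
          unfolding set_lebesgue_integral_def pd H_def using K'S out
          by (intro Bochner_Integration.integral_cong) (auto simp: indicator_def)
        moreover have "(LINT y:S|lborel. g y $ i * complex_of_real (?\<phi> y)) = (\<integral>y. G i y * complex_of_real (k n (x - y)) \<partial>lborel)"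
          unfolding set_lebesgue_integral_def G_def using K'S out
          by (intro Bochner_Integration.integral_cong) (auto simp: indicator_def)
        ultimately show ?thesis by simp
      qed (simp add: q_def)
    qed
    with eq0 show ?thesis by (simp only:)
  qed
  let ?J = "%f a. \<integral>x. f x * a x \<partial>lborel"
  have "(%n. (\<Sum>i\<in>UNIV. ?I (p i) H (k n)) + (\<Sum>i\<in>UNIV. ?I (q i) (G i) (k n)) + ?I s H (k n))
      \<longlonglongrightarrow> (\<Sum>i\<in>UNIV. ?J (p i) H) + (\<Sum>i\<in>UNIV. ?J (q i) (G i)) + ?J s H"
    unfolding k_def
    by (intro tendsto_add tendsto_sum approximate_identity_mollifier P Q Sf Hf Gf r0 rlim)
  then have lim: "(\<Sum>i\<in>UNIV. ?J (p i) H) + (\<Sum>i\<in>UNIV. ?J (q i) (G i)) + ?J s H = 0"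
    unfolding identity by (simp add: LIMSEQ_const_iff)
  have KK': "K \<subseteq> K'" using cb e(1) by force
  note iP = square_integrable_mult[OF P(1) Hf(1)] and iQ = square_integrable_mult[OF Q(1) Gf(1)]
    and iS = square_integrable_mult[OF Sf(1) Hf(1)]
  have "(LINT x:S|lborel. h x * (\<Sum>i\<in>UNIV. u x $ i * complex_of_real (partial i \<eta> x))) = (\<integral>x. (\<Sum>i\<in>UNIV. p i x * H x) \<partial>lborel)"
    unfolding set_lebesgue_integral_def
  proof (intro Bochner_Integration.integral_cong refl)
    fix x
    show "indicator S x *\<^sub>R (h x * (\<Sum>i\<in>UNIV. u x $ i * complex_of_real (partial i \<eta> x))) = (\<Sum>i\<in>UNIV. p i x * H x)"
    proof (cases "x \<in> K")
      case True
      then have "x \<in> S" "x \<in> K'" using K(3) KK' by auto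
      then show ?thesis using True by (simp add: p_def H_def sum_distrib_left mult_ac)
    qed (simp add: p_def K(5))
  qed
  also have "\<dots> = (\<Sum>i\<in>UNIV. ?J (p i) H)" using iP by simp
  also have "\<dots> = - ((\<Sum>i\<in>UNIV. ?J (q i) (G i)) + ?J s H)" using lim by (simp only: eq_neg_iff_add_eq_0 add.assoc)
  also have "(\<Sum>i\<in>UNIV. ?J (q i) (G i)) + ?J s H = (\<integral>x. (\<Sum>i\<in>UNIV. q i x * G i x) + s x * H x \<partial>lborel)"
    using iQ iS by simp
  also have "\<dots> = (LINT x:S|lborel. ((\<Sum>i\<in>UNIV. u x $ i * g x $ i) + d x * h x) * complex_of_real (\<eta> x))"
    unfolding set_lebesgue_integral_def
  proof (intro Bochner_Integration.integral_cong refl)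
    fix x
    show "(\<Sum>i\<in>UNIV. q i x * G i x) + s x * H x
       = indicator S x *\<^sub>R (((\<Sum>i\<in>UNIV. u x $ i * g x $ i) + d x * h x) * complex_of_real (\<eta> x))"
    proof (cases "x \<in> K")
      case True
      then have "x \<in> S" "x \<in> K'" using K(3) KK' by auto
      then show ?thesis using True by (simp add: q_def s_def G_def H_def sum_distrib_left sum_distrib_right distrib_right distrib_left mult_ac)
    qed (simp add: q_def s_def K(4))
  qed
  finally show ?thesis .
qed

text \<open>Since \<eta> times a mollifier is again a test function, \<eta> d is orthogonal to all
  mollifications of the conjugate of d; in the limit this pairing becomes the weighted norm.\<close>

lemma fundamental_lemma:
  assumes S: "open S" and d: "locally_L2 S d"
    and div: "!!\<phi>. \<phi> \<in> test_functions S ==> (LINT x:S|lborel. d x * complex_of_real (\<phi> x)) = 0"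
    and \<eta>: "\<eta> \<in> test_functions S"
  shows "(LINT x:S|lborel. (norm (d x))\<^sup>2 * \<eta> x) = 0"
proof -
  obtain K where K: "smooth \<eta>" "compact K" "K \<subseteq> S" "!!x. x \<notin> K ==> \<eta> x = 0"
    by (rule test_functionsE[OF \<eta>]) (rule that)
  define r where "r n = 1 * inverse (real (Suc n))" for n
  have r0: "r n > 0" for n by (auto simp: r_def field_simps)
  have rlim: "r \<longlonglongrightarrow> 0" unfolding r_def by (rule tendsto_mult_right_zero[OF LIMSEQ_inverse_real_of_nat])
  define s where "s x = indicator K x *\<^sub>R (d x * complex_of_real (\<eta> x))" for x
  define H where "H x = indicator K x *\<^sub>R (d x * complex_of_real 1)" for x
  obtain M0 where M0: "!!x. \<bar>\<eta> x\<bar> <= M0" by (rule test_functions_bounded[OF \<eta>]) (rule that)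
  have Sf: "square_integrable s" "integrable lborel s"
    unfolding s_def using locally_L2_cutoff[OF d K(2,3) test_functions_measurable[OF \<eta>] M0] by blast+
  have Hf: "square_integrable H" "integrable lborel H"
    unfolding H_def using locally_L2_cutoff[OF d K(2,3), of "%x. 1" 1] by simp_all
  have cf: "square_integrable (%x. cnj (H x))" "integrable lborel (%x. cnj (H x))"
    using Hf by (auto simp: square_integrable_def intro!: borel_measurable_continuous_on[of cnj] continuous_intros)
  have "(\<integral>x. s x * (\<integral>y. cnj (H y) * complex_of_real (mollifier (r n) (x - y)) \<partial>lborel) \<partial>lborel) = 0" for n
  proof -
    have t: "mollifier (r n) \<in> test_functions UNIV" using test_mollifier[OF r0[of n], of 0 UNIV] by simp
    obtain M where M: "!!x. \<bar>mollifier (r n) x\<bar> <= M" by (rule test_functions_bounded[OF t]) (rule that)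
    have "(\<integral>x. s x * complex_of_real (mollifier (r n) (x - y)) \<partial>lborel) = 0" for y
    proof -
      have smk: "smooth (%x. mollifier (r n) (x - y))"
        using test_mollifier[OF r0(1)[of n], of y UNIV] by (auto elim: test_functionsE)
      have "(\<integral>x. s x * complex_of_real (mollifier (r n) (x - y)) \<partial>lborel)
          = (LINT x:S|lborel. d x * complex_of_real (\<eta> x * mollifier (r n) (x - y)))"
        unfolding set_lebesgue_integral_def s_def using K(3,4)
        by (intro Bochner_Integration.integral_cong) (auto simp: indicator_def)
      then show ?thesis using div[OF test_functions_mult[OF \<eta> smk]] by simp
    qed
    then show ?thesis
      by (subst convolution_kernel_swap[symmetric, OF Sf(2) cf(2) test_functions_measurable[OF t] M]) simp
  qed
  then have "(\<integral>x. s x * cnj (H x) \<partial>lborel) = 0"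
    using approximate_identity_mollifier[OF Sf cf r0 rlim] by (simp add: LIMSEQ_const_iff)
  moreover have "s x * cnj (H x) = complex_of_real (indicator S x *\<^sub>R ((norm (d x))\<^sup>2 * \<eta> x))" for x
    using K(3,4) complex_norm_square[of "d x"]
    by (cases "x \<in> K") (auto simp: s_def H_def indicator_def mult_ac)
  ultimately show ?thesis by (simp add: set_lebesgue_integral_def del: of_real_mult of_real_power)
qed

section \<open>Hardy's inequality and the duality of gradient and divergence\<close>

lemma
  fixes f :: "'i => 'a => 'b::{banach, second_countable_topology}"
  assumes "!!i. i \<in> I ==> set_integrable M A (f i)"
  shows set_integrable_sum: "set_integrable M A (%x. \<Sum>i\<in>I. f i x)"
    and set_integral_sum: "(LINT x:A|M. (\<Sum>i\<in>I. f i x)) = (\<Sum>i\<in>I. LINT x:A|M. f i x)"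
  using assms unfolding set_integrable_def set_lebesgue_integral_def scaleR_sum_right
  by (auto intro!: Bochner_Integration.integrable_sum Bochner_Integration.integral_sum)

lemma locally_L2_mult_test:
  assumes a: "locally_L2 S a" and b: "locally_L2 S b" and \<phi>: "\<phi> \<in> test_functions S"
  shows "set_integrable lborel S (%x. a x * b x * complex_of_real (\<phi> x))"
proof -
  obtain K where K: "compact K" "K \<subseteq> S" "!!x. x \<notin> K ==> \<phi> x = 0"
    by (rule test_functionsE[OF \<phi>]) (rule that)
  obtain M where M: "!!x. \<bar>\<phi> x\<bar> <= M" by (rule test_functions_bounded[OF \<phi>]) (rule that)
  have "square_integrable (%x. indicator K x *\<^sub>R (a x * complex_of_real (\<phi> x)))"
    by (rule locally_L2_cutoff(1)[OF a K(1,2) test_functions_measurable[OF \<phi>] M])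
  moreover have "square_integrable (%x. indicator K x *\<^sub>R (b x * complex_of_real 1))"
    by (rule locally_L2_cutoff(1)[OF b K(1,2), of "%x. 1" 1]) simp_all
  ultimately have "integrable lborel (%x. (indicator K x *\<^sub>R (a x * complex_of_real (\<phi> x))) * (indicator K x *\<^sub>R (b x * complex_of_real 1)))"
    by (rule square_integrable_mult)
  moreover have "(%x. (indicator K x *\<^sub>R (a x * complex_of_real (\<phi> x))) * (indicator K x *\<^sub>R (b x * complex_of_real 1)))
      = (%x. indicator S x *\<^sub>R (a x * b x * complex_of_real (\<phi> x)))"
  proof
    fix x
    show "(indicator K x *\<^sub>R (a x * complex_of_real (\<phi> x))) * (indicator K x *\<^sub>R (b x * complex_of_real 1))
      = indicator S x *\<^sub>R (a x * b x * complex_of_real (\<phi> x))"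
      using K(2,3) by (cases "x \<in> K") (auto simp: indicator_def mult_ac)
  qed
  ultimately show ?thesis by (simp add: set_integrable_def)
qed

lemma locally_L2_cnj: "locally_L2 S a ==> locally_L2 S (%x. cnj (a x))"
proof -
  assume a: "locally_L2 S a"
  have "(%x. cnj (indicator S x *\<^sub>R a x)) \<in> borel_measurable lborel"
    using a by (intro borel_measurable_continuous_on[of cnj] continuous_intros)
      (simp add: locally_L2_def set_borel_measurable_def)
  then show ?thesis using a by (simp add: locally_L2_def set_borel_measurable_def)
qed

lemma bounded_linear_axis_cnj: "bounded_linear (%z. axis i (cnj z) :: complex^3)"
  unfolding linear_conv_bounded_linear[symmetric]
  by (intro linearI) (auto simp: vec_eq_iff axis_def)

lemma has_weak_gradient_cnj:
  assumes "has_weak_gradient S h g" "\<phi> \<in> test_functions S"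
  shows "(LINT x:S|lborel. cnj (h x) * complex_of_real (partial i \<phi> x)) =
    - (LINT x:S|lborel. cnj (g x $ i) * complex_of_real (\<phi> x))"
proof -
  have "(LINT x:S|lborel. cnj (f x) * complex_of_real (\<kappa> x)) = cnj (LINT x:S|lborel. f x * complex_of_real (\<kappa> x))" for f \<kappa>
    unfolding set_lebesgue_integral_def by (subst Bochner_Integration.integral_cnj[symmetric]) simp
  then show ?thesis using assms unfolding has_weak_gradient_def by simp
qed

text \<open>The field with the single component cnj h in direction i has weak divergence cnj (g i).
  Pairing it with h itself gives the derivative of |h|^2.\<close>

lemma weak_gradient_norm_sq:
  assumes S: "open S" and grad: "has_weak_gradient S h g"
    and h: "locally_L2 S h" and g: "!!i. locally_L2 S (%x. g x $ i)"
    and \<phi>: "\<phi> \<in> test_functions S"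
  shows "(LINT x:S|lborel. (norm (h x))\<^sup>2 * partial i \<phi> x) = - (LINT x:S|lborel. 2 * Re (cnj (h x) * g x $ i) * \<phi> x)"
proof -
  let ?u = "%x. axis i (cnj (h x)) :: complex^3" and ?d = "%x. cnj (g x $ i)"
  have div: "has_weak_divergence S ?u ?d"
    unfolding has_weak_divergence_def locally_integrable_def
  proof (intro conjI allI impI ballI)
    fix K assume K: "compact K & K \<subseteq> S"
    then have "set_integrable lborel K h" using grad by (simp add: has_weak_gradient_def locally_integrable_def)
    note i1 = integrable_bounded_linear[OF bounded_linear_axis_cnj[of i] this[unfolded set_integrable_def]]
    show "set_integrable lborel K ?u"
    proof -
      have "axis i (cnj (indicator K x *\<^sub>R h x)) = indicator K x *\<^sub>R ?u x" for x
        by (simp add: vec_eq_iff axis_def)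
      with i1 show ?thesis unfolding set_integrable_def by (simp only:)
    qed
    have "set_integrable lborel K g" using grad K by (simp add: has_weak_gradient_def locally_integrable_def)
    from integrable_bounded_linear[OF bounded_linear_compose[OF bounded_linear_cnj bounded_linear_vec_nth[of i]] this[unfolded set_integrable_def]]
    show "set_integrable lborel K ?d" unfolding set_integrable_def by simp
  next
    fix \<psi> assume "\<psi> \<in> test_functions S"
    moreover have "(\<Sum>j\<in>UNIV. ?u x $ j * complex_of_real (partial j \<psi> x)) = cnj (h x) * complex_of_real (partial i \<psi> x)" for x
      by (subst sum.remove[of _ i]) (auto simp: axis_def intro!: sum.neutral)
    ultimately show "(LINT x:S|lborel. (\<Sum>j\<in>UNIV. ?u x $ j * complex_of_real (partial j \<psi> x)))
        = - (LINT x:S|lborel. ?d x * complex_of_real (\<psi> x))"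
      using has_weak_gradient_cnj[OF grad] by simp
  qed
  have u2: "locally_L2 S (%x. ?u x $ j)" for j
    using locally_L2_cnj[OF h] by (cases "j = i") (auto simp: axis_def locally_L2_def set_borel_measurable_def set_integrable_def)
  have s: "(\<Sum>j\<in>UNIV. ?u x $ j * complex_of_real (partial j \<phi> x)) = cnj (h x) * complex_of_real (partial i \<phi> x)"
          "(\<Sum>j\<in>UNIV. ?u x $ j * g x $ j) = cnj (h x) * g x $ i" for x
    by (subst sum.remove[of _ i]; auto simp: axis_def intro!: sum.neutral)+
  have "(LINT x:S|lborel. h x * (cnj (h x) * complex_of_real (partial i \<phi> x)))
      = - (LINT x:S|lborel. (cnj (h x) * g x $ i + cnj (g x $ i) * h x) * complex_of_real (\<phi> x))"
    using weak_derivative_pairing[OF S div grad u2 locally_L2_cnj[OF g] h g \<phi>] unfolding s .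
  moreover have "h x * (cnj (h x) * complex_of_real (partial i \<phi> x)) = complex_of_real ((norm (h x))\<^sup>2 * partial i \<phi> x)" for x
    by (simp add: complex_norm_square mult.assoc del: of_real_power)
  moreover have "(cnj (h x) * g x $ i + cnj (g x $ i) * h x) * complex_of_real (\<phi> x)
      = complex_of_real (2 * Re (cnj (h x) * g x $ i) * \<phi> x)" for x
    by (simp add: complex_eq_iff algebra_simps)
  moreover note set_integral_complex_of_real
  ultimately have "complex_of_real (LINT x:S|lborel. (norm (h x))\<^sup>2 * partial i \<phi> x)
      = complex_of_real (- (LINT x:S|lborel. 2 * Re (cnj (h x) * g x $ i) * \<phi> x))"
    by (simp only: of_real_minus set_integral_complex_of_real)
  then show ?thesis by (simp only: of_real_eq_iff)
qed

lemma exp_flat_Suc: "t > 0 ==> t * exp_flat (Suc j) t = exp_flat j t"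
  by (simp add: exp_flat_def)

text \<open>With t = (n + 1) \<delta> - 1 the factor t + 1 is (n + 1) \<delta>, so the left side is
  \<delta> times the slope of the cutoff below.\<close>

lemma exp_flat_2_weighted: "t > 0 ==> (t + 1) * exp_flat 2 t = exp_flat 1 t + exp_flat 2 t"
  using exp_flat_Suc[of t 1] by (simp add: distrib_right numeral_2_eq_2)

lemma exp_flat_le: "exp_flat j t <= fact j"
proof (cases "t > 0 & j > 0")
  case True
  then obtain i where i: "j = Suc i" by (cases j) auto
  have "exp_flat j t = exp_flat i t / t" using True by (simp add: exp_flat_def i)
  also have "\<dots> <= fact j" using exp_flat_bound[of i t] True by (simp add: divide_le_eq i del: fact_Suc)
  finally show ?thesis .
qed (auto simp: exp_flat_def)

lemma exp_flat_0_tendsto: "filterlim f at_top sequentially ==> (%n. exp_flat 0 (f n)) \<longlonglongrightarrow> 1"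
proof -
  assume f: "filterlim f at_top sequentially"
  have "((%t::real. exp (- 1 / t)) \<longlongrightarrow> exp 0) at_top"
    by (intro tendsto_exp tendsto_divide_0[OF tendsto_const] filterlim_at_top_imp_at_infinity filterlim_ident)
  then have "((%t. exp_flat 0 t) \<longlongrightarrow> 1) at_top"
    unfolding exp_zero
    by (rule Lim_transform_eventually) (auto simp: exp_flat_def intro: eventually_mono[OF eventually_gt_at_top[of 0]])
  with f show ?thesis by (auto intro: filterlim_compose)
qed

section \<open>Cutoffs of the ball\<close>

locale ball_domain =
  fixes R :: real
  assumes R: "R > 0"
begin

abbreviation S :: "(real^3) set" where "S \<equiv> ball 0 R"

text \<open>A polynomial substitute for the boundary distance: inside the ball it is that distance
  times a factor between R and 2 R.\<close>

definition \<delta> :: "real^3 => real" where "\<delta> x = R\<^sup>2 - (norm x)\<^sup>2"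

lemma \<delta>_pos: "x \<in> S ==> \<delta> x > 0"
  using power_strict_mono[of "norm x" R 2] by (simp add: \<delta>_def)

lemma continuous_\<delta>: "continuous_on A \<delta>" unfolding \<delta>_def by (intro continuous_intros)

lemma \<delta>_measurable [measurable]: "\<delta> \<in> borel_measurable borel"
  by (rule borel_measurable_continuous_onI) (rule continuous_\<delta>)

lemma smooth_\<delta>: "smooth \<delta>"
  using smooth_diff[OF smooth_const smooth_norm_sq[of 0]] unfolding \<delta>_def by simp

lemma partial_\<delta>: "partial i \<delta> x = - 2 * x $ i"
proof -
  have "(\<delta> has_derivative (%h. (- 2 *\<^sub>R x) \<bullet> h)) (at x)"
    unfolding \<delta>_def power2_norm_eq_inner
    by (auto intro!: derivative_eq_intros simp: inner_commute)
  from has_derivative_inner_axis[OF this] show ?thesis by simp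
qed

text \<open>Zero where \<delta> <= 1 / (n + 1), and a nondecreasing function of \<delta>; the
  monotonicity gives its gradient the sign needed in the Hardy inequality.\<close>

definition cutoff :: "nat => real^3 => real" where
  "cutoff n x = exp_flat 0 (real (Suc n) * \<delta> x - 1)"

lemma smooth_cutoff: "smooth (cutoff n)"
  unfolding cutoff_def by (intro smooth_exp_flat smooth_diff smooth_mult smooth_const smooth_\<delta>)

lemma cutoff_test: "cutoff n \<in> test_functions S"
proof (rule test_functionsI[OF smooth_cutoff])
  let ?K = "{x. real (Suc n) * \<delta> x >= 1}"
  have sub: "?K \<subseteq> S"
  proof
    fix x assume "x \<in> ?K"
    then have "0 < real (Suc n) * \<delta> x" by simp
    then have "\<delta> x > 0" by (simp add: zero_less_mult_iff)
    then have "norm x < R" using R by (auto simp: \<delta>_def intro: power2_less_imp_less)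
    then show "x \<in> S" by simp
  qed
  then show "?K \<subseteq> S" .
  have "closed ?K" by (intro closed_Collect_le continuous_intros continuous_\<delta>)
  moreover have "bounded ?K" using bounded_subset[OF bounded_ball sub] .
  ultimately show "compact ?K" by (simp add: compact_eq_bounded_closed)
  show "cutoff n x = 0" if "x \<notin> ?K" for x using that by (simp add: cutoff_def exp_flat_def)
qed

lemma cutoff_nonneg: "cutoff n x >= 0" by (simp add: cutoff_def exp_flat_nonneg)
lemma cutoff_le: "cutoff n x <= 1" using exp_flat_le[of 0] by (simp add: cutoff_def)

lemma cutoff_arg_at_top:
  assumes "x \<in> S"
  shows "filterlim (%n. real (Suc n) * \<delta> x - 1) at_top sequentially"
proof -
  have "\<delta> x > 0" using assms by (rule \<delta>_pos)
  moreover have "filterlim (%n. real (Suc n)) at_top sequentially"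
    by (rule filterlim_compose[OF filterlim_real_sequentially filterlim_Suc])
  ultimately have "filterlim (%n. \<delta> x * real (Suc n)) at_top sequentially"
    by (intro filterlim_tendsto_pos_mult_at_top[OF tendsto_const])
  then have "filterlim (%n. - 1 + \<delta> x * real (Suc n)) at_top sequentially"
    by (intro filterlim_tendsto_add_at_top[OF tendsto_const])
  then show ?thesis by (simp add: mult.commute)
qed

lemma cutoff_tendsto: "x \<in> S ==> (%n. cutoff n x) \<longlonglongrightarrow> 1"
  unfolding cutoff_def by (intro exp_flat_0_tendsto cutoff_arg_at_top)

lemma partial_cutoff: "partial i (cutoff n) x = - 2 * x $ i * (real (Suc n) * exp_flat 2 (real (Suc n) * \<delta> x - 1))"
proof -
  have "((%t. exp_flat 0 (real (Suc n) * t - 1)) has_real_derivative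
      exp_flat 2 (real (Suc n) * \<delta> x - 1) * real (Suc n)) (at (\<delta> x))"
    by (rule DERIV_chain2[of "exp_flat 0"]) (use exp_flat_deriv[of 0] in \<open>auto intro!: derivative_eq_intros simp: numeral_2_eq_2\<close>)
  from partial_chain[OF smooth_\<delta> this, of i] show ?thesis
    unfolding cutoff_def partial_\<delta> by (simp add: mult_ac)
qed

text \<open>Independence of n makes 1 / \<delta> a dominating function for all cutoff gradients. The
  constant is 1! + 2!, from the bounds on \<open>exp_flat 1\<close> and
  \<open>exp_flat 2\<close>.\<close>

lemma cutoff_gradient_bound:
  assumes "x \<in> S"
  shows "real (Suc n) * exp_flat 2 (real (Suc n) * \<delta> x - 1) <= 3 / \<delta> x"
proof -
  let ?t = "real (Suc n) * \<delta> x - 1"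
  have d: "\<delta> x > 0" using assms by (rule \<delta>_pos)
  have "(?t + 1) * exp_flat 2 ?t <= 3"
  proof (cases "?t > 0")
    case True
    show ?thesis unfolding exp_flat_2_weighted[OF True]
      using exp_flat_le[of 1 ?t] exp_flat_le[of 2 ?t] unfolding fact_1 fact_2 by linarith
  qed (simp add: exp_flat_def)
  then have "real (Suc n) * exp_flat 2 ?t * \<delta> x <= 3" by (simp add: mult_ac)
  then show ?thesis using d by (simp add: le_divide_eq)
qed

text \<open>One more power of t is gained from \<open>exp_flat_Suc\<close>: \<delta> times the slope
  is at most 2 / t, and t tends to infinity at each interior point.\<close>

lemma cutoff_gradient_tendsto:
  assumes "x \<in> S"
  shows "(%n. real (Suc n) * exp_flat 2 (real (Suc n) * \<delta> x - 1)) \<longlonglongrightarrow> 0"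
proof -
  have d: "\<delta> x > 0" using assms by (rule \<delta>_pos)
  have "(%n. (2 / \<delta> x) / (real (Suc n) * \<delta> x - 1)) \<longlonglongrightarrow> 0"
    by (intro tendsto_divide_0[OF tendsto_const] filterlim_at_top_imp_at_infinity cutoff_arg_at_top assms)
  moreover have "\<forall>\<^sub>F n in sequentially. norm (real (Suc n) * exp_flat 2 (real (Suc n) * \<delta> x - 1))
      <= (2 / \<delta> x) / (real (Suc n) * \<delta> x - 1)"
    using filterlim_at_top_dense[THEN iffD1, OF cutoff_arg_at_top[OF assms], rule_format, of 0]
  proof eventually_elim
    case (elim n)
    let ?t = "real (Suc n) * \<delta> x - 1"
    have e: "exp_flat 0 ?t <= 1" "exp_flat 1 ?t <= 1" using exp_flat_le[of 0 ?t] exp_flat_le[of 1 ?t] by simp_all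
    have "(?t + 1) * exp_flat 2 ?t = exp_flat 0 ?t / ?t + exp_flat 1 ?t / ?t"
      using exp_flat_2_weighted[OF elim] exp_flat_Suc[OF elim, of 0] exp_flat_Suc[OF elim, of 1] elim
      by (metis One_nat_def Suc_1 less_irrefl nonzero_mult_div_cancel_left)
    also have "\<dots> <= 1 / ?t + 1 / ?t" using e elim by (intro add_mono divide_right_mono) auto
    finally have "real (Suc n) * exp_flat 2 ?t * \<delta> x <= 2 / ?t" by (simp add: mult_ac)
    then have "real (Suc n) * exp_flat 2 ?t <= 2 / ?t / \<delta> x" using d by (simp only: le_divide_eq if_True)
    then show ?case using exp_flat_nonneg[of 2 ?t] by (simp add: mult.commute)
  qed
  ultimately show ?thesis by (rule Lim_null_comparison[rotated])
qed

lemma locally_L2_mult_test_Re: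
  assumes "locally_L2 S a" "locally_L2 S b" "\<phi> \<in> test_functions S"
  shows "set_integrable lborel S (%x. Re (cnj (a x) * b x) * \<phi> x)"
proof -
  have "integrable lborel (%x. Re (indicator S x *\<^sub>R (cnj (a x) * b x * complex_of_real (\<phi> x))))"
    using locally_L2_mult_test[OF locally_L2_cnj[OF assms(1)] assms(2,3)]
    unfolding set_integrable_def by (rule integrable_Re)
  then show ?thesis by (simp add: set_integrable_def)
qed

lemma locally_L2_norm_sq_test:
  assumes "locally_L2 S a" "\<phi> \<in> test_functions S"
  shows "set_integrable lborel S (%x. (norm (a x))\<^sup>2 * \<phi> x)"
proof -
  have "Re (cnj z * z) = (norm z)\<^sup>2" for z
    unfolding cmod_power2 by (simp add: power2_eq_square)
  then show ?thesis using locally_L2_mult_test_Re[OF assms(1) assms(1,2)] by simp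
qed

lemma norm_sq_vec: "(norm v)\<^sup>2 = (\<Sum>i\<in>UNIV. (norm (v $ i))\<^sup>2)" for v :: "'b::real_normed_vector^3"
  by (simp add: norm_vec_def L2_set_def sum_nonneg)

text \<open>
  The vector field tested against \<open>|h|\<^sup>2\<close> is \<open>- x \<theta>\<close> with \<open>\<theta>\<close> a smooth version of \<open>\<surd>\<delta>\<close>; its
  divergence controls \<open>1 / \<surd>\<delta>\<close>, and the derivative of the cutoff enters with a favourable sign.
\<close>

lemma hardy_cutoff:
  assumes grad: "has_weak_gradient S h g"
    and h: "locally_L2 S h" and g: "!!i. locally_L2 S (%x. g x $ i)"
    and hi: "set_integrable lborel S (%x. sqrt (\<delta> x) * (norm (h x))\<^sup>2)"
    and gi: "set_integrable lborel S (%x. \<delta> x * sqrt (\<delta> x) * (norm (g x))\<^sup>2)"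
  shows "set_integrable lborel S (%x. cutoff n x * ((norm x)\<^sup>2 * (norm (h x))\<^sup>2 / sqrt (\<delta> x)))"
    and "(LINT x:S|lborel. cutoff n x * ((norm x)\<^sup>2 * (norm (h x))\<^sup>2 / sqrt (\<delta> x)))
      <= 24 * (LINT x:S|lborel. sqrt (\<delta> x) * (norm (h x))\<^sup>2) + 64 * (LINT x:S|lborel. \<delta> x * sqrt (\<delta> x) * (norm (g x))\<^sup>2)"
proof -
  define e where "e = 1 / real (Suc n)"
  have e: "e > 0" by (simp add: e_def)
  \<comment> \<open>A test function has to be smooth on the whole space, where \<surd>\<delta> fails
    at the sphere. Adding e^2 repairs this, and with e = 1 / (n + 1) the support of the cutoff lies
    in e <= \<delta>, where q is still comparable to \<surd>\<delta>.\<close>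
  define q where "q x = ((\<delta> x)\<^sup>2 + e\<^sup>2) powr (1/4)" for x
  define qd where "qd x = 1/4 * ((\<delta> x)\<^sup>2 + e\<^sup>2) powr (1/4 - 1) * (2 * \<delta> x)" for x
  define N where "N x = real (Suc n) * exp_flat 2 (real (Suc n) * \<delta> x - 1)" for x
  have pos: "t\<^sup>2 + e\<^sup>2 > 0" for t using e by (simp add: add_nonneg_pos)
  have sq: "smooth q" unfolding q_def
  proof (rule smooth_powr[OF _ pos])
    show "smooth (%x. (\<delta> x)\<^sup>2 + e\<^sup>2)"
      unfolding power2_eq_square by (intro smooth_add smooth_mult smooth_\<delta> smooth_const)
  qed
  have pq: "partial i q x = - 2 * x $ i * qd x" for i x
  proof -
    have "((%t. (t\<^sup>2 + e\<^sup>2) powr (1/4)) has_real_derivative qd x) (at (\<delta> x))"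
    proof -
      have "((%t. t\<^sup>2 + e\<^sup>2) has_real_derivative 2 * \<delta> x) (at (\<delta> x))"
        by (auto intro!: derivative_eq_intros)
      from DERIV_chain2[OF has_real_derivative_powr[OF pos[of "\<delta> x"], of "1/4"] this] show ?thesis
        by (simp add: qd_def)
    qed
    from partial_chain[OF smooth_\<delta> this, of i] show ?thesis by (simp add: q_def[abs_def] partial_\<delta> mult_ac)
  qed
  define W where "W i x = cutoff n x * q x * (- 1 * x $ i)" for i x
  have sx: "smooth (%x. - 1 * x $ i)" for i by (intro smooth_mult smooth_const smooth_nth)
  have tq: "(%x. cutoff n x * q x) \<in> test_functions S" by (rule test_functions_mult[OF cutoff_test sq])
  have tW: "W i \<in> test_functions S" for i
    unfolding W_def[abs_def] by (rule test_functions_mult[OF tq sx])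
  have pW: "partial i (W i) x = 2 * (x $ i)\<^sup>2 * (N x * q x + cutoff n x * qd x) - cutoff n x * q x" for i x
  proof -
    have "((%x. - 1 * x $ i) has_derivative (%h. (- axis i 1) \<bullet> h)) (at x)"
      using has_derivative_minus[OF bounded_linear_imp_has_derivative[OF bounded_linear_vec_nth[of i]], where F = "at x"]
      by (simp add: inner_axis')
    from has_derivative_inner_axis[OF this, of i] have "partial i (%x. - 1 * x $ i) x = - 1" by simp
    moreover have "partial i (%x. cutoff n x * q x) x = - 2 * x $ i * (N x * q x + cutoff n x * qd x)"
      unfolding partial_mult[OF smooth_cutoff sq] partial_cutoff pq N_def by (simp add: algebra_simps)
    moreover have "W i = (%x. cutoff n x * q x * (- 1 * x $ i))" by (rule ext) (rule W_def)
    ultimately have "partial i (W i) x = (- 2 * x $ i * (N x * q x + cutoff n x * qd x)) * (- 1 * x $ i) + cutoff n x * q x * (- 1)"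
      using partial_mult[OF smooth_mult[OF smooth_cutoff sq] sx, of i n i x] by (simp only:)
    also have "\<dots> = 2 * (x $ i)\<^sup>2 * (N x * q x + cutoff n x * qd x) - cutoff n x * q x"
      by (simp add: power2_eq_square)
    finally show ?thesis .
  qed
  let ?P = "%x. \<Sum>i\<in>UNIV. (norm (h x))\<^sup>2 * partial i (W i) x + 2 * (Re (cnj (h x) * g x $ i) * W i x)"
  note i1 = locally_L2_norm_sq_test[OF h test_functions_partial[OF tW]]
  note i2 = locally_L2_mult_test_Re[OF h g tW]
  have iP: "set_integrable lborel S ?P"
    using i1 i2 by (intro set_integrable_sum set_integral_add(1) set_integrable_mult_right) auto
  have IP: "(LINT x:S|lborel. ?P x) = 0"
  proof -
    have "(LINT x:S|lborel. ?P x) = (\<Sum>i\<in>UNIV. LINT x:S|lborel. (norm (h x))\<^sup>2 * partial i (W i) x + 2 * (Re (cnj (h x) * g x $ i) * W i x))"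
      using i1 i2 by (intro set_integral_sum set_integral_add(1) set_integrable_mult_right) auto
    also have "\<dots> = (\<Sum>i\<in>(UNIV :: 3 set). 0)"
    proof (rule sum.cong[OF refl])
      fix i :: 3
      have "(LINT x:S|lborel. (norm (h x))\<^sup>2 * partial i (W i) x + 2 * (Re (cnj (h x) * g x $ i) * W i x))
        = (LINT x:S|lborel. (norm (h x))\<^sup>2 * partial i (W i) x) + (LINT x:S|lborel. 2 * (Re (cnj (h x) * g x $ i) * W i x))"
        using i1 i2 by (intro set_integral_add set_integrable_mult_right) auto
      then show "(LINT x:S|lborel. (norm (h x))\<^sup>2 * partial i (W i) x + 2 * (Re (cnj (h x) * g x $ i) * W i x)) = 0"
        using weak_gradient_norm_sq[OF open_ball grad h g tW, of i i] by (simp only: mult.assoc add.left_inverse)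
    qed
    finally show ?thesis by simp
  qed
  \<comment> \<open>\<open>?P\<close> integrates to zero and dominates a quarter of the left side up
    to error terms, whence the factor 4. The errors are 6 = 3 * 2 (three coordinates, and q <= 2
    \<surd>\<delta>) and 16 from the Young inequality below, each times 4.\<close>
  let ?B = "%x. 4 * ?P x + 24 * (sqrt (\<delta> x) * (norm (h x))\<^sup>2) + 64 * (\<delta> x * sqrt (\<delta> x) * (norm (g x))\<^sup>2)"
  have iB: "set_integrable lborel S ?B"
    using iP hi gi by (intro set_integral_add(1) set_integrable_mult_right) auto
  have IB: "(LINT x:S|lborel. ?B x) = 24 * (LINT x:S|lborel. sqrt (\<delta> x) * (norm (h x))\<^sup>2) + 64 * (LINT x:S|lborel. \<delta> x * sqrt (\<delta> x) * (norm (g x))\<^sup>2)"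
  proof -
    note i = set_integrable_mult_right[where a = 4, OF iP] set_integrable_mult_right[where a = 24, OF hi] set_integrable_mult_right[where a = 64, OF gi]
    have "(LINT x:S|lborel. ?B x) = (LINT x:S|lborel. 4 * ?P x) + (LINT x:S|lborel. 24 * (sqrt (\<delta> x) * (norm (h x))\<^sup>2))
        + (LINT x:S|lborel. 64 * (\<delta> x * sqrt (\<delta> x) * (norm (g x))\<^sup>2))"
      by (simp only: set_integral_add[OF set_integral_add(1)[OF i(1,2)] i(3)] set_integral_add[OF i(1,2)])
    then show ?thesis using IP by simp
  qed
  have bound: "cutoff n x * ((norm x)\<^sup>2 * (norm (h x))\<^sup>2 / sqrt (\<delta> x)) <= ?B x" if x: "x \<in> S" for x
  proof -
    have d: "\<delta> x > 0" using x by (rule \<delta>_pos)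
    define u where "u = sqrt (\<delta> x)"
    have u: "u > 0" "u\<^sup>2 = \<delta> x" using d by (simp_all add: u_def)
    define c where "c = cutoff n x"
    define H where "H = norm (h x)"
    have c: "0 <= c" "c <= 1" using cutoff_nonneg cutoff_le by (simp_all add: c_def)
    have N0: "N x >= 0" by (simp add: N_def exp_flat_nonneg)
    have key: "c * q x <= 2 * c * u & c / (4 * u) <= c * qd x"
    proof (cases "c = 0")
      case False
      then have "real (Suc n) * \<delta> x - 1 > 0" by (auto simp: c_def cutoff_def exp_flat_def split: if_splits)
      then have "e <= \<delta> x" by (simp add: e_def field_simps)
      then have "e\<^sup>2 <= (\<delta> x)\<^sup>2" using e by (intro power_mono) auto
      then have le: "(\<delta> x)\<^sup>2 + e\<^sup>2 <= 2 * u ^ 4" using u(2)[symmetric] by (simp add: power_mult[symmetric])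
      have pw: "(2 * u ^ 4) powr a = 2 powr a * u powr (4 * a)" for a
      proof -
        have u4: "u ^ 4 = u powr 4" using powr_numeral[OF less_imp_le[OF u(1)]] by (rule sym)
        show ?thesis unfolding u4 powr_mult powr_powr ..
      qed
      have "q x <= (2 * u ^ 4) powr (1/4)" unfolding q_def using le pos[of "\<delta> x"] by (intro powr_mono2) auto
      also have "\<dots> = 2 powr (1/4) * u" unfolding pw using u(1) by simp
      also have "\<dots> <= 2 powr 1 * u" using u(1) by (intro mult_right_mono powr_mono) auto
      finally have q: "q x <= 2 * u" by simp
      have "1 / 2 * (1 / u ^ 3) <= ((\<delta> x)\<^sup>2 + e\<^sup>2) powr (1/4 - 1)"
      proof -
        have e3: "4 * (1/4 - 1) = (- 3 :: real)" by simp
        have "u powr 3 = u ^ 3" using less_imp_le[OF u(1)] by (rule powr_numeral)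
        then have u3: "1 / u ^ 3 = u powr (4 * (1/4 - 1))" by (simp only: e3 powr_minus inverse_eq_divide)
        have "(1::real) / 2 = 2 powr (-1)" by (simp add: powr_minus)
        also have "\<dots> <= 2 powr (1/4 - 1)" by (intro powr_mono) auto
        finally have "1 / 2 * (1 / u ^ 3) <= 2 powr (1/4 - 1) * (1 / u ^ 3)" using u(1) by (intro mult_right_mono) auto
        also have "\<dots> = (2 * u ^ 4) powr (1/4 - 1)" by (simp only: pw u3)
        also have "\<dots> <= ((\<delta> x)\<^sup>2 + e\<^sup>2) powr (1/4 - 1)" using le pos[of "\<delta> x"] by (intro powr_mono2') auto
        finally show ?thesis .
      qed
      then have "1/4 * (1 / 2 * (1 / u ^ 3)) * (2 * \<delta> x) <= qd x"
        unfolding qd_def using d by (intro mult_right_mono mult_left_mono) auto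
      then have "1 / (4 * u) <= qd x" using u by (simp add: u(2)[symmetric] power2_eq_square power3_eq_cube)
      from mult_left_mono[OF q c(1)] mult_left_mono[OF this c(1)] show ?thesis by (simp add: mult_ac)
    qed simp
    have s: "(norm x)\<^sup>2 = (\<Sum>i\<in>UNIV. (x $ i)\<^sup>2)" by (simp add: norm_sq_vec)
    have "c * (1/4 * (x $ i)\<^sup>2 * H\<^sup>2 / u) - 2 * c * u * H\<^sup>2 - 16 * c * u ^ 3 * (norm (g x $ i))\<^sup>2
       <= H\<^sup>2 * partial i (W i) x + 2 * (Re (cnj (h x) * g x $ i) * W i x)" for i
    proof -
      define G where "G = norm (g x $ i)"
      define X where "X = \<bar>x $ i\<bar>"
      have X2: "(x $ i)\<^sup>2 = X\<^sup>2" by (simp add: X_def)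
      have q0: "q x >= 0" by (simp add: q_def)
      have "c * (1 / (4 * u)) <= N x * q x + c * qd x" using key mult_nonneg_nonneg[OF N0 q0] by simp
      then have "2 * X\<^sup>2 * (c * (1 / (4 * u))) <= 2 * X\<^sup>2 * (N x * q x + c * qd x)"
        by (intro mult_left_mono) auto
      then have "2 * X\<^sup>2 * (c * (1 / (4 * u))) - 2 * c * u <= partial i (W i) x"
        unfolding pW X2 c_def[symmetric] using key by linarith
      then have a1: "H\<^sup>2 * (2 * X\<^sup>2 * (c * (1 / (4 * u))) - 2 * c * u) <= H\<^sup>2 * partial i (W i) x"
        by (intro mult_left_mono) auto
      have "\<bar>Re (cnj (h x) * g x $ i)\<bar> <= norm (cnj (h x) * g x $ i)" by (rule abs_Re_le_cmod)
      then have "\<bar>Re (cnj (h x) * g x $ i)\<bar> <= H * G" by (simp add: norm_mult H_def G_def)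
      moreover have "\<bar>W i x\<bar> <= 2 * c * u * X"
        unfolding W_def using key c q0 mult_right_mono[of "c * q x" "2 * c * u" X]
        by (simp add: abs_mult c_def[symmetric] X_def)
      ultimately have "\<bar>Re (cnj (h x) * g x $ i) * W i x\<bar> <= (H * G) * (2 * c * u * X)"
        unfolding abs_mult by (intro mult_mono) (auto simp: H_def G_def)
      then have a2: "- (4 * c * (u * H * G * X)) <= 2 * (Re (cnj (h x) * g x $ i) * W i x)"
        by (simp add: mult_ac abs_le_iff)
      \<comment> \<open>The weights are such that the mixed term uses up exactly half of the good
        term X^2 H^2 / (2 u).\<close>
      have "0 <= (1/2 * X * H - 4 * u\<^sup>2 * G)\<^sup>2" by simp
      then have "4 * u\<^sup>2 * (X * H * G) <= 1/4 * X\<^sup>2 * H\<^sup>2 + 16 * u ^ 4 * G\<^sup>2"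
        by (simp add: power2_eq_square algebra_simps power4_eq_xxxx)
      then have "4 * u\<^sup>2 * (X * H * G) / u <= (1/4 * X\<^sup>2 * H\<^sup>2 + 16 * u ^ 4 * G\<^sup>2) / u"
        using u by (intro divide_right_mono) auto
      then have "4 * (u * H * G * X) <= 1/4 * X\<^sup>2 * H\<^sup>2 / u + 16 * u ^ 3 * G\<^sup>2"
        using u(1) by (simp add: add_divide_distrib power2_eq_square power3_eq_cube power4_eq_xxxx mult_ac)
      from mult_left_mono[OF this c(1)] have a3: "4 * c * (u * H * G * X) <= c * (1/4 * X\<^sup>2 * H\<^sup>2 / u) + 16 * c * u ^ 3 * G\<^sup>2"
        by (simp add: algebra_simps)
      have "H\<^sup>2 * (2 * X\<^sup>2 * (c * (1 / (4 * u))) - 2 * c * u) = 2 * (c * (1/4 * X\<^sup>2 * H\<^sup>2 / u)) - 2 * c * u * H\<^sup>2"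
        by (simp add: algebra_simps)
      with a1 a2 a3 show ?thesis unfolding X2 G_def[symmetric] by linarith
    qed
    then have "(\<Sum>i\<in>UNIV. c * (1/4 * (x $ i)\<^sup>2 * H\<^sup>2 / u) - 2 * c * u * H\<^sup>2 - 16 * c * u ^ 3 * (norm (g x $ i))\<^sup>2) <= ?P x"
      unfolding H_def by (intro sum_mono) auto
    also have "(\<Sum>i\<in>UNIV. c * (1/4 * (x $ i)\<^sup>2 * H\<^sup>2 / u) - 2 * c * u * H\<^sup>2 - 16 * c * u ^ 3 * (norm (g x $ i))\<^sup>2)
       = c * (1/4 * (norm x)\<^sup>2 * H\<^sup>2 / u) - c * (6 * u * H\<^sup>2) - c * (16 * u ^ 3 * (norm (g x))\<^sup>2)"
      unfolding s norm_sq_vec[of "g x"]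
      by (simp add: sum_subtractf sum_distrib_left sum_distrib_right sum_divide_distrib mult_ac)
    finally have b1: "c * (1/4 * (norm x)\<^sup>2 * H\<^sup>2 / u) <= ?P x + c * (6 * u * H\<^sup>2) + c * (16 * u ^ 3 * (norm (g x))\<^sup>2)" by linarith
    have b2: "c * (6 * u * H\<^sup>2) <= 6 * u * H\<^sup>2" "c * (16 * u ^ 3 * (norm (g x))\<^sup>2) <= 16 * u ^ 3 * (norm (g x))\<^sup>2"
      using c u(1) by (intro mult_left_le_one_le; simp)+
    have u3: "u ^ 3 = \<delta> x * u"
      unfolding u(2)[symmetric] by (simp add: power2_eq_square power3_eq_cube)
    have "c * ((norm x)\<^sup>2 * H\<^sup>2 / u) = 4 * (c * (1/4 * (norm x)\<^sup>2 * H\<^sup>2 / u))" by simp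
    also have "\<dots> <= 4 * (?P x + 6 * u * H\<^sup>2 + 16 * u ^ 3 * (norm (g x))\<^sup>2)"
      using b1 b2 by (intro mult_left_mono) linarith+
    also have "\<dots> = 4 * ?P x + 24 * (u * H\<^sup>2) + 64 * (u ^ 3 * (norm (g x))\<^sup>2)"
    proof -
      have "4 * (p + 6 * u * k + 16 * v * l) = 4 * p + 24 * (u * k) + 64 * (v * l)" for p k v l :: real by simp
      then show ?thesis .
    qed
    finally show ?thesis unfolding u3 unfolding c_def H_def u_def .
  qed
  have m: "set_borel_measurable lborel S (%x. cutoff n x * ((norm x)\<^sup>2 * (norm (h x))\<^sup>2 / sqrt (\<delta> x)))"
  proof -
    have [measurable]: "(%x. indicator S x *\<^sub>R h x) \<in> borel_measurable borel"
      using h by (simp add: locally_L2_def set_borel_measurable_def)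
    note [measurable] = test_functions_measurable[OF cutoff_test]
    have eq: "(%x. indicator S x *\<^sub>R (cutoff n x * ((norm x)\<^sup>2 * (norm (h x))\<^sup>2 / sqrt (\<delta> x))))
      = (%x. cutoff n x * ((norm x)\<^sup>2 * (norm (indicator S x *\<^sub>R h x))\<^sup>2 / sqrt (\<delta> x)))"
      by (auto simp: indicator_def)
    show ?thesis unfolding set_borel_measurable_def eq by measurable
  qed
  show i: "set_integrable lborel S (%x. cutoff n x * ((norm x)\<^sup>2 * (norm (h x))\<^sup>2 / sqrt (\<delta> x)))"
  proof (rule set_integrable_bound[OF iB m])
    show "AE x in lborel. x \<in> S --> norm (cutoff n x * ((norm x)\<^sup>2 * (norm (h x))\<^sup>2 / sqrt (\<delta> x))) <= norm (?B x)"
    proof (intro AE_I2 impI)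
      fix x assume x: "x \<in> S"
      have "0 <= cutoff n x * ((norm x)\<^sup>2 * (norm (h x))\<^sup>2 / sqrt (\<delta> x))"
        using \<delta>_pos[OF x] cutoff_nonneg by simp
      then show "norm (cutoff n x * ((norm x)\<^sup>2 * (norm (h x))\<^sup>2 / sqrt (\<delta> x))) <= norm (?B x)"
        unfolding real_norm_def by (simp only: abs_of_nonneg order_trans[OF bound[OF x] abs_ge_self])
    qed
  qed
  show "(LINT x:S|lborel. cutoff n x * ((norm x)\<^sup>2 * (norm (h x))\<^sup>2 / sqrt (\<delta> x)))
      <= 24 * (LINT x:S|lborel. sqrt (\<delta> x) * (norm (h x))\<^sup>2) + 64 * (LINT x:S|lborel. \<delta> x * sqrt (\<delta> x) * (norm (g x))\<^sup>2)"
    unfolding IB[symmetric] by (rule set_integral_mono[OF i iB bound])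
qed

text \<open>Fatou's lemma removes the cutoff from the uniform bound. The factor |x|^2 is removed
  through R^2 = |x|^2 + \<delta>, where the \<delta> part is the assumed integrability with weight
  \<surd>\<delta>.\<close>

theorem hardy:
  assumes grad: "has_weak_gradient S h g"
    and h: "locally_L2 S h" and g: "!!i. locally_L2 S (%x. g x $ i)"
    and hi: "set_integrable lborel S (%x. sqrt (\<delta> x) * (norm (h x))\<^sup>2)"
    and gi: "set_integrable lborel S (%x. \<delta> x * sqrt (\<delta> x) * (norm (g x))\<^sup>2)"
  shows "set_integrable lborel S (%x. (norm (h x))\<^sup>2 / sqrt (\<delta> x))"
proof -
  define G where "G x = indicator S x *\<^sub>R ((norm x)\<^sup>2 * (norm (h x))\<^sup>2 / sqrt (\<delta> x))" for x
  define C where "C = 24 * (LINT x:S|lborel. sqrt (\<delta> x) * (norm (h x))\<^sup>2) + 64 * (LINT x:S|lborel. \<delta> x * sqrt (\<delta> x) * (norm (g x))\<^sup>2)"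
  have [measurable]: "(%x. indicator S x *\<^sub>R h x) \<in> borel_measurable borel"
    using h by (simp add: locally_L2_def set_borel_measurable_def)
  have Geq: "G = (%x. (norm x)\<^sup>2 * (norm (indicator S x *\<^sub>R h x))\<^sup>2 / sqrt (\<delta> x))"
    by (auto simp: G_def indicator_def)
  have mG [measurable]: "G \<in> borel_measurable lborel" unfolding Geq by measurable
  have G0: "G x >= 0" for x using \<delta>_pos[of x] by (auto simp: G_def indicator_def)
  have [measurable]: "cutoff n \<in> borel_measurable borel" for n by (rule test_functions_measurable[OF cutoff_test])
  have ic: "integrable lborel (%x. cutoff n x * G x)" "(\<integral>x. cutoff n x * G x \<partial>lborel) <= C" for n
    using hardy_cutoff[OF assms, of n] unfolding G_def C_def set_integrable_def set_lebesgue_integral_def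
    by (simp_all add: mult_ac)
  have "(\<integral>\<^sup>+x. ennreal (G x) \<partial>lborel) = (\<integral>\<^sup>+x. liminf (%n. ennreal (cutoff n x * G x)) \<partial>lborel)"
  proof (intro nn_integral_cong)
    fix x
    have "(%n. cutoff n x * G x) \<longlonglongrightarrow> G x"
    proof (cases "x \<in> S")
      case True
      have "(%n. cutoff n x * G x) \<longlonglongrightarrow> 1 * G x" by (intro tendsto_mult cutoff_tendsto True tendsto_const)
      then show ?thesis by simp
    qed (simp add: G_def)
    then have "(%n. ennreal (cutoff n x * G x)) \<longlonglongrightarrow> ennreal (G x)" by (rule tendsto_ennrealI)
    then show "ennreal (G x) = liminf (%n. ennreal (cutoff n x * G x))"
      by (intro lim_imp_Liminf[symmetric]) simp_all
  qed
  also have "\<dots> <= liminf (%n. \<integral>\<^sup>+x. ennreal (cutoff n x * G x) \<partial>lborel)"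
    using mG by (intro nn_integral_liminf) measurable
  also have "\<dots> <= liminf (%n::nat. ennreal C)"
  proof (intro Liminf_mono always_eventually allI)
    fix n
    have "(\<integral>\<^sup>+x. ennreal (cutoff n x * G x) \<partial>lborel) = ennreal (\<integral>x. cutoff n x * G x \<partial>lborel)"
      using ic(1) G0 cutoff_nonneg by (intro nn_integral_eq_integral) auto
    also have "\<dots> <= ennreal C" using ic(2) by (rule ennreal_leI)
    finally show "(\<integral>\<^sup>+x. ennreal (cutoff n x * G x) \<partial>lborel) <= ennreal C" .
  qed
  also have "\<dots> = ennreal C" by (simp add: Liminf_const)
  finally have "integrable lborel G"
    using mG G0 by (intro integrableI_nonneg) (auto simp: top_unique less_top[symmetric])
  then have "set_integrable lborel S (%x. (norm x)\<^sup>2 * (norm (h x))\<^sup>2 / sqrt (\<delta> x))"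
    by (simp add: set_integrable_def G_def[abs_def])
  then have "set_integrable lborel S (%x. 1 / R\<^sup>2 * ((norm x)\<^sup>2 * (norm (h x))\<^sup>2 / sqrt (\<delta> x) + sqrt (\<delta> x) * (norm (h x))\<^sup>2))"
    by (intro set_integrable_mult_right set_integral_add(1) hi)
  moreover have "1 / R\<^sup>2 * ((norm x)\<^sup>2 * (norm (h x))\<^sup>2 / sqrt (\<delta> x) + sqrt (\<delta> x) * (norm (h x))\<^sup>2) = (norm (h x))\<^sup>2 / sqrt (\<delta> x)"
    if "x \<in> S" for x
  proof -
    have d: "\<delta> x > 0" using that by (rule \<delta>_pos)
    have sum_eq: "(norm x)\<^sup>2 + sqrt (\<delta> x) * sqrt (\<delta> x) = R\<^sup>2" using d by (simp add: \<delta>_def)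
    have gen: "a * b / u + u * b = (a + u * u) * (b / u)" if "u ~= 0" for a b u :: real
      using that by (simp add: distrib_right add_divide_distrib)
    have "sqrt (\<delta> x) ~= 0" using d by simp
    from gen[OF this] have "(norm x)\<^sup>2 * (norm (h x))\<^sup>2 / sqrt (\<delta> x) + sqrt (\<delta> x) * (norm (h x))\<^sup>2 = R\<^sup>2 * ((norm (h x))\<^sup>2 / sqrt (\<delta> x))"
      by (simp only: sum_eq)
    then show ?thesis using R by simp
  qed
  ultimately show ?thesis by (subst (asm) set_integrable_cong[OF refl refl]) simp_all
qed

section \<open>Weighted spaces on the ball\<close>

lemma weighted_L2_locally_L2:
  fixes u :: "real^3 => complex"
  assumes u: "u \<in> weighted_L2 S wt" and wt: "!!K. compact K ==> K \<subseteq> S ==> \<exists>c>0. \<forall>x\<in>K. c <= wt x"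
  shows "locally_L2 S u"
  unfolding locally_L2_def
proof (intro conjI allI impI)
  show m: "set_borel_measurable lborel S u" using u by (simp add: weighted_L2_def)
  fix K assume K: "compact K & K \<subseteq> S"
  obtain c where c: "c > 0" "!!x. x \<in> K ==> c <= wt x" using wt[of K] K by blast
  have Ks: "K \<in> sets lborel" using K by (simp add: borel_compact)
  have "set_integrable lborel S (%x. wt x * (norm (u x))\<^sup>2)" using u by (simp add: weighted_L2_def)
  then have "set_integrable lborel K (%x. wt x * (norm (u x))\<^sup>2)"
    by (rule set_integrable_subset) (use K Ks in auto)
  then have i: "set_integrable lborel K (%x. 1 / c * (wt x * (norm (u x))\<^sup>2))" by (rule set_integrable_mult_right)
  have mK: "set_borel_measurable lborel K u" by (rule set_borel_measurable_subset[OF m]) (use K Ks in auto)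
  have "set_borel_measurable lborel K (%x. (norm (u x))\<^sup>2)"
  proof -
    have eq: "(%x. indicator K x *\<^sub>R (norm (u x))\<^sup>2) = (%x. (norm (indicator K x *\<^sub>R u x))\<^sup>2)"
      by (auto simp: indicator_def)
    show ?thesis using mK unfolding set_borel_measurable_def eq by measurable
  qed
  then show "set_integrable lborel K (%x. (norm (u x))\<^sup>2)"
  proof (rule set_integrable_bound[OF i])
    show "AE x in lborel. x \<in> K --> norm ((norm (u x))\<^sup>2) <= norm (1 / c * (wt x * (norm (u x))\<^sup>2))"
    proof (intro AE_I2 impI)
      fix x assume "x \<in> K"
      then have "c * (norm (u x))\<^sup>2 <= wt x * (norm (u x))\<^sup>2" by (intro mult_right_mono c) auto
      then show "norm ((norm (u x))\<^sup>2) <= norm (1 / c * (wt x * (norm (u x))\<^sup>2))"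
        using c(1) \<open>x \<in> K\<close> c(2)[of x] by (simp add: field_simps)
    qed
  qed
qed

lemma weighted_L2_nth:
  fixes v :: "real^3 => complex^3"
  assumes v: "v \<in> weighted_L2 S wt" and wt: "!!x. x \<in> S ==> wt x >= 0"
    and m: "set_borel_measurable lborel S wt"
  shows "(%x. v x $ i) \<in> weighted_L2 S wt"
proof -
  have mv: "(%x. indicator S x *\<^sub>R v x) \<in> borel_measurable lborel"
    using v by (simp add: weighted_L2_def set_borel_measurable_def)
  have "(%x. (indicator S x *\<^sub>R v x) $ i) \<in> borel_measurable lborel"
    by (intro borel_measurable_continuous_on[OF _ mv, of "%x. x $ i"] continuous_intros)
  then have mi: "set_borel_measurable lborel S (%x. v x $ i)" by (simp add: set_borel_measurable_def)
  have i: "set_integrable lborel S (%x. wt x * (norm (v x))\<^sup>2)" using v by (simp add: weighted_L2_def)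
  have "(%x. (indicator S x *\<^sub>R wt x) * (norm (indicator S x *\<^sub>R (v x $ i)))\<^sup>2) \<in> borel_measurable lborel"
  proof -
    note [measurable] = m[unfolded set_borel_measurable_def] mi[unfolded set_borel_measurable_def]
    show ?thesis by measurable
  qed
  moreover have "(%x. (indicator S x *\<^sub>R wt x) * (norm (indicator S x *\<^sub>R (v x $ i)))\<^sup>2) = (%x. indicator S x *\<^sub>R (wt x * (norm (v x $ i))\<^sup>2))"
    by (auto simp: indicator_def)
  ultimately have "set_borel_measurable lborel S (%x. wt x * (norm (v x $ i))\<^sup>2)"
    by (simp add: set_borel_measurable_def)
  then have "set_integrable lborel S (%x. wt x * (norm (v x $ i))\<^sup>2)"
  proof (rule set_integrable_bound[OF i])
    show "AE x in lborel. x \<in> S --> norm (wt x * (norm (v x $ i))\<^sup>2) <= norm (wt x * (norm (v x))\<^sup>2)"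
    proof (intro AE_I2 impI)
      fix x assume "x \<in> S"
      have "(norm (v x $ i))\<^sup>2 <= (norm (v x))\<^sup>2" by (intro power_mono Finite_Cartesian_Product.norm_nth_le) auto
      then show "norm (wt x * (norm (v x $ i))\<^sup>2) <= norm (wt x * (norm (v x))\<^sup>2)"
        using wt[OF \<open>x \<in> S\<close>] by (simp add: mult_left_mono)
    qed
  qed
  with mi show ?thesis by (simp add: weighted_L2_def)
qed

lemma \<delta>_lower_bound:
  assumes "compact K" "K \<subseteq> S"
  obtains c where "c > 0" "!!x. x \<in> K ==> c <= \<delta> x"
proof (cases "K = {}")
  case False
  obtain x0 where "x0 \<in> K" "!!x. x \<in> K ==> \<delta> x0 <= \<delta> x"
    using continuous_attains_inf[OF assms(1) False continuous_\<delta>] by blast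
  moreover have "\<delta> x0 > 0" using \<delta>_pos subsetD[OF assms(2) \<open>x0 \<in> K\<close>] .
  ultimately show ?thesis using that[of "\<delta> x0"] by simp
next
  case True
  then show ?thesis using that[of 1] by simp
qed

text \<open>Young's inequality with the square root of the weight moved from one factor to the
  other.\<close>

lemma product_set_integrable:
  fixes a b :: "real^3 => complex"
  assumes a: "a \<in> weighted_L2 S p" and b: "b \<in> weighted_L2 S (%x. 1 / p x)" and p: "!!x. x \<in> S ==> p x > 0"
  shows "set_integrable lborel S (%x. a x * b x)"
proof -
  have i: "set_integrable lborel S (%x. p x * (norm (a x))\<^sup>2 + 1 / p x * (norm (b x))\<^sup>2)"
    using a b unfolding weighted_L2_def by (intro set_integral_add(1)) auto
  have "(%x. (indicator S x *\<^sub>R a x) * (indicator S x *\<^sub>R b x)) \<in> borel_measurable lborel"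
    using a b unfolding weighted_L2_def set_borel_measurable_def by (intro borel_measurable_times) auto
  moreover have "(%x. (indicator S x *\<^sub>R a x) * (indicator S x *\<^sub>R b x)) = (%x. indicator S x *\<^sub>R (a x * b x))"
    by (auto simp: indicator_def)
  ultimately have "set_borel_measurable lborel S (%x. a x * b x)" by (simp add: set_borel_measurable_def)
  then show ?thesis
  proof (rule set_integrable_bound[OF i])
    show "AE x in lborel. x \<in> S --> norm (a x * b x) <= norm (p x * (norm (a x))\<^sup>2 + 1 / p x * (norm (b x))\<^sup>2)"
    proof (intro AE_I2 impI)
      fix x assume "x \<in> S"
      then have p: "p x > 0" by (rule p)
      define s where "s = sqrt (p x)"
      have s: "s > 0" "p x = s\<^sup>2" using p by (simp_all add: s_def)
      have "norm (a x * b x) = (s * norm (a x)) * (norm (b x) / s)" using s by (simp add: norm_mult)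
      also have "\<dots> <= (s * norm (a x))\<^sup>2 + (norm (b x) / s)\<^sup>2"
        using norm_mult_le_squares[of "s * norm (a x)" "norm (b x) / s"] s(1) by (simp add: abs_mult)
      also have "\<dots> = p x * (norm (a x))\<^sup>2 + 1 / p x * (norm (b x))\<^sup>2"
        by (simp add: s(2) power_mult_distrib power_divide)
      finally show "norm (a x * b x) <= norm (p x * (norm (a x))\<^sup>2 + 1 / p x * (norm (b x))\<^sup>2)" by simp
    qed
  qed
qed

lemma real_mult_le_squares: "a * b <= a\<^sup>2 + b\<^sup>2" for a b :: real
  using norm_mult_le_squares[of a b] abs_ge_self[of "a * b"] unfolding real_norm_def power2_abs by linarith

text \<open>The product rule is tested with the cutoffs. The boundary term h w times the cutoff
  gradient is dominated by |w|^2 / \<rho> + \<rho> |h|^2 / \<delta>^2 up to constants; since \<rho>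
  / \<delta>^2 <= C / \<surd>\<delta>, the Hardy inequality makes the second summand integrable. As
  the cutoff gradients tend to 0 pointwise, the boundary term disappears in the limit.\<close>

theorem weak_gradient_divergence_adjoint:
  assumes \<alpha>: "c > 0" "!!x. x \<in> S ==> c <= \<alpha> x" "!!x. x \<in> S ==> c * sqrt (\<delta> x) <= 1 / \<alpha> x"
    and \<rho>: "!!x. x \<in> S ==> c * (\<delta> x * sqrt (\<delta> x)) <= \<rho> x" "!!x. x \<in> S ==> \<rho> x <= C * (\<delta> x * sqrt (\<delta> x))"
    and m: "set_borel_measurable lborel S \<rho>"
    and w: "w \<in> weighted_L2 S (%x. 1 / \<rho> x)" and t: "t \<in> weighted_L2 S \<alpha>"
    and div: "has_weak_divergence S w (%x. - t x)"
    and h: "h \<in> weighted_L2 S (%x. 1 / \<alpha> x)" and g: "g \<in> weighted_L2 S \<rho>"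
    and grad: "has_weak_gradient S h g"
  shows "(LINT x:S|lborel. t x * h x) = (LINT x:S|lborel. (\<Sum>i\<in>UNIV. w x $ i * g x $ i))"
proof -
  have d: "\<delta> x > 0" if "x \<in> S" for x using that by (rule \<delta>_pos)
  have \<alpha>0: "\<alpha> x > 0" if "x \<in> S" for x using \<alpha>(1) \<alpha>(2)[OF that] by linarith
  have \<rho>0: "\<rho> x > 0" if "x \<in> S" for x
    using \<rho>(1)[OF that] d[OF that] \<alpha>(1) by (smt (verit) mult_pos_pos real_sqrt_gt_zero)
  have C: "C > 0"
  proof -
    have "0 < C * (\<delta> 0 * sqrt (\<delta> 0))" using \<rho>0[of 0] \<rho>(2)[of 0] R by simp
    moreover have "\<delta> 0 * sqrt (\<delta> 0) > 0" using d[of 0] R by simp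
    ultimately show ?thesis by (rule zero_less_mult_pos2)
  qed
  have m1: "set_borel_measurable lborel S (%x. 1 / \<rho> x)"
  proof -
    have "(%x. indicator S x *\<^sub>R (1 / \<rho> x)) = (%x. indicator S x / (indicator S x *\<^sub>R \<rho> x))"
      by (auto simp: indicator_def)
    moreover have "(%x. indicator S x / (indicator S x *\<^sub>R \<rho> x)) \<in> borel_measurable lborel"
      using m unfolding set_borel_measurable_def by (intro borel_measurable_divide borel_measurable_indicator) auto
    ultimately show ?thesis by (simp add: set_borel_measurable_def)
  qed
  have wi: "(%x. w x $ i) \<in> weighted_L2 S (%x. 1 / \<rho> x)" for i
    using \<rho>0 by (intro weighted_L2_nth[OF w _ m1]) (simp add: less_imp_le)
  have gi: "(%x. g x $ i) \<in> weighted_L2 S \<rho>" for i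
    using \<rho>0 by (intro weighted_L2_nth[OF g _ m]) (simp add: less_imp_le)
  have tl: "locally_L2 S t"
  proof (rule weighted_L2_locally_L2[OF t])
    fix K assume K: "K \<subseteq> S"
    show "\<exists>c>0. \<forall>x\<in>K. c <= \<alpha> x"
    proof (intro exI conjI ballI)
      show "c > 0" by (rule \<alpha>(1))
      show "c <= \<alpha> x" if "x \<in> K" for x by (rule \<alpha>(2)[OF subsetD[OF K that]])
    qed
  qed
  have hl: "locally_L2 S h"
  proof (rule weighted_L2_locally_L2[OF h])
    fix K assume "compact K" "K \<subseteq> S"
    then obtain b where b: "b > 0" "!!x. x \<in> K ==> b <= \<delta> x" by (rule \<delta>_lower_bound) (rule that)
    have "c * sqrt b <= 1 / \<alpha> x" if "x \<in> K" for x
    proof -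
      have "c * sqrt b <= c * sqrt (\<delta> x)" using \<alpha>(1) b(2)[OF that] by simp
      also have "\<dots> <= 1 / \<alpha> x" by (rule \<alpha>(3)[OF subsetD[OF \<open>K \<subseteq> S\<close> that]])
      finally show ?thesis .
    qed
    then show "\<exists>c>0. \<forall>x\<in>K. c <= 1 / \<alpha> x" using \<alpha>(1) b(1) by (intro exI[of _ "c * sqrt b"]) auto
  qed
  have gl: "locally_L2 S (%x. g x $ i)" for i
  proof (rule weighted_L2_locally_L2[OF gi])
    fix K assume "compact K" "K \<subseteq> S"
    then obtain b where b: "b > 0" "!!x. x \<in> K ==> b <= \<delta> x" by (rule \<delta>_lower_bound) (rule that)
    have "c * (b * sqrt b) <= \<rho> x" if "x \<in> K" for x
    proof -
      have "b * sqrt b <= \<delta> x * sqrt (\<delta> x)" using b(1) b(2)[OF that] by (intro mult_mono) auto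
      then have "c * (b * sqrt b) <= c * (\<delta> x * sqrt (\<delta> x))" using \<alpha>(1) by simp
      also have "\<dots> <= \<rho> x" by (rule \<rho>(1)[OF subsetD[OF \<open>K \<subseteq> S\<close> that]])
      finally show ?thesis .
    qed
    then show "\<exists>c>0. \<forall>x\<in>K. c <= \<rho> x" using \<alpha>(1) b(1) by (intro exI[of _ "c * (b * sqrt b)"]) auto
  qed
  have wl: "locally_L2 S (%x. w x $ i)" for i
  proof (rule weighted_L2_locally_L2[OF wi])
    fix K assume K: "compact K" "K \<subseteq> S"
    have "1 / (C * (R\<^sup>2 * sqrt (R\<^sup>2))) <= 1 / \<rho> x" if "x \<in> S" for x
    proof -
      have "\<delta> x * sqrt (\<delta> x) <= R\<^sup>2 * sqrt (R\<^sup>2)"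
        using d[OF that] by (intro mult_mono real_sqrt_le_mono) (auto simp: \<delta>_def)
      then have "\<rho> x <= C * (R\<^sup>2 * sqrt (R\<^sup>2))"
        by (intro order_trans[OF \<rho>(2)[OF that]] mult_left_mono less_imp_le[OF C])
      then show ?thesis using \<rho>0[OF that] by (intro divide_left_mono) auto
    qed
    then show "\<exists>c>0. \<forall>x\<in>K. c <= 1 / \<rho> x"
    proof (intro exI conjI ballI)
      show "1 / (C * (R\<^sup>2 * sqrt (R\<^sup>2))) > 0" using C R by simp
      show "1 / (C * (R\<^sup>2 * sqrt (R\<^sup>2))) <= 1 / \<rho> x" if "x \<in> K" for x
        by (rule \<open>!!x. x \<in> S ==> 1 / (C * (R\<^sup>2 * sqrt (R\<^sup>2))) <= 1 / \<rho> x\<close>[OF subsetD[OF K(2) that]])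
    qed
  qed
  have th: "set_integrable lborel S (%x. t x * h x)" by (rule product_set_integrable[OF t h \<alpha>0])
  have wg: "set_integrable lborel S (%x. w x $ i * g x $ i)" for i
    using product_set_integrable[OF gi wi \<rho>0] by (simp add: mult.commute)
  have "set_integrable lborel S (%x. (norm (h x))\<^sup>2 / sqrt (\<delta> x))"
  proof (rule hardy[OF grad hl gl])
    have hm [measurable]: "(%x. indicator S x *\<^sub>R h x) \<in> borel_measurable lborel"
      using h by (simp add: weighted_L2_def set_borel_measurable_def)
    have gm [measurable]: "(%x. indicator S x *\<^sub>R g x) \<in> borel_measurable lborel"
      using g by (simp add: weighted_L2_def set_borel_measurable_def)
    have hs: "(%x. indicator S x *\<^sub>R (sqrt (\<delta> x) * (norm (h x))\<^sup>2)) = (%x. sqrt (\<delta> x) * (norm (indicator S x *\<^sub>R h x))\<^sup>2)"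
      by (auto simp: indicator_def)
    have gs: "(%x. indicator S x *\<^sub>R (\<delta> x * sqrt (\<delta> x) * (norm (g x))\<^sup>2)) = (%x. \<delta> x * sqrt (\<delta> x) * (norm (indicator S x *\<^sub>R g x))\<^sup>2)"
      by (auto simp: indicator_def)
    have mh: "set_borel_measurable lborel S (%x. sqrt (\<delta> x) * (norm (h x))\<^sup>2)"
      unfolding set_borel_measurable_def hs by measurable
    have mg: "set_borel_measurable lborel S (%x. \<delta> x * sqrt (\<delta> x) * (norm (g x))\<^sup>2)"
      unfolding set_borel_measurable_def gs by measurable
    have "set_integrable lborel S (%x. 1 / c * (1 / \<alpha> x * (norm (h x))\<^sup>2))"
      using h by (intro set_integrable_mult_right) (simp add: weighted_L2_def)
    then show "set_integrable lborel S (%x. sqrt (\<delta> x) * (norm (h x))\<^sup>2)"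
    proof (rule set_integrable_bound[OF _ mh], intro AE_I2 impI)
      fix x assume x: "x \<in> S"
      have "c * sqrt (\<delta> x) * (norm (h x))\<^sup>2 <= 1 / \<alpha> x * (norm (h x))\<^sup>2" using \<alpha>(3)[OF x] by (rule mult_right_mono) simp
      then have "1 / c * (c * sqrt (\<delta> x) * (norm (h x))\<^sup>2) <= 1 / c * (1 / \<alpha> x * (norm (h x))\<^sup>2)"
        using \<alpha>(1) by (intro mult_left_mono) auto
      then show "norm (sqrt (\<delta> x) * (norm (h x))\<^sup>2) <= norm (1 / c * (1 / \<alpha> x * (norm (h x))\<^sup>2))"
        using \<alpha>(1) d[OF x] \<alpha>0[OF x] by simp
    qed
    have "set_integrable lborel S (%x. 1 / c * (\<rho> x * (norm (g x))\<^sup>2))"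
      using g by (intro set_integrable_mult_right) (simp add: weighted_L2_def)
    then show "set_integrable lborel S (%x. \<delta> x * sqrt (\<delta> x) * (norm (g x))\<^sup>2)"
    proof (rule set_integrable_bound[OF _ mg], intro AE_I2 impI)
      fix x assume x: "x \<in> S"
      have "c * (\<delta> x * sqrt (\<delta> x)) * (norm (g x))\<^sup>2 <= \<rho> x * (norm (g x))\<^sup>2" using \<rho>(1)[OF x] by (rule mult_right_mono) simp
      then have "1 / c * (c * (\<delta> x * sqrt (\<delta> x)) * (norm (g x))\<^sup>2) <= 1 / c * (\<rho> x * (norm (g x))\<^sup>2)"
        using \<alpha>(1) by (intro mult_left_mono) auto
      then show "norm (\<delta> x * sqrt (\<delta> x) * (norm (g x))\<^sup>2) <= norm (1 / c * (\<rho> x * (norm (g x))\<^sup>2))"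
        using \<alpha>(1) d[OF x] \<rho>0[OF x] by simp
    qed
  qed
  then have hh: "set_integrable lborel S (%x. 36 * R\<^sup>2 * (C * ((norm (h x))\<^sup>2 / sqrt (\<delta> x))))"
    by (intro set_integrable_mult_right)
  define L where "L n x = h x * (\<Sum>i\<in>UNIV. w x $ i * complex_of_real (partial i (cutoff n) x))" for n x
  \<comment> \<open>36 R^2 is the square of 2 R * 3: a partial derivative of \<delta> is at most 2
    R, and \<delta> times the slope of the cutoff at most 3.\<close>
  define D where "D x = (\<Sum>i\<in>UNIV. 1 / \<rho> x * (norm (w x $ i))\<^sup>2 + 36 * R\<^sup>2 * (C * ((norm (h x))\<^sup>2 / sqrt (\<delta> x))))" for x
  have D: "set_integrable lborel S D"
    unfolding D_def using wi hh by (intro set_integrable_sum set_integral_add(1)) (auto simp: weighted_L2_def)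
  have Lb: "norm (L n x) <= D x" if x: "x \<in> S" for n x
  proof -
    define N where "N = real (Suc n) * exp_flat 2 (real (Suc n) * \<delta> x - 1)"
    have N: "0 <= N" "N <= 3 / \<delta> x" using cutoff_gradient_bound[OF x, of n] by (simp_all add: N_def exp_flat_nonneg)
    have "norm (L n x) <= (\<Sum>i\<in>UNIV. norm (h x * (w x $ i * complex_of_real (partial i (cutoff n) x))))"
      unfolding L_def sum_distrib_left by (rule norm_sum)
    also have "\<dots> <= D x"
      unfolding D_def
    proof (rule sum_mono)
      fix i
      have "\<bar>x $ i\<bar> <= R" using component_le_norm_cart[of x i] x by simp
      then have "\<bar>partial i (cutoff n) x\<bar> <= 2 * R * (3 / \<delta> x)"
      proof -
        assume xi: "\<bar>x $ i\<bar> <= R"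
        have "\<bar>partial i (cutoff n) x\<bar> = (2 * \<bar>x $ i\<bar>) * N"
          unfolding partial_cutoff N_def[symmetric] using N(1) by (simp add: abs_mult)
        also have "\<dots> <= (2 * R) * (3 / \<delta> x)" using xi N R by (intro mult_mono) auto
        finally show ?thesis .
      qed
      then have "norm (h x * (w x $ i * complex_of_real (partial i (cutoff n) x))) <= norm (h x) * (norm (w x $ i) * (2 * R * (3 / \<delta> x)))"
        unfolding norm_mult norm_of_real by (intro mult_left_mono) auto
      also have "\<dots> = (norm (w x $ i) / sqrt (\<rho> x)) * (6 * R * sqrt (\<rho> x) * norm (h x) / \<delta> x)"
        using \<rho>0[OF x] by (simp add: field_simps)
      also have "\<dots> <= (norm (w x $ i) / sqrt (\<rho> x))\<^sup>2 + (6 * R * sqrt (\<rho> x) * norm (h x) / \<delta> x)\<^sup>2"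
        by (rule real_mult_le_squares)
      also have "\<dots> = 1 / \<rho> x * (norm (w x $ i))\<^sup>2 + 36 * R\<^sup>2 * (\<rho> x / (\<delta> x)\<^sup>2 * (norm (h x))\<^sup>2)"
        using \<rho>0[OF x] by (simp add: power_mult_distrib power_divide)
      also have "\<dots> <= 1 / \<rho> x * (norm (w x $ i))\<^sup>2 + 36 * R\<^sup>2 * (C * ((norm (h x))\<^sup>2 / sqrt (\<delta> x)))"
      proof -
        have "\<rho> x / (\<delta> x)\<^sup>2 <= C * (\<delta> x * sqrt (\<delta> x)) / (\<delta> x)\<^sup>2" using \<rho>(2)[OF x] by (rule divide_right_mono) simp
        also have "\<dots> = C / sqrt (\<delta> x)"
        proof -
          have "sqrt (\<delta> x) * sqrt (\<delta> x) = \<delta> x" using d[OF x] by simp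
          then show ?thesis using d[OF x] by (simp add: field_simps power2_eq_square)
        qed
        finally have "\<rho> x / (\<delta> x)\<^sup>2 * (norm (h x))\<^sup>2 <= C / sqrt (\<delta> x) * (norm (h x))\<^sup>2" by (rule mult_right_mono) simp
        then show ?thesis by (intro add_left_mono mult_left_mono) (auto simp: R)
      qed
      finally show "norm (h x * (w x $ i * complex_of_real (partial i (cutoff n) x)))
        <= 1 / \<rho> x * (norm (w x $ i))\<^sup>2 + 36 * R\<^sup>2 * (C * ((norm (h x))\<^sup>2 / sqrt (\<delta> x)))" .
    qed
    finally show ?thesis .
  qed
  have Ll: "(%n. L n x) \<longlonglongrightarrow> 0" if x: "x \<in> S" for x
  proof -
    have "(%n. L n x) \<longlonglongrightarrow> h x * (\<Sum>i\<in>(UNIV::3 set). w x $ i * complex_of_real (- 2 * x $ i * 0))"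
      unfolding L_def partial_cutoff
      by (intro tendsto_mult tendsto_sum tendsto_of_real tendsto_const cutoff_gradient_tendsto x)
    then show ?thesis by simp
  qed
  have mp: "partial i (cutoff n) \<in> borel_measurable borel" for i n
    by (rule test_functions_measurable[OF test_functions_partial[OF cutoff_test]])
  have mw: "(%x. indicator S x *\<^sub>R (w x $ i)) \<in> borel_measurable lborel"
    and mh: "(%x. indicator S x *\<^sub>R h x) \<in> borel_measurable lborel" for i
    using wi h by (auto simp: weighted_L2_def set_borel_measurable_def)
  have mL: "(%x. indicator S x *\<^sub>R L n x) \<in> borel_measurable lborel" for n
  proof -
    have Leq: "(%x. indicator S x *\<^sub>R L n x) = (%x. (indicator S x *\<^sub>R h x) * (\<Sum>i\<in>UNIV. (indicator S x *\<^sub>R (w x $ i)) * complex_of_real (partial i (cutoff n) x)))"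
      by (auto simp: L_def indicator_def)
    note [measurable] = mw mh mp
    show ?thesis unfolding Leq by measurable
  qed
  have lim1: "(%n. LINT x:S|lborel. L n x) \<longlonglongrightarrow> (\<integral>x. 0 \<partial>(lborel :: (real^3) measure))"
    unfolding set_lebesgue_integral_def
  proof (rule integral_dominated_convergence[where w = "%x. indicator S x *\<^sub>R D x"])
    show "integrable lborel (%x. indicator S x *\<^sub>R D x)" using D by (simp add: set_integrable_def)
    show "AE x in lborel. (%n. indicator S x *\<^sub>R L n x) \<longlonglongrightarrow> 0"
      using Ll by (intro AE_I2) (auto simp: indicator_def)
    show "AE x in lborel. norm (indicator S x *\<^sub>R L n x) <= indicator S x *\<^sub>R D x" for n
      using Lb by (intro AE_I2) (auto simp: indicator_def)
  qed (use mL in auto)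
  let ?T = "%x. (\<Sum>i\<in>UNIV. w x $ i * g x $ i) - t x * h x"
  have iT: "set_integrable lborel S ?T" using wg th by (intro set_integral_diff(1) set_integrable_sum) auto
  have lim2: "(%n. LINT x:S|lborel. ?T x * complex_of_real (cutoff n x)) \<longlonglongrightarrow> (LINT x:S|lborel. ?T x)"
    unfolding set_lebesgue_integral_def
  proof (rule integral_dominated_convergence[where w = "%x. norm (indicator S x *\<^sub>R ?T x)"])
    show "integrable lborel (%x. norm (indicator S x *\<^sub>R ?T x))"
      using iT unfolding set_integrable_def by (rule integrable_norm)
    show "(%x. indicator S x *\<^sub>R ?T x) \<in> borel_measurable lborel" using iT unfolding set_integrable_def by (rule borel_measurable_integrable)
    note [measurable] = test_functions_measurable[OF cutoff_test] this
    have "(%x. (indicator S x *\<^sub>R ?T x) * complex_of_real (cutoff n x)) \<in> borel_measurable lborel" for n by measurable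
    then show "(%x. indicator S x *\<^sub>R (?T x * complex_of_real (cutoff n x))) \<in> borel_measurable lborel" for n
      by simp
    show "AE x in lborel. (%n. indicator S x *\<^sub>R (?T x * complex_of_real (cutoff n x))) \<longlonglongrightarrow> indicator S x *\<^sub>R ?T x"
    proof (intro AE_I2)
      fix x
      show "(%n. indicator S x *\<^sub>R (?T x * complex_of_real (cutoff n x))) \<longlonglongrightarrow> indicator S x *\<^sub>R ?T x"
      proof (cases "x \<in> S")
        case True
        have "(%n. indicator S x *\<^sub>R (?T x * complex_of_real (cutoff n x))) \<longlonglongrightarrow> indicator S x *\<^sub>R (?T x * complex_of_real 1)"
          by (intro tendsto_scaleR tendsto_mult tendsto_of_real tendsto_const cutoff_tendsto True)
        then show ?thesis by simp
      qed simp
    qed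
    show "AE x in lborel. norm (indicator S x *\<^sub>R (?T x * complex_of_real (cutoff n x))) <= norm (indicator S x *\<^sub>R ?T x)" for n
    proof (rule AE_I2)
      fix x
      have "norm (indicator S x *\<^sub>R (?T x * complex_of_real (cutoff n x))) = norm (indicator S x *\<^sub>R ?T x) * cutoff n x"
        using cutoff_nonneg[of n x] by (simp add: norm_mult)
      also have "\<dots> <= norm (indicator S x *\<^sub>R ?T x)" by (rule mult_left_le[OF cutoff_le norm_ge_zero])
      finally show "norm (indicator S x *\<^sub>R (?T x * complex_of_real (cutoff n x))) <= norm (indicator S x *\<^sub>R ?T x)" .
    qed
  qed
  have tl': "locally_L2 S (%x. - t x)"
    using tl by (simp add: locally_L2_def set_borel_measurable_def)
  have "(LINT x:S|lborel. L n x) = - (LINT x:S|lborel. ?T x * complex_of_real (cutoff n x))" for n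
    using weak_derivative_pairing[OF open_ball div grad wl tl' hl gl cutoff_test, of n]
    by (simp only: L_def mult_minus_left diff_conv_add_uminus)
  then have "(%n. LINT x:S|lborel. L n x) \<longlonglongrightarrow> - (LINT x:S|lborel. ?T x)"
    using tendsto_minus[OF lim2] by (simp only:)
  moreover have "(%n. LINT x:S|lborel. L n x) \<longlonglongrightarrow> 0" using lim1 by (simp only: integral_zero)
  ultimately have "- (LINT x:S|lborel. ?T x) = 0" by (rule LIMSEQ_unique)
  moreover have "(LINT x:S|lborel. ?T x) = (LINT x:S|lborel. (\<Sum>i\<in>UNIV. w x $ i * g x $ i)) - (LINT x:S|lborel. t x * h x)"
    using wg th by (intro set_integral_diff(2) set_integrable_sum) auto
  ultimately show ?thesis by simp
qed

end

section \<open>Reflections\<close>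

definition reflect :: "real^3 => real^3 => real^3" where
  "reflect e x = x - (2 * (x \<bullet> e)) *\<^sub>R e"

lemma linear_reflect: "linear (reflect e)"
  by (intro linearI) (auto simp: reflect_def algebra_simps inner_add_left)

context
  fixes e :: "real^3"
  assumes e: "norm e = 1"
begin

lemma unit_inner: "e \<bullet> e = 1" using e by (simp add: norm_eq_1)

lemma reflect_inner: "reflect e x \<bullet> e = - (x \<bullet> e)"
  by (simp add: reflect_def inner_diff_left unit_inner)

lemma reflect_reflect [simp]: "reflect e (reflect e x) = x"
  unfolding reflect_def[of e "reflect e x"] reflect_inner by (simp add: reflect_def)

lemma inner_reflect: "reflect e x \<bullet> y = x \<bullet> reflect e y"
  by (simp add: reflect_def inner_diff_left inner_diff_right inner_commute mult_ac)

lemma inner_reflect_reflect: "reflect e x \<bullet> reflect e y = x \<bullet> y"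
  by (simp add: inner_reflect)

lemma norm_reflect [simp]: "norm (reflect e x) = norm x"
  by (simp add: norm_eq_sqrt_inner inner_reflect_reflect)

lemma norm_reflect_diff: "norm (reflect e x - reflect e y) = norm (x - y)"
  using norm_reflect[of "x - y"] by (simp add: linear_diff[OF linear_reflect])

lemma norm_diff_reflect: "norm (x - reflect e y) = norm (reflect e x - y)"
  using norm_reflect_diff[of x "reflect e y"] by simp

lemma orthogonal_reflect: "orthogonal_transformation (reflect e)"
  by (simp add: orthogonal_transformation_def linear_reflect inner_reflect_reflect)

lemma reflect_measurable [measurable]: "reflect e \<in> borel_measurable borel"
  unfolding reflect_def by measurable

text \<open>Boxes determine the measure. The mirror image of a box need not be a box, so its volume
  is taken from the invariance of Lebesgue measure under orthogonal maps.\<close>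

lemma lborel_distr_reflect: "distr lborel borel (reflect e) = lborel"
proof (rule lborel_eqI[symmetric])
  fix l u :: "real^3" assume lu: "!!b. b \<in> Basis ==> l \<bullet> b <= u \<bullet> b"
  have eq: "reflect e -` box l u = reflect e ` box l u"
    by (auto simp: image_iff intro!: bexI[where x = "reflect e _"])
  have lm: "box l u \<in> lmeasurable" by simp
  have "reflect e -` box l u \<in> sets borel"
    using measurable_sets[OF reflect_measurable, of "box l u"] by simp
  then have sb: "reflect e ` box l u \<in> sets borel" by (simp only: eq)
  have "measure lebesgue (reflect e ` box l u) = measure lebesgue (box l u)"
    by (rule measure_orthogonal_image[OF orthogonal_reflect lm])
  moreover have "reflect e ` box l u \<in> lmeasurable"
    by (rule measurable_orthogonal_image[OF orthogonal_reflect lm])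
  ultimately have "emeasure lebesgue (reflect e ` box l u) = emeasure lebesgue (box l u)"
    using lm by (simp add: emeasure_eq_measure2)
  then have "emeasure lborel (reflect e ` box l u) = emeasure lborel (box l u)"
    using sb by simp
  then show "emeasure (distr lborel borel (reflect e)) (box l u) = (\<Prod>b\<in>Basis. (u - l) \<bullet> b)"
    using lu by (simp add: emeasure_distr eq)
qed simp

lemma integral_reflect:
  fixes f :: "real^3 => 'b::{banach, second_countable_topology}"
  assumes "f \<in> borel_measurable borel"
  shows "(\<integral>x. f (reflect e x) \<partial>lborel) = (\<integral>x. f x \<partial>lborel)"
  using integral_distr[of "reflect e" lborel borel f] assms by (simp add: lborel_distr_reflect)

lemma integrable_reflect:
  fixes f :: "real^3 => 'b::{banach, second_countable_topology}"
  assumes "integrable lborel f"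
  shows "integrable lborel (%x. f (reflect e x))"
  using integrable_distr[of "reflect e" lborel borel f] assms by (simp add: lborel_distr_reflect)

end

text \<open>The mirror is the bisecting plane of x and y, which contains the centre because the
  norms agree. Through this, invariance under reflections amounts to rotational symmetry.\<close>

lemma reflection_exists:
  assumes "norm x = norm y" "x ~= y"
  obtains e where "norm e = 1" "reflect e x = y"
proof
  let ?e = "(1 / norm (x - y)) *\<^sub>R (x - y)"
  have n: "norm (x - y) > 0" using assms(2) by simp
  then show "norm ?e = 1" by simp
  have "x \<bullet> x = y \<bullet> y" using assms(1) by (simp add: norm_eq)
  then have "2 * (x \<bullet> (x - y)) = (norm (x - y))\<^sup>2"
    by (simp add: power2_norm_eq_inner inner_diff_left inner_diff_right inner_commute)
  then have "(2 * (x \<bullet> ?e)) *\<^sub>R ?e = x - y"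
    using n by (simp add: power2_eq_square)
  then show "reflect ?e x = y" by (simp add: reflect_def)
qed

section \<open>Axially symmetric integrals\<close>

text \<open>The nesting of the pairs separates the axis from the orthogonal plane, as Fubini needs
  it.\<close>

definition cartesian3 :: "real \<times> real \<times> real => real^3" where
  "cartesian3 p = fst p *\<^sub>R axis 1 1 + fst (snd p) *\<^sub>R axis 2 1 + snd (snd p) *\<^sub>R axis 3 1"

lemma cartesian3_nth [simp]:
  "cartesian3 p $ 1 = fst p" "cartesian3 p $ 2 = fst (snd p)" "cartesian3 p $ 3 = snd (snd p)"
  by (simp_all add: cartesian3_def axis_def)

lemma cartesian3_measurable [measurable]: "cartesian3 \<in> borel_measurable borel"
  unfolding cartesian3_def by (intro borel_measurable_continuous_onI continuous_intros)

lemma prod_3: "prod f (UNIV :: 3 set) = f 1 * f 2 * f 3"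
  unfolding UNIV_3 by (simp add: mult.assoc)

lemma prod_Basis_3:
  fixes f :: "real^3 => 'b::comm_monoid_mult"
  shows "(\<Prod>b\<in>Basis. f b) = f (axis 1 1) * f (axis 2 1) * f (axis 3 1)"
proof -
  have B: "(Basis :: (real^3) set) = range (%i. axis i 1)" by (auto simp: Basis_vec_def)
  have "inj (%i. axis i (1::real) :: real^3)" by (auto simp: inj_on_def axis_eq_axis)
  then have "(\<Prod>b\<in>Basis. f b) = (\<Prod>i\<in>UNIV. f (axis i 1))"
    unfolding B by (simp only: prod.reindex o_def)
  then show ?thesis by (simp only: prod_3)
qed

lemma lborel_distr_cartesian3: "distr lborel borel cartesian3 = lborel"
proof (rule lborel_eqI[symmetric])
  fix l u :: "real^3" assume lu: "!!b. b \<in> Basis ==> l \<bullet> b <= u \<bullet> b"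
  have le: "l $ i <= u $ i" for i using lu[of "axis i 1"] by (simp add: inner_axis)
  have "cartesian3 -` box l u = {l $ 1 <..< u $ 1} \<times> ({l $ 2 <..< u $ 2} \<times> {l $ 3 <..< u $ 3})"
    by (auto simp: mem_box_cart forall_3)
  then have "emeasure (distr lborel borel cartesian3) (box l u)
     = emeasure (lborel \<Otimes>\<^sub>M (lborel \<Otimes>\<^sub>M lborel)) ({l $ 1 <..< u $ 1} \<times> ({l $ 2 <..< u $ 2} \<times> {l $ 3 <..< u $ 3}))"
    by (simp add: emeasure_distr lborel_prod)
  also have "\<dots> = emeasure lborel {l $ 1 <..< u $ 1} * (emeasure lborel {l $ 2 <..< u $ 2} * emeasure lborel {l $ 3 <..< u $ 3})"
  proof -
    have "emeasure (lborel \<Otimes>\<^sub>M (lborel \<Otimes>\<^sub>M lborel)) ({l $ 1 <..< u $ 1} \<times> ({l $ 2 <..< u $ 2} \<times> {l $ 3 <..< u $ 3}))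
      = emeasure lborel {l $ 1 <..< u $ 1} * emeasure (lborel \<Otimes>\<^sub>M lborel) ({l $ 2 <..< u $ 2} \<times> {l $ 3 <..< u $ 3})"
      unfolding lborel_prod[where 'a = real and 'b = real] by (rule lborel.emeasure_pair_measure_Times) (auto intro!: borel_open open_Times)
    moreover have "emeasure (lborel \<Otimes>\<^sub>M lborel) ({l $ 2 <..< u $ 2} \<times> {l $ 3 <..< u $ 3})
      = emeasure lborel {l $ 2 <..< u $ 2} * emeasure lborel {l $ 3 <..< u $ 3}"
      by (rule lborel.emeasure_pair_measure_Times) auto
    ultimately show ?thesis by simp
  qed
  also have "\<dots> = (\<Prod>b\<in>Basis. (u - l) \<bullet> b)"
    using le by (simp add: prod_Basis_3 inner_axis ennreal_mult'[symmetric] mult.assoc)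
  finally show "emeasure (distr lborel borel cartesian3) (box l u) = (\<Prod>b\<in>Basis. (u - l) \<bullet> b)" .
qed simp

lemma norm_cartesian3: "norm (cartesian3 (a, q)) = sqrt (a\<^sup>2 + (norm q)\<^sup>2)"
  by (simp add: norm_vec_def L2_set_def sum_3 norm_prod_def)

text \<open>In the plane at height a, the points closer than c to the origin form a disc of area
  \<pi> (c^2 - a^2), whose derivative in c is 2 \<pi> c.\<close>

lemma distr_norm_plane:
  "distr lborel borel (%q::real \<times> real. sqrt (a\<^sup>2 + (norm q)\<^sup>2))
    = density lborel (%r. ennreal (2 * pi * r) * indicator {\<bar>a\<bar><..} r)"
proof (rule measure_eqI_generator_eq[where E = "range lessThan" and \<Omega> = UNIV and A = "%n::nat. {..<real n}"])
  let ?M = "distr lborel borel (%q::real \<times> real. sqrt (a\<^sup>2 + (norm q)\<^sup>2))"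
  have M: "emeasure ?M {..<c} = ennreal (if c > \<bar>a\<bar> then pi * (c\<^sup>2 - a\<^sup>2) else 0)" for c
  proof (cases "c > \<bar>a\<bar>")
    case True
    then have "\<bar>a\<bar>\<^sup>2 < c\<^sup>2" by (intro power_strict_mono) auto
    then have "a\<^sup>2 < c\<^sup>2" by simp
    have c: "sqrt (c\<^sup>2) = c" using True by simp
    have "(%q::real \<times> real. sqrt (a\<^sup>2 + (norm q)\<^sup>2)) -` {..<c} = ball 0 (sqrt (c\<^sup>2 - a\<^sup>2))"
    proof (intro set_eqI)
      fix q :: "real \<times> real"
      have "sqrt (a\<^sup>2 + (norm q)\<^sup>2) < c \<longleftrightarrow> a\<^sup>2 + (norm q)\<^sup>2 < c\<^sup>2"
        using real_sqrt_less_iff[of "a\<^sup>2 + (norm q)\<^sup>2" "c\<^sup>2"] unfolding c .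
      also have "\<dots> \<longleftrightarrow> norm q < sqrt (c\<^sup>2 - a\<^sup>2)"
        using \<open>a\<^sup>2 < c\<^sup>2\<close> real_sqrt_less_iff[of "(norm q)\<^sup>2" "c\<^sup>2 - a\<^sup>2"] by auto
      finally show "q \<in> (%q. sqrt (a\<^sup>2 + (norm q)\<^sup>2)) -` {..<c} \<longleftrightarrow> q \<in> ball 0 (sqrt (c\<^sup>2 - a\<^sup>2))" by simp
    qed
    then show ?thesis using True \<open>a\<^sup>2 < c\<^sup>2\<close>
      by (simp add: emeasure_distr emeasure_ball unit_ball_vol_2)
  next
    case False
    have "sqrt (a\<^sup>2 + (norm q)\<^sup>2) >= \<bar>a\<bar>" for q :: "real \<times> real"
      by (rule real_le_rsqrt) simp
    with False have "\<not> sqrt (a\<^sup>2 + (norm q)\<^sup>2) < c" for q :: "real \<times> real"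
      by (meson le_less_trans not_less)
    then have "(%q::real \<times> real. sqrt (a\<^sup>2 + (norm q)\<^sup>2)) -` {..<c} = {}"
      by (intro equals0I) simp
    then show ?thesis using False by (simp add: emeasure_distr)
  qed
  show "emeasure ?M X = emeasure (density lborel (%r. ennreal (2 * pi * r) * indicator {\<bar>a\<bar><..} r)) X"
    if XE: "X \<in> range lessThan" for X
  proof -
    obtain c where X: "X = {..<c}" using XE by auto
    have "emeasure (density lborel (%r. ennreal (2 * pi * r) * indicator {\<bar>a\<bar><..} r)) X
        = (\<integral>\<^sup>+r. ennreal (2 * pi * r) * indicator {\<bar>a\<bar><..} r * indicator {..<c} r \<partial>lborel)"
      unfolding X by (subst emeasure_density) auto
    also have "\<dots> = ennreal (if c > \<bar>a\<bar> then pi * (c\<^sup>2 - a\<^sup>2) else 0)"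
    proof (cases "c > \<bar>a\<bar>")
      case True
      have "(\<integral>\<^sup>+r. ennreal (2 * pi * r) * indicator {\<bar>a\<bar><..} r * indicator {..<c} r \<partial>lborel)
         = (\<integral>\<^sup>+r. ennreal (2 * pi * r) * indicator {\<bar>a\<bar>..c} r \<partial>lborel)"
        using AE_lborel_singleton[of "\<bar>a\<bar>"] AE_lborel_singleton[of c]
        by (intro nn_integral_cong_AE) (auto simp: indicator_def elim!: eventually_elim2)
      also have "\<dots> = ennreal (pi * c\<^sup>2 - pi * \<bar>a\<bar>\<^sup>2)"
        using True by (intro nn_integral_FTC_Icc) (auto intro!: derivative_eq_intros)
      finally show ?thesis using True by (simp add: right_diff_distrib)
    next
      case False
      then have "(%r. ennreal (2 * pi * r) * indicator {\<bar>a\<bar><..} r * indicator {..<c} r) = (%r. 0)"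
        by (auto simp: indicator_def)
      then show ?thesis using False by simp
    qed
    finally show ?thesis using M[of c] by (simp add: X)
  qed
  show "emeasure ?M {..<real n} ~= \<infinity>" for n unfolding M by simp
  have "{..<b} \<inter> {..<c} = {..<min b c}" for b c :: real by auto
  then show "Int_stable (range (lessThan :: real => _))" by (auto simp: Int_stable_def)
  show "(\<Union>n::nat. {..<real n}) = UNIV" using reals_Archimedean2 by auto
qed (auto simp: borel_Iio)

text \<open>Archimedes: on a sphere, the projection to an axis is uniformly distributed.\<close>

theorem distr_norm_axis:
  "distr lborel (borel \<Otimes>\<^sub>M borel) (%y::real^3. (norm y, y $ 1))
   = density (lborel \<Otimes>\<^sub>M lborel) (%(r, t). ennreal (2 * pi * r) * indicator {\<bar>t\<bar><..} r)"
proof (rule measure_eqI)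
  have [measurable]: "(%y::real^3. (norm y, y $ 1)) \<in> borel \<rightarrow>\<^sub>M borel \<Otimes>\<^sub>M borel"
    by (intro measurable_Pair borel_measurable_continuous_onI continuous_intros)
  have [measurable]: "(%(r::real, t::real). indicator {\<bar>t\<bar><..} r :: ennreal) \<in> borel_measurable (borel \<Otimes>\<^sub>M borel)"
    unfolding greaterThan_def indicator_def by measurable
  fix A assume "A \<in> sets (distr lborel (borel \<Otimes>\<^sub>M borel) (%y::real^3. (norm y, y $ 1)))"
  then have A [measurable]: "A \<in> sets (borel \<Otimes>\<^sub>M borel)" by simp
  have ss: "sets (lborel \<Otimes>\<^sub>M (lborel :: real measure)) = sets (borel \<Otimes>\<^sub>M (borel :: real measure))"
    by (intro sets_pair_measure_cong) simp_all
  let ?k = "%p. (case p of (r, t) => ennreal (2 * pi * r) * indicator {\<bar>t\<bar><..} r) * indicator A p"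
  have "?k \<in> borel_measurable (borel \<Otimes>\<^sub>M borel)" by measurable
  then have mk: "?k \<in> borel_measurable (lborel \<Otimes>\<^sub>M lborel)" by (simp only: measurable_cong_sets[OF ss refl])
  have "emeasure (distr lborel (borel \<Otimes>\<^sub>M borel) (%y::real^3. (norm y, y $ 1))) A
      = (\<integral>\<^sup>+p. indicator A p \<partial>(distr lborel (borel \<Otimes>\<^sub>M borel) (%y::real^3. (norm y, y $ 1))))"
    by (rule nn_integral_indicator[symmetric]) simp
  also have "\<dots> = (\<integral>\<^sup>+y. indicator A (norm y, y $ 1) \<partial>(lborel :: (real^3) measure))"
    by (rule nn_integral_distr) measurable
  also have "\<dots> = (\<integral>\<^sup>+y. indicator A (norm y, y $ 1) \<partial>(distr lborel borel cartesian3))"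
    by (simp only: lborel_distr_cartesian3)
  also have "\<dots> = (\<integral>\<^sup>+p. indicator A (norm (cartesian3 p), cartesian3 p $ 1) \<partial>lborel)"
    by (rule nn_integral_distr) measurable
  also have "\<dots> = (\<integral>\<^sup>+p. indicator A (norm (cartesian3 p), cartesian3 p $ 1) \<partial>(lborel \<Otimes>\<^sub>M lborel))"
    by (simp only: lborel_prod)
  also have "\<dots> = (\<integral>\<^sup>+a. \<integral>\<^sup>+q. indicator A (norm (cartesian3 (a, q)), cartesian3 (a, q) $ 1) \<partial>lborel \<partial>lborel)"
    by (rule lborel.nn_integral_fst[symmetric]) (simp only: lborel_prod measurable_lborel2, measurable)
  also have "\<dots> = (\<integral>\<^sup>+a. \<integral>\<^sup>+q. indicator A (sqrt (a\<^sup>2 + (norm q)\<^sup>2), a) \<partial>(lborel :: (real \<times> real) measure) \<partial>lborel)"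
    by (simp only: norm_cartesian3 cartesian3_nth fst_conv)
  also have "\<dots> = (\<integral>\<^sup>+a. \<integral>\<^sup>+r. indicator A (r, a) \<partial>(distr lborel borel (%q::real \<times> real. sqrt (a\<^sup>2 + (norm q)\<^sup>2))) \<partial>lborel)"
    by (intro nn_integral_cong nn_integral_distr[symmetric]) measurable
  also have "\<dots> = (\<integral>\<^sup>+a. \<integral>\<^sup>+r. ennreal (2 * pi * r) * indicator {\<bar>a\<bar><..} r * indicator A (r, a) \<partial>lborel \<partial>lborel)"
    unfolding distr_norm_plane by (intro nn_integral_cong nn_integral_density) auto
  also have "\<dots> = (\<integral>\<^sup>+r. \<integral>\<^sup>+a. ennreal (2 * pi * r) * indicator {\<bar>a\<bar><..} r * indicator A (r, a) \<partial>lborel \<partial>lborel)"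
    by (rule lborel_pair.Fubini'[symmetric]) measurable
  also have "\<dots> = (\<integral>\<^sup>+p. (case p of (r, t) => ennreal (2 * pi * r) * indicator {\<bar>t\<bar><..} r) * indicator A p \<partial>(lborel \<Otimes>\<^sub>M lborel))"
    using lborel.nn_integral_fst[OF mk] by (simp only: prod.case)
  also have "\<dots> = emeasure (density (lborel \<Otimes>\<^sub>M lborel) (%(r, t). ennreal (2 * pi * r) * indicator {\<bar>t\<bar><..} r)) A"
    by (rule emeasure_density[symmetric]) (simp_all add: measurable_cong_sets[OF ss refl] ss)
  finally show "emeasure (distr lborel (borel \<Otimes>\<^sub>M borel) (%y::real^3. (norm y, y $ 1))) A
    = emeasure (density (lborel \<Otimes>\<^sub>M lborel) (%(r, t). ennreal (2 * pi * r) * indicator {\<bar>t\<bar><..} r)) A" .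
qed (simp add: lborel_prod borel_prod)

text \<open>Only the pair (norm, first coordinate) enters; for a fixed norm r > 0 the coordinate
  runs over (-r, r) with the constant density 2 \<pi> r.\<close>

lemma
  fixes F :: "real => real => real"
  assumes [measurable]: "(%(r, t). F r t) \<in> borel_measurable (borel \<Otimes>\<^sub>M borel)"
    and int: "integrable lborel (%y::real^3. F (norm y) (y $ 1))"
  shows integral_axially_symmetric: "(\<integral>y. F (norm y) (y $ 1) \<partial>(lborel :: (real^3) measure))
      = (\<integral>r. indicator {0<..} r * (2 * pi * r) * (\<integral>t. indicator {-r<..<r} t * F r t \<partial>lborel) \<partial>lborel)"
    and integrable_axially_symmetric:
      "integrable lborel (%r. indicator {0<..} r * (2 * pi * r) * (\<integral>t. indicator {-r<..<r} t * F r t \<partial>lborel))"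
proof -
  have [measurable]: "(%y::real^3. (norm y, y $ 1)) \<in> lborel \<rightarrow>\<^sub>M borel \<Otimes>\<^sub>M borel"
    unfolding measurable_lborel2
    by (intro measurable_Pair borel_measurable_continuous_onI continuous_intros)
  have [measurable]: "(%(r::real, t::real). indicator {\<bar>t\<bar><..} r :: real) \<in> borel_measurable (borel \<Otimes>\<^sub>M borel)"
    unfolding greaterThan_def indicator_def by measurable
  define w :: "real \<times> real => real" where "w = (%(r, t). 2 * pi * r * indicator {\<bar>t\<bar><..} r)"
  have w0: "w p >= 0" for p by (auto simp: w_def indicator_def split: prod.splits)
  have [measurable]: "w \<in> borel_measurable (borel \<Otimes>\<^sub>M borel)" unfolding w_def by measurable
  have D: "distr lborel (borel \<Otimes>\<^sub>M borel) (%y::real^3. (norm y, y $ 1)) = density (lborel \<Otimes>\<^sub>M lborel) (%p. ennreal (w p))"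
    unfolding distr_norm_axis
    by (intro arg_cong2[where f = density] refl ext) (auto simp: w_def indicator_def split: prod.splits)
  have "integrable (distr lborel (borel \<Otimes>\<^sub>M borel) (%y::real^3. (norm y, y $ 1))) (%(r, t). F r t)"
    using int by (subst integrable_distr_eq) auto
  then have i: "integrable (lborel \<Otimes>\<^sub>M lborel) (%p. w p *\<^sub>R (case p of (r, t) => F r t))"
    unfolding D by (subst (asm) integrable_density) (auto simp: w0)
  have eq: "(\<integral>t. w (r, t) *\<^sub>R F r t \<partial>lborel) = indicator {0<..} r * (2 * pi * r) * (\<integral>t. indicator {-r<..<r} t * F r t \<partial>lborel)" for r
  proof -
    have "(%t. w (r, t) *\<^sub>R F r t) = (%t. (indicator {0<..} r * (2 * pi * r)) * (indicator {-r<..<r} t * F r t))"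
    proof
      fix t show "w (r, t) *\<^sub>R F r t = (indicator {0<..} r * (2 * pi * r)) * (indicator {-r<..<r} t * F r t)"
        by (cases "0 < r"; cases "\<bar>t\<bar> < r") (auto simp: w_def indicator_def abs_less_iff)
    qed
    then show ?thesis by simp
  qed
  show "integrable lborel (%r. indicator {0<..} r * (2 * pi * r) * (\<integral>t. indicator {-r<..<r} t * F r t \<partial>lborel))"
    using lborel_pair.integrable_fst'[OF i] by (simp only: eq prod.case)
  have "(\<integral>y. F (norm y) (y $ 1) \<partial>(lborel :: (real^3) measure)) = (\<integral>p. (case p of (r, t) => F r t) \<partial>distr lborel (borel \<Otimes>\<^sub>M borel) (%y::real^3. (norm y, y $ 1)))"
    by (subst integral_distr) auto
  also have "\<dots> = (\<integral>p. w p *\<^sub>R (case p of (r, t) => F r t) \<partial>(lborel \<Otimes>\<^sub>M lborel))"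
    unfolding D by (subst integral_density) (auto simp: w0)
  also have "\<dots> = (\<integral>r. (\<integral>t. w (r, t) *\<^sub>R F r t \<partial>lborel) \<partial>lborel)"
    using lborel_pair.integral_fst'[OF i] by simp
  finally show "(\<integral>y. F (norm y) (y $ 1) \<partial>(lborel :: (real^3) measure))
      = (\<integral>r. indicator {0<..} r * (2 * pi * r) * (\<integral>t. indicator {-r<..<r} t * F r t \<partial>lborel) \<partial>lborel)"
    by (simp only: eq)
qed

section \<open>Newtonian potentials of radial and dipole densities\<close>

text \<open>Moments of 1 / |x - y| over the sphere |y| = r with |x| = a, in the variable t along x.
  The zeroth is Newton's shell theorem, the first the potential of a dipole shell. The radius r = a,
  at which the kernel is singular for t = r, is a null set in the later radial integrals.\<close>

lemma
  fixes a r :: real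
  assumes a: "a > 0" and r: "r > 0" and ne: "a ~= r"
  shows newton_kernel_0: "(\<integral>t. indicator {-r<..<r} t * (1 / sqrt (a\<^sup>2 + r\<^sup>2 - 2 * a * t)) \<partial>lborel) = 2 * r / max a r"
    and newton_kernel_1: "(\<integral>t. indicator {-r<..<r} t * (t / sqrt (a\<^sup>2 + r\<^sup>2 - 2 * a * t)) \<partial>lborel) = 2 * (min a r) ^ 3 / (3 * a\<^sup>2)"
proof -
  define D where "D t = a\<^sup>2 + r\<^sup>2 - 2 * a * t" for t
  define q where "q t = sqrt (D t)" for t
  have D: "D t > 0" if "\<bar>t\<bar> <= r" for t
  proof -
    have "a * t <= a * r" using that a by (intro mult_left_mono) auto
    moreover have "0 < (a - r)\<^sup>2" using ne by simp
    ultimately show ?thesis unfolding D_def power2_diff by linarith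
  qed
  have q: "q t > 0" "q t * q t = D t" if "\<bar>t\<bar> <= r" for t using D[OF that] by (simp_all add: q_def)
  have dq: "(q has_real_derivative - a / q t) (at t)" if "\<bar>t\<bar> <= r" for t
  proof -
    have "(D has_real_derivative - 2 * a) (at t)" unfolding D_def by (auto intro!: derivative_eq_intros)
    note d = DERIV_chain2[OF DERIV_real_sqrt[OF D[OF that]] this]
    have e: "inverse z / 2 * (- 2 * a) = - a / z" for z by (simp add: inverse_eq_divide)
    have "q = (%t. sqrt (D t))" by (rule ext) (rule q_def)
    with DERIV_cong[OF d e] show ?thesis by (simp only:)
  qed
  have cq: "continuous_on {-r..r} q"
  proof (rule continuous_at_imp_continuous_on, intro ballI)
    fix t assume "t \<in> {-r..r}"
    then have "\<bar>t\<bar> <= r" by (simp add: abs_le_iff)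
    from DERIV_isCont[OF dq[OF this]] show "isCont q t" .
  qed
  have qr: "q r = \<bar>a - r\<bar>" "q (- r) = a + r"
  proof -
    have "D r = (a - r)\<^sup>2" "D (- r) = (a + r)\<^sup>2" by (auto simp: D_def power2_eq_square algebra_simps)
    then show "q r = \<bar>a - r\<bar>" "q (- r) = a + r" using a r by (simp_all add: q_def)
  qed
  have open_closed: "(\<integral>t. indicator {-r<..<r} t * f t \<partial>lborel) = (\<integral>t. indicator {-r..r} t *\<^sub>R f t \<partial>lborel)" if [measurable]: "f \<in> borel_measurable borel" for f :: "real => real"
    using AE_lborel_singleton[of r] AE_lborel_singleton[of "-r"]
    by (intro integral_cong_AE) (auto simp: indicator_def)
  have mq [measurable]: "q \<in> borel_measurable borel" unfolding q_def D_def by measurable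
  \<comment> \<open>As q' = - a / q, a primitive is - q / a.\<close>
  have "(\<integral>t. indicator {-r..r} t *\<^sub>R (1 / q t) \<partial>lborel) = (- q r / a) - (- q (- r) / a)"
  proof (rule integral_FTC_Icc)
    fix t assume "- r <= t" "t <= r"
    then have t: "\<bar>t\<bar> <= r" by (simp add: abs_le_iff)
    have "((%t. - q t / a) has_real_derivative 1 / q t) (at t)"
    proof -
      have e: "- (- a / q t) / a = 1 / q t" using a q(1)[OF t] by simp
      show ?thesis by (rule DERIV_cong[OF DERIV_cdivide[OF DERIV_minus[OF dq[OF t]]] e])
    qed
    then show "((%t. - q t / a) has_vector_derivative 1 / q t) (at t within {- r..r})"
      unfolding has_real_derivative_iff_has_vector_derivative[symmetric] by (rule has_field_derivative_at_within)
  next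
    have "q t ~= 0" if "t \<in> {-r..r}" for t using q(1)[of t] that by (auto simp: abs_le_iff)
    then show "continuous_on {- r..r} (%t. 1 / q t)" by (intro continuous_intros cq) auto
  qed (use r in simp)
  also have "\<dots> = (a + r - \<bar>a - r\<bar>) / a"
  proof -
    have "- u / z - (- v / z) = (v - u) / z" for u v z :: real by (simp add: diff_divide_distrib)
    then show ?thesis unfolding qr .
  qed
  also have "\<dots> = 2 * r / max a r"
  proof (cases "a < r")
    case True
    then have "a + r - \<bar>a - r\<bar> = 2 * a" "max a r = r" by simp_all
    then show ?thesis using a r by simp
  next
    case False
    then have "a + r - \<bar>a - r\<bar> = 2 * r" "max a r = a" by simp_all
    then show ?thesis by simp
  qed
  finally show "(\<integral>t. indicator {-r<..<r} t * (1 / sqrt (a\<^sup>2 + r\<^sup>2 - 2 * a * t)) \<partial>lborel) = 2 * r / max a r"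
    using open_closed[of "%t. 1 / q t"] unfolding q_def D_def by simp
  \<comment> \<open>The primitive - q (a^2 + r^2 + a t) / (3 a^2) comes from expressing t through
    q^2 = a^2 + r^2 - 2 a t and integrating a polynomial in q.\<close>
  have "(\<integral>t. indicator {-r..r} t *\<^sub>R (t / q t) \<partial>lborel)
      = (- (q r * (a\<^sup>2 + r\<^sup>2 + a * r)) / (3 * a\<^sup>2)) - (- (q (- r) * (a\<^sup>2 + r\<^sup>2 + a * (- r))) / (3 * a\<^sup>2))"
  proof (rule integral_FTC_Icc)
    fix t assume "- r <= t" "t <= r"
    then have t: "\<bar>t\<bar> <= r" by (simp add: abs_le_iff)
    have lin: "((%t. a\<^sup>2 + r\<^sup>2 + a * t) has_real_derivative a) (at t)"
      by (auto intro!: derivative_eq_intros)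
    have "((%t. - (q t * (a\<^sup>2 + r\<^sup>2 + a * t)) / (3 * a\<^sup>2)) has_real_derivative
        - ((- a / q t) * (a\<^sup>2 + r\<^sup>2 + a * t) + a * q t) / (3 * a\<^sup>2)) (at t)"
      by (rule DERIV_cdivide[OF DERIV_minus[OF DERIV_mult[OF dq[OF t] lin]]])
    moreover have "- ((- a / q t) * (a\<^sup>2 + r\<^sup>2 + a * t) + a * q t) / (3 * a\<^sup>2) = t / q t"
    proof -
      have "q t * (- ((- a / q t) * (a\<^sup>2 + r\<^sup>2 + a * t) + a * q t)) = a * (a\<^sup>2 + r\<^sup>2 + a * t) - a * (q t * q t)"
        using q(1)[OF t] by (simp add: algebra_simps)
      also have "\<dots> = 3 * a\<^sup>2 * t" unfolding q(2)[OF t] D_def by (simp add: algebra_simps power2_eq_square)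
      finally have "q t * N = 3 * a\<^sup>2 * t" if "N = - ((- a / q t) * (a\<^sup>2 + r\<^sup>2 + a * t) + a * q t)" for N
        by (simp only: that)
      from this[OF refl] show ?thesis using q(1)[OF t] a by (subst frac_eq_eq) (simp_all only: mult_ac power_eq_0_iff mult_eq_0_iff, simp_all)
    qed
    ultimately have "((%t. - (q t * (a\<^sup>2 + r\<^sup>2 + a * t)) / (3 * a\<^sup>2)) has_real_derivative t / q t) (at t)" by simp
    then show "((%t. - (q t * (a\<^sup>2 + r\<^sup>2 + a * t)) / (3 * a\<^sup>2)) has_vector_derivative t / q t) (at t within {- r..r})"
      unfolding has_real_derivative_iff_has_vector_derivative[symmetric] by (rule has_field_derivative_at_within)
  next
    have "q t ~= 0" if "t \<in> {-r..r}" for t using q(1)[of t] that by (auto simp: abs_le_iff)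
    then show "continuous_on {- r..r} (%t. t / q t)" by (intro continuous_intros cq) auto
  qed (use r in simp)
  also have "\<dots> = 2 * (min a r) ^ 3 / (3 * a\<^sup>2)"
  proof -
    have key: "(a + r) * (a\<^sup>2 + r\<^sup>2 + a * (- r)) - \<bar>a - r\<bar> * (a\<^sup>2 + r\<^sup>2 + a * r) = 2 * (min a r) ^ 3"
    proof (cases "a < r")
      case True
      then have "\<bar>a - r\<bar> = r - a" "min a r = a" by simp_all
      then show ?thesis by (simp add: power2_eq_square power3_eq_cube algebra_simps)
    next
      case False
      then have "\<bar>a - r\<bar> = a - r" "min a r = r" by simp_all
      then show ?thesis by (simp add: power2_eq_square power3_eq_cube algebra_simps)
    qed
    have "- u / z - (- v / z) = (v - u) / z" for u v z :: real by (simp add: diff_divide_distrib)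
    then show ?thesis unfolding qr by (simp only: key)
  qed
  finally show "(\<integral>t. indicator {-r<..<r} t * (t / sqrt (a\<^sup>2 + r\<^sup>2 - 2 * a * t)) \<partial>lborel) = 2 * (min a r) ^ 3 / (3 * a\<^sup>2)"
    using open_closed[of "%t. t / q t"] unfolding q_def D_def by simp
qed

lemma norm_axis_diff: "norm (a *\<^sub>R axis 1 1 - y) = sqrt (a\<^sup>2 + (norm y)\<^sup>2 - 2 * a * y $ 1)" for y :: "real^3"
proof -
  have "(norm (a *\<^sub>R axis 1 1 - y))\<^sup>2 = a\<^sup>2 + (norm y)\<^sup>2 - 2 * a * y $ 1"
  proof -
    let ?e = "axis 1 1 :: real^3"
    have "(norm (a *\<^sub>R ?e - y))\<^sup>2 = (a *\<^sub>R ?e - y) \<bullet> (a *\<^sub>R ?e - y)" by (rule power2_norm_eq_inner)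
    also have "\<dots> = a\<^sup>2 * (?e \<bullet> ?e) - 2 * a * (?e \<bullet> y) + y \<bullet> y"
      by (simp only: inner_diff_left inner_diff_right inner_scaleR_left inner_scaleR_right inner_commute[of y ?e])
        (simp only: power2_eq_square, simp add: algebra_simps)
    also have "\<dots> = a\<^sup>2 + (norm y)\<^sup>2 - 2 * a * y $ 1"
      unfolding power2_norm_eq_inner[symmetric] by (simp add: inner_axis')
    finally show ?thesis .
  qed
  then show ?thesis by (metis norm_ge_zero real_sqrt_unique)
qed

text \<open>A reflection takes x to the point of equal norm on the first axis; carrying y along
  leaves the integral unchanged.\<close>

lemma to_axis:
  fixes x :: "real^3" and f :: "real^3 => real^3 => real"
  assumes inv: "!!e x y. norm e = 1 ==> f (reflect e x) (reflect e y) = f x y"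
    and int: "integrable lborel (f x)"
  shows "integrable lborel (f (norm x *\<^sub>R axis 1 1))" "(\<integral>y. f x y \<partial>lborel) = (\<integral>y. f (norm x *\<^sub>R axis 1 1) y \<partial>lborel)"
proof -
  let ?x' = "norm x *\<^sub>R axis 1 1 :: real^3"
  have "integrable lborel (f ?x') & (\<integral>y. f x y \<partial>lborel) = (\<integral>y. f ?x' y \<partial>lborel)"
  proof (cases "x = ?x'")
    case True then show ?thesis using int by metis
  next
    case False
    have "norm x = norm ?x'" by simp
    from reflection_exists[OF this False] obtain e where e: "norm e = 1" "reflect e x = ?x'" by metis
    have eq: "f x (reflect e y) = f ?x' y" for y
      using inv[OF e(1), of x "reflect e y"] by (simp add: e reflect_reflect[OF e(1)])
    show ?thesis using integrable_reflect[OF e(1) int] integral_reflect[OF e(1), of "f x"] int by (simp add: eq)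
  qed
  then show "integrable lborel (f ?x')" "(\<integral>y. f x y \<partial>lborel) = (\<integral>y. f ?x' y \<partial>lborel)" by auto
qed

theorem radial_potential:
  fixes s :: "real => real" and x :: "real^3"
  assumes [measurable]: "s \<in> borel_measurable borel" and x: "x ~= 0"
    and int: "integrable lborel (%y. s (norm y) / norm (x - y))"
  shows "(\<integral>y. s (norm y) / norm (x - y) \<partial>lborel) = (\<integral>r. indicator {0<..} r * (s r * (4 * pi * r\<^sup>2) / max (norm x) r) \<partial>lborel)"
proof -
  define a where "a = norm x"
  have a: "a > 0" using x by (simp add: a_def)
  define F where "F r t = s r / sqrt (a\<^sup>2 + r\<^sup>2 - 2 * a * t)" for r t
  have mF: "(%(r, t). F r t) \<in> borel_measurable (borel \<Otimes>\<^sub>M borel)" unfolding F_def by measurable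
  have eqF: "(%y::real^3. s (norm y) / norm (a *\<^sub>R axis 1 1 - y)) = (%y. F (norm y) (y $ 1))"
    by (simp add: F_def norm_axis_diff)
  note ax = to_axis[where f = "%x y. s (norm y) / norm (x - y)" and x = x, OF _ int, folded a_def]
  have inv: "s (norm (reflect e y)) / norm (reflect e x - reflect e y) = s (norm y) / norm (x - y)" if "norm e = 1" for e x y
    using that by (simp add: norm_reflect_diff)
  have i: "integrable lborel (%y::real^3. F (norm y) (y $ 1))"
    using ax(1)[OF inv] unfolding eqF by blast
  have "(\<integral>y. s (norm y) / norm (x - y) \<partial>lborel) = (\<integral>y. F (norm y) (y $ 1) \<partial>(lborel :: (real^3) measure))"
    using ax(2)[OF inv] unfolding eqF by blast
  also have "\<dots> = (\<integral>r. indicator {0<..} r * (2 * pi * r) * (\<integral>t. indicator {-r<..<r} t * F r t \<partial>lborel) \<partial>lborel)"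
    by (rule integral_axially_symmetric[OF mF i])
  also have "\<dots> = (\<integral>r. indicator {0<..} r * (s r * (4 * pi * r\<^sup>2) / max a r) \<partial>lborel)"
  proof (rule integral_cong_AE)
    show "(%r. indicator {0<..} r * (2 * pi * r) * (\<integral>t. indicator {-r<..<r} t * F r t \<partial>lborel)) \<in> borel_measurable lborel"
      using integrable_axially_symmetric[OF mF i] by (rule borel_measurable_integrable)
    show "AE r in lborel. indicator {0<..} r * (2 * pi * r) * (\<integral>t. indicator {-r<..<r} t * F r t \<partial>lborel)
       = indicator {0<..} r * (s r * (4 * pi * r\<^sup>2) / max a r)"
      using AE_lborel_singleton[of a]
    proof (rule AE_mp, intro AE_I2 impI)
      fix r assume "r ~= a"
      show "indicator {0<..} r * (2 * pi * r) * (\<integral>t. indicator {-r<..<r} t * F r t \<partial>lborel)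
         = indicator {0<..} r * (s r * (4 * pi * r\<^sup>2) / max a r)"
      proof (cases "r > 0")
        case True
        have fe: "(%t. indicator {-r<..<r} t * F r t) = (%t. s r * (indicator {-r<..<r} t * (1 / sqrt (a\<^sup>2 + r\<^sup>2 - 2 * a * t))))"
          by (auto simp: F_def)
        have "(\<integral>t. indicator {-r<..<r} t * F r t \<partial>lborel) = s r * (2 * r / max a r)"
          by (simp only: fe integral_mult_right_zero newton_kernel_0[OF a True \<open>r ~= a\<close>[symmetric]])
        then show ?thesis using True by (simp add: power2_eq_square)
      qed simp
    qed
  qed measurable
  finally show ?thesis by (simp add: a_def)
qed

text \<open>The component of e orthogonal to x contributes nothing, by a reflection fixing x. What
  remains is a multiple of the case e = x, which is axially symmetric and reduces to the first
  moment of the kernel.\<close>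

theorem dipole_potential:
  fixes g :: "real => real" and x e :: "real^3"
  assumes [measurable]: "g \<in> borel_measurable borel" and x: "x ~= 0"
    and int: "integrable lborel (%y. g (norm y) * norm y / norm (x - y))"
  shows "(\<integral>y. g (norm y) * (y \<bullet> e) / norm (x - y) \<partial>lborel)
    = (x \<bullet> e) * (\<integral>r. indicator {0<..} r * (g r * (4 * pi / 3) * r * (min (norm x) r) ^ 3 / (norm x) ^ 3) \<partial>lborel)"
proof -
  define a where "a = norm x"
  have a: "a > 0" using x by (simp add: a_def)
  have inte: "integrable lborel (%y. g (norm y) * (y \<bullet> e) / norm (x - y))" for e
  proof (rule Bochner_Integration.integrable_bound)
    show "integrable lborel (%y. norm e * (g (norm y) * norm y / norm (x - y)))" by (intro integrable_mult_right int)
    show "AE y in lborel. norm (g (norm y) * (y \<bullet> e) / norm (x - y)) <= norm (norm e * (g (norm y) * norm y / norm (x - y)))"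
    proof (rule AE_I2)
      fix y
      have "\<bar>g (norm y)\<bar> * \<bar>y \<bullet> e\<bar> <= \<bar>g (norm y)\<bar> * (norm y * norm e)"
        by (intro mult_left_mono Cauchy_Schwarz_ineq2) auto
      then have "\<bar>g (norm y)\<bar> * \<bar>y \<bullet> e\<bar> / norm (x - y) <= \<bar>g (norm y)\<bar> * (norm y * norm e) / norm (x - y)"
        by (rule divide_right_mono) simp
      then show "norm (g (norm y) * (y \<bullet> e) / norm (x - y)) <= norm (norm e * (g (norm y) * norm y / norm (x - y)))"
        by (simp add: abs_mult mult_ac)
    qed
  qed measurable
  define J where "J = (\<integral>y. g (norm y) * (y \<bullet> x) / norm (x - y) \<partial>lborel)"
  \<comment> \<open>The reflection in the plane orthogonal to e fixes x and changes the sign of the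
    integrand.\<close>
  have perp: "(\<integral>y. g (norm y) * (y \<bullet> e) / norm (x - y) \<partial>lborel) = 0" if "x \<bullet> e = 0" "norm e = 1" for e
  proof -
    have "reflect e x = x" using that by (simp add: reflect_def)
    have "g (norm (reflect e y)) * (reflect e y \<bullet> e) / norm (x - reflect e y) = - (g (norm y) * (y \<bullet> e) / norm (x - y))" for y
      using that \<open>reflect e x = x\<close> by (simp add: norm_diff_reflect reflect_inner)
    then show ?thesis using integral_reflect[OF that(2), of "%y. g (norm y) * (y \<bullet> e) / norm (x - y)"] by simp
  qed
  have perp': "(\<integral>y. g (norm y) * (y \<bullet> e) / norm (x - y) \<partial>lborel) = 0" if "x \<bullet> e = 0" for e
  proof (cases "e = 0")
    case False
    then have z: "(\<integral>y. g (norm y) * (y \<bullet> ((1 / norm e) *\<^sub>R e)) / norm (x - y) \<partial>lborel) = 0"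
      using that by (intro perp) auto
    have fe: "(%y. g (norm y) * (y \<bullet> e) / norm (x - y)) = (%y. norm e * (g (norm y) * (y \<bullet> ((1 / norm e) *\<^sub>R e)) / norm (x - y)))"
      using False by auto
    show ?thesis by (simp only: fe integral_mult_right_zero z mult_zero_right)
  qed simp
  define c where "c = (x \<bullet> e) / a\<^sup>2"
  have xx: "x \<bullet> x = a\<^sup>2" by (simp add: a_def power2_norm_eq_inner)
  have "x \<bullet> (e - c *\<^sub>R x) = 0" using a by (simp add: inner_diff_right xx c_def)
  from perp'[OF this] have "0 = (\<integral>y. g (norm y) * (y \<bullet> e) / norm (x - y) - c * (g (norm y) * (y \<bullet> x) / norm (x - y)) \<partial>lborel)"
    by (simp add: inner_diff_right diff_divide_distrib right_diff_distrib mult_ac)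
  also have "\<dots> = (\<integral>y. g (norm y) * (y \<bullet> e) / norm (x - y) \<partial>lborel) - c * J"
    unfolding J_def by (subst Bochner_Integration.integral_diff[OF inte integrable_mult_right[OF inte]]) (simp only: integral_mult_right_zero)
  finally have split: "(\<integral>y. g (norm y) * (y \<bullet> e) / norm (x - y) \<partial>lborel) = c * J" by simp
  define F where "F r t = g r * (a * t) / sqrt (a\<^sup>2 + r\<^sup>2 - 2 * a * t)" for r t
  have mF: "(%(r, t). F r t) \<in> borel_measurable (borel \<Otimes>\<^sub>M borel)" unfolding F_def by measurable
  have eqF: "(%y::real^3. g (norm y) * (y \<bullet> (a *\<^sub>R axis 1 1)) / norm (a *\<^sub>R axis 1 1 - y)) = (%y. F (norm y) (y $ 1))"
    by (simp add: F_def norm_axis_diff inner_axis)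
  note ax = to_axis[where f = "%x y. g (norm y) * (y \<bullet> x) / norm (x - y)" and x = x, OF _ inte, folded a_def]
  have inv: "g (norm (reflect e y)) * (reflect e y \<bullet> reflect e x) / norm (reflect e x - reflect e y) = g (norm y) * (y \<bullet> x) / norm (x - y)"
    if "norm e = 1" for e x y using that by (simp add: norm_reflect_diff inner_reflect_reflect)
  have i: "integrable lborel (%y::real^3. F (norm y) (y $ 1))"
    using ax(1)[OF inv] unfolding eqF by blast
  have "J = (\<integral>y. F (norm y) (y $ 1) \<partial>(lborel :: (real^3) measure))"
    using ax(2)[OF inv] unfolding eqF J_def by blast
  also have "\<dots> = (\<integral>r. indicator {0<..} r * (2 * pi * r) * (\<integral>t. indicator {-r<..<r} t * F r t \<partial>lborel) \<partial>lborel)"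
    by (rule integral_axially_symmetric[OF mF i])
  also have "\<dots> = (\<integral>r. a\<^sup>2 * (indicator {0<..} r * (g r * (4 * pi / 3) * r * (min a r) ^ 3 / a ^ 3)) \<partial>lborel)"
  proof (rule integral_cong_AE)
    show "(%r. indicator {0<..} r * (2 * pi * r) * (\<integral>t. indicator {-r<..<r} t * F r t \<partial>lborel)) \<in> borel_measurable lborel"
      using integrable_axially_symmetric[OF mF i] by (rule borel_measurable_integrable)
    show "AE r in lborel. indicator {0<..} r * (2 * pi * r) * (\<integral>t. indicator {-r<..<r} t * F r t \<partial>lborel)
       = a\<^sup>2 * (indicator {0<..} r * (g r * (4 * pi / 3) * r * (min a r) ^ 3 / a ^ 3))"
      using AE_lborel_singleton[of a]
    proof (rule AE_mp, intro AE_I2 impI)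
      fix r assume "r ~= a"
      show "indicator {0<..} r * (2 * pi * r) * (\<integral>t. indicator {-r<..<r} t * F r t \<partial>lborel)
         = a\<^sup>2 * (indicator {0<..} r * (g r * (4 * pi / 3) * r * (min a r) ^ 3 / a ^ 3))"
      proof (cases "r > 0")
        case True
        have fe: "(%t. indicator {-r<..<r} t * F r t) = (%t. (g r * a) * (indicator {-r<..<r} t * (t / sqrt (a\<^sup>2 + r\<^sup>2 - 2 * a * t))))"
          by (auto simp: F_def)
        have "(\<integral>t. indicator {-r<..<r} t * F r t \<partial>lborel) = (g r * a) * (2 * (min a r) ^ 3 / (3 * a\<^sup>2))"
          by (simp only: fe integral_mult_right_zero newton_kernel_1[OF a True \<open>r ~= a\<close>[symmetric]])
        then show ?thesis using True a by (simp add: power2_eq_square power3_eq_cube)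
      qed simp
    qed
  qed measurable
  also have "\<dots> = a\<^sup>2 * (\<integral>r. indicator {0<..} r * (g r * (4 * pi / 3) * r * (min a r) ^ 3 / a ^ 3) \<partial>lborel)"
    by (rule integral_mult_right_zero)
  finally show ?thesis unfolding split c_def using a by (simp add: a_def)
qed

lemma nn_integral_radial:
  fixes f :: "real => ennreal"
  assumes [measurable]: "f \<in> borel_measurable borel"
  shows "(\<integral>\<^sup>+y. f (norm y) \<partial>(lborel :: (real^3) measure)) = (\<integral>\<^sup>+r. indicator {0<..} r * (ennreal (4 * pi * r\<^sup>2) * f r) \<partial>lborel)"
proof -
  have [measurable]: "(%y::real^3. (norm y, y $ 1)) \<in> lborel \<rightarrow>\<^sub>M borel \<Otimes>\<^sub>M borel"
    unfolding measurable_lborel2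
    by (intro measurable_Pair borel_measurable_continuous_onI continuous_intros)
  have ss: "sets (lborel \<Otimes>\<^sub>M (lborel :: real measure)) = sets (borel \<Otimes>\<^sub>M (borel :: real measure))"
    by (intro sets_pair_measure_cong) simp_all
  have [measurable]: "(%(r::real, t::real). indicator {\<bar>t\<bar><..} r :: ennreal) \<in> borel_measurable (borel \<Otimes>\<^sub>M borel)"
    unfolding greaterThan_def indicator_def by measurable
  let ?w = "%(r::real, t::real). ennreal (2 * pi * r) * indicator {\<bar>t\<bar><..} r"
  have w: "?w \<in> borel_measurable (lborel \<Otimes>\<^sub>M lborel)" unfolding measurable_cong_sets[OF ss refl] by measurable
  have f1: "(%p::real \<times> real. f (fst p)) \<in> borel_measurable (lborel \<Otimes>\<^sub>M lborel)" unfolding measurable_cong_sets[OF ss refl] by measurable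
  have wf: "(%p. ?w p * f (fst p)) \<in> borel_measurable (lborel \<Otimes>\<^sub>M lborel)" using w f1 by (rule borel_measurable_times_ennreal)
  have "(\<integral>\<^sup>+y. f (norm y) \<partial>(lborel :: (real^3) measure)) = (\<integral>\<^sup>+y. f (fst (norm y, y $ 1)) \<partial>(lborel :: (real^3) measure))" by simp
  also have "\<dots> = (\<integral>\<^sup>+p. f (fst p) \<partial>distr lborel (borel \<Otimes>\<^sub>M borel) (%y::real^3. (norm y, y $ 1)))"
    by (rule nn_integral_distr[symmetric]) measurable
  also have "\<dots> = (\<integral>\<^sup>+p. ?w p * f (fst p) \<partial>(lborel \<Otimes>\<^sub>M lborel))"
    unfolding distr_norm_axis by (rule nn_integral_density[OF w f1])
  also have "\<dots> = (\<integral>\<^sup>+r. \<integral>\<^sup>+t. ennreal (2 * pi * r) * indicator {\<bar>t\<bar><..} r * f r \<partial>lborel \<partial>lborel)"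
    using lborel.nn_integral_fst[OF wf] by simp
  also have "\<dots> = (\<integral>\<^sup>+r. indicator {0<..} r * (ennreal (4 * pi * r\<^sup>2) * f r) \<partial>lborel)"
  proof (rule nn_integral_cong)
    fix r :: real
    show "(\<integral>\<^sup>+t. ennreal (2 * pi * r) * indicator {\<bar>t\<bar><..} r * f r \<partial>lborel) = indicator {0<..} r * (ennreal (4 * pi * r\<^sup>2) * f r)"
    proof (cases "r > 0")
      case True
      have "(%t. ennreal (2 * pi * r) * indicator {\<bar>t\<bar><..} r * f r) = (%t. (ennreal (2 * pi * r) * f r) * indicator {-r<..<r} t)"
      proof
        fix t show "ennreal (2 * pi * r) * indicator {\<bar>t\<bar><..} r * f r = (ennreal (2 * pi * r) * f r) * indicator {-r<..<r} t"
          by (cases "\<bar>t\<bar> < r") (auto simp: indicator_def abs_less_iff mult_ac)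
      qed
      then have "(\<integral>\<^sup>+t. ennreal (2 * pi * r) * indicator {\<bar>t\<bar><..} r * f r \<partial>lborel) = ennreal (2 * pi * r) * f r * ennreal (2 * r)"
        using True by (simp add: nn_integral_cmult_indicator)
      also have "\<dots> = ennreal (2 * pi * r) * ennreal (2 * r) * f r" by (simp only: mult_ac)
      also have "ennreal (2 * pi * r) * ennreal (2 * r) = ennreal (4 * pi * r\<^sup>2)"
        using True by (subst ennreal_mult[symmetric]) (auto simp: power2_eq_square mult_ac)
      finally show ?thesis using True by simp
    next
      case False
      then have "\<not> \<bar>t\<bar> < r" for t by linarith
      then have "(%t. ennreal (2 * pi * r) * indicator {\<bar>t\<bar><..} r * f r) = (%t. 0)" by simp
      then show ?thesis using False by simp
    qed
  qed
  finally show ?thesis .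
qed

text \<open>The singularity is moved to the origin; in polar coordinates the volume element r^2
  cancels it. This bounds the Newtonian kernel in L2.\<close>

lemma
  fixes x :: "real^3"
  assumes "R > 0"
  shows integrable_inverse_square: "integrable lborel (%y. indicator (ball 0 R) y / (norm (x - y))\<^sup>2)"
    and integral_inverse_square: "(\<integral>y. indicator (ball 0 R) y / (norm (x - y))\<^sup>2 \<partial>lborel) <= 4 * pi * (R + norm x)"
proof -
  \<comment> \<open>Seen from x, the ball lies within this radius.\<close>
  define Q where "Q = R + norm x"
  have Q: "Q > 0" using assms by (simp add: Q_def add_pos_nonneg)
  define f where "f r = ennreal (indicator {..<Q} r / r\<^sup>2)" for r :: real
  have [measurable]: "f \<in> borel_measurable borel" unfolding f_def by measurable
  have "(\<integral>\<^sup>+y. ennreal (indicator (ball 0 R) y / (norm (x - y))\<^sup>2) \<partial>lborel) <= (\<integral>\<^sup>+y. f (norm (- x + y)) \<partial>lborel)"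
  proof (intro nn_integral_mono)
    fix y :: "real^3"
    have "norm (x - y) = norm (- x + y)" using norm_minus_commute[of x y] by simp
    moreover have "norm (- x + y) < Q" if "norm y < R" using that norm_triangle_ineq[of "- x" y] by (simp add: Q_def)
    ultimately show "ennreal (indicator (ball 0 R) y / (norm (x - y))\<^sup>2) <= f (norm (- x + y))"
      unfolding f_def by (intro ennreal_leI) (auto simp: indicator_def)
  qed
  also have "\<dots> = (\<integral>\<^sup>+y. f (norm y) \<partial>distr lborel borel ((+) (- x)))"
    by (rule nn_integral_distr[symmetric]) measurable
  also have "\<dots> = (\<integral>\<^sup>+y. f (norm y) \<partial>(lborel :: (real^3) measure))" by (simp only: lborel_distr_plus)
  also have "\<dots> = (\<integral>\<^sup>+r. indicator {0<..} r * (ennreal (4 * pi * r\<^sup>2) * f r) \<partial>lborel)"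
    by (rule nn_integral_radial) measurable
  also have "\<dots> = (\<integral>\<^sup>+r. ennreal (4 * pi) * indicator {0<..<Q} r \<partial>lborel)"
  proof (rule nn_integral_cong)
    fix r :: real
    show "indicator {0<..} r * (ennreal (4 * pi * r\<^sup>2) * f r) = ennreal (4 * pi) * indicator {0<..<Q} r"
      by (cases "0 < r"; cases "r < Q") (auto simp: f_def ennreal_mult'[symmetric])
  qed
  also have "\<dots> = ennreal (4 * pi * Q)" using Q by (simp add: nn_integral_cmult_indicator ennreal_mult)
  finally have le: "(\<integral>\<^sup>+y. ennreal (indicator (ball 0 R) y / (norm (x - y))\<^sup>2) \<partial>lborel) <= ennreal (4 * pi * Q)" .
  have [measurable]: "(%y. (norm (x - y))\<^sup>2) \<in> borel_measurable borel"
    by (intro borel_measurable_continuous_onI continuous_intros)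
  have "(indicator (ball 0 R) :: real^3 => real) \<in> borel_measurable borel" by (rule borel_measurable_indicator) simp
  then have m: "(%y. indicator (ball 0 R) y / (norm (x - y))\<^sup>2 :: real) \<in> borel_measurable lborel"
    unfolding measurable_lborel2 by (rule borel_measurable_divide) measurable
  show i: "integrable lborel (%y. indicator (ball 0 R) y / (norm (x - y))\<^sup>2)"
    by (rule integrableI_nonneg[OF m]) (simp, rule le_less_trans[OF le], simp)
  have "(\<integral>\<^sup>+y. ennreal (indicator (ball 0 R) y / (norm (x - y))\<^sup>2) \<partial>lborel)
      = ennreal (\<integral>y. indicator (ball 0 R) y / (norm (x - y))\<^sup>2 \<partial>lborel)"
    by (rule nn_integral_eq_integral[OF i]) simp
  with le have "ennreal (\<integral>y. indicator (ball 0 R) y / (norm (x - y))\<^sup>2 \<partial>lborel) <= ennreal (4 * pi * Q)"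
    by (simp only:)
  then have "(\<integral>y. indicator (ball 0 R) y / (norm (x - y))\<^sup>2 \<partial>lborel) <= 4 * pi * Q"
    using Q by (subst (asm) ennreal_le_iff) simp_all
  then show "(\<integral>y. indicator (ball 0 R) y / (norm (x - y))\<^sup>2 \<partial>lborel) <= 4 * pi * (R + norm x)"
    by (simp only: Q_def)
qed

section \<open>White dwarf profiles\<close>

locale white_dwarf = ball_domain R for R :: real +
  fixes A B \<mu> :: real and y :: "real => real"
  assumes AB: "A > 0" "B > 0" and \<mu>: "\<mu> > 0"
    and profile: "stellar_profile (white_dwarf_pressure A B) \<mu> y"
    and yR: "y R = 0"
begin

definition P where "P = white_dwarf_pressure A B"
text \<open>At density B x^3 the enthalpy derivative is k (sqrt (1 + x^2) - 1). Solving this for a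
  given value s yields \<open>c s\<close> = sqrt (1 + x^2), \<open>X s\<close> = x and
  \<open>F s\<close> = B x^3.\<close>

definition k where "k = 8 * A / B"
definition c where "c s = 1 + s / k" for s
definition X where "X s = sqrt ((c s)\<^sup>2 - 1)" for s
definition F where "F s = B * X s ^ 3" for s
definition F' where "F' s = 3 * B / k * (c s * X s)" for s

lemma k: "k > 0" using AB by (simp add: k_def)

lemma c: "s > 0 ==> c s > 1" using k by (simp add: c_def)

lemma X: "s > 0 ==> X s > 0" "s >= 0 ==> X s >= 0" "s >= 0 ==> (X s)\<^sup>2 = (c s)\<^sup>2 - 1" "X 0 = 0"
proof -
  have c2: "(c s)\<^sup>2 > 1" if "s > 0" for s
    using power_strict_mono[of 1 "c s" 2] c[OF that] by simp
  show "s > 0 ==> X s > 0" using c2 by (simp add: X_def)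
  have c1: "(c s)\<^sup>2 >= 1" if "s >= 0" for s
    using power_mono[of 1 "c s" 2] that k by (simp add: c_def)
  show "s >= 0 ==> X s >= 0" "s >= 0 ==> (X s)\<^sup>2 = (c s)\<^sup>2 - 1" using c1[of s] by (simp_all add: X_def)
  show "X 0 = 0" by (simp add: X_def c_def)
qed

lemma F_pos: "s > 0 ==> F s > 0" using X(1) AB by (simp add: F_def)
lemma F'_pos: "s > 0 ==> F' s > 0" using X(1) AB k c[of s] by (simp add: F'_def)
lemma F_0: "F 0 = 0" by (simp add: F_def X(4))
lemma continuous_F: "continuous_on U F" "continuous_on U F'"
  unfolding F_def F'_def X_def c_def using k by (auto intro!: continuous_intros)

lemma F_measurable [measurable]: "F \<in> borel_measurable borel" "F' \<in> borel_measurable borel"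
  using continuous_F by (auto intro: borel_measurable_continuous_onI)

lemma c_deriv: "(c has_real_derivative 1 / k) (at s)"
  unfolding c_def using k by (auto intro!: derivative_eq_intros)

lemma X_deriv: "s > 0 ==> (X has_real_derivative c s / (k * X s)) (at s)"
proof -
  assume s: "s > 0"
  have b: "((%s. (c s)\<^sup>2 - 1) has_real_derivative 2 * c s * (1 / k)) (at s)"
    by (auto intro!: derivative_eq_intros c_deriv)
  have "(X s)\<^sup>2 > 0" using X(1)[OF s] by simp
  then have p: "(c s)\<^sup>2 - 1 > 0" using X(3)[of s] s by simp
  note d = DERIV_chain2[where f = sqrt and g = "%s. (c s)\<^sup>2 - 1", OF DERIV_real_sqrt[OF p] b]
  have e: "inverse z / 2 * (2 * c s * (1 / k)) = c s / (k * z)" for z by (simp add: inverse_eq_divide)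
  have "X = (%s. sqrt ((c s)\<^sup>2 - 1))" by (rule ext) (rule X_def)
  with DERIV_cong[OF d e] show ?thesis by (simp only:)
qed

lemma F_deriv: "s > 0 ==> (F has_real_derivative F' s) (at s)"
proof -
  assume s: "s > 0"
  have "(F has_real_derivative B * (3 * (X s)\<^sup>2 * (c s / (k * X s)))) (at s)"
    unfolding F_def by (auto intro!: derivative_eq_intros X_deriv s simp: power2_eq_square)
  moreover have "B * (3 * (X s)\<^sup>2 * (c s / (k * X s))) = F' s"
    using X(1)[OF s] by (simp add: F'_def power2_eq_square)
  ultimately show ?thesis by simp
qed

lemma root_deriv:
  assumes "t > 0"
  shows "((%t. root 3 (t / B)) has_real_derivative 1 / (3 * B * (root 3 (t / B))\<^sup>2)) (at t)"
proof -
  have t: "t / B > 0" using assms AB by simp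
  have "((%t. t / B) has_real_derivative 1 / B) (at t)" using AB by (auto intro!: derivative_eq_intros)
  note d = DERIV_chain2[where f = "root 3" and g = "%t. t / B", OF DERIV_real_root[of 3, OF _ t] this]
  have e: "inverse (real 3 * z ^ (3 - Suc 0)) * (1 / B) = 1 / (3 * B * z\<^sup>2)" for z
    by (simp add: inverse_eq_divide mult_ac)
  show ?thesis by (rule DERIV_cong[OF d e]) simp
qed

lemma pressure_deriv:
  assumes "t > 0"
  shows "deriv P t = k / 3 * (root 3 (t / B))\<^sup>2 / sqrt (1 + (root 3 (t / B))\<^sup>2)"
proof -
  let ?x = "root 3 (t / B)"
  have x: "?x > 0" using assms AB by simp
  have "(P has_real_derivative A * (8 * ?x ^ 4 / sqrt (1 + ?x\<^sup>2) * (1 / (3 * B * ?x\<^sup>2)))) (at t)"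
    unfolding P_def white_dwarf_pressure_def
    by (intro DERIV_cmult DERIV_chain2[OF white_dwarf_f_has_derivative root_deriv] assms)
  moreover have "A * (8 * ?x ^ 4 / sqrt (1 + ?x\<^sup>2) * (1 / (3 * B * ?x\<^sup>2))) = k / 3 * ?x\<^sup>2 / sqrt (1 + ?x\<^sup>2)"
  proof -
    have "A * (8 * z ^ 4 / q * (1 / (3 * B * z\<^sup>2))) = k / 3 * z\<^sup>2 / q" if "z > 0" for z q :: real
      using that AB by (cases "q = 0") (simp_all add: k_def field_simps power2_eq_square power4_eq_xxxx)
    from this[OF x] show ?thesis .
  qed
  ultimately show ?thesis by (simp add: DERIV_imp_deriv)
qed

text \<open>The integrand behaves like the power -1/3 of the density at 0, so the fundamental
  theorem is used in the version that asks for a derivative in the open interval only.\<close>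

lemma enthalpy_deriv_eq:
  assumes "t >= 0"
  shows "enthalpy_deriv P t = k * (sqrt (1 + (root 3 (t / B))\<^sup>2) - 1)"
proof -
  let ?h = "%t. k * (sqrt (1 + (root 3 (t / B))\<^sup>2) - 1)"
  have "((%s. deriv P s / s) has_integral (?h t - ?h 0)) {0..t}"
  proof (rule fundamental_theorem_of_calculus_interior[OF assms])
    show "continuous_on {0..t} ?h" using AB by (auto intro!: continuous_intros)
    fix s assume "s \<in> {0<..<t}"
    then have s: "s > 0" by simp
    let ?x = "root 3 (s / B)"
    have x: "?x > 0" "?x ^ 3 = s / B" using s AB by simp_all
    have p: "1 + ?x\<^sup>2 > 0" by (simp add: add_pos_nonneg)
    have "((%s. (root 3 (s / B))\<^sup>2) has_real_derivative 2 * ?x * (1 / (3 * B * ?x\<^sup>2))) (at s)"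
      using DERIV_power[OF root_deriv[OF s], of 2] by (simp add: mult_ac)
    from DERIV_add[OF DERIV_const[of 1] this]
    have "((%s. 1 + (root 3 (s / B))\<^sup>2) has_real_derivative 2 * ?x * (1 / (3 * B * ?x\<^sup>2))) (at s)"
      by (simp only: add_0)
    from DERIV_chain2[where f = sqrt and g = "%s. 1 + (root 3 (s / B))\<^sup>2", OF DERIV_real_sqrt[OF p] this]
    have "((%s. sqrt (1 + (root 3 (s / B))\<^sup>2)) has_real_derivative inverse (sqrt (1 + ?x\<^sup>2)) / 2 * (2 * ?x * (1 / (3 * B * ?x\<^sup>2)))) (at s)" .
    from DERIV_cmult[OF DERIV_diff[OF this DERIV_const[of 1]], of k]
    have d: "(?h has_real_derivative k * (inverse (sqrt (1 + ?x\<^sup>2)) / 2 * (2 * ?x * (1 / (3 * B * ?x\<^sup>2))))) (at s)"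
      by (simp only: diff_0_right)
    have sx: "s = B * ?x ^ 3" using x(2) AB by simp
    have "deriv P s / s = k / 3 * ?x\<^sup>2 / sqrt (1 + ?x\<^sup>2) / s" using pressure_deriv[OF s] by simp
    also have "\<dots> = k / 3 * ?x\<^sup>2 / sqrt (1 + ?x\<^sup>2) / (B * ?x ^ 3)" using sx by simp
    also have "\<dots> = k * (inverse (sqrt (1 + ?x\<^sup>2)) / 2 * (2 * ?x * (1 / (3 * B * ?x\<^sup>2))))"
    proof -
      have "k / 3 * z\<^sup>2 / q / (B * z ^ 3) = k * (inverse q / 2 * (2 * z * (1 / (3 * B * z\<^sup>2))))" if "z > 0" for z q :: real
        using that AB by (cases "q = 0") (simp_all add: field_simps power2_eq_square power3_eq_cube)
      from this[OF x(1)] show ?thesis .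
    qed
    finally show "(?h has_vector_derivative deriv P s / s) (at s)"
      using d by (simp add: has_real_derivative_iff_has_vector_derivative)
  qed
  then show ?thesis unfolding enthalpy_deriv_def by (simp add: integral_unique)
qed

lemma root_F: "s > 0 ==> root 3 (F s / B) = X s" "s > 0 ==> sqrt (1 + (X s)\<^sup>2) = c s"
proof -
  assume s: "s > 0"
  show "root 3 (F s / B) = X s" using AB X(1)[OF s] by (simp add: F_def real_root_power_cancel)
  show "sqrt (1 + (X s)\<^sup>2) = c s" using X(3)[of s] s c[of s] by simp
qed

text \<open>Every s > 0 is a value of the enthalpy derivative, attained at \<open>F s\<close>: the
  range is unbounded for this equation of state.\<close>

lemma enthalpy_inv_eq: "enthalpy_inv P s = (if s <= 0 then 0 else F s)"
proof (cases "s <= 0")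
  case False
  then have s: "s > 0" by simp
  have "inj_on (enthalpy_deriv P) {0<..}"
  proof (rule inj_onI)
    fix t u :: real assume tu: "t \<in> {0<..}" "u \<in> {0<..}" "enthalpy_deriv P t = enthalpy_deriv P u"
    then have "sqrt (1 + (root 3 (t / B))\<^sup>2) = sqrt (1 + (root 3 (u / B))\<^sup>2)"
      using k by (simp add: enthalpy_deriv_eq)
    then have "(root 3 (t / B))\<^sup>2 = (root 3 (u / B))\<^sup>2" by simp
    then have "root 3 (t / B) = root 3 (u / B)" using tu AB by (simp add: power2_eq_iff_nonneg)
    then show "t = u" using AB by simp
  qed
  moreover have "enthalpy_deriv P (F s) = s"
    using k less_imp_le[OF F_pos[OF s]] by (simp add: enthalpy_deriv_eq root_F[OF s] c_def)
  ultimately have "inv_into {0<..} (enthalpy_deriv P) s = F s"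
    using F_pos[OF s] by (intro inv_into_f_eq) auto
  then show ?thesis using False by (simp add: enthalpy_inv_def)
qed (simp add: enthalpy_inv_def)

lemma enthalpy_deriv2_eq: "s > 0 ==> enthalpy_deriv2 P (F s) = 1 / F' s"
proof -
  assume s: "s > 0"
  have "enthalpy_deriv2 P (F s) = k / 3 * (X s)\<^sup>2 / c s / F s"
    unfolding enthalpy_deriv2_def pressure_deriv[OF F_pos[OF s]] root_F[OF s] ..
  also have "\<dots> = 1 / F' s"
    using X(1)[OF s] AB k c[OF s] by (simp add: F_def F'_def power2_eq_square power3_eq_cube)
  finally show ?thesis .
qed

section \<open>The profile: behaviour at the centre, monotonicity, behaviour at the surface\<close>

definition is_derivative :: "(real => real) => bool" where
  "is_derivative d \<longleftrightarrow> (\<exists>y''. (\<forall>r\<ge>0. (y has_real_derivative d r) (at r within {0..})) & d 0 = 0 \<and>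
   (\<forall>r>0. (d has_real_derivative y'' r) (at r) & y'' r + 2 / r * d r = - 4 * pi * enthalpy_inv P (y r)))"

text \<open>The profile predicate hides its derivative behind an existential; one choice is fixed
  for all that follows.\<close>

definition y' where "y' = (SOME d. is_derivative d)"

lemma y'_spec: "\<exists>y''. (\<forall>r\<ge>0. (y has_real_derivative y' r) (at r within {0..})) & y' 0 = 0 \<and>
   (\<forall>r>0. (y' has_real_derivative y'' r) (at r) & y'' r + 2 / r * y' r = - 4 * pi * enthalpy_inv P (y r))"
proof -
  have "\<exists>d. is_derivative d"
    using profile unfolding stellar_profile_def is_derivative_def P_def by (rule conjunct2)
  then have "is_derivative y'" unfolding y'_def by (rule someI_ex)
  then show ?thesis unfolding is_derivative_def .
qed

lemma y_deriv_within: "r >= 0 ==> (y has_real_derivative y' r) (at r within {0..})" using y'_spec by blast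

lemma y_deriv: "r > 0 ==> (y has_real_derivative y' r) (at r)"
  using y_deriv_within[of r] at_within_interior[of r "{0..}"] by (simp add: interior_real_atLeast)

lemma continuous_y: "continuous_on {0..} y"
  using y_deriv_within by (auto intro: DERIV_continuous_on)

lemma y'_deriv: "r > 0 ==> (y' has_real_derivative - 4 * pi * enthalpy_inv P (y r) - 2 / r * y' r) (at r)"
proof -
  assume "r > 0"
  then obtain z where "(y' has_real_derivative z) (at r)" "z + 2 / r * y' r = - 4 * pi * enthalpy_inv P (y r)"
    using y'_spec by blast
  then show ?thesis by (simp add: eq_diff_eq[symmetric])
qed

text \<open>Minus the mass inside radius r, as its derivative and its limit 0 at the centre
  show.\<close>

definition w where "w r = r\<^sup>2 * y' r" for r

lemma w_deriv: "r > 0 ==> (w has_real_derivative - 4 * pi * r\<^sup>2 * enthalpy_inv P (y r)) (at r)"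
proof -
  assume r: "r > 0"
  have "(w has_real_derivative r\<^sup>2 * (- 4 * pi * enthalpy_inv P (y r) - 2 / r * y' r) + 2 * r * y' r) (at r)"
    unfolding w_def by (auto intro!: derivative_eq_intros y'_deriv r)
  moreover have "r\<^sup>2 * (- 4 * pi * enthalpy_inv P (y r) - 2 / r * y' r) + 2 * r * y' r = - 4 * pi * r\<^sup>2 * enthalpy_inv P (y r)"
    using r by (simp add: power2_eq_square algebra_simps)
  ultimately show ?thesis by simp
qed

lemma enthalpy_inv_nonneg: "enthalpy_inv P s >= 0"
  using F_pos[of s] by (auto simp: enthalpy_inv_eq)

lemma w_antimono: "0 < r ==> r <= s ==> w s <= w r"
  by (rule DERIV_nonpos_imp_nonincreasing)
     (auto intro!: exI w_deriv simp: enthalpy_inv_nonneg)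

lemma y_bounded_near_0: obtains M where "!!r. 0 <= r ==> r <= 1 ==> \<bar>y r\<bar> <= M"
proof -
  have "compact (y ` {0..1})"
    by (rule compact_continuous_image[OF continuous_on_subset[OF continuous_y]]) auto
  then obtain M where "!!z. z \<in> y ` {0..1} ==> norm z <= M" using compact_imp_bounded bounded_iff by metis
  then show ?thesis by (intro that[of M]) force
qed

text \<open>A nonzero limit of \<open>r\<^sup>2 y'\<close> at the origin would make \<open>y\<close> unbounded.\<close>

lemma w_tendsto_0: "(w \<longlongrightarrow> 0) (at_right 0)"
proof -
  obtain M where M: "!!r. 0 <= r ==> r <= 1 ==> \<bar>y r\<bar> <= M" by (rule y_bounded_near_0) (rule that)
  \<comment> \<open>The sign \<sigma> lets one argument exclude a positive and a negative limit: y
    would behave like a multiple of 1 / r.\<close>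
  have key: False if l: "l > 0" and \<sigma>: "\<sigma> = 1 \<or> \<sigma> = -1" and r0: "0 < r0" "r0 <= 1" and b: "!!r. 0 < r ==> r <= r0 ==> l <= \<sigma> * w r" for l \<sigma> r0 :: real
  proof -
    \<comment> \<open>At e = l / C the term l / e equals C, which exceeds l / r0 by more than the
      oscillation 2 M of y.\<close>
    define C where "C = l / r0 + 2 * M + 1"
    have M0: "M >= 0" using M[of 0] by simp
    have C: "C > l / r0" using M0 by (simp add: C_def)
    have C0: "C > 0" using C l r0 by (smt (verit) divide_pos_pos)
    define e where "e = l / C"
    have e: "e > 0" "e < r0" using l C C0 r0 by (simp_all add: e_def field_simps)
    have "\<sigma> * y e + l / e <= \<sigma> * y r0 + l / r0"
    proof (rule DERIV_nonneg_imp_nondecreasing[of e r0])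
      show "e <= r0" using e by simp
      fix r assume r: "e <= r" "r <= r0"
      then have r1: "r > 0" using e by simp
      have "((%r. \<sigma> * y r + l / r) has_real_derivative \<sigma> * y' r - l / r\<^sup>2) (at r)"
        using r1 by (auto intro!: derivative_eq_intros y_deriv simp: power2_eq_square)
      moreover have "\<sigma> * y' r - l / r\<^sup>2 >= 0"
      proof -
        have "l / r\<^sup>2 <= \<sigma> * w r / r\<^sup>2" using b[OF r1 r(2)] by (rule divide_right_mono) simp
        then show ?thesis using r1 by (simp add: w_def)
      qed
      ultimately show "\<exists>d. ((%r. \<sigma> * y r + l / r) has_real_derivative d) (at r) & 0 <= d" by blast
    qed
    moreover have "\<bar>\<sigma> * y e\<bar> <= M" "\<bar>\<sigma> * y r0\<bar> <= M" using M[of e] M[of r0] \<sigma> e r0 by (auto simp: abs_mult)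
    moreover have "l / e = C" using l C0 by (simp add: e_def)
    ultimately show False unfolding C_def by linarith
  qed
  have neg: "w r <= 0" if r: "r > 0" for r
  proof (rule ccontr)
    assume "\<not> w r <= 0"
    then have "w (min r 1) > 0" using w_antimono[of "min r 1" r] r by (auto simp: min_def split: if_splits)
    then show False using w_antimono r by (intro key[of "w (min r 1)" 1 "min r 1"]) auto
  qed
  show ?thesis
  proof (rule tendstoI)
    fix e :: real assume e: "e > 0"
    have "\<exists>r>0. r <= 1 & - w r < e"
    proof (rule ccontr)
      assume "\<not> ?thesis"
      then have "e <= - 1 * w r" if "0 < r" "r <= 1" for r using that by force
      then show False using e by (intro key[of e "-1" 1]) auto
    qed
    then obtain r where r: "r > 0" "- w r < e" by blast
    have "\<forall>s\<in>{0<..<r}. dist (w s) 0 < e"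
    proof
      fix s assume s: "s \<in> {0<..<r}"
      then show "dist (w s) 0 < e" using w_antimono[of s r] neg[of s] r by (simp add: dist_real_def)
    qed
    then show "\<forall>\<^sub>F s in at_right 0. dist (w s) 0 < e"
      using r(1) eventually_at_right_less[of 0] by (auto simp: eventually_at_right_field)
  qed
qed

lemma w_le: "r > 0 ==> w r <= 0"
proof -
  assume r: "r > 0"
  have "\<forall>\<^sub>F s in at_right 0. w r <= w s"
    unfolding eventually_at_right_field using r by (intro exI[of _ r]) (auto intro: w_antimono)
  with w_tendsto_0 show ?thesis by (intro tendsto_lowerbound) auto
qed

lemma y0: "y 0 > 0"
proof -
  have "y 0 = enthalpy_deriv P \<mu>" using profile by (simp add: stellar_profile_def P_def)
  moreover have "1 < sqrt (1 + (root 3 (\<mu> / B))\<^sup>2)" using AB \<mu> by simp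
  ultimately show ?thesis using k \<mu> by (simp add: enthalpy_deriv_eq)
qed

text \<open>Near the centre y is positive, so w decreases strictly from a value <= 0; further out it
  is still nonincreasing.\<close>

lemma w_neg: "r > 0 ==> w r < 0"
proof -
  assume r: "r > 0"
  have "(y \<longlongrightarrow> y 0) (at 0 within {0..})" using continuous_y by (auto simp: continuous_on_def)
  from order_tendstoD(1)[OF this y0] obtain d where d: "d > 0" "!!s. 0 < s ==> s < d ==> y s > 0"
    by (auto simp: eventually_at dist_real_def)
  define s where "s = min r (d / 2)"
  have s: "0 < s" "s <= r" "s < d" using r d by (auto simp: s_def min_def)
  have "w s < w (s / 2)"
  proof (rule DERIV_neg_imp_decreasing[where f = w and a = "s / 2" and b = s])
    fix t assume "s / 2 <= t" "t <= s"
    then have t: "t > 0" "y t > 0" using s d by auto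
    then show "\<exists>z. (w has_real_derivative z) (at t) & z < 0"
      using w_deriv[OF t(1)] F_pos[OF t(2)] by (intro exI[of _ "- 4 * pi * t\<^sup>2 * enthalpy_inv P (y t)"]) (auto simp: enthalpy_inv_eq)
  qed (use s in simp)
  also have "\<dots> <= 0" using s by (intro w_le) simp
  finally show "w r < 0" using w_antimono[OF s(1,2)] by linarith
qed

lemma y'_neg: "r > 0 ==> y' r < 0"
  using w_neg[of r] by (simp add: w_def mult_less_0_iff)

lemma y_strict_antimono:
  assumes "0 <= r" "r < s" shows "y s < y r"
proof (rule DERIV_neg_imp_decreasing_open[OF assms(2)])
  show "\<exists>z. (y has_real_derivative z) (at t) & z < 0" if "r < t" "t < s" for t
    using that assms y_deriv[of t] y'_neg[of t] by auto
  show "continuous_on {r..s} y" using assms by (auto intro: continuous_on_subset[OF continuous_y])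
qed

lemma y_pos: "0 <= r ==> r < R ==> y r > 0"
  using y_strict_antimono[of r R] yR by simp

lemma y_le: "0 <= r ==> y r <= y 0"
  using y_strict_antimono[of 0 r] by (cases "r = 0") auto

lemma w_deriv_F: "0 < r ==> r < R ==> (w has_real_derivative - 4 * pi * r\<^sup>2 * F (y r)) (at r)"
  using w_deriv[of r] y_pos[of r] by (simp add: enthalpy_inv_eq)

lemma X_mono: "0 <= s ==> s <= t ==> X s <= X t"
  unfolding X_def c_def using k by (intro real_sqrt_le_mono diff_right_mono power_mono add_left_mono divide_right_mono) auto

lemma F_mono: "0 <= s ==> s <= t ==> F s <= F t"
  unfolding F_def using AB X_mono X(2) by (intro mult_left_mono power_mono) auto

lemma F'_mono: "0 <= s ==> s <= t ==> F' s <= F' t"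
  unfolding F'_def using AB k X_mono X(2) by (intro mult_left_mono mult_mono) (auto simp: c_def divide_right_mono)

text \<open>The enclosed mass is at most that of a homogeneous ball of central density.\<close>

lemma w_lower: "0 < r ==> r < R ==> - (4 * pi * F (y 0) / 3 * r ^ 3) <= w r"
proof -
  assume r: "0 < r" "r < R"
  let ?C = "4 * pi * F (y 0) / 3"
  have mono: "w s + ?C * s ^ 3 <= w r + ?C * r ^ 3" if s: "0 < s" "s <= r" for s
  proof (rule DERIV_nonneg_imp_nondecreasing[OF s(2)])
    fix t assume "s <= t" "t <= r"
    then have t: "0 < t" "t < R" using s r by auto
    have "((%t. w t + ?C * t ^ 3) has_real_derivative - 4 * pi * t\<^sup>2 * F (y t) + ?C * (3 * t\<^sup>2)) (at t)"
      by (auto intro!: derivative_eq_intros w_deriv_F t)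
    moreover have "- 4 * pi * t\<^sup>2 * F (y t) + ?C * (3 * t\<^sup>2) = 4 * pi * t\<^sup>2 * (F (y 0) - F (y t))"
      by (simp add: algebra_simps)
    moreover have "F (y t) <= F (y 0)" using t y_pos[of t] y_le[of t] by (intro F_mono) auto
    ultimately show "\<exists>z. ((%t. w t + ?C * t ^ 3) has_real_derivative z) (at t) & 0 <= z" by auto
  qed
  have "((%s. w s + ?C * s ^ 3) \<longlongrightarrow> 0 + ?C * 0 ^ 3) (at_right 0)"
    by (intro tendsto_intros w_tendsto_0)
  moreover have "\<forall>\<^sub>F s in at_right 0. w s + ?C * s ^ 3 <= w r + ?C * r ^ 3"
    unfolding eventually_at_right_field using r mono by (intro exI[of _ r]) auto
  ultimately have "0 + ?C * 0 ^ 3 <= w r + ?C * r ^ 3" by (intro tendsto_upperbound) auto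
  then show ?thesis by simp
qed

lemma y'_lower: "0 < r ==> r < R ==> - y' r <= 4 * pi * F (y 0) / 3 * r"
proof -
  assume r: "0 < r" "r < R"
  have "r\<^sup>2 * (- y' r) <= r\<^sup>2 * (4 * pi * F (y 0) / 3 * r)"
    using w_lower[OF r] by (simp add: w_def power2_eq_square power3_eq_cube algebra_simps)
  then show ?thesis using r by (simp only: mult_le_cancel_left_pos zero_less_power)
qed

text \<open>The quotient of y and R^2 - r^2 extends continuously to r = R with the value - y'(R) /
  (2 R), which is positive because y' does not vanish at the surface. Compactness of [0, R] gives
  both bounds.\<close>

lemma y_comparable: obtains a b where "a > 0" "!!x. x \<in> S ==> a * \<delta> x <= y (norm x)" "!!x. x \<in> S ==> y (norm x) <= b * \<delta> x" "b > 0"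
proof -
  define f where "f r = (if r = R then - y' R / (2 * R) else y r / (R\<^sup>2 - r\<^sup>2))" for r
  have Rr: "R\<^sup>2 - r\<^sup>2 = (R - r) * (R + r)" for r by (simp add: power2_eq_square algebra_simps)
  have pos: "R\<^sup>2 - r\<^sup>2 > 0" if "0 <= r" "r < R" for r unfolding Rr using that by simp
  have cont: "continuous_on {0..R} f"
  proof (rule continuous_on_eq_continuous_within[THEN iffD2], intro ballI)
    fix r assume r: "r \<in> {0..R}"
    show "continuous (at r within {0..R}) f"
    proof (cases "r = R")
      case False
      have "continuous (at r within {0..R}) (%r. y r / (R\<^sup>2 - r\<^sup>2))"
        using r False pos[of r] continuous_on_subset[OF continuous_y, of "{0..R}"]
        by (intro continuous_intros) (auto simp: continuous_on_eq_continuous_within)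
      moreover have "\<forall>\<^sub>F s in at r within {0..R}. f s = y s / (R\<^sup>2 - s\<^sup>2)"
        unfolding eventually_at_filter using t1_space_nhds[OF False] by (rule eventually_mono) (simp add: f_def)
      ultimately show ?thesis
        unfolding continuous_within using False by (subst tendsto_cong) (auto simp: f_def)
    next
      case True
      have "((%s. (y s - y R) / (s - R)) \<longlongrightarrow> y' R) (at R)"
        using y_deriv[OF R] by (simp add: has_field_derivative_iff)
      then have "((%s. - ((y s - y R) / (s - R)) / (R + s)) \<longlongrightarrow> - y' R / (R + R)) (at R within {0..R})"
        using R by (intro tendsto_intros) (auto intro: tendsto_within_subset)
      moreover have "\<forall>\<^sub>F s in at R within {0..R}. - ((y s - y R) / (s - R)) / (R + s) = f s"
        unfolding eventually_at_filter
      proof (intro always_eventually allI impI)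
        fix s assume "s ~= R" "s \<in> {0..R}"
        then have "R - s ~= 0" "R + s ~= 0" using R by auto
        have "- ((y s - y R) / (s - R)) = y s / (R - s)" using yR by (simp add: minus_divide_right)
        then show "- ((y s - y R) / (s - R)) / (R + s) = f s" using \<open>s ~= R\<close> by (simp add: f_def Rr)
      qed
      ultimately have "(f \<longlongrightarrow> - y' R / (R + R)) (at R within {0..R})" by (rule Lim_transform_eventually)
      then show ?thesis unfolding continuous_within True by (simp add: f_def)
    qed
  qed
  have fpos: "f r > 0" if "r \<in> {0..R}" for r
    using that y'_neg[OF R] R y_pos[of r] pos[of r] by (cases "r = R") (auto simp: f_def intro: divide_pos_pos divide_neg_pos)
  obtain r0 where r0: "r0 \<in> {0..R}" "!!r. r \<in> {0..R} ==> f r0 <= f r"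
    using continuous_attains_inf[OF compact_Icc _ cont] R by auto
  obtain r1 where r1: "r1 \<in> {0..R}" "!!r. r \<in> {0..R} ==> f r <= f r1"
    using continuous_attains_sup[OF compact_Icc _ cont] R by auto
  have fx: "f (norm x) * \<delta> x = y (norm x)" if "x \<in> S" for x
    using that \<delta>_pos[OF that] by (auto simp: f_def \<delta>_def)
  show ?thesis
  proof (rule that[of "f r0" "f r1"])
    show "f r0 > 0" "f r1 > 0" using fpos r0 r1 by auto
    fix x assume x: "x \<in> S"
    then have n: "norm x \<in> {0..R}" by simp
    show "f r0 * \<delta> x <= y (norm x)" "y (norm x) <= f r1 * \<delta> x"
      using mult_right_mono[OF r0(2)[OF n] less_imp_le[OF \<delta>_pos[OF x]]]
        mult_right_mono[OF r1(2)[OF n] less_imp_le[OF \<delta>_pos[OF x]]] unfolding fx[OF x] by auto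
  qed
qed

end

section \<open>The linearized operator at a white dwarf\<close>

context white_dwarf begin

definition dens :: "real^3 => real" where "dens = stellar_density P y R"
definition \<phi> :: "real^3 => real" where "\<phi> x = F' (y (norm x))"
definition \<alpha> :: "real^3 => real" where "\<alpha> x = enthalpy_deriv2 P (dens x)"

lemma dens_eq: "x \<in> S ==> dens x = F (y (norm x))"
  using y_pos[of "norm x"] by (simp add: dens_def stellar_density_def enthalpy_inv_eq)

lemma dens_0: "x \<notin> S ==> dens x = 0" by (simp add: dens_def stellar_density_def)

lemma \<phi>_pos: "x \<in> S ==> \<phi> x > 0" using y_pos[of "norm x"] by (simp add: \<phi>_def F'_pos)

lemma dens_pos: "x \<in> S ==> dens x > 0" using y_pos[of "norm x"] by (simp add: dens_eq F_pos)

lemma \<alpha>_eq: "x \<in> S ==> \<alpha> x = 1 / \<phi> x"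
  using y_pos[of "norm x"] by (simp add: \<alpha>_def \<phi>_def dens_eq enthalpy_deriv2_eq)

lemma \<alpha>_pos: "x \<in> S ==> \<alpha> x > 0" using \<phi>_pos by (simp add: \<alpha>_eq)

lemma \<phi>_le: "\<phi> x <= F' (y 0)" if "x \<in> S" for x
  unfolding \<phi>_def using that y_pos[of "norm x"] y_le[of "norm x"] by (intro F'_mono) auto

lemma continuous_y_norm: "continuous_on UNIV (%x::real^3. y (norm x))"
  by (rule continuous_on_compose2[OF continuous_y continuous_on_norm_id]) auto

lemma y_norm_measurable: "(%x::real^3. y (norm x)) \<in> borel_measurable borel"
  by (rule borel_measurable_continuous_onI[OF continuous_y_norm])

lemma \<phi>_measurable: "\<phi> \<in> borel_measurable borel"
  unfolding \<phi>_def using measurable_compose[OF y_norm_measurable F_measurable(2)] by simp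

lemma dens_measurable: "dens \<in> borel_measurable borel"
proof -
  have "dens = (%x. indicator S x * F (y (norm x)))"
    using dens_eq dens_0 by (auto simp: fun_eq_iff indicator_def)
  moreover have "(%x. indicator S x * F (y (norm x))) \<in> borel_measurable borel"
    using measurable_compose[OF y_norm_measurable F_measurable(1)]
    by (intro borel_measurable_times borel_measurable_indicator) simp_all
  ultimately show ?thesis by simp
qed

text \<open>Since (X s)^2 = (2 + s / k) (s / k) and y is comparable to \<delta>, X behaves like
  \<surd>\<delta>. Hence F, cubic in X, behaves like \<delta> \<surd>\<delta>, and F', which is c X
  up to a constant, like \<surd>\<delta>. These are the hypotheses of the adjointness
  theorem.\<close>

lemma weight_bounds:
  obtains c0 C0 where "c0 > 0" "!!x. x \<in> S ==> c0 <= \<alpha> x" "!!x. x \<in> S ==> c0 * sqrt (\<delta> x) <= 1 / \<alpha> x"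
    "!!x. x \<in> S ==> c0 * (\<delta> x * sqrt (\<delta> x)) <= dens x" "!!x. x \<in> S ==> dens x <= C0 * (\<delta> x * sqrt (\<delta> x))"
proof -
  obtain a b where ab: "a > 0" "!!x. x \<in> S ==> a * \<delta> x <= y (norm x)" "!!x. x \<in> S ==> y (norm x) <= b * \<delta> x" "b > 0"
    by (rule y_comparable) (rule that)
  define a' where "a' = a / k"
  define b' where "b' = (2 + y 0 / k) * b / k"
  have a'0: "a' > 0" using ab k by (simp add: a'_def)
  have b'0: "b' > 0" using ab k y0 by (simp add: b'_def add_pos_pos)
  have X2: "a' * \<delta> x <= (X (y (norm x)))\<^sup>2 & (X (y (norm x)))\<^sup>2 <= b' * \<delta> x" if x: "x \<in> S" for x
  proof -
    define s where "s = y (norm x)"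
    have s: "s > 0" "s <= y 0" using y_pos[of "norm x"] y_le[of "norm x"] x by (simp_all add: s_def)
    have e: "(X s)\<^sup>2 = (2 + s / k) * (s / k)" using X(3)[of s] s k by (simp add: c_def power2_eq_square algebra_simps)
    have "a' * \<delta> x <= s / k" using ab(2)[OF x] k by (simp add: a'_def s_def divide_right_mono)
    also have "\<dots> <= (2 + s / k) * (s / k)" using s k mult_right_mono[of 1 "2 + s / k" "s / k"] by simp
    finally have 1: "a' * \<delta> x <= (X s)\<^sup>2" by (simp only: e)
    have "(2 + s / k) * (s / k) <= (2 + y 0 / k) * (b * \<delta> x / k)"
      using s k ab(3)[OF x] by (intro mult_mono add_left_mono divide_right_mono) (auto simp: s_def)
    also have "\<dots> = b' * \<delta> x" by (simp add: b'_def)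
    finally show ?thesis using 1 by (simp only: e s_def[symmetric])
  qed
  have X1: "sqrt a' * sqrt (\<delta> x) <= X (y (norm x))" "X (y (norm x)) <= sqrt b' * sqrt (\<delta> x)" if x: "x \<in> S" for x
  proof -
    have X0: "X (y (norm x)) >= 0" using y_pos[of "norm x"] x by (intro X(2)) simp
    show "sqrt a' * sqrt (\<delta> x) <= X (y (norm x))"
      unfolding real_sqrt_mult[symmetric] using X2[OF x] X0 by (intro real_le_lsqrt) auto
    show "X (y (norm x)) <= sqrt b' * sqrt (\<delta> x)"
      unfolding real_sqrt_mult[symmetric] using X2[OF x] by (intro real_le_rsqrt) auto
  qed
  define c0 where "c0 = min (1 / F' (y 0)) (min (3 * B / k * sqrt a') (B * (a' * sqrt a')))"
  have c0: "c0 > 0" using F'_pos[OF y0] AB k a'0 by (simp add: c0_def)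
  have cl: "c0 <= 1 / F' (y 0)" "c0 <= 3 * B / k * sqrt a'" "c0 <= B * (a' * sqrt a')"
    unfolding c0_def by linarith+
  show ?thesis
  proof (rule that[OF c0])
    fix x assume x: "x \<in> S"
    have d: "\<delta> x > 0" by (rule \<delta>_pos[OF x])
    have yp: "y (norm x) > 0" using y_pos[of "norm x"] x by simp
    have X0: "X (y (norm x)) >= 0" using yp by (intro X(2)) simp
    have "1 / F' (y 0) <= 1 / \<phi> x" using \<phi>_le[OF x] \<phi>_pos[OF x] by (intro divide_left_mono mult_pos_pos) auto
    then show "c0 <= \<alpha> x" using cl(1) by (simp only: \<alpha>_eq[OF x])
    have "c0 * sqrt (\<delta> x) <= 3 * B / k * sqrt a' * sqrt (\<delta> x)" using cl(2) d by (intro mult_right_mono) auto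
    also have "\<dots> = 3 * B / k * (1 * (sqrt a' * sqrt (\<delta> x)))" by simp
    also have "\<dots> <= 3 * B / k * (c (y (norm x)) * X (y (norm x)))"
      using AB k X1(1)[OF x] c[OF yp] a'0 d by (intro mult_left_mono mult_mono) auto
    finally show "c0 * sqrt (\<delta> x) <= 1 / \<alpha> x" using \<alpha>_eq[OF x] by (simp add: \<phi>_def F'_def)
    have XX: "X (y (norm x)) ^ 3 = (X (y (norm x)))\<^sup>2 * X (y (norm x))" by (simp add: power2_eq_square power3_eq_cube)
    have "c0 * (\<delta> x * sqrt (\<delta> x)) <= B * (a' * sqrt a') * (\<delta> x * sqrt (\<delta> x))" using cl(3) d by (intro mult_right_mono) auto
    also have "\<dots> = B * ((a' * \<delta> x) * (sqrt a' * sqrt (\<delta> x)))" by simp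
    also have "\<dots> <= B * ((X (y (norm x)))\<^sup>2 * X (y (norm x)))"
      using AB X1(1)[OF x] X2[OF x] a'0 d by (intro mult_left_mono mult_mono) auto
    finally show "c0 * (\<delta> x * sqrt (\<delta> x)) <= dens x" by (simp only: dens_eq[OF x] F_def XX)
    have "B * ((X (y (norm x)))\<^sup>2 * X (y (norm x))) <= B * ((b' * \<delta> x) * (sqrt b' * sqrt (\<delta> x)))"
      using AB X1(2)[OF x] X2[OF x] b'0 d X0 by (intro mult_left_mono mult_mono) auto
    also have "\<dots> = B * b' * sqrt b' * (\<delta> x * sqrt (\<delta> x))" by simp
    finally show "dens x <= B * b' * sqrt b' * (\<delta> x * sqrt (\<delta> x))" by (simp only: dens_eq[OF x] F_def XX)
  qed
qed

lemma dens_set_measurable: "set_borel_measurable lborel S dens"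
  unfolding set_borel_measurable_def real_scaleR_def
  by (intro borel_measurable_times borel_measurable_indicator) (simp_all add: dens_measurable)

section \<open>Eigenvectors and their energy\<close>

definition eigenpair :: "complex => (real^3 => complex) => (real^3 => complex^3) => bool" where
  "eigenpair z \<sigma> v \<longleftrightarrow> \<sigma> \<in> weighted_L2 S \<alpha> & v \<in> weighted_L2 S dens \<and>
     A_op dens v \<in> weighted_L2 S (%x. 1 / dens x) & (%x. z * \<sigma> x) \<in> weighted_L2 S \<alpha> \<and>
     has_weak_divergence S (A_op dens v) (%x. - (z * \<sigma> x)) \<and>
     L_op P S dens \<sigma> \<in> weighted_L2 S (%x. 1 / \<alpha> x) & (%x. - (z *s v x)) \<in> weighted_L2 S dens \<and>
     has_weak_gradient S (L_op P S dens \<sigma>) (%x. - (z *s v x))"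

lemma eigenpair_iff: "JL_graph P S dens p (state_scale z p) \<longleftrightarrow> eigenpair z (fst p) (snd p)"
  by (simp add: JL_graph_def J_graph_def B_graph_def B'_graph_def eigenpair_def state_scale_def
      X_space_def Y_space_def X_dual_def Y_dual_def \<alpha>_def[abs_def])

lemma weighted_L2_cnj:
  fixes u :: "real^3 => complex"
  assumes "u \<in> weighted_L2 S q" shows "(%x. cnj (u x)) \<in> weighted_L2 S q"
proof -
  have "(%x. cnj (indicator S x *\<^sub>R u x)) \<in> borel_measurable lborel"
    using assms by (intro borel_measurable_continuous_on[of cnj] continuous_intros)
      (simp add: weighted_L2_def set_borel_measurable_def)
  then show ?thesis using assms by (simp add: weighted_L2_def set_borel_measurable_def)
qed

lemma bounded_linear_cnj_vec: "bounded_linear (%v. (\<chi> i. cnj (v $ i)) :: complex^3)"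
  unfolding linear_conv_bounded_linear[symmetric] by (intro linearI) (auto simp: vec_eq_iff)

lemma norm_cnj_vec: "norm ((\<chi> i. cnj (v $ i)) :: complex^3) = norm v"
  by (simp add: norm_vec_def)

lemma cnj_vec_scaleR: "(\<chi> i. cnj ((a *\<^sub>R v) $ i)) = a *\<^sub>R ((\<chi> i. cnj (v $ i)) :: complex^3)"
  by (simp add: vec_eq_iff)

lemma weighted_L2_cnj_vec:
  fixes u :: "real^3 => complex^3"
  assumes "u \<in> weighted_L2 S q" shows "(%x. \<chi> i. cnj (u x $ i)) \<in> weighted_L2 S q"
proof -
  have "(%x. (\<chi> i. cnj ((indicator S x *\<^sub>R u x) $ i)) :: complex^3) \<in> borel_measurable lborel"
    using assms by (intro borel_measurable_continuous_on[OF linear_continuous_on[OF bounded_linear_cnj_vec]])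
      (simp add: weighted_L2_def set_borel_measurable_def)
  then show ?thesis using assms
    unfolding weighted_L2_def set_borel_measurable_def cnj_vec_scaleR by (simp only: norm_cnj_vec mem_Collect_eq)
qed

lemma has_weak_gradient_cnj_vec:
  assumes "has_weak_gradient S h g"
  shows "has_weak_gradient S (%x. cnj (h x)) (%x. \<chi> i. cnj (g x $ i))"
  unfolding has_weak_gradient_def locally_integrable_def
proof (intro conjI allI impI ballI)
  fix K assume K: "compact K & K \<subseteq> S"
  then have h: "integrable lborel (%x. indicator K x *\<^sub>R h x)" and g: "integrable lborel (%x. indicator K x *\<^sub>R g x)"
    using assms by (auto simp: has_weak_gradient_def locally_integrable_def set_integrable_def)
  show "set_integrable lborel K (%x. cnj (h x))"
    using integrable_bounded_linear[OF bounded_linear_cnj h] by (simp add: set_integrable_def)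
  show "set_integrable lborel K (%x. (\<chi> i. cnj (g x $ i)) :: complex^3)"
    using integrable_bounded_linear[OF bounded_linear_cnj_vec g] unfolding set_integrable_def cnj_vec_scaleR .
qed (use has_weak_gradient_cnj[OF assms] in simp)

lemma adjoint:
  assumes "u \<in> weighted_L2 S (%x. 1 / dens x)" "t \<in> weighted_L2 S \<alpha>" "has_weak_divergence S u (%x. - t x)"
    and "h \<in> weighted_L2 S (%x. 1 / \<alpha> x)" "g \<in> weighted_L2 S dens" "has_weak_gradient S h g"
  shows "(LINT x:S|lborel. t x * h x) = (LINT x:S|lborel. (\<Sum>i\<in>UNIV. u x $ i * g x $ i))"
proof -
  obtain c0 C0 where c: "c0 > 0" "!!x. x \<in> S ==> c0 <= \<alpha> x" "!!x. x \<in> S ==> c0 * sqrt (\<delta> x) <= 1 / \<alpha> x"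
    "!!x. x \<in> S ==> c0 * (\<delta> x * sqrt (\<delta> x)) <= dens x" "!!x. x \<in> S ==> dens x <= C0 * (\<delta> x * sqrt (\<delta> x))"
    by (rule weight_bounds) (rule that)
  show ?thesis by (rule weak_gradient_divergence_adjoint[OF c dens_set_measurable assms])
qed

definition kinetic :: "(real^3 => complex^3) => real" where
  "kinetic v = (LINT x:S|lborel. dens x * (norm (v x))\<^sup>2)"

lemma kinetic_nonneg: "kinetic v >= 0"
  unfolding kinetic_def set_lebesgue_integral_def
  by (rule integral_nonneg_AE, rule AE_I2) (use dens_pos in \<open>force simp: indicator_def less_imp_le\<close>)

text \<open>Adjointness is available for the bilinear pairing, so it is applied to the conjugate of
  L \<sigma>, whose gradient is the conjugate of - z v; this is the source of the factor - cnj
  z.\<close>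

lemma energy_identity:
  assumes e: "eigenpair z \<sigma> v"
  shows "z * (LINT x:S|lborel. \<sigma> x * cnj (L_op P S dens \<sigma> x)) = - cnj z * complex_of_real (kinetic v)"
proof -
  let ?h = "%x. cnj (L_op P S dens \<sigma> x)" and ?g = "%x. (\<chi> i. cnj ((- (z *s v x)) $ i)) :: complex^3"
  have "(LINT x:S|lborel. z * \<sigma> x * ?h x) = (LINT x:S|lborel. (\<Sum>i\<in>UNIV. A_op dens v x $ i * ?g x $ i))"
    using e weighted_L2_cnj weighted_L2_cnj_vec has_weak_gradient_cnj_vec
    unfolding eigenpair_def by (intro adjoint) blast+
  moreover have "(LINT x:S|lborel. z * \<sigma> x * ?h x) = z * (LINT x:S|lborel. \<sigma> x * ?h x)"
    by (simp only: mult.assoc set_integral_mult_right)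
  moreover have "(\<Sum>i\<in>UNIV. A_op dens v x $ i * ?g x $ i) = - cnj z * complex_of_real (dens x * (norm (v x))\<^sup>2)" for x
  proof -
    have "A_op dens v x $ i * ?g x $ i = - cnj z * complex_of_real (dens x * (norm (v x $ i))\<^sup>2)" for i
    proof -
      have "A_op dens v x $ i = complex_of_real (dens x) * v x $ i"
        unfolding A_op_def vector_scaleR_component by (rule scaleR_conv_of_real)
      moreover have "?g x $ i = - cnj z * cnj (v x $ i)" by simp
      ultimately have "A_op dens v x $ i * ?g x $ i = - cnj z * (complex_of_real (dens x) * (v x $ i * cnj (v x $ i)))"
        by (simp only: mult_ac)
      then show ?thesis by (simp only: complex_norm_square of_real_mult)
    qed
    then have "(\<Sum>i\<in>UNIV. A_op dens v x $ i * ?g x $ i) = (\<Sum>i\<in>UNIV. - cnj z * complex_of_real (dens x * (norm (v x $ i))\<^sup>2))"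
      by (intro sum.cong refl)
    then show ?thesis unfolding norm_sq_vec sum_distrib_left of_real_sum .
  qed
  ultimately show ?thesis unfolding kinetic_def
    by (simp only: set_integral_mult_right set_integral_complex_of_real)
qed

text \<open>Places the constant function in the dual space, where it can be paired with a
  divergence.\<close>

lemma \<alpha>_inverse_integrable: "(%x. 1 :: complex) \<in> weighted_L2 S (%x. 1 / \<alpha> x)"
proof -
  have [measurable]: "\<phi> \<in> borel_measurable borel" by (rule \<phi>_measurable)
  have fS: "integrable lborel (%x. indicator S x * F' (y 0))"
    using emeasure_lborel_ball_finite[of "0 :: real^3" R] by (intro integrable_mult_left integrable_real_indicator) auto
  have "integrable lborel (%x. indicator S x * \<phi> x)"
  proof (rule Bochner_Integration.integrable_bound[OF fS])
    show "(%x. indicator S x * \<phi> x) \<in> borel_measurable lborel"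
      by (intro borel_measurable_times borel_measurable_indicator) (simp_all add: \<phi>_measurable)
    have "norm (indicator S x * \<phi> x) <= norm (indicator S x * F' (y 0))" for x
      using \<phi>_le[of x] \<phi>_pos[of x] by (auto simp: indicator_def)
    then show "AE x in lborel. norm (indicator S x * \<phi> x) <= norm (indicator S x * F' (y 0))" by simp
  qed
  moreover have "(%x. indicator S x *\<^sub>R (1 / \<alpha> x * (norm (1::complex))\<^sup>2)) = (%x. indicator S x * \<phi> x)"
    using \<alpha>_eq by (auto simp: indicator_def fun_eq_iff)
  ultimately have i: "integrable lborel (%x. indicator S x *\<^sub>R (1 / \<alpha> x * (norm (1::complex))\<^sup>2))" by (simp only:)
  have "(%x. indicator S x *\<^sub>R (1 :: complex)) \<in> borel_measurable lborel"
    by (intro borel_measurable_scaleR borel_measurable_indicator) simp_all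
  with i show ?thesis unfolding weighted_L2_def set_borel_measurable_def set_integrable_def mem_Collect_eq by (intro conjI)
qed

text \<open>Difference quotients integrate to zero by translation invariance; they are bounded by
  the mean value theorem and supported in a ball of radius R + 1, so dominated convergence
  applies.\<close>

lemma integral_partial_eq_0:
  assumes \<psi>: "\<psi> \<in> test_functions S"
  shows "(\<integral>x. partial i \<psi> x \<partial>lborel) = 0"
proof -
  obtain K where K: "smooth \<psi>" "compact K" "K \<subseteq> S" "!!x. x \<notin> K ==> \<psi> x = 0"
    by (rule test_functionsE[OF \<psi>]) (rule that)
  obtain M where M: "!!x. \<bar>partial i \<psi> x\<bar> <= M"
    by (rule test_functions_bounded[OF test_functions_partial[OF \<psi>]]) (rule that)
  have M0: "M >= 0" using M[of 0] by linarith
  define e :: "real^3" where "e = axis i 1"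
  have ne: "norm e = 1" by (simp add: e_def)
  have line: "((%t. \<psi> (x + t *\<^sub>R e)) has_real_derivative partial i \<psi> (x + t *\<^sub>R e)) (at t)" for x t
  proof -
    have "((%t. x + t *\<^sub>R e) has_derivative (%h. h *\<^sub>R e)) (at t)" by (auto intro!: derivative_eq_intros)
    from has_derivative_compose[OF this smooth_has_derivative[OF K(1)]]
    have "((%t. \<psi> (x + t *\<^sub>R e)) has_derivative (%h. (\<chi> j. partial j \<psi> (x + t *\<^sub>R e)) \<bullet> (h *\<^sub>R e))) (at t)" .
    moreover have "(\<chi> j. partial j \<psi> (x + t *\<^sub>R e)) \<bullet> (h *\<^sub>R e) = partial i \<psi> (x + t *\<^sub>R e) * h" for h
    proof -
      have "(\<chi> j. partial j \<psi> p) \<bullet> e = partial i \<psi> p" for p by (simp add: e_def inner_axis)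
      then show ?thesis by (simp only: inner_scaleR_right mult.commute)
    qed
    ultimately show ?thesis by (simp only: has_field_derivative_def)
  qed
  define r where "r n = inverse (real (Suc n))" for n
  have r: "r n > 0" "r n <= 1" for n by (auto simp: r_def field_simps)
  have rl: "r \<longlonglongrightarrow> 0" unfolding r_def by (rule LIMSEQ_inverse_real_of_nat)
  define q where "q n x = (\<psi> (r n *\<^sub>R e + x) - \<psi> x) / r n" for n x
  have ps: "\<psi> \<in> borel_measurable borel" by (rule test_functions_measurable[OF \<psi>])
  obtain N where N: "!!x. \<bar>\<psi> x\<bar> <= N" by (rule test_functions_bounded[OF \<psi>]) (rule that)
  have fin: "integrable lborel (%x::real^3. indicator (cball 0 (R + 1)) x * C :: real)" for C
    using emeasure_lborel_cball_finite[of "0 :: real^3" "R + 1"]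
    by (intro integrable_mult_left integrable_real_indicator) simp_all
  have N0: "N >= 0" using N[of 0] by linarith
  have out: "\<psi> x = 0" if "norm x > R" for x using K(3,4) that by force
  have ip: "integrable lborel \<psi>"
  proof (rule Bochner_Integration.integrable_bound[OF fin[of N]])
    have "norm (\<psi> x) <= norm (indicator (cball 0 (R + 1)) x * N)" for x
      using N[of x] out[of x] N0 by (cases "norm x > R") (auto simp: indicator_def)
    then show "AE x in lborel. norm (\<psi> x) <= norm (indicator (cball 0 (R + 1)) x * N)" by simp
  qed (use ps in simp)
  have q0: "(\<integral>x. q n x \<partial>lborel) = 0" for n
    unfolding q_def using ip integrable_translate[OF ip, of "r n *\<^sub>R e"] integral_translate[OF ps, of "r n *\<^sub>R e"] by simp
  have qb: "\<bar>q n x\<bar> <= indicator (cball 0 (R + 1)) x * M" for n x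
  proof (cases "norm x <= R + 1")
    case True
    obtain \<xi> where "\<psi> (x + r n *\<^sub>R e) - \<psi> (x + 0 *\<^sub>R e) = (r n - 0) * partial i \<psi> (x + \<xi> *\<^sub>R e)"
      using MVT2[of 0 "r n" "%t. \<psi> (x + t *\<^sub>R e)" "%t. partial i \<psi> (x + t *\<^sub>R e)"] r(1) line by blast
    then have "q n x = partial i \<psi> (x + \<xi> *\<^sub>R e)" using r(1)[of n] by (simp add: q_def add.commute)
    then show ?thesis using M True by simp
  next
    case False
    have "norm (r n *\<^sub>R e) <= 1" using r[of n] ne by simp
    then have "norm (r n *\<^sub>R e + x) > R" using False norm_triangle_ineq4[of "r n *\<^sub>R e + x" "r n *\<^sub>R e"] by simp
    then show ?thesis using False out M0 R by (simp add: q_def)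
  qed
  have "(%n. \<integral>x. q n x \<partial>lborel) \<longlonglongrightarrow> (\<integral>x. partial i \<psi> x \<partial>lborel)"
  proof (rule integral_dominated_convergence[OF _ _ fin[of M]])
    show "partial i \<psi> \<in> borel_measurable lborel"
      using test_functions_measurable[OF test_functions_partial[OF \<psi>]] by simp
    show "q n \<in> borel_measurable lborel" for n
      unfolding q_def using ip integrable_translate[OF ip, of "r n *\<^sub>R e"] by simp
    have "(%n. q n x) \<longlonglongrightarrow> partial i \<psi> x" for x
    proof -
      have "((%h. (\<psi> (x + h *\<^sub>R e) - \<psi> x) / h) \<longlongrightarrow> partial i \<psi> x) (at 0)"
        using line[of x 0] by (simp add: DERIV_def)
      moreover have "filterlim r (at 0) sequentially"
        using rl r(1) by (auto simp: filterlim_at intro!: always_eventually less_imp_neq[symmetric])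
      ultimately show ?thesis unfolding q_def add.commute[of _ x] by (rule filterlim_compose)
    qed
    then show "AE x in lborel. (%n. q n x) \<longlonglongrightarrow> partial i \<psi> x" by simp
    show "AE x in lborel. norm (q n x) <= indicator (cball 0 (R + 1)) x * M" for n using qb by simp
  qed
  then show ?thesis unfolding q0 by (simp add: LIMSEQ_const_iff)
qed

lemma constant_weak_gradient: "has_weak_gradient S (%x. 1) (%x. 0)"
  unfolding has_weak_gradient_def locally_integrable_def
proof (intro conjI allI impI ballI)
  fix K :: "(real^3) set" assume "compact K & K \<subseteq> S"
  then have "emeasure lborel K < \<infinity>" "K \<in> sets borel" using emeasure_compact_finite[of K] borel_compact[of K] by auto
  then have "integrable lborel (%x. complex_of_real (indicator K x))" by (intro integrable_of_real integrable_real_indicator) (auto simp: infinity_ennreal_def)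
  then show "set_integrable lborel K (%x. 1 :: complex)" by (simp add: set_integrable_def scaleR_conv_of_real)
  show "set_integrable lborel K (%x. 0 :: complex^3)" by (simp add: set_integrable_def)
next
  fix \<psi> i assume \<psi>: "\<psi> \<in> test_functions S"
  obtain K where K: "K \<subseteq> S" "!!x i. x \<notin> K ==> partial i \<psi> x = 0" by (rule test_functionsE[OF \<psi>]) (rule that)
  have "(LINT x:S|lborel. 1 * complex_of_real (partial i \<psi> x)) = complex_of_real (LINT x:S|lborel. partial i \<psi> x)"
    by (simp only: mult_1 set_integral_complex_of_real)
  also have "(LINT x:S|lborel. partial i \<psi> x) = (\<integral>x. partial i \<psi> x \<partial>lborel)"
    unfolding set_lebesgue_integral_def
  proof (intro Bochner_Integration.integral_cong refl)
    show "indicator S x *\<^sub>R partial i \<psi> x = partial i \<psi> x" for x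
      using K(1) K(2)[of x i] by force
  qed
  finally show "(LINT x:S|lborel. 1 * complex_of_real (partial i \<psi> x)) = - (LINT x:S|lborel. (0 :: complex^3) $ i * complex_of_real (\<psi> x))"
    using integral_partial_eq_0[OF \<psi>] by (simp add: set_lebesgue_integral_def)
qed

text \<open>Adjointness with the function 1 and its gradient 0.\<close>

lemma mean_zero:
  assumes e: "eigenpair z \<sigma> v" and z: "z ~= 0"
  shows "(LINT x:S|lborel. \<sigma> x) = 0"
proof -
  have "(%x. 0 :: complex^3) \<in> weighted_L2 S dens"
    by (simp add: weighted_L2_def set_borel_measurable_def set_integrable_def)
  then have "(LINT x:S|lborel. z * \<sigma> x * 1) = (LINT x:S|lborel. (\<Sum>i\<in>UNIV. A_op dens v x $ i * (0 :: complex^3) $ i))"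
    using e unfolding eigenpair_def by (intro adjoint \<alpha>_inverse_integrable constant_weak_gradient) blast+
  then have "z * (LINT x:S|lborel. \<sigma> x) = 0" by (simp add: set_lebesgue_integral_def)
  then show ?thesis using z by simp
qed

lemma weighted_L2_locally: "\<sigma> \<in> weighted_L2 S \<alpha> ==> locally_L2 S \<sigma>" for \<sigma> :: "real^3 => complex"
proof -
  assume s: "\<sigma> \<in> weighted_L2 S \<alpha>"
  obtain c0 where c: "c0 > 0" "!!x. x \<in> S ==> c0 <= \<alpha> x" by (rule weight_bounds) (rule that)
  show ?thesis
  proof (rule weighted_L2_locally_L2[OF s])
    fix K assume "K \<subseteq> S"
    then have "\<forall>x\<in>K. c0 <= \<alpha> x" using c(2) by (simp add: subset_iff)
    then show "\<exists>c>0. \<forall>x\<in>K. c <= \<alpha> x" using c(1) by (intro exI[of _ c0]) simp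
  qed
qed

text \<open>The real part of the energy identity reads Re z (q + kinetic energy) = 0 with both
  summands nonnegative, so the velocity vanishes. Then z \<sigma>, a weak divergence of zero,
  vanishes too; strict positivity of the energy is not at issue.\<close>

lemma eigenpair_trivial:
  assumes e: "eigenpair z \<sigma> v" and z: "Re z > 0"
    and I: "(LINT x:S|lborel. \<sigma> x * cnj (L_op P S dens \<sigma> x)) = complex_of_real q" "q >= 0"
  shows "AE x in lborel. x \<in> S --> \<sigma> x = 0" "AE x in lborel. x \<in> S --> v x = 0"
proof -
  have "Re (z * complex_of_real q) = Re (- cnj z * complex_of_real (kinetic v))"
    using energy_identity[OF e] unfolding I(1) by simp
  then have "Re z * (q + kinetic v) = 0" by (simp add: algebra_simps)
  then have N: "kinetic v = 0" using z I(2) kinetic_nonneg[of v] by simp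
  have "integrable lborel (%x. indicator S x *\<^sub>R (dens x * (norm (v x))\<^sup>2))"
    using e by (simp add: eigenpair_def weighted_L2_def set_integrable_def)
  moreover have "AE x in lborel. 0 <= indicator S x *\<^sub>R (dens x * (norm (v x))\<^sup>2)"
    using dens_pos by (intro AE_I2) (force simp: indicator_def less_imp_le)
  ultimately have "AE x in lborel. indicator S x *\<^sub>R (dens x * (norm (v x))\<^sup>2) = 0"
    using N integral_nonneg_eq_0_iff_AE unfolding kinetic_def set_lebesgue_integral_def by blast
  then show v0: "AE x in lborel. x \<in> S --> v x = 0"
  proof (rule AE_mp, intro AE_I2 impI)
    fix x assume "indicator S x *\<^sub>R (dens x * (norm (v x))\<^sup>2) = 0" "x \<in> S"
    then show "v x = 0" using dens_pos[of x] by simp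
  qed
  have zero: "(LINT x:S|lborel. \<sigma> x * complex_of_real (\<psi> x)) = 0" if "\<psi> \<in> test_functions S" for \<psi>
  proof -
    have "(LINT x:S|lborel. (\<Sum>i\<in>UNIV. A_op dens v x $ i * complex_of_real (partial i \<psi> x))) = 0"
      unfolding set_lebesgue_integral_def
    proof (rule integral_eq_zero_AE)
      show "AE x in lborel. indicator S x *\<^sub>R (\<Sum>i\<in>UNIV. A_op dens v x $ i * complex_of_real (partial i \<psi> x)) = 0"
        using v0 by (rule AE_mp) (intro AE_I2 impI, simp add: A_op_def indicator_def)
    qed
    moreover have "(LINT x:S|lborel. (\<Sum>i\<in>UNIV. A_op dens v x $ i * complex_of_real (partial i \<psi> x)))
        = - (LINT x:S|lborel. - (z * \<sigma> x) * complex_of_real (\<psi> x))"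
      using e that unfolding eigenpair_def has_weak_divergence_def by blast
    moreover have "(LINT x:S|lborel. - (z * \<sigma> x) * complex_of_real (\<psi> x)) = - z * (LINT x:S|lborel. \<sigma> x * complex_of_real (\<psi> x))"
      unfolding set_integral_mult_right[symmetric] by (simp only: mult.assoc minus_mult_left)
    ultimately have "z * (LINT x:S|lborel. \<sigma> x * complex_of_real (\<psi> x)) = 0" by simp
    then show ?thesis using z by auto
  qed
  have l: "locally_L2 S \<sigma>" using e by (intro weighted_L2_locally) (simp add: eigenpair_def)
  have "AE x in lborel. indicator S x *\<^sub>R ((norm (\<sigma> x))\<^sup>2 * cutoff n x) = 0" for n
  proof -
    have "integrable lborel (%x. indicator S x *\<^sub>R ((norm (\<sigma> x))\<^sup>2 * cutoff n x))"
      using locally_L2_norm_sq_test[OF l cutoff_test] by (simp add: set_integrable_def)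
    moreover have "AE x in lborel. 0 <= indicator S x *\<^sub>R ((norm (\<sigma> x))\<^sup>2 * cutoff n x)"
      by (intro AE_I2) (simp add: cutoff_nonneg)
    ultimately show ?thesis
      using fundamental_lemma[OF open_ball l zero cutoff_test, of n] integral_nonneg_eq_0_iff_AE
      unfolding set_lebesgue_integral_def by blast
  qed
  then have "AE x in lborel. \<forall>n. indicator S x *\<^sub>R ((norm (\<sigma> x))\<^sup>2 * cutoff n x) = 0" unfolding AE_all_countable by (rule allI)
  then show "AE x in lborel. x \<in> S --> \<sigma> x = 0"
  proof (rule AE_mp, intro AE_I2 impI)
    fix x assume a: "\<forall>n. indicator S x *\<^sub>R ((norm (\<sigma> x))\<^sup>2 * cutoff n x) = 0" and x: "x \<in> S"
    have "(%n. (norm (\<sigma> x))\<^sup>2 * cutoff n x) \<longlonglongrightarrow> (norm (\<sigma> x))\<^sup>2 * 1"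
      by (intro tendsto_mult tendsto_const cutoff_tendsto x)
    moreover have "(norm (\<sigma> x))\<^sup>2 * cutoff n x = 0" for n using a x by (meson indicator_eq_0_iff scaleR_eq_0_iff)
    ultimately have "(norm (\<sigma> x))\<^sup>2 = 0" by (simp add: LIMSEQ_const_iff)
    then show "\<sigma> x = 0" by simp
  qed
qed

end

section \<open>The Newtonian energy of square-integrable functions\<close>

context ball_domain begin

text \<open>Functions vanish everywhere outside the ball, not merely almost everywhere, so that
  integrals over the whole space carry no indicator.\<close>

definition L2S :: "(real^3 => real) set" where
  "L2S = {u. u \<in> borel_measurable borel & (\<forall>x. x \<notin> S --> u x = 0) & integrable lborel (%x. (u x)\<^sup>2)}"

text \<open>4 \<pi> times the inverse Laplacian, that is, the nonlocal part of the operator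
  L.\<close>

definition pot :: "(real^3 => real) => real^3 => real" where
  "pot u x = (\<integral>z. u z / norm (x - z) \<partial>lborel)"

lemma L2S_measurable: "u \<in> L2S ==> u \<in> borel_measurable borel"
  by (simp add: L2S_def)

lemma L2S_abs: "u \<in> L2S ==> (%x. \<bar>u x\<bar>) \<in> L2S"
  by (auto simp: L2S_def)

lemma pot_mult: "(\<integral>z. c * (u z / norm (x - z)) \<partial>lborel) = c * pot u x"
  unfolding pot_def by (rule integral_mult_right_zero)

lemma L2S_bounded:
  assumes m: "u \<in> borel_measurable borel" and b: "!!x. \<bar>u x\<bar> <= C" and z: "!!x. x \<notin> S ==> u x = 0"
  shows "u \<in> L2S"
proof -
  have i: "integrable lborel (%x::real^3. indicator S x * C\<^sup>2 :: real)"
    using emeasure_lborel_ball_finite[of "0 :: real^3" R] by (intro integrable_mult_left integrable_real_indicator) auto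
  have "integrable lborel (%x. (u x)\<^sup>2)"
  proof (rule Bochner_Integration.integrable_bound[OF i])
    show "(%x. (u x)\<^sup>2) \<in> borel_measurable lborel" using m by simp
    have "norm ((u x)\<^sup>2) <= norm (indicator S x * C\<^sup>2)" for x
      using power_mono[OF b[of x], of 2] z[of x] by (cases "x \<in> S") auto
    then show "AE x in lborel. norm ((u x)\<^sup>2) <= norm (indicator S x * C\<^sup>2)" by simp
  qed
  then show ?thesis using m z by (simp add: L2S_def)
qed

text \<open>AM-GM splits the product into two integrable terms, because the squared Newtonian kernel
  is locally integrable in dimension three.\<close>

lemma kernel_le:
  assumes "u \<in> L2S"
  shows "\<bar>u z / norm (x - z)\<bar> <= (u z)\<^sup>2 + indicator S z / (norm (x - z))\<^sup>2"
proof (cases "z \<in> S")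
  case True
  have "2 * (\<bar>u z\<bar> * (1 / norm (x - z))) <= \<bar>u z\<bar>\<^sup>2 + (1 / norm (x - z))\<^sup>2"
    using sum_squares_bound[of "\<bar>u z\<bar>" "1 / norm (x - z)"] by simp
  moreover have "0 <= \<bar>u z\<bar> * (1 / norm (x - z))" by simp
  ultimately have "\<bar>u z\<bar> * (1 / norm (x - z)) <= \<bar>u z\<bar>\<^sup>2 + (1 / norm (x - z))\<^sup>2" by linarith
  then show ?thesis using True by (simp add: power_divide abs_divide)
next
  case False
  then show ?thesis using assms by (simp add: L2S_def)
qed

lemma kernel_integrable:
  assumes u: "u \<in> L2S"
  shows "integrable lborel (%z. u z / norm (x - z))"
proof (rule Bochner_Integration.integrable_bound)
  show "integrable lborel (%z. (u z)\<^sup>2 + indicator S z / (norm (x - z))\<^sup>2)"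
    using u integrable_inverse_square[OF R, of x] by (intro Bochner_Integration.integrable_add) (simp_all add: L2S_def)
  have [measurable]: "u \<in> borel_measurable borel" by (rule L2S_measurable[OF u])
  show "(%z. u z / norm (x - z)) \<in> borel_measurable lborel" by measurable
  have "norm (u z / norm (x - z)) <= norm ((u z)\<^sup>2 + indicator S z / (norm (x - z))\<^sup>2)" for z
    using kernel_le[OF u, of z x] by simp
  then show "AE z in lborel. norm (u z / norm (x - z)) <= norm ((u z)\<^sup>2 + indicator S z / (norm (x - z))\<^sup>2)" by simp
qed

lemma pot_abs_le:
  assumes u: "u \<in> L2S"
  shows "pot (%z. \<bar>u z\<bar>) x <= (\<integral>z. (u z)\<^sup>2 \<partial>lborel) + 4 * pi * (R + norm x)"
proof -
  have i: "integrable lborel (%z. (u z)\<^sup>2)" using u by (simp add: L2S_def)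
  have "pot (%z. \<bar>u z\<bar>) x <= (\<integral>z. (u z)\<^sup>2 + indicator S z / (norm (x - z))\<^sup>2 \<partial>lborel)"
    unfolding pot_def
  proof (rule Bochner_Integration.integral_mono)
    show "integrable lborel (%z. \<bar>u z\<bar> / norm (x - z))" by (rule kernel_integrable[OF L2S_abs[OF u]])
    show "integrable lborel (%z. (u z)\<^sup>2 + indicator S z / (norm (x - z))\<^sup>2)"
      by (rule Bochner_Integration.integrable_add[OF i integrable_inverse_square[OF R]])
    show "\<bar>u z\<bar> / norm (x - z) <= (u z)\<^sup>2 + indicator S z / (norm (x - z))\<^sup>2" for z
      using kernel_le[OF u, of z x] by (simp add: abs_divide)
  qed
  also have "\<dots> = (\<integral>z. (u z)\<^sup>2 \<partial>lborel) + (\<integral>z. indicator S z / (norm (x - z))\<^sup>2 \<partial>lborel)"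
    by (rule Bochner_Integration.integral_add[OF i integrable_inverse_square[OF R]])
  finally show ?thesis using integral_inverse_square[OF R, of x] by simp
qed

lemma L2S_integrable:
  assumes u: "u \<in> L2S"
  shows "integrable lborel u"
proof (rule Bochner_Integration.integrable_bound)
  have "integrable lborel (%x::real^3. indicator S x :: real)"
    using emeasure_lborel_ball_finite[of "0 :: real^3" R] by (intro integrable_real_indicator) auto
  then show "integrable lborel (%x. (u x)\<^sup>2 + indicator S x)"
    using u by (intro Bochner_Integration.integrable_add) (simp_all add: L2S_def)
  show "u \<in> borel_measurable lborel" using L2S_measurable[OF u] by simp
  have "norm (u x) <= norm ((u x)\<^sup>2 + indicator S x)" for x
  proof (cases "x \<in> S")
    case True
    have "2 * (\<bar>u x\<bar> * 1) <= \<bar>u x\<bar>\<^sup>2 + 1\<^sup>2" using sum_squares_bound[of "\<bar>u x\<bar>" 1] by simp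
    then have "\<bar>u x\<bar> <= (u x)\<^sup>2 + 1" by simp
    then show ?thesis using True by simp
  qed (use u in \<open>simp add: L2S_def\<close>)
  then show "AE x in lborel. norm (u x) <= norm ((u x)\<^sup>2 + indicator S x)" by simp
qed

lemma kernel_product_integrable:
  assumes u: "u \<in> L2S" and v: "v \<in> L2S"
  shows "integrable (lborel \<Otimes>\<^sub>M lborel) (%(x, z). u x * (v z / norm (x - z)))"
proof (rule lborel_pair.Fubini_integrable)
  have [measurable]: "u \<in> borel_measurable borel" "v \<in> borel_measurable borel" using u v by (simp_all add: L2S_def)
  show m: "(%(x, z). u x * (v z / norm (x - z))) \<in> borel_measurable (lborel \<Otimes>\<^sub>M lborel)" by measurable
  have eq: "(\<integral>z. norm (case (x, z) of (x, z) => u x * (v z / norm (x - z))) \<partial>lborel) = \<bar>u x\<bar> * pot (%z. \<bar>v z\<bar>) x" for x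
    unfolding pot_mult[symmetric] by (simp add: abs_mult abs_divide)
  have pm: "pot (%z. \<bar>v z\<bar>) \<in> borel_measurable borel" unfolding pot_def by measurable
  show "integrable lborel (%x. \<integral>z. norm (case (x, z) of (x, z) => u x * (v z / norm (x - z))) \<partial>lborel)"
    unfolding eq
  proof (rule Bochner_Integration.integrable_bound)
    define C where "C = (\<integral>z. (v z)\<^sup>2 \<partial>lborel) + 4 * pi * (R + R)"
    show "integrable lborel (%x. \<bar>u x\<bar> * C)" using L2S_integrable[OF L2S_abs[OF u]] by simp
    show "(%x. \<bar>u x\<bar> * pot (%z. \<bar>v z\<bar>) x) \<in> borel_measurable lborel" using pm by measurable
    have "norm (\<bar>u x\<bar> * pot (%z. \<bar>v z\<bar>) x) <= norm (\<bar>u x\<bar> * C)" for x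
    proof (cases "x \<in> S")
      case True
      have "0 <= pot (%z. \<bar>v z\<bar>) x" unfolding pot_def by (intro Bochner_Integration.integral_nonneg) simp
      moreover have "4 * pi * (R + norm x) <= 4 * pi * (R + R)" using True by (intro mult_left_mono) auto
      then have "pot (%z. \<bar>v z\<bar>) x <= C" using pot_abs_le[OF v, of x] by (simp only: C_def)
      ultimately show ?thesis by (simp add: abs_mult mult_left_mono)
    qed (use u in \<open>simp add: L2S_def\<close>)
    then show "AE x in lborel. norm (\<bar>u x\<bar> * pot (%z. \<bar>v z\<bar>) x) <= norm (\<bar>u x\<bar> * C)" by simp
  qed
  show "AE x in lborel. integrable lborel (%z. case (x, z) of (x, z) => u x * (v z / norm (x - z)))"
    using kernel_integrable[OF v] by fast
qed

lemma pot_measurable: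
  assumes "u \<in> L2S" shows "pot u \<in> borel_measurable borel"
proof -
  have [measurable]: "u \<in> borel_measurable borel" by (rule L2S_measurable[OF assms])
  show ?thesis unfolding pot_def by measurable
qed

lemma pot_mult_integrable:
  assumes u: "u \<in> L2S" and v: "v \<in> L2S"
  shows "integrable lborel (%x. u x * pot v x)"
  using lborel_pair.integrable_fst'[OF kernel_product_integrable[OF u v]] by (simp only: prod.case pot_mult)

lemma pot_symmetric:
  assumes u: "u \<in> L2S" and v: "v \<in> L2S"
  shows "(\<integral>x. u x * pot v x \<partial>lborel) = (\<integral>x. v x * pot u x \<partial>lborel)"
proof -
  have "(\<integral>x. u x * pot v x \<partial>lborel) = (\<integral>x. (\<integral>z. u x * (v z / norm (x - z)) \<partial>lborel) \<partial>lborel)"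
    by (simp only: pot_mult)
  also have "\<dots> = (\<integral>z. (\<integral>x. u x * (v z / norm (x - z)) \<partial>lborel) \<partial>lborel)"
    by (rule lborel_pair.Fubini_integral[OF kernel_product_integrable[OF u v], symmetric])
  also have "\<dots> = (\<integral>z. v z * pot u z \<partial>lborel)"
  proof (rule Bochner_Integration.integral_cong[OF refl])
    fix z
    have "(%x. u x * (v z / norm (x - z))) = (%x. v z * (u x / norm (z - x)))"
      by (auto simp: fun_eq_iff norm_minus_commute)
    then show "(\<integral>x. u x * (v z / norm (x - z)) \<partial>lborel) = v z * pot u z" by (simp only: pot_mult)
  qed
  finally show ?thesis .
qed

end

section \<open>Schur test, Cauchy-Schwarz and Hardy inequalities from weighted AM-GM\<close>

lemma weighted_AMGM:
  fixes a b p q :: real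
  assumes "p > 0" "q > 0"
  shows "2 * (a * b) <= a\<^sup>2 * q / p + b\<^sup>2 * p / q"
proof -
  have "a\<^sup>2 * q / p + b\<^sup>2 * p / q - 2 * (a * b) = (a * q - b * p)\<^sup>2 / (p * q)"
    using assms by (simp add: field_simps power2_eq_square)
  moreover have "(a * q - b * p)\<^sup>2 / (p * q) >= 0" using assms by simp
  ultimately show ?thesis by linarith
qed

text \<open>The positive function h satisfies \<kappa> h = a h on T. AM-GM with weights h x and h z
  bounds the product |u x| |u z|, and the symmetry of \<kappa> makes both resulting terms equal to
  the right side. Extended nonnegative integrals keep questions of integrability out of the
  estimate.\<close>

lemma nn_integral_schur:
  fixes \<kappa> :: "real^3 => real^3 => real" and u h a :: "real^3 => real"
  assumes [measurable]: "(%(x, z). \<kappa> x z) \<in> borel_measurable (borel \<Otimes>\<^sub>M borel)"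
      "u \<in> borel_measurable borel" "h \<in> borel_measurable borel" "a \<in> borel_measurable borel"
    and \<kappa>: "!!x z. \<kappa> x z >= 0" "!!x z. \<kappa> x z = \<kappa> z x" and u: "!!x. x \<notin> T ==> u x = 0"
    and h: "!!x. x \<in> T ==> h x > 0" "!!x. h x >= 0"
    and row: "!!x. x \<in> T ==> (\<integral>\<^sup>+z. ennreal (\<kappa> x z * h z) \<partial>lborel) = ennreal (a x * h x)"
  shows "(\<integral>\<^sup>+x. (\<integral>\<^sup>+z. ennreal (\<kappa> x z * \<bar>u x\<bar> * \<bar>u z\<bar>) \<partial>lborel) \<partial>lborel) <= (\<integral>\<^sup>+x. ennreal (a x * (u x)\<^sup>2) \<partial>lborel)"
    (is "?L <= ?A")
proof -
  define G where "G x z = \<kappa> x z * ((u x)\<^sup>2 * h z / h x)" for x z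
  have [measurable]: "(%(x, z). G x z) \<in> borel_measurable (borel \<Otimes>\<^sub>M borel)" unfolding G_def by measurable
  have G0: "G x z >= 0" for x z using \<kappa>(1)[of x z] h(2)[of x] h(2)[of z] by (simp add: G_def)
  have rowG: "(\<integral>\<^sup>+z. ennreal (G x z) \<partial>lborel) = ennreal (a x * (u x)\<^sup>2)" for x
  proof (cases "x \<in> T")
    case True
    have hx: "h x > 0" by (rule h(1)[OF True])
    have "(\<integral>\<^sup>+z. ennreal (G x z) \<partial>lborel) = (\<integral>\<^sup>+z. ennreal ((u x)\<^sup>2 / h x) * ennreal (\<kappa> x z * h z) \<partial>lborel)"
      using hx \<kappa>(1) h(2) by (intro nn_integral_cong) (simp add: G_def ennreal_mult[symmetric] mult_ac)
    also have "\<dots> = ennreal ((u x)\<^sup>2 / h x) * ennreal (a x * h x)"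
      by (subst nn_integral_cmult) (simp_all add: row[OF True])
    also have "\<dots> = ennreal ((u x)\<^sup>2 / h x * (a x * h x))" using hx by (intro ennreal_mult'[symmetric]) simp
    also have "(u x)\<^sup>2 / h x * (a x * h x) = a x * (u x)\<^sup>2" using hx by simp
    finally show ?thesis .
  qed (simp add: G_def u)
  have pt: "2 * (\<kappa> x z * \<bar>u x\<bar> * \<bar>u z\<bar>) <= G x z + G z x" for x z
  proof (cases "x \<in> T & z \<in> T")
    case True
    then have hx: "h x > 0" and hz: "h z > 0" using h by auto
    have "2 * (\<bar>u x\<bar> * \<bar>u z\<bar>) <= (u x)\<^sup>2 * h z / h x + (u z)\<^sup>2 * h x / h z"
      using weighted_AMGM[OF hx hz, of "\<bar>u x\<bar>" "\<bar>u z\<bar>"] by simp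
    from mult_left_mono[OF this \<kappa>(1)[of x z]] show ?thesis unfolding G_def \<kappa>(2)[of z x] by (simp add: algebra_simps)
  next
    case False
    then have "\<bar>u x\<bar> * \<bar>u z\<bar> = 0" using u by auto
    then have "2 * (\<kappa> x z * \<bar>u x\<bar> * \<bar>u z\<bar>) = 0" by (simp only: mult.assoc mult_zero_right)
    then show ?thesis using G0[of x z] G0[of z x] by linarith
  qed
  have "2 * ?L = (\<integral>\<^sup>+x. (\<integral>\<^sup>+z. 2 * ennreal (\<kappa> x z * \<bar>u x\<bar> * \<bar>u z\<bar>) \<partial>lborel) \<partial>lborel)"
    by (simp add: nn_integral_cmult)
  also have "\<dots> <= (\<integral>\<^sup>+x. (\<integral>\<^sup>+z. ennreal (G x z) + ennreal (G z x) \<partial>lborel) \<partial>lborel)"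
  proof (intro nn_integral_mono)
    fix x z
    have "2 * ennreal (\<kappa> x z * \<bar>u x\<bar> * \<bar>u z\<bar>) = ennreal (2 * (\<kappa> x z * \<bar>u x\<bar> * \<bar>u z\<bar>))"
      by (subst ennreal_mult') simp_all
    also have "\<dots> <= ennreal (G x z + G z x)" by (rule ennreal_leI[OF pt])
    finally show "2 * ennreal (\<kappa> x z * \<bar>u x\<bar> * \<bar>u z\<bar>) <= ennreal (G x z) + ennreal (G z x)" using G0 by (simp add: ennreal_plus)
  qed
  also have "\<dots> = (\<integral>\<^sup>+x. (\<integral>\<^sup>+z. ennreal (G x z) \<partial>lborel) \<partial>lborel) + (\<integral>\<^sup>+x. (\<integral>\<^sup>+z. ennreal (G z x) \<partial>lborel) \<partial>lborel)"
    by (simp add: nn_integral_add)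
  also have "(\<integral>\<^sup>+x. (\<integral>\<^sup>+z. ennreal (G z x) \<partial>lborel) \<partial>lborel) = (\<integral>\<^sup>+z. (\<integral>\<^sup>+x. ennreal (G z x) \<partial>lborel) \<partial>lborel)"
    by (rule lborel_pair.Fubini') simp
  finally have "2 * ?L <= 2 * ?A" unfolding rowG by (simp add: mult_2)
  then show ?thesis by (subst (asm) ennreal_mult_le_mult_iff) simp_all
qed

text \<open>Written for extended integrals, so that infinite values are covered. The square becomes
  a double integral, and AM-GM with weights q s and q t is applied under it.\<close>

lemma nn_integral_Cauchy_Schwarz:
  fixes f q :: "real => real"
  assumes [measurable]: "f \<in> borel_measurable borel" "q \<in> borel_measurable borel"
    and nn: "!!t. f t >= 0" "!!t. q t >= 0" "!!t. q t = 0 ==> f t = 0"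
  shows "(\<integral>\<^sup>+t. ennreal (f t) \<partial>lborel)\<^sup>2 <= (\<integral>\<^sup>+t. ennreal ((f t)\<^sup>2 / q t) \<partial>lborel) * (\<integral>\<^sup>+t. ennreal (q t) \<partial>lborel)"
    (is "?f\<^sup>2 <= ?a * ?q")
proof -
  have pt: "2 * (f s * f t) <= (f s)\<^sup>2 / q s * q t + (f t)\<^sup>2 / q t * q s" for s t
  proof (cases "q s = 0 \<or> q t = 0")
    case True
    then have "f s * f t = 0" using nn(3) by auto
    moreover have "0 <= (f s)\<^sup>2 / q s * q t + (f t)\<^sup>2 / q t * q s" using nn by simp
    ultimately show ?thesis by linarith
  next
    case False
    then have p: "q s > 0" "q t > 0" using nn(2)[of s] nn(2)[of t] by auto
    show ?thesis using weighted_AMGM[OF p, of "f s" "f t"] by simp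
  qed
  have "2 * ?f\<^sup>2 = (\<integral>\<^sup>+s. (\<integral>\<^sup>+t. 2 * (ennreal (f s) * ennreal (f t)) \<partial>lborel) \<partial>lborel)"
    by (simp add: nn_integral_cmult nn_integral_multc power2_eq_square)
  also have "\<dots> <= (\<integral>\<^sup>+s. (\<integral>\<^sup>+t. ennreal ((f s)\<^sup>2 / q s) * ennreal (q t) + ennreal ((f t)\<^sup>2 / q t) * ennreal (q s) \<partial>lborel) \<partial>lborel)"
  proof (intro nn_integral_mono)
    fix s t
    have "2 * (ennreal (f s) * ennreal (f t)) = ennreal (2 * (f s * f t))"
      using nn by (simp add: ennreal_mult)
    also have "\<dots> <= ennreal ((f s)\<^sup>2 / q s * q t + (f t)\<^sup>2 / q t * q s)" by (rule ennreal_leI[OF pt])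
    also have "\<dots> = ennreal ((f s)\<^sup>2 / q s) * ennreal (q t) + ennreal ((f t)\<^sup>2 / q t) * ennreal (q s)"
      by (simp only: ennreal_plus ennreal_mult nn divide_nonneg_nonneg zero_le_power2 mult_nonneg_nonneg)
    finally show "2 * (ennreal (f s) * ennreal (f t)) <= ennreal ((f s)\<^sup>2 / q s) * ennreal (q t) + ennreal ((f t)\<^sup>2 / q t) * ennreal (q s)" .
  qed
  also have "\<dots> = ?a * ?q + ?a * ?q"
    by (simp add: nn_integral_add nn_integral_cmult nn_integral_multc)
  finally have "2 * ?f\<^sup>2 <= 2 * (?a * ?q)" by (simp add: mult_2)
  then show ?thesis by (subst (asm) ennreal_mult_le_mult_iff) simp_all
qed

text \<open>M plays the role of a primitive of q, and \<theta> that of a primitive of \<kappa> M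
  taken from the opposite end. Cauchy-Schwarz with weight q bounds the inner square by M, and
  Tonelli then produces \<theta>. The relation E is an order relation in the applications, so that
  the inner integral may start at either end of A.\<close>

lemma weighted_hardy:
  fixes f q M \<kappa> \<theta> :: "real => real" and A :: "real set" and E :: "real => real => bool"
  assumes [measurable]: "f \<in> borel_measurable borel" "(%t. indicator A t * q t) \<in> borel_measurable borel"
      "(%t. indicator A t * M t) \<in> borel_measurable borel" "\<kappa> \<in> borel_measurable borel" "A \<in> sets borel"
      "Measurable.pred (borel \<Otimes>\<^sub>M borel) (%(t, \<tau>). E t \<tau>)"
    and nn: "!!t. f t >= 0" "!!t. t \<in> A ==> q t > 0" "!!t. \<kappa> t >= 0" "!!t. t \<in> A ==> M t >= 0"
    and H1: "!!\<tau>. \<tau> \<in> A ==> (\<integral>\<^sup>+t. ennreal (indicator A t * of_bool (E t \<tau>) * q t) \<partial>lborel) <= ennreal (M \<tau>)"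
    and H2: "!!t. t \<in> A ==> (\<integral>\<^sup>+\<tau>. ennreal (indicator A \<tau> * of_bool (E t \<tau>) * (\<kappa> \<tau> * M \<tau>)) \<partial>lborel) <= ennreal (\<theta> t)"
    and \<theta>: "!!t. t \<in> A ==> \<theta> t >= 0"
  shows "(\<integral>\<^sup>+\<tau>. ennreal (indicator A \<tau> * \<kappa> \<tau>) * (\<integral>\<^sup>+t. ennreal (indicator A t * of_bool (E t \<tau>) * f t) \<partial>lborel)\<^sup>2 \<partial>lborel)
    <= (\<integral>\<^sup>+t. ennreal (indicator A t * ((f t)\<^sup>2 * \<theta> t / q t)) \<partial>lborel)"
proof -
  define q' where "q' t = indicator A t * q t" for t
  define M' where "M' t = indicator A t * M t" for t
  have [measurable]: "q' \<in> borel_measurable borel" "M' \<in> borel_measurable borel" unfolding q'_def M'_def by simp_all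
  define B where "B t \<tau> = (indicator A t * of_bool (E t \<tau>) :: real)" for t \<tau>
  have [measurable]: "(%(t, \<tau>). B t \<tau>) \<in> borel_measurable (borel \<Otimes>\<^sub>M borel)" unfolding B_def of_bool_def by measurable
  have B01: "B t \<tau> = 0 \<or> (B t \<tau> = 1 & t \<in> A & E t \<tau>)" for t \<tau> by (simp add: B_def indicator_def)
  have q0: "q' t >= 0" for t using nn(2)[of t] by (auto simp: q'_def indicator_def less_imp_le)
  have M0: "M' t >= 0" for t using nn(4)[of t] by (simp add: M'_def indicator_def)
  have CS: "(\<integral>\<^sup>+t. ennreal (indicator A t * of_bool (E t \<tau>) * f t) \<partial>lborel)\<^sup>2
      <= (\<integral>\<^sup>+t. ennreal (B t \<tau> * ((f t)\<^sup>2 / q' t)) \<partial>lborel) * ennreal (M' \<tau>)" if \<tau>: "\<tau> \<in> A" for \<tau>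
  proof -
    have z: "B t \<tau> * q' t = 0 ==> B t \<tau> * f t = 0" for t using B01[of t \<tau>] nn(2)[of t] by (auto simp: q'_def)
    have n: "B t \<tau> * f t >= 0" "B t \<tau> * q' t >= 0" for t using B01[of t \<tau>] nn(1)[of t] q0[of t] by auto
    have "(\<integral>\<^sup>+t. ennreal (B t \<tau> * f t) \<partial>lborel)\<^sup>2
        <= (\<integral>\<^sup>+t. ennreal ((B t \<tau> * f t)\<^sup>2 / (B t \<tau> * q' t)) \<partial>lborel) * (\<integral>\<^sup>+t. ennreal (B t \<tau> * q' t) \<partial>lborel)"
      by (rule nn_integral_Cauchy_Schwarz[OF _ _ n z]) measurable
    also have "(%t. ennreal ((B t \<tau> * f t)\<^sup>2 / (B t \<tau> * q' t))) = (%t. ennreal (B t \<tau> * ((f t)\<^sup>2 / q' t)))"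
    proof
      show "ennreal ((B t \<tau> * f t)\<^sup>2 / (B t \<tau> * q' t)) = ennreal (B t \<tau> * ((f t)\<^sup>2 / q' t))" for t
        using B01[of t \<tau>] by auto
    qed
    also have "(%t. ennreal (B t \<tau> * q' t)) = (%t. ennreal (indicator A t * of_bool (E t \<tau>) * q t))"
      by (auto simp: B_def q'_def indicator_def fun_eq_iff)
    also have "(\<integral>\<^sup>+t. ennreal (B t \<tau> * ((f t)\<^sup>2 / q' t)) \<partial>lborel) * (\<integral>\<^sup>+t. ennreal (indicator A t * of_bool (E t \<tau>) * q t) \<partial>lborel)
        <= (\<integral>\<^sup>+t. ennreal (B t \<tau> * ((f t)\<^sup>2 / q' t)) \<partial>lborel) * ennreal (M' \<tau>)"
      using H1[OF \<tau>] \<tau> by (intro mult_left_mono) (simp_all add: M'_def)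
    finally show ?thesis by (simp add: B_def)
  qed
  have "(\<integral>\<^sup>+\<tau>. ennreal (indicator A \<tau> * \<kappa> \<tau>) * (\<integral>\<^sup>+t. ennreal (indicator A t * of_bool (E t \<tau>) * f t) \<partial>lborel)\<^sup>2 \<partial>lborel)
      <= (\<integral>\<^sup>+\<tau>. (\<integral>\<^sup>+t. ennreal (B t \<tau> * ((f t)\<^sup>2 / q' t) * (\<kappa> \<tau> * M' \<tau>)) \<partial>lborel) \<partial>lborel)"
  proof (intro nn_integral_mono)
    fix \<tau>
    show "ennreal (indicator A \<tau> * \<kappa> \<tau>) * (\<integral>\<^sup>+t. ennreal (indicator A t * of_bool (E t \<tau>) * f t) \<partial>lborel)\<^sup>2
      <= (\<integral>\<^sup>+t. ennreal (B t \<tau> * ((f t)\<^sup>2 / q' t) * (\<kappa> \<tau> * M' \<tau>)) \<partial>lborel)"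
    proof (cases "\<tau> \<in> A")
      case True
      have "ennreal (\<kappa> \<tau>) * (\<integral>\<^sup>+t. ennreal (indicator A t * of_bool (E t \<tau>) * f t) \<partial>lborel)\<^sup>2
          <= ennreal (\<kappa> \<tau>) * ((\<integral>\<^sup>+t. ennreal (B t \<tau> * ((f t)\<^sup>2 / q' t)) \<partial>lborel) * ennreal (M' \<tau>))"
        by (rule mult_left_mono[OF CS[OF True]]) simp
      also have "\<dots> = (\<integral>\<^sup>+t. ennreal (B t \<tau> * ((f t)\<^sup>2 / q' t)) \<partial>lborel) * ennreal (\<kappa> \<tau> * M' \<tau>)"
        using nn(3)[of \<tau>] M0[of \<tau>] by (simp add: ennreal_mult mult_ac)
      also have "\<dots> = (\<integral>\<^sup>+t. ennreal (B t \<tau> * ((f t)\<^sup>2 / q' t)) * ennreal (\<kappa> \<tau> * M' \<tau>) \<partial>lborel)"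
        by (subst nn_integral_multc) simp_all
      also have "\<dots> = (\<integral>\<^sup>+t. ennreal (B t \<tau> * ((f t)\<^sup>2 / q' t) * (\<kappa> \<tau> * M' \<tau>)) \<partial>lborel)"
        by (intro nn_integral_cong ennreal_mult''[symmetric] mult_nonneg_nonneg nn(3) M0)
      finally show ?thesis using True by simp
    qed simp
  qed
  also have "\<dots> = (\<integral>\<^sup>+t. (\<integral>\<^sup>+\<tau>. ennreal (B t \<tau> * ((f t)\<^sup>2 / q' t) * (\<kappa> \<tau> * M' \<tau>)) \<partial>lborel) \<partial>lborel)"
    by (rule lborel_pair.Fubini') measurable
  also have "\<dots> <= (\<integral>\<^sup>+t. ennreal (indicator A t * ((f t)\<^sup>2 * \<theta> t / q t)) \<partial>lborel)"
  proof (intro nn_integral_mono)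
    fix t
    show "(\<integral>\<^sup>+\<tau>. ennreal (B t \<tau> * ((f t)\<^sup>2 / q' t) * (\<kappa> \<tau> * M' \<tau>)) \<partial>lborel) <= ennreal (indicator A t * ((f t)\<^sup>2 * \<theta> t / q t))"
    proof (cases "t \<in> A")
      case True
      have "(\<integral>\<^sup>+\<tau>. ennreal (B t \<tau> * ((f t)\<^sup>2 / q' t) * (\<kappa> \<tau> * M' \<tau>)) \<partial>lborel)
          = (\<integral>\<^sup>+\<tau>. ennreal ((f t)\<^sup>2 / q t) * ennreal (indicator A \<tau> * of_bool (E t \<tau>) * (\<kappa> \<tau> * M \<tau>)) \<partial>lborel)"
      proof (intro nn_integral_cong)
        fix \<tau>
        have "B t \<tau> * ((f t)\<^sup>2 / q' t) * (\<kappa> \<tau> * M' \<tau>) = (f t)\<^sup>2 / q t * (indicator A \<tau> * of_bool (E t \<tau>) * (\<kappa> \<tau> * M \<tau>))"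
          using True by (simp add: B_def q'_def M'_def)
        moreover have "(f t)\<^sup>2 / q t >= 0" using nn(2)[OF True] by simp
        ultimately show "ennreal (B t \<tau> * ((f t)\<^sup>2 / q' t) * (\<kappa> \<tau> * M' \<tau>)) = ennreal ((f t)\<^sup>2 / q t) * ennreal (indicator A \<tau> * of_bool (E t \<tau>) * (\<kappa> \<tau> * M \<tau>))"
          by (simp only: ennreal_mult')
      qed
      also have "\<dots> = ennreal ((f t)\<^sup>2 / q t) * (\<integral>\<^sup>+\<tau>. ennreal (indicator A \<tau> * of_bool (E t \<tau>) * (\<kappa> \<tau> * M \<tau>)) \<partial>lborel)"
      proof (rule nn_integral_cmult)
        have "(%\<tau>. indicator A \<tau> * of_bool (E t \<tau>) * (\<kappa> \<tau> * M \<tau>)) = (%\<tau>. B t \<tau> * (\<kappa> \<tau> * M' \<tau>))"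
          using True by (auto simp: B_def M'_def indicator_def fun_eq_iff)
        moreover have "(%\<tau>. B t \<tau> * (\<kappa> \<tau> * M' \<tau>)) \<in> borel_measurable lborel" by measurable
        ultimately have "(%\<tau>. indicator A \<tau> * of_bool (E t \<tau>) * (\<kappa> \<tau> * M \<tau>)) \<in> borel_measurable lborel" by (simp only:)
        then show "(%\<tau>. ennreal (indicator A \<tau> * of_bool (E t \<tau>) * (\<kappa> \<tau> * M \<tau>))) \<in> borel_measurable lborel" by (rule measurable_compose[OF _ measurable_ennreal])
      qed
      also have "\<dots> <= ennreal ((f t)\<^sup>2 / q t) * ennreal (\<theta> t)" by (rule mult_left_mono[OF H2[OF True]]) simp
      also have "\<dots> = ennreal ((f t)\<^sup>2 * \<theta> t / q t)" using nn(2)[OF True] by (simp add: ennreal_mult'[symmetric])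
      finally show ?thesis using True by simp
    qed (simp add: B_def)
  qed
  finally show ?thesis .
qed

text \<open>Only limits at the end points are required; at the centre of the star the primitives
  used below are known through their limits.\<close>

lemma has_bochner_integral_FTC_nonneg:
  fixes f G :: "real => real"
  assumes ab: "a < b" and D: "!!x. a < x ==> x < b ==> (G has_real_derivative f x) (at x)"
    and cont: "!!x. a < x ==> x < b ==> isCont f x" and nn: "!!x. a < x ==> x < b ==> f x >= 0"
    and lim: "(G \<longlongrightarrow> L) (at_right a)" "(G \<longlongrightarrow> U) (at_left b)"
  shows "has_bochner_integral lborel (%x. indicator {a<..<b} x * f x) (U - L)"
proof -
  have lim': "((G \<circ> real_of_ereal) \<longlongrightarrow> L) (at_right (ereal a))" "((G \<circ> real_of_ereal) \<longlongrightarrow> U) (at_left (ereal b))"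
    using lim by (simp_all add: ereal_tendsto_simps)
  have ae: "AE x in lborel. ereal a < ereal x --> ereal x < ereal b --> 0 <= f x" using nn by simp
  have s: "set_integrable lborel (einterval (ereal a) (ereal b)) f"
    by (rule interval_integral_FTC_nonneg(1)[OF _ _ _ ae lim']) (use ab D cont in simp_all)
  have i: "(LBINT x=ereal a..ereal b. f x) = U - L"
    by (rule interval_integral_FTC_nonneg(2)[OF _ _ _ ae lim']) (use ab D cont in simp_all)
  have e: "einterval (ereal a) (ereal b) = {a<..<b}" by (rule einterval_eq)
  show ?thesis
    using s i ab by (simp add: e has_bochner_integral_iff set_integrable_def interval_lebesgue_integral_def set_lebesgue_integral_def)
qed

lemma nn_integral_FTC_nonneg:
  fixes f G :: "real => real"
  assumes "a < b" "!!x. a < x ==> x < b ==> (G has_real_derivative f x) (at x)"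
    "!!x. a < x ==> x < b ==> isCont f x" and nn: "!!x. a < x ==> x < b ==> f x >= 0"
    and "(G \<longlongrightarrow> L) (at_right a)" "(G \<longlongrightarrow> U) (at_left b)"
  shows "(\<integral>\<^sup>+x. ennreal (indicator {a<..<b} x * f x) \<partial>lborel) = ennreal (U - L)"
proof -
  have h: "has_bochner_integral lborel (%x. indicator {a<..<b} x * f x) (U - L)"
    by (rule has_bochner_integral_FTC_nonneg[OF assms])
  have n: "AE x in lborel. 0 <= indicator {a<..<b} x * f x" using nn by (simp add: indicator_def)
  show ?thesis using nn_integral_eq_integral[OF _ n] h by (simp add: has_bochner_integral_iff)
qed

section \<open>Positivity of the energy on odd functions\<close>

lemma borel_measurable_indicator_isCont:
  fixes f :: "real => real"
  assumes "!!t. t \<in> A ==> isCont f t" "A \<in> sets borel"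
  shows "(%t. indicator A t * f t) \<in> borel_measurable borel"
proof -
  have "continuous_on A f" using assms(1) by (intro continuous_at_imp_continuous_on) auto
  from borel_measurable_continuous_on_indicator[OF assms(2) this] show ?thesis by simp
qed

context white_dwarf begin

lemma isCont_y: "r > 0 ==> isCont y r" by (rule DERIV_isCont[OF y_deriv])
lemma isCont_y': "r > 0 ==> isCont y' r" by (rule DERIV_isCont[OF y'_deriv])

lemma isCont_F: "isCont F s" "isCont F' s"
  using continuous_F[of UNIV] by (simp_all add: continuous_on_eq_continuous_at)

lemma isCont_Fy: "r > 0 ==> isCont (%r. F (y r)) r" "r > 0 ==> isCont (%r. F' (y r)) r"
  by (rule isCont_o2[OF isCont_y isCont_F(1)], assumption) (rule isCont_o2[OF isCont_y isCont_F(2)], assumption)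

lemma y_at_0: "(y \<longlongrightarrow> y 0) (at_right 0)"
  using continuous_y unfolding continuous_on_def by (auto intro: tendsto_within_subset)

lemma Fy_at_0: "((%r. F (y r)) \<longlongrightarrow> F (y 0)) (at_right 0)"
  by (rule isCont_tendsto_compose[OF isCont_F(1) y_at_0])

lemma Fy_at_R: "((%r. F (y r)) \<longlongrightarrow> 0) (at_left R)"
proof -
  have "((%r. F (y r)) \<longlongrightarrow> F (y R)) (at R)" using isCont_Fy(1)[OF R] by (simp add: isCont_def)
  then show ?thesis by (simp add: filterlim_at_split yR F_0)
qed

lemma Fy_deriv: "0 < r ==> r < R ==> ((%r. F (y r)) has_real_derivative F' (y r) * y' r) (at r)"
  using DERIV_chain2[where f = F and g = y, OF F_deriv y_deriv, of r] y_pos[of r] by simp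

text \<open>Minus the radial derivative of the density, divided by the radius. The quotient stays
  bounded at the centre since y' is O(r) there.\<close>

definition slope :: "real => real" where
  "slope r = indicator {0<..<R} r * (- F' (y r) * y' r / r)"

lemma slope_measurable [measurable]: "slope \<in> borel_measurable borel"
  unfolding slope_def
  by (rule borel_measurable_indicator_isCont) (auto intro!: isCont_divide isCont_mult isCont_minus isCont_Fy isCont_y' continuous_ident)

lemma slope_pos: "0 < r ==> r < R ==> slope r > 0"
  using y_pos[of r] F'_pos[of "y r"] y'_neg[of r] by (simp add: slope_def mult_pos_neg divide_neg_pos)

lemma slope_nonneg: "slope r >= 0"
  using slope_pos[of r] by (cases "0 < r & r < R") (auto simp: slope_def)

lemma slope_le: "slope r <= F' (y 0) * (4 * pi * F (y 0) / 3)"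
proof (cases "0 < r & r < R")
  case True
  have "- y' r / r <= 4 * pi * F (y 0) / 3" using y'_lower[of r] True by (simp add: field_simps)
  moreover have "F' (y r) <= F' (y 0)" using y_pos[of r] y_le[of r] True by (intro F'_mono) auto
  moreover have "- y' r / r >= 0" using y'_neg[of r] True by (simp add: divide_le_0_iff less_imp_le)
  ultimately have "F' (y r) * (- y' r / r) <= F' (y 0) * (4 * pi * F (y 0) / 3)"
    using F'_pos[OF y0] by (intro mult_mono) auto
  then show ?thesis using True by (simp add: slope_def)
next
  case False
  then show ?thesis using F'_pos[OF y0] F_pos[OF y0] by (auto simp: slope_def)
qed

text \<open>The kernel min a r splits the integral at a, and both parts have explicit primitives.
  Their contributions in F (y a) cancel, leaving - w a / a^3.\<close>

lemma slope_integral: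
  assumes a: "0 < a" "a < R"
  shows "(\<integral>r. indicator {0<..} r * (slope r * (4 * pi / 3) * r * (min a r) ^ 3 / a ^ 3) \<partial>lborel) = - y' a / a"
proof -
  define f1 where "f1 r = - F' (y r) * y' r * (4 * pi / 3) * r ^ 3 / a ^ 3" for r
  define f2 where "f2 r = - F' (y r) * y' r * (4 * pi / 3)" for r
  \<comment> \<open>Adding w cancels the term 4 \<pi> r^2 F that arises when the derivative falls on
    r^3.\<close>
  define G1 where "G1 r = - ((4 * pi / 3) * F (y r) * r ^ 3 + w r) / a ^ 3" for r
  define G2 where "G2 r = - (4 * pi / 3) * F (y r)" for r
  have neg: "- F' (y r) * y' r >= 0" if "0 < r" "r < R" for r
    using y_pos[of r] F'_pos[of "y r"] y'_neg[of r] that by (simp add: mult_nonneg_nonpos)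
  have wc: "isCont w a" by (rule DERIV_isCont[OF w_deriv[OF a(1)]])
  have 1: "has_bochner_integral lborel (%r. indicator {0<..<a} r * f1 r) (G1 a - 0)"
  proof (rule has_bochner_integral_FTC_nonneg[OF a(1), where G = G1])
    fix r assume r: "0 < r" "r < a"
    have r': "r < R" using r a by simp
    have "(G1 has_real_derivative - (((4 * pi / 3) * (F' (y r) * y' r)) * r ^ 3 + (3 * r\<^sup>2) * ((4 * pi / 3) * F (y r)) + - 4 * pi * r\<^sup>2 * F (y r)) / a ^ 3) (at r)"
      unfolding G1_def
      by (intro DERIV_cdivide DERIV_minus DERIV_add DERIV_mult DERIV_cmult Fy_deriv w_deriv_F r(1) r') (auto intro!: derivative_eq_intros simp: r(1) r')
    also have "- (((4 * pi / 3) * (F' (y r) * y' r)) * r ^ 3 + (3 * r\<^sup>2) * ((4 * pi / 3) * F (y r)) + - 4 * pi * r\<^sup>2 * F (y r)) / a ^ 3 = f1 r"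
      by (simp add: f1_def algebra_simps)
    finally show "(G1 has_real_derivative f1 r) (at r)" .
    show "isCont f1 r" unfolding f1_def
      using r a by (intro isCont_divide isCont_mult isCont_minus isCont_Fy isCont_y' isCont_power continuous_ident continuous_const) auto
    have "0 <= (- F' (y r) * y' r) * ((4 * pi / 3) * (r ^ 3 / a ^ 3))" by (rule mult_nonneg_nonneg[OF neg[OF r(1) r']]) (use r a in simp)
    also have "\<dots> = f1 r" by (simp add: f1_def)
    finally show "0 <= f1 r" .
  next
    have "((%r. - ((4 * pi / 3) * F (y r) * r ^ 3 + w r) / a ^ 3) \<longlongrightarrow> - ((4 * pi / 3) * F (y 0) * 0 ^ 3 + 0) / a ^ 3) (at_right 0)"
      using a by (intro tendsto_intros Fy_at_0 w_tendsto_0) auto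
    then show "(G1 \<longlongrightarrow> 0) (at_right 0)" by (simp add: G1_def[abs_def])
    have "isCont G1 a" unfolding G1_def
      using a wc by (intro isCont_divide isCont_mult isCont_minus isCont_add isCont_Fy isCont_power continuous_ident continuous_const) auto
    then show "(G1 \<longlongrightarrow> G1 a) (at_left a)" by (simp add: isCont_def filterlim_at_split)
  qed
  have 2: "has_bochner_integral lborel (%r. indicator {a<..<R} r * f2 r) (0 - G2 a)"
  proof (rule has_bochner_integral_FTC_nonneg[OF a(2), where G = G2])
    fix r assume r: "a < r" "r < R"
    have r': "0 < r" using r a by simp
    have "(G2 has_real_derivative - (4 * pi / 3) * (F' (y r) * y' r)) (at r)"
      unfolding G2_def by (rule DERIV_cmult[OF Fy_deriv[OF r' r(2)]])
    then show "(G2 has_real_derivative f2 r) (at r)" by (simp add: f2_def mult_ac)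
    show "isCont f2 r" unfolding f2_def using r' by (intro isCont_mult isCont_minus isCont_Fy isCont_y' continuous_const) auto
    show "0 <= f2 r" unfolding f2_def by (rule mult_nonneg_nonneg[OF neg[OF r' r(2)]]) simp
  next
    have "isCont G2 a" unfolding G2_def using a by (intro isCont_mult isCont_Fy continuous_const) auto
    then show "(G2 \<longlongrightarrow> G2 a) (at_right a)" by (simp add: isCont_def filterlim_at_split)
    have "((%r. - (4 * pi / 3) * F (y r)) \<longlongrightarrow> - (4 * pi / 3) * 0) (at_left R)" by (intro tendsto_intros Fy_at_R)
    then show "(G2 \<longlongrightarrow> 0) (at_left R)" by (simp add: G2_def[abs_def])
  qed
  note h = has_bochner_integral_add[OF 1 2]
  have "(\<integral>r. indicator {0<..} r * (slope r * (4 * pi / 3) * r * (min a r) ^ 3 / a ^ 3) \<partial>lborel)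
      = (\<integral>r. indicator {0<..<a} r * f1 r + indicator {a<..<R} r * f2 r \<partial>lborel)"
  proof (rule integral_cong_AE)
    show "(%r. indicator {0<..} r * (slope r * (4 * pi / 3) * r * (min a r) ^ 3 / a ^ 3)) \<in> borel_measurable lborel" by measurable
    show "(%r. indicator {0<..<a} r * f1 r + indicator {a<..<R} r * f2 r) \<in> borel_measurable lborel"
      by (rule borel_measurable_integrable[OF h[unfolded has_bochner_integral_iff, THEN conjunct1]])
    show "AE r in lborel. indicator {0<..} r * (slope r * (4 * pi / 3) * r * (min a r) ^ 3 / a ^ 3)
        = indicator {0<..<a} r * f1 r + indicator {a<..<R} r * f2 r"
      using AE_lborel_singleton[of a]
    proof (rule AE_mp, intro AE_I2 impI)
      fix r assume ne: "r ~= a"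
      consider "r <= 0" | "0 < r" "r < a" | "a < r" "r < R" | "R <= r" using ne by linarith
      then show "indicator {0<..} r * (slope r * (4 * pi / 3) * r * (min a r) ^ 3 / a ^ 3)
        = indicator {0<..<a} r * f1 r + indicator {a<..<R} r * f2 r"
      proof cases
        case 2
        then show ?thesis using a by (simp add: slope_def f1_def min_def)
      next
        case 3
        then show ?thesis using a by (simp add: slope_def f2_def min_def)
      qed (use a in \<open>auto simp: slope_def indicator_def\<close>)
    qed
  qed
  also have "\<dots> = (G1 a - 0) + (0 - G2 a)" using h by (simp add: has_bochner_integral_iff)
  also have "\<dots> = - y' a / a" using a by (simp add: G1_def G2_def w_def field_simps power2_eq_square power3_eq_cube)
  finally show ?thesis .
qed

text \<open>Minus the derivative of the density in direction e: the infinitesimal translation of the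
  star.\<close>

definition dipole :: "real^3 => real^3 => real" where
  "dipole e x = slope (norm x) * (x \<bullet> e)"

lemma dipole_L2S:
  assumes e: "norm e = 1" shows "dipole e \<in> L2S"
proof (rule L2S_bounded)
  show "dipole e \<in> borel_measurable borel" unfolding dipole_def by measurable
  show "dipole e x = 0" if "x \<notin> S" for x using that by (simp add: dipole_def slope_def)
  show "\<bar>dipole e x\<bar> <= F' (y 0) * (4 * pi * F (y 0) / 3) * R" for x
  proof (cases "x \<in> S")
    case True
    have "\<bar>x \<bullet> e\<bar> <= R" using Cauchy_Schwarz_ineq2[of x e] e True by simp
    then show ?thesis unfolding dipole_def abs_mult
      using slope_le[of "norm x"] slope_nonneg[of "norm x"] F'_pos[OF y0] F_pos[OF y0] by (intro mult_mono) auto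
  next
    case False
    then show ?thesis using F'_pos[OF y0] F_pos[OF y0] R by (simp add: dipole_def slope_def)
  qed
qed

text \<open>The linearized form of translation invariance: L annihilates the translation mode. It is
  computed from the dipole potential, since the gravity of the density perturbation is again a
  multiple of x.e y'.\<close>

lemma pot_dipole:
  assumes e: "norm e = 1" and x: "x \<in> S" "x ~= 0"
  shows "pot (dipole e) x = dipole e x / \<phi> x"
proof -
  have "(%z::real^3. slope (norm z) * norm z) \<in> L2S"
  proof (rule L2S_bounded)
    show "slope (norm z) * norm z = 0" if "z \<notin> S" for z :: "real^3" using that by (simp add: slope_def)
    show "\<bar>slope (norm z) * norm z\<bar> <= F' (y 0) * (4 * pi * F (y 0) / 3) * R" for z :: "real^3"
    proof (cases "z \<in> S")
      case True
      then show ?thesis unfolding abs_mult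
        using slope_le[of "norm z"] slope_nonneg[of "norm z"] F'_pos[OF y0] F_pos[OF y0] by (intro mult_mono) auto
    next
      case False
      then show ?thesis using F'_pos[OF y0] F_pos[OF y0] R by (simp add: slope_def)
    qed
  qed measurable
  from kernel_integrable[OF this] have int: "integrable lborel (%z. slope (norm z) * norm z / norm (x - z))" .
  have n: "0 < norm x" "norm x < R" using x by simp_all
  have "pot (dipole e) x = (\<integral>z. slope (norm z) * (z \<bullet> e) / norm (x - z) \<partial>lborel)" by (simp add: pot_def dipole_def)
  also have "\<dots> = (x \<bullet> e) * (- y' (norm x) / norm x)"
    using dipole_potential[OF slope_measurable x(2) int, of e] by (simp only: slope_integral[OF n])
  also have "\<dots> = dipole e x / \<phi> x"
    using n F'_pos[OF y_pos, of "norm x"] by (simp add: dipole_def slope_def \<phi>_def)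
  finally show ?thesis .
qed

lemma reflect_S: "norm e = 1 ==> reflect e x \<in> S \<longleftrightarrow> x \<in> S" by simp

text \<open>For odd u the Newtonian kernel may be replaced by its odd part in the mirror, D. Its
  sign is that of (x.e)(z.e), because reflecting one point brings points on opposite sides closer
  together. The translation mode has the same sign pattern, so the absolute kernel maps |dipole| to
  |dipole| / \<phi>, and the Schur test gives the constant 1.\<close>

lemma odd_energy:
  assumes e: "norm e = 1" and u: "u \<in> L2S" and ui: "integrable lborel (%x. (u x)\<^sup>2 / \<phi> x)"
    and odd: "!!x. u (reflect e x) = - u x"
  shows "(\<integral>x. u x * pot u x \<partial>lborel) <= (\<integral>x. (u x)\<^sup>2 / \<phi> x \<partial>lborel)"
proof -
  note [measurable] = reflect_measurable[OF e] L2S_measurable[OF u] \<phi>_measurable L2S_measurable[OF dipole_L2S[OF e]]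
  define D where "D x z = 1 / norm (x - z) - 1 / norm (reflect e x - z)" for x z
  \<comment> \<open>The half reflects the folding: the integral of D against an odd function is
    twice its potential.\<close>
  define \<kappa> where "\<kappa> x z = \<bar>D x z\<bar> / 2" for x z
  \<comment> \<open>On the mirror plane the comparison function vanishes, but so does u by
    oddness.\<close>
  define T where "T = {x \<in> S. x \<bullet> e ~= 0}"
  have Dsym: "D x z = D z x" for x z
    using norm_diff_reflect[OF e, of z x] norm_minus_commute[of z "reflect e x"] norm_minus_commute[of x z] by (simp add: D_def)
  have cmp: "(norm (reflect e x - z))\<^sup>2 = (norm (x - z))\<^sup>2 + 4 * ((x \<bullet> e) * (z \<bullet> e))" for x z
  proof -
    define p where "p = x - z"
    define q where "q = (2 * (x \<bullet> e)) *\<^sub>R e"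
    have 1: "(norm (p - q))\<^sup>2 = (norm p)\<^sup>2 + (norm q)\<^sup>2 - 2 * (p \<bullet> q)" using dot_norm_neg[of p q] by simp
    have 2: "(norm q)\<^sup>2 = 4 * (x \<bullet> e)\<^sup>2" using e by (simp add: q_def power_mult_distrib)
    have 3: "p \<bullet> q = 2 * (x \<bullet> e) * ((x \<bullet> e) - (z \<bullet> e))" by (simp add: p_def q_def inner_diff_left)
    have 4: "reflect e x - z = p - q" by (simp add: p_def q_def reflect_def)
    show ?thesis unfolding 4 1 2 3 p_def[symmetric] by (simp add: algebra_simps power2_eq_square)
  qed
  \<comment> \<open>At the two excluded points one of the fractions has the default value 1 / 0 = 0,
    which can spoil the sign.\<close>
  have sgnD: "D x z * ((x \<bullet> e) * (z \<bullet> e)) >= 0" if "z ~= x" "z ~= reflect e x" for x z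
  proof -
    have n: "0 < norm (x - z)" "0 < norm (reflect e x - z)" using that by auto
    show ?thesis
    proof (cases "(x \<bullet> e) * (z \<bullet> e) >= 0")
      case True
      have "norm (x - z) <= norm (reflect e x - z)"
      proof (rule power2_le_imp_le)
        show "(norm (x - z))\<^sup>2 <= (norm (reflect e x - z))\<^sup>2" unfolding cmp using True by linarith
      qed (rule norm_ge_zero)
      then have "1 / norm (reflect e x - z) <= 1 / norm (x - z)" by (intro frac_le n) simp_all
      then have "D x z >= 0" unfolding D_def by linarith
      then show ?thesis using True by (rule mult_nonneg_nonneg)
    next
      case False
      have "norm (reflect e x - z) <= norm (x - z)"
      proof (rule power2_le_imp_le)
        show "(norm (reflect e x - z))\<^sup>2 <= (norm (x - z))\<^sup>2" unfolding cmp using False by linarith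
      qed (rule norm_ge_zero)
      then have "1 / norm (x - z) <= 1 / norm (reflect e x - z)" by (intro frac_le n) simp_all
      then have "D x z <= 0" unfolding D_def by linarith
      moreover have "(x \<bullet> e) * (z \<bullet> e) <= 0" using False by linarith
      ultimately show ?thesis by (rule mult_nonpos_nonpos)
    qed
  qed
  have Dint: "integrable lborel (%z. D x z * v z)" "(\<integral>z. D x z * v z \<partial>lborel) = pot v x - pot v (reflect e x)" if v: "v \<in> L2S" for v x
  proof -
    have eq: "(%z. D x z * v z) = (%z. v z / norm (x - z) - v z / norm (reflect e x - z))"
      by (simp add: D_def fun_eq_iff left_diff_distrib)
    show "integrable lborel (%z. D x z * v z)" unfolding eq
      by (intro Bochner_Integration.integrable_diff kernel_integrable v)
    show "(\<integral>z. D x z * v z \<partial>lborel) = pot v x - pot v (reflect e x)" unfolding eq pot_def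
      by (intro Bochner_Integration.integral_diff kernel_integrable v)
  qed
  have potu: "pot u (reflect e x) = - pot u x" for x
  proof -
    have "pot u (reflect e x) = (\<integral>z. u (reflect e z) / norm (reflect e x - reflect e z) \<partial>lborel)"
      unfolding pot_def by (rule integral_reflect[OF e, symmetric]) measurable
    also have "\<dots> = (\<integral>z. - (u z / norm (x - z)) \<partial>lborel)" by (simp only: odd norm_reflect_diff[OF e] minus_divide_left)
    finally show ?thesis by (simp add: pot_def)
  qed
  have dodd: "dipole e (reflect e x) = - dipole e x" for x
    using e reflect_inner[OF e] by (simp add: dipole_def)
  have row: "(\<integral>\<^sup>+z. ennreal (\<kappa> x z * \<bar>dipole e z\<bar>) \<partial>lborel) = ennreal (1 / \<phi> x * \<bar>dipole e x\<bar>)" if x: "x \<in> T" for x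
  proof -
    have x': "x \<in> S" "x \<bullet> e ~= 0" "x ~= 0" using x by (auto simp: T_def)
    have rx: "reflect e x \<in> S" "reflect e x ~= 0" using x' reflect_S[OF e] norm_reflect[OF e, of x] by auto
    \<comment> \<open>For fixed x the sign of D times the mode is that of x.e for almost all z, so
      the absolute values come off and the integral is a difference of two potentials.\<close>
    define s where "s = sgn (x \<bullet> e)"
    have ae: "AE z in lborel. \<kappa> x z * \<bar>dipole e z\<bar> = s / 2 * (D x z * dipole e z)"
      using AE_lborel_singleton[of x] AE_lborel_singleton[of "reflect e x"]
    proof (eventually_elim)
      case (elim z)
      have "s * (D x z * dipole e z) >= 0"
      proof -
        have sx: "\<bar>x \<bullet> e\<bar> * s = x \<bullet> e" by (simp add: s_def abs_mult_sgn)
        have "\<bar>x \<bullet> e\<bar> * (s * (D x z * dipole e z)) = (\<bar>x \<bullet> e\<bar> * s) * (D x z * dipole e z)" by (simp only: mult.assoc)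
        also have "\<dots> = slope (norm z) * (D x z * ((x \<bullet> e) * (z \<bullet> e)))" unfolding sx dipole_def by (simp only: mult_ac)
        also have "\<dots> >= 0" using sgnD[OF elim] slope_nonneg by simp
        finally have "\<bar>x \<bullet> e\<bar> * 0 <= \<bar>x \<bullet> e\<bar> * (s * (D x z * dipole e z))" by (simp only: mult_zero_right)
        moreover have "\<bar>x \<bullet> e\<bar> > 0" using x'(2) by simp
        ultimately show ?thesis by (rule mult_left_le_imp_le)
      qed
      then have "s * (D x z * dipole e z) = \<bar>s\<bar> * (\<bar>D x z\<bar> * \<bar>dipole e z\<bar>)" by (simp add: abs_mult[symmetric])
      moreover have "\<bar>s\<bar> = 1" using x'(2) by (simp add: s_def abs_sgn_eq)
      ultimately show ?case by (simp add: \<kappa>_def)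
    qed
    have "(\<integral>\<^sup>+z. ennreal (\<kappa> x z * \<bar>dipole e z\<bar>) \<partial>lborel) = (\<integral>\<^sup>+z. ennreal (s / 2 * (D x z * dipole e z)) \<partial>lborel)"
    proof (rule nn_integral_cong_AE)
      show "AE z in lborel. ennreal (\<kappa> x z * \<bar>dipole e z\<bar>) = ennreal (s / 2 * (D x z * dipole e z))"
        using ae by (rule AE_mp) (intro AE_I2 impI, rule arg_cong[where f = ennreal])
    qed
    also have "\<dots> = ennreal (\<integral>z. s / 2 * (D x z * dipole e z) \<partial>lborel)"
    proof (rule nn_integral_eq_integral)
      show "integrable lborel (%z. s / 2 * (D x z * dipole e z))" using Dint(1)[OF dipole_L2S[OF e]] by simp
      show "AE z in lborel. 0 <= s / 2 * (D x z * dipole e z)"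
        using ae
      proof eventually_elim
        case (elim z)
        show ?case unfolding elim[symmetric] by (simp add: \<kappa>_def)
      qed
    qed
    also have "(\<integral>z. s / 2 * (D x z * dipole e z) \<partial>lborel) = s / 2 * (pot (dipole e) x - pot (dipole e) (reflect e x))"
      by (simp only: integral_mult_right_zero Dint(2)[OF dipole_L2S[OF e]])
    also have "\<dots> = s * (dipole e x / \<phi> x)"
      using pot_dipole[OF e x'(1,3)] pot_dipole[OF e rx] norm_reflect[OF e, of x] by (simp add: dodd \<phi>_def)
    also have "\<dots> = 1 / \<phi> x * \<bar>dipole e x\<bar>"
    proof -
      have "\<bar>dipole e x\<bar> = slope (norm x) * \<bar>x \<bullet> e\<bar>" using slope_nonneg[of "norm x"] by (simp add: dipole_def abs_mult)
      also have "\<bar>x \<bullet> e\<bar> = (x \<bullet> e) * s" unfolding s_def by (rule abs_sgn)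
      also have "slope (norm x) * ((x \<bullet> e) * s) = s * dipole e x" unfolding dipole_def by (simp only: mult_ac)
      finally show ?thesis by simp
    qed
    finally show ?thesis .
  qed
  have T0: "u x = 0" if "x \<notin> T" for x
  proof (cases "x \<in> S")
    case True
    then have "x \<bullet> e = 0" using that by (simp add: T_def)
    then have "reflect e x = x" by (simp add: reflect_def)
    then show ?thesis using odd[of x] by simp
  qed (use u in \<open>simp add: L2S_def\<close>)
  have schur: "(\<integral>\<^sup>+x. (\<integral>\<^sup>+z. ennreal (\<kappa> x z * \<bar>u x\<bar> * \<bar>u z\<bar>) \<partial>lborel) \<partial>lborel) <= (\<integral>\<^sup>+x. ennreal (1 / \<phi> x * (u x)\<^sup>2) \<partial>lborel)"
  proof (rule nn_integral_schur[where h = "%x. \<bar>dipole e x\<bar>" and T = T])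
    show "(%(x, z). \<kappa> x z) \<in> borel_measurable (borel \<Otimes>\<^sub>M borel)" unfolding \<kappa>_def D_def by measurable
    show "\<kappa> x z = \<kappa> z x" for x z using Dsym[of x z] by (simp add: \<kappa>_def)
    show "0 < \<bar>dipole e x\<bar>" if "x \<in> T" for x
    proof -
      have "x ~= 0" "norm x < R" "x \<bullet> e ~= 0" using that by (auto simp: T_def)
      moreover from this have "slope (norm x) > 0" by (intro slope_pos) auto
      ultimately show ?thesis by (simp add: dipole_def)
    qed
  qed (use row T0 in \<open>simp_all add: \<kappa>_def\<close>)
  have pt: "ennreal (norm (u x * pot u x)) <= (\<integral>\<^sup>+z. ennreal (\<kappa> x z * \<bar>u x\<bar> * \<bar>u z\<bar>) \<partial>lborel)" for x
  proof -
    have eq: "u x * pot u x = (\<integral>z. u x / 2 * (D x z * u z) \<partial>lborel)"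
      by (simp only: integral_mult_right_zero Dint(2)[OF u] potu) simp
    have i: "integrable lborel (%z. u x / 2 * (D x z * u z))" using Dint(1)[OF u] by simp
    have "ennreal (norm (u x * pot u x)) <= (\<integral>\<^sup>+z. ennreal (norm (u x / 2 * (D x z * u z))) \<partial>lborel)"
      unfolding eq by (rule integral_norm_bound_ennreal[OF i])
    also have "\<dots> = (\<integral>\<^sup>+z. ennreal (\<kappa> x z * \<bar>u x\<bar> * \<bar>u z\<bar>) \<partial>lborel)"
      by (intro nn_integral_cong) (simp add: \<kappa>_def abs_mult mult_ac)
    finally show ?thesis .
  qed
  have pos: "(u x)\<^sup>2 / \<phi> x >= 0" for x
    using \<phi>_pos[of x] u by (cases "x \<in> S") (auto simp: L2S_def)
  have "ennreal (norm (\<integral>x. u x * pot u x \<partial>lborel)) <= (\<integral>\<^sup>+x. ennreal (norm (u x * pot u x)) \<partial>lborel)"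
    by (rule integral_norm_bound_ennreal[OF pot_mult_integrable[OF u u]])
  also have "\<dots> <= (\<integral>\<^sup>+x. (\<integral>\<^sup>+z. ennreal (\<kappa> x z * \<bar>u x\<bar> * \<bar>u z\<bar>) \<partial>lborel) \<partial>lborel)" by (rule nn_integral_mono[OF pt])
  also have "\<dots> <= (\<integral>\<^sup>+x. ennreal ((u x)\<^sup>2 / \<phi> x) \<partial>lborel)" using schur by simp
  also have "\<dots> = ennreal (\<integral>x. (u x)\<^sup>2 / \<phi> x \<partial>lborel)"
    using pos by (intro nn_integral_eq_integral[OF ui]) simp
  finally have "norm (\<integral>x. u x * pot u x \<partial>lborel) <= (\<integral>x. (u x)\<^sup>2 / \<phi> x \<partial>lborel)"
    using pos by (subst (asm) ennreal_le_iff) (auto intro: Bochner_Integration.integral_nonneg)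
  then show ?thesis by simp
qed

section \<open>Positivity of the energy on radial functions of mean zero\<close>

text \<open>The first summand is 3F / F' at y r. Thus \<theta> is the factor by which r times the
  logarithmic derivative of 4\<pi>r^3\<rho> differs from F' / F, and it changes sign where that
  function peaks.\<close>

definition \<theta> :: "real => real" where
  "\<theta> r = k * (c (y r) - inverse (c (y r))) + r * y' r"

definition mass :: "real => real" where "mass r = 4 * pi * r ^ 3 * F (y r)"
definition mass' :: "real => real" where "mass' r = 4 * pi * r\<^sup>2 * F' (y r) * \<theta> r"

lemma c_ge: "s >= 0 ==> c s >= 1" using k by (simp add: c_def)

lemma y_nonneg: "0 <= r ==> r <= R ==> y r >= 0"
  using y_pos[of r] yR by (cases "r = R") auto

text \<open>Since c' = 1 / k, the enthalpy part contributes y' + y' / c^2; by the profile equation r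
  y' contributes - y' - 4 \<pi> r F. The cancellation of y' is where the pressure exponent is
  compared with 4/3.\<close>

lemma \<theta>_deriv:
  assumes r: "0 < r" "r <= R"
  shows "(\<theta> has_real_derivative y' r / (c (y r))\<^sup>2 - 4 * pi * r * F (y r)) (at r)"
proof -
  have c0: "c (y r) ~= 0" using c_ge[of "y r"] y_nonneg[of r] r by auto
  have E: "enthalpy_inv P (y r) = F (y r)" using y_nonneg[of r] r F_0 by (auto simp: enthalpy_inv_eq)
  have dc: "((%r. c (y r)) has_real_derivative 1 / k * y' r) (at r)"
    by (rule DERIV_chain2[where f = c and g = y, OF c_deriv y_deriv[OF r(1)]])
  have "(\<theta> has_real_derivative k * (1 / k * y' r - - (inverse (c (y r)) * (1 / k * y' r) * inverse (c (y r))))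
      + (1 * y' r + (- 4 * pi * F (y r) - 2 / r * y' r) * r)) (at r)"
    unfolding \<theta>_def
    using y'_deriv[OF r(1)] c0 by (intro DERIV_add DERIV_cmult DERIV_diff dc DERIV_inverse' DERIV_mult DERIV_ident) (simp_all add: E)
  also have "k * (1 / k * y' r - - (inverse (c (y r)) * (1 / k * y' r) * inverse (c (y r))))
      + (1 * y' r + (- 4 * pi * F (y r) - 2 / r * y' r) * r) = y' r / (c (y r))\<^sup>2 - 4 * pi * r * F (y r)"
  proof -
    define d where "d = 1 / k * y' r"
    define i where "i = inverse (c (y r))"
    have 1: "k * d = y' r" using k by (simp add: d_def)
    have 2: "2 / r * y' r * r = 2 * y' r" using r by simp
    have 3: "y' r / (c (y r))\<^sup>2 = i * y' r * i" by (simp add: i_def power2_eq_square divide_inverse)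
    have "k * (d - - (i * d * i)) + (1 * y' r + (- 4 * pi * F (y r) - 2 / r * y' r) * r)
        = k * d + i * (k * d) * i + y' r - 4 * pi * r * F (y r) - 2 / r * y' r * r" by argo
    then show ?thesis unfolding d_def[symmetric] i_def[symmetric] 3 1 2 by simp
  qed
  finally show ?thesis .
qed

lemma isCont_\<theta>: "0 < r ==> r <= R ==> isCont \<theta> r" by (rule DERIV_isCont[OF \<theta>_deriv])

lemma \<theta>_decreasing:
  assumes "0 < r" "r < s" "s < R" shows "\<theta> s < \<theta> r"
proof (rule DERIV_neg_imp_decreasing[OF assms(2)])
  fix x assume x: "r <= x" "x <= s"
  have "y' x < 0" "c (y x) >= 1" "F (y x) > 0" using x assms y'_neg[of x] c_ge[of "y x"] y_pos[of x] F_pos[of "y x"] by auto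
  then have "y' x / (c (y x))\<^sup>2 < 0" "4 * pi * x * F (y x) > 0" using x assms by (auto intro!: divide_neg_pos)
  then show "\<exists>D. (\<theta> has_real_derivative D) (at x) & D < 0"
    using \<theta>_deriv[of x] x assms by (intro exI[of _ "y' x / (c (y x))\<^sup>2 - 4 * pi * x * F (y x)"]) auto
qed

text \<open>Connects \<theta> with the equation of state: c^2 - 1 is X^2, so F' supplies one factor
  X and c - 1 / c the other two.\<close>

lemma F'_c: "s >= 0 ==> F' s * (k * (c s - inverse (c s))) = 3 * F s"
proof -
  assume s: "s >= 0"
  have c0: "c s ~= 0" using c_ge[OF s] by auto
  have "F' s * (k * (c s - inverse (c s))) = 3 * B * (X s * ((c s)\<^sup>2 - 1))"
    using k c0 by (simp add: F'_def field_simps power2_eq_square)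
  also have "(c s)\<^sup>2 - 1 = (X s)\<^sup>2" using X(3)[OF s] by simp
  finally show ?thesis by (simp add: F_def power2_eq_square power3_eq_cube)
qed

lemma mass_deriv:
  assumes r: "0 < r" "r < R" shows "(mass has_real_derivative mass' r) (at r)"
proof -
  have "(mass has_real_derivative (4 * pi * (3 * r\<^sup>2)) * F (y r) + (F' (y r) * y' r) * (4 * pi * r ^ 3)) (at r)"
    unfolding mass_def by (intro DERIV_mult Fy_deriv r DERIV_cmult) (auto intro!: derivative_eq_intros)
  also have "(4 * pi * (3 * r\<^sup>2)) * F (y r) + (F' (y r) * y' r) * (4 * pi * r ^ 3)
      = 4 * pi * r\<^sup>2 * (F' (y r) * (k * (c (y r) - inverse (c (y r)))) + F' (y r) * (r * y' r))"
    using F'_c[OF y_nonneg, of r] r by (simp add: algebra_simps power2_eq_square power3_eq_cube)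
  also have "\<dots> = mass' r" by (simp add: mass'_def \<theta>_def algebra_simps)
  finally show ?thesis .
qed

text \<open>Near the centre r y' is negligible against the positive enthalpy part; at the surface c
  = 1, so only the negative term R y'(R) is left.\<close>

lemma \<theta>_zero: obtains r0 where "0 < r0" "r0 < R" "\<theta> r0 = 0"
proof -
  define s where "s = y (R / 2)"
  have s: "s > 0" using y_pos[of "R / 2"] R by (simp add: s_def)
  define K0 where "K0 = k * (c s - inverse (c s))"
  have cs: "c s > 1" by (rule c[OF s])
  have K0: "K0 > 0" using k cs inverse_less_1_iff[of "c s"] by (simp add: K0_def)
  define C where "C = 4 * pi * F (y 0) / 3"
  have C: "C > 0" using F_pos[OF y0] by (simp add: C_def)
  \<comment> \<open>Small enough that |r y'| <= C r^2 is at most K0 / 2 at this radius, while the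
    enthalpy part, decreasing in r, is at least its value K0 at R / 2.\<close>
  define \<epsilon> where "\<epsilon> = min (R / 2) (K0 / (2 * C * R))"
  have \<epsilon>: "\<epsilon> > 0" "\<epsilon> <= R / 2" "\<epsilon> <= K0 / (2 * C * R)" using R K0 C by (auto simp: \<epsilon>_def)
  have "C * \<epsilon> * R <= K0 / 2" using \<epsilon>(3) C R by (simp add: field_simps)
  moreover have "C * \<epsilon> * \<epsilon> <= C * \<epsilon> * R" using \<epsilon> C R by (intro mult_left_mono) auto
  moreover have "\<epsilon> * (- y' \<epsilon>) <= \<epsilon> * (C * \<epsilon>)" using y'_lower[of \<epsilon>] \<epsilon> R by (intro mult_left_mono) (auto simp: C_def)
  moreover have "s <= y \<epsilon>" using y_strict_antimono[of \<epsilon> "R / 2"] \<epsilon> by (cases "\<epsilon> = R / 2") (auto simp: s_def)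
  then have "c s <= c (y \<epsilon>)" using k by (simp add: c_def divide_right_mono)
  then have "c s - inverse (c s) <= c (y \<epsilon>) - inverse (c (y \<epsilon>))" using cs by (intro diff_mono le_imp_inverse_le) auto
  then have "K0 <= k * (c (y \<epsilon>) - inverse (c (y \<epsilon>)))" using k by (simp add: K0_def)
  ultimately have p: "\<theta> \<epsilon> > 0" using K0 by (simp add: \<theta>_def algebra_simps)
  have n: "\<theta> R < 0" using y'_neg[OF R] R by (simp add: \<theta>_def yR c_def mult_pos_neg)
  obtain r0 where r0: "\<epsilon> <= r0" "r0 <= R" "\<theta> r0 = 0"
  proof -
    have "\<exists>x\<ge>\<epsilon>. x <= R & \<theta> x = 0"
    proof (rule IVT2)
      show "\<theta> R <= 0" "0 <= \<theta> \<epsilon>" "\<epsilon> <= R" using p n \<epsilon> R by simp_all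
      show "\<forall>x. \<epsilon> <= x & x <= R --> isCont \<theta> x" using isCont_\<theta> \<epsilon>(1) by (meson less_le_trans)
    qed
    then obtain r0 where "\<epsilon> <= r0" "r0 <= R" "\<theta> r0 = 0" by blast
    then show ?thesis by (rule that)
  qed
  have "r0 ~= R" using r0 n by auto
  then show ?thesis using r0 \<epsilon> by (intro that[of r0]) auto
qed

lemma mass_over: "r > 0 ==> 1 / r\<^sup>2 * mass r = 4 * pi * r * F (y r)"
  by (simp add: mass_def power2_eq_square power3_eq_cube)

lemma mass_nonneg: "0 < r ==> r < R ==> mass r >= 0"
  using F_pos[OF y_pos, of r] by (simp add: mass_def)

text \<open>The supersolution inequality: - \<theta>' = 4 \<pi> r F - y' / c^2 is at least 4 \<pi> r
  F, which is the mass function over r^2.\<close>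

lemma \<theta>_integral:
  assumes "0 < a" "a < b" "b < R"
  shows "(\<integral>\<^sup>+r. ennreal (indicator {a<..<b} r * (1 / r\<^sup>2 * mass r)) \<partial>lborel) <= ennreal (\<theta> a - \<theta> b)"
proof -
  define f where "f r = 4 * pi * r * F (y r) - y' r / (c (y r))\<^sup>2" for r
  have y'2: "- (y' r / (c (y r))\<^sup>2) >= 0" if "0 < r" for r using y'_neg[OF that] by (simp add: divide_nonpos_nonneg)
  have "(\<integral>\<^sup>+r. ennreal (indicator {a<..<b} r * (1 / r\<^sup>2 * mass r)) \<partial>lborel) <= (\<integral>\<^sup>+r. ennreal (indicator {a<..<b} r * f r) \<partial>lborel)"
  proof (intro nn_integral_mono ennreal_leI)
    fix r
    show "indicator {a<..<b} r * (1 / r\<^sup>2 * mass r) <= indicator {a<..<b} r * f r"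
      using mass_over[of r] y'2[of r] assms by (cases "r \<in> {a<..<b}") (auto simp: f_def)
  qed
  also have "\<dots> = ennreal (- \<theta> b - - \<theta> a)"
  proof (rule nn_integral_FTC_nonneg[OF assms(2), where G = "%r. - \<theta> r"])
    fix r assume r: "a < r" "r < b"
    have r': "0 < r" "r < R" using r assms by auto
    have D: "(\<theta> has_real_derivative y' r / (c (y r))\<^sup>2 - 4 * pi * r * F (y r)) (at r)" using \<theta>_deriv[of r] r' by simp
    show "((%r. - \<theta> r) has_real_derivative f r) (at r)" using DERIV_minus[OF D] by (simp add: f_def)
    have "isCont (%r. c (y r)) r" by (rule isCont_o2[OF isCont_y[OF r'(1)] DERIV_isCont[OF c_deriv]])
    moreover have "c (y r) ~= 0" using c_ge[OF y_nonneg, of r] r' by auto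
    ultimately show "isCont f r" unfolding f_def
      using r' by (intro isCont_diff isCont_mult isCont_divide isCont_power isCont_y' isCont_Fy continuous_ident continuous_const) auto
    have "4 * pi * r * F (y r) >= 0" using F_pos[OF y_pos, of r] r' by simp
    then show "0 <= f r" unfolding f_def using y'2[OF r'(1)] by linarith
  next
    have "isCont \<theta> a" "isCont \<theta> b" using isCont_\<theta> assms by auto
    then show "((%r. - \<theta> r) \<longlongrightarrow> - \<theta> a) (at_right a)" "((%r. - \<theta> r) \<longlongrightarrow> - \<theta> b) (at_left b)"
      by (auto simp: isCont_def filterlim_at_split intro: tendsto_minus)
  qed
  finally show ?thesis by simp
qed

lemma isCont_mass': "0 < r ==> r < R ==> isCont mass' r"
  unfolding mass'_def by (intro isCont_mult isCont_power isCont_Fy isCont_\<theta> continuous_ident continuous_const) auto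

text \<open>The mass function \<open>4\<pi>r\<^sup>3\<rho>\<close>, which is the mass displaced by a homologous contraction of the star,
  is a supersolution of the radial Euler-Lagrange equation. It increases up to the zero of \<open>\<theta>\<close> and decreases
  afterwards, so the Hardy inequality is applied from both ends of the interval.\<close>

lemma hardy_radial:
  fixes g :: "real => real"
  assumes [measurable]: "g \<in> borel_measurable borel" and gi: "integrable lborel g" and g1: "(\<integral>t. g t \<partial>lborel) = 0"
    and g0: "!!t. t \<notin> {0<..<R} ==> g t = 0"
  shows "(\<integral>\<^sup>+\<tau>. ennreal (indicator {0<..<R} \<tau> * ((\<integral>t. (if t < \<tau> then g t else 0) \<partial>lborel)\<^sup>2 / \<tau>\<^sup>2)) \<partial>lborel)
    <= (\<integral>\<^sup>+t. ennreal (indicator {0<..<R} t * ((g t)\<^sup>2 / (4 * pi * t\<^sup>2 * F' (y t)))) \<partial>lborel)"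
proof -
  obtain r0 where r0: "0 < r0" "r0 < R" "\<theta> r0 = 0" by (rule \<theta>_zero) (rule that)
  define m where "m \<tau> = (\<integral>t. (if t < \<tau> then g t else 0) \<partial>lborel)" for \<tau>
  define p where "p t = (g t)\<^sup>2 / (4 * pi * t\<^sup>2 * F' (y t))" for t
  have gint: "integrable lborel (%t. if t < \<tau> then g t else 0)" for \<tau>
  proof (rule Bochner_Integration.integrable_bound[OF gi])
    show "(%t. if t < \<tau> then g t else 0) \<in> borel_measurable lborel" by measurable
    show "AE t in lborel. norm (if t < \<tau> then g t else 0) <= norm (g t)" by (intro AE_I2) auto
  qed
  have gint2: "integrable lborel (%t. if \<tau> < t then g t else 0)" for \<tau>
  proof (rule Bochner_Integration.integrable_bound[OF gi])
    show "(%t. if \<tau> < t then g t else 0) \<in> borel_measurable lborel" by measurable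
    show "AE t in lborel. norm (if \<tau> < t then g t else 0) <= norm (g t)" by (intro AE_I2) auto
  qed
  \<comment> \<open>Zero mean allows m to be computed from the outer end, which the estimate beyond
    r0 relies on.\<close>
  have m2: "m \<tau> = - (\<integral>t. (if \<tau> < t then g t else 0) \<partial>lborel)" for \<tau>
  proof -
    have "(\<integral>t. g t \<partial>lborel) = (\<integral>t. (if t < \<tau> then g t else 0) + (if \<tau> < t then g t else 0) \<partial>lborel)"
    proof (rule integral_cong_AE)
      show "AE t in lborel. g t = (if t < \<tau> then g t else 0) + (if \<tau> < t then g t else 0)"
        using AE_lborel_singleton[of \<tau>] by (rule AE_mp) (intro AE_I2, auto)
    qed measurable
    then show ?thesis using g1 by (simp add: m_def Bochner_Integration.integral_add[OF gint gint2])
  qed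
  have F'p: "F' (y t) > 0" if "0 < t" "t < R" for t using F'_pos[OF y_pos, of t] that by simp
  have left: "(\<integral>\<^sup>+\<tau>. ennreal (indicator {0<..<r0} \<tau> * ((m \<tau>)\<^sup>2 / \<tau>\<^sup>2)) \<partial>lborel) <= (\<integral>\<^sup>+t. ennreal (indicator {0<..<r0} t * p t) \<partial>lborel)"
  proof -
    have q: "mass' t > 0" if "t \<in> {0<..<r0}" for t
      using \<theta>_decreasing[of t r0] r0 F'p[of t] that by (simp add: mass'_def)
    have "(\<integral>\<^sup>+\<tau>. ennreal (indicator {0<..<r0} \<tau> * ((m \<tau>)\<^sup>2 / \<tau>\<^sup>2)) \<partial>lborel)
        <= (\<integral>\<^sup>+\<tau>. ennreal (indicator {0<..<r0} \<tau> * (1 / \<tau>\<^sup>2)) * (\<integral>\<^sup>+t. ennreal (indicator {0<..<r0} t * of_bool (t < \<tau>) * \<bar>g t\<bar>) \<partial>lborel)\<^sup>2 \<partial>lborel)"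
    proof (intro nn_integral_mono)
      fix \<tau>
      show "ennreal (indicator {0<..<r0} \<tau> * ((m \<tau>)\<^sup>2 / \<tau>\<^sup>2))
        <= ennreal (indicator {0<..<r0} \<tau> * (1 / \<tau>\<^sup>2)) * (\<integral>\<^sup>+t. ennreal (indicator {0<..<r0} t * of_bool (t < \<tau>) * \<bar>g t\<bar>) \<partial>lborel)\<^sup>2"
      proof (cases "\<tau> \<in> {0<..<r0}")
        case True
        have "ennreal (norm (m \<tau>)) <= (\<integral>\<^sup>+t. ennreal (norm (if t < \<tau> then g t else 0)) \<partial>lborel)"
          unfolding m_def by (rule integral_norm_bound_ennreal[OF gint])
        also have "\<dots> = (\<integral>\<^sup>+t. ennreal (indicator {0<..<r0} t * of_bool (t < \<tau>) * \<bar>g t\<bar>) \<partial>lborel)"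
        proof (intro nn_integral_cong)
          show "ennreal (norm (if t < \<tau> then g t else 0)) = ennreal (indicator {0<..<r0} t * of_bool (t < \<tau>) * \<bar>g t\<bar>)" for t
            using True g0[of t] by (cases "t \<in> {0<..<r0}") auto
        qed
        finally have "ennreal (norm (m \<tau>)) ^ 2 <= (\<integral>\<^sup>+t. ennreal (indicator {0<..<r0} t * of_bool (t < \<tau>) * \<bar>g t\<bar>) \<partial>lborel)\<^sup>2"
          by (rule power_mono) simp
        then have "ennreal ((m \<tau>)\<^sup>2) <= (\<integral>\<^sup>+t. ennreal (indicator {0<..<r0} t * of_bool (t < \<tau>) * \<bar>g t\<bar>) \<partial>lborel)\<^sup>2"
          by (simp add: ennreal_power)
        then have "ennreal (1 / \<tau>\<^sup>2) * ennreal ((m \<tau>)\<^sup>2) <= ennreal (1 / \<tau>\<^sup>2) * (\<integral>\<^sup>+t. ennreal (indicator {0<..<r0} t * of_bool (t < \<tau>) * \<bar>g t\<bar>) \<partial>lborel)\<^sup>2"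
          by (rule mult_left_mono) simp
        moreover have "ennreal (1 / \<tau>\<^sup>2) * ennreal ((m \<tau>)\<^sup>2) = ennreal ((m \<tau>)\<^sup>2 / \<tau>\<^sup>2)" by (simp add: ennreal_mult'[symmetric])
        ultimately show ?thesis using True by simp
      qed simp
    qed
    \<comment> \<open>The weight q = mass' has primitive \<open>mass\<close>, and \<theta> / mass'
      is exactly 1 / (4 \<pi> t^2 F'), the weight of the claim. The bound by \<theta> t uses that
      \<theta> vanishes at r0.\<close>
    also have "\<dots> <= (\<integral>\<^sup>+t. ennreal (indicator {0<..<r0} t * (\<bar>g t\<bar>\<^sup>2 * \<theta> t / mass' t)) \<partial>lborel)"
    proof (rule weighted_hardy[where M = mass and E = "%t \<tau>. t < \<tau>"])
      show "(%t. indicator {0<..<r0} t * mass' t) \<in> borel_measurable borel"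
        by (rule borel_measurable_indicator_isCont) (use r0 isCont_mass' in auto)
      show "(%t. indicator {0<..<r0} t * mass t) \<in> borel_measurable borel"
        by (rule borel_measurable_indicator_isCont) (use r0 DERIV_isCont[OF mass_deriv] in auto)
      show "mass t >= 0" if "t \<in> {0<..<r0}" for t using mass_nonneg[of t] r0 that by simp
      show "\<theta> t >= 0" if "t \<in> {0<..<r0}" for t using \<theta>_decreasing[of t r0] r0 that by simp
      show "(\<integral>\<^sup>+t. ennreal (indicator {0<..<r0} t * of_bool (t < \<tau>) * mass' t) \<partial>lborel) <= ennreal (mass \<tau>)" if \<tau>: "\<tau> \<in> {0<..<r0}" for \<tau>
      proof -
        have "(\<integral>\<^sup>+t. ennreal (indicator {0<..<r0} t * of_bool (t < \<tau>) * mass' t) \<partial>lborel) = (\<integral>\<^sup>+t. ennreal (indicator {0<..<\<tau>} t * mass' t) \<partial>lborel)"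
          using \<tau> by (intro nn_integral_cong) (auto simp: indicator_def)
        also have "\<dots> = ennreal (mass \<tau> - 0)"
        proof (rule nn_integral_FTC_nonneg[where G = mass])
          have "((%r. 4 * pi * r ^ 3 * F (y r)) \<longlongrightarrow> 4 * pi * 0 ^ 3 * F (y 0)) (at_right 0)" by (intro tendsto_intros Fy_at_0)
          then show "(mass \<longlongrightarrow> 0) (at_right 0)" by (simp add: mass_def[abs_def])
          have "isCont mass \<tau>" using \<tau> r0 DERIV_isCont[OF mass_deriv, of \<tau>] by auto
          then show "(mass \<longlongrightarrow> mass \<tau>) (at_left \<tau>)" by (simp add: isCont_def filterlim_at_split)
        qed (use \<tau> r0 in \<open>auto intro!: mass_deriv isCont_mass' less_imp_le[OF q]\<close>)
        finally show ?thesis by simp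
      qed
      show "(\<integral>\<^sup>+\<tau>. ennreal (indicator {0<..<r0} \<tau> * of_bool (t < \<tau>) * (1 / \<tau>\<^sup>2 * mass \<tau>)) \<partial>lborel) <= ennreal (\<theta> t)" if t: "t \<in> {0<..<r0}" for t
      proof -
        have "(\<integral>\<^sup>+\<tau>. ennreal (indicator {0<..<r0} \<tau> * of_bool (t < \<tau>) * (1 / \<tau>\<^sup>2 * mass \<tau>)) \<partial>lborel)
            = (\<integral>\<^sup>+\<tau>. ennreal (indicator {t<..<r0} \<tau> * (1 / \<tau>\<^sup>2 * mass \<tau>)) \<partial>lborel)"
          using t by (intro nn_integral_cong) (auto simp: indicator_def)
        also have "\<dots> <= ennreal (\<theta> t - \<theta> r0)" using t r0 by (intro \<theta>_integral) auto
        finally show ?thesis using r0 by simp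
      qed
    qed (use q in \<open>auto\<close>)
    also have "\<dots> = (\<integral>\<^sup>+t. ennreal (indicator {0<..<r0} t * p t) \<partial>lborel)"
    proof (intro nn_integral_cong)
      fix t
      show "ennreal (indicator {0<..<r0} t * (\<bar>g t\<bar>\<^sup>2 * \<theta> t / mass' t)) = ennreal (indicator {0<..<r0} t * p t)"
        using q[of t] by (cases "t \<in> {0<..<r0}") (auto simp: p_def mass'_def mult.assoc)
    qed
    finally show ?thesis .
  qed
  have right: "(\<integral>\<^sup>+\<tau>. ennreal (indicator {r0<..<R} \<tau> * ((m \<tau>)\<^sup>2 / \<tau>\<^sup>2)) \<partial>lborel) <= (\<integral>\<^sup>+t. ennreal (indicator {r0<..<R} t * p t) \<partial>lborel)"
  proof -
    have q: "- mass' t > 0" if "t \<in> {r0<..<R}" for t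
      using \<theta>_decreasing[of r0 t] r0 F'p[of t] that by (simp add: mass'_def mult_pos_neg)
    have "(\<integral>\<^sup>+\<tau>. ennreal (indicator {r0<..<R} \<tau> * ((m \<tau>)\<^sup>2 / \<tau>\<^sup>2)) \<partial>lborel)
        <= (\<integral>\<^sup>+\<tau>. ennreal (indicator {r0<..<R} \<tau> * (1 / \<tau>\<^sup>2)) * (\<integral>\<^sup>+t. ennreal (indicator {r0<..<R} t * of_bool (\<tau> < t) * \<bar>g t\<bar>) \<partial>lborel)\<^sup>2 \<partial>lborel)"
    proof (intro nn_integral_mono)
      fix \<tau>
      show "ennreal (indicator {r0<..<R} \<tau> * ((m \<tau>)\<^sup>2 / \<tau>\<^sup>2))
        <= ennreal (indicator {r0<..<R} \<tau> * (1 / \<tau>\<^sup>2)) * (\<integral>\<^sup>+t. ennreal (indicator {r0<..<R} t * of_bool (\<tau> < t) * \<bar>g t\<bar>) \<partial>lborel)\<^sup>2"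
      proof (cases "\<tau> \<in> {r0<..<R}")
        case True
        have "ennreal (norm (m \<tau>)) <= (\<integral>\<^sup>+t. ennreal (norm (if \<tau> < t then g t else 0)) \<partial>lborel)"
          unfolding m2 norm_minus_cancel by (rule integral_norm_bound_ennreal[OF gint2])
        also have "\<dots> = (\<integral>\<^sup>+t. ennreal (indicator {r0<..<R} t * of_bool (\<tau> < t) * \<bar>g t\<bar>) \<partial>lborel)"
        proof (intro nn_integral_cong)
          show "ennreal (norm (if \<tau> < t then g t else 0)) = ennreal (indicator {r0<..<R} t * of_bool (\<tau> < t) * \<bar>g t\<bar>)" for t
            using True g0[of t] by (cases "t \<in> {r0<..<R}") auto
        qed
        finally have "ennreal (norm (m \<tau>)) ^ 2 <= (\<integral>\<^sup>+t. ennreal (indicator {r0<..<R} t * of_bool (\<tau> < t) * \<bar>g t\<bar>) \<partial>lborel)\<^sup>2"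
          by (rule power_mono) simp
        then have "ennreal ((m \<tau>)\<^sup>2) <= (\<integral>\<^sup>+t. ennreal (indicator {r0<..<R} t * of_bool (\<tau> < t) * \<bar>g t\<bar>) \<partial>lborel)\<^sup>2"
          by (simp add: ennreal_power)
        then have "ennreal (1 / \<tau>\<^sup>2) * ennreal ((m \<tau>)\<^sup>2) <= ennreal (1 / \<tau>\<^sup>2) * (\<integral>\<^sup>+t. ennreal (indicator {r0<..<R} t * of_bool (\<tau> < t) * \<bar>g t\<bar>) \<partial>lborel)\<^sup>2"
          by (rule mult_left_mono) simp
        moreover have "ennreal (1 / \<tau>\<^sup>2) * ennreal ((m \<tau>)\<^sup>2) = ennreal ((m \<tau>)\<^sup>2 / \<tau>\<^sup>2)" by (simp add: ennreal_mult'[symmetric])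
        ultimately show ?thesis using True by simp
      qed simp
    qed
    \<comment> \<open>Beyond r0 both \<theta> and mass' are negative, so their opposites serve as
      weights; their quotient is unchanged. The mass function vanishes at R, which replaces its
      vanishing at 0.\<close>
    also have "\<dots> <= (\<integral>\<^sup>+t. ennreal (indicator {r0<..<R} t * (\<bar>g t\<bar>\<^sup>2 * (- \<theta> t) / (- mass' t))) \<partial>lborel)"
    proof (rule weighted_hardy[where M = mass and E = "%t \<tau>. \<tau> < t"])
      show "(%t. indicator {r0<..<R} t * (- mass' t)) \<in> borel_measurable borel"
        by (rule borel_measurable_indicator_isCont) (use r0 isCont_mass' in auto)
      show "(%t. indicator {r0<..<R} t * mass t) \<in> borel_measurable borel"
        by (rule borel_measurable_indicator_isCont) (use r0 DERIV_isCont[OF mass_deriv] in auto)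
      show "mass t >= 0" if "t \<in> {r0<..<R}" for t using mass_nonneg[of t] r0 that by simp
      show "- \<theta> t >= 0" if "t \<in> {r0<..<R}" for t using \<theta>_decreasing[of r0 t] r0 that by simp
      show "(\<integral>\<^sup>+t. ennreal (indicator {r0<..<R} t * of_bool (\<tau> < t) * (- mass' t)) \<partial>lborel) <= ennreal (mass \<tau>)" if \<tau>: "\<tau> \<in> {r0<..<R}" for \<tau>
      proof -
        have "(\<integral>\<^sup>+t. ennreal (indicator {r0<..<R} t * of_bool (\<tau> < t) * (- mass' t)) \<partial>lborel) = (\<integral>\<^sup>+t. ennreal (indicator {\<tau><..<R} t * (- mass' t)) \<partial>lborel)"
          using \<tau> by (intro nn_integral_cong) (auto simp: indicator_def)
        also have "\<dots> = ennreal (- 0 - - mass \<tau>)"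
        proof (rule nn_integral_FTC_nonneg[where G = "%r. - mass r"])
          have "((%r. - (4 * pi * r ^ 3 * F (y r))) \<longlongrightarrow> - (4 * pi * R ^ 3 * 0)) (at_left R)" by (intro tendsto_intros Fy_at_R)
          then show "((%r. - mass r) \<longlongrightarrow> - 0) (at_left R)" by (simp add: mass_def)
          have "isCont mass \<tau>" using \<tau> r0 DERIV_isCont[OF mass_deriv, of \<tau>] by auto
          then show "((%r. - mass r) \<longlongrightarrow> - mass \<tau>) (at_right \<tau>)" by (auto simp: isCont_def filterlim_at_split intro: tendsto_minus)
        qed (use \<tau> r0 in \<open>auto intro!: DERIV_minus mass_deriv isCont_minus isCont_mass' simp: less_imp_le[OF q, simplified]\<close>)
        finally show ?thesis by simp
      qed
      show "(\<integral>\<^sup>+\<tau>. ennreal (indicator {r0<..<R} \<tau> * of_bool (\<tau> < t) * (1 / \<tau>\<^sup>2 * mass \<tau>)) \<partial>lborel) <= ennreal (- \<theta> t)" if t: "t \<in> {r0<..<R}" for t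
      proof -
        have "(\<integral>\<^sup>+\<tau>. ennreal (indicator {r0<..<R} \<tau> * of_bool (\<tau> < t) * (1 / \<tau>\<^sup>2 * mass \<tau>)) \<partial>lborel)
            = (\<integral>\<^sup>+\<tau>. ennreal (indicator {r0<..<t} \<tau> * (1 / \<tau>\<^sup>2 * mass \<tau>)) \<partial>lborel)"
          using t by (intro nn_integral_cong) (auto simp: indicator_def)
        also have "\<dots> <= ennreal (\<theta> r0 - \<theta> t)" using t r0 by (intro \<theta>_integral) auto
        finally show ?thesis using r0 by simp
      qed
    qed (use q in \<open>auto\<close>)
    also have "\<dots> = (\<integral>\<^sup>+t. ennreal (indicator {r0<..<R} t * p t) \<partial>lborel)"
    proof (intro nn_integral_cong)
      fix t
      show "ennreal (indicator {r0<..<R} t * (\<bar>g t\<bar>\<^sup>2 * (- \<theta> t) / (- mass' t))) = ennreal (indicator {r0<..<R} t * p t)"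
        using q[of t] by (cases "t \<in> {r0<..<R}") (auto simp: p_def mass'_def mult.assoc)
    qed
    finally show ?thesis .
  qed
  have p0: "indicator {0<..<R} t * p t >= 0" for t using F'p[of t] by (cases "t \<in> {0<..<R}") (auto simp: p_def)
  have split: "(\<integral>\<^sup>+t. ennreal (indicator {0<..<R} t * h t) \<partial>lborel) = (\<integral>\<^sup>+t. ennreal (indicator {0<..<r0} t * h t) \<partial>lborel) + (\<integral>\<^sup>+t. ennreal (indicator {r0<..<R} t * h t) \<partial>lborel)"
    if [measurable]: "(%t. indicator {0<..<R} t * h t) \<in> borel_measurable borel" for h :: "real => real"
  proof -
    have e: "indicator {0<..<r0} t * h t = indicator {0<..<r0} t * (indicator {0<..<R} t * h t)"
      "indicator {r0<..<R} t * h t = indicator {r0<..<R} t * (indicator {0<..<R} t * h t)" for t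
      using r0 by (auto simp: indicator_def)
    have "(\<integral>\<^sup>+t. ennreal (indicator {0<..<R} t * h t) \<partial>lborel) = (\<integral>\<^sup>+t. ennreal (indicator {0<..<r0} t * h t) + ennreal (indicator {r0<..<R} t * h t) \<partial>lborel)"
    proof (rule nn_integral_cong_AE)
      show "AE t in lborel. ennreal (indicator {0<..<R} t * h t) = ennreal (indicator {0<..<r0} t * h t) + ennreal (indicator {r0<..<R} t * h t)"
        using AE_lborel_singleton[of r0] by (rule AE_mp) (intro AE_I2, use r0 in \<open>auto simp: indicator_def\<close>)
    qed
    also have "\<dots> = (\<integral>\<^sup>+t. ennreal (indicator {0<..<r0} t * h t) \<partial>lborel) + (\<integral>\<^sup>+t. ennreal (indicator {r0<..<R} t * h t) \<partial>lborel)"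
      unfolding e by (rule nn_integral_add) measurable
    finally show ?thesis .
  qed
  have mm [measurable]: "m \<in> borel_measurable borel" unfolding m_def by measurable
  have pm: "(%t. indicator {0<..<R} t * p t) \<in> borel_measurable borel"
  proof -
    have "(%t. indicator {0<..<R} t * (1 / (4 * pi * t\<^sup>2 * F' (y t)))) \<in> borel_measurable borel"
    proof (rule borel_measurable_indicator_isCont)
      show "isCont (%t. 1 / (4 * pi * t\<^sup>2 * F' (y t))) t" if "t \<in> {0<..<R}" for t
        using that F'p[of t] by (intro isCont_divide isCont_mult isCont_power isCont_Fy continuous_ident continuous_const) auto
    qed simp
    then have "(%t. (g t)\<^sup>2 * (indicator {0<..<R} t * (1 / (4 * pi * t\<^sup>2 * F' (y t))))) \<in> borel_measurable borel" by measurable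
    then show ?thesis by (simp add: p_def mult_ac)
  qed
  have mq: "(%\<tau>. indicator {0<..<R} \<tau> * ((m \<tau>)\<^sup>2 / \<tau>\<^sup>2)) \<in> borel_measurable borel"
    by (intro borel_measurable_times borel_measurable_indicator borel_measurable_divide borel_measurable_power mm) simp_all
  show ?thesis
    unfolding m_def[symmetric] p_def[symmetric] split[OF pm] split[OF mq] by (rule add_mono[OF left right])
qed

end

section \<open>Reflected eigenfunctions\<close>

lemma integrable_reflect_iff:
  fixes f :: "real^3 => 'b::{banach, second_countable_topology}"
  assumes e: "norm e = 1"
  shows "integrable lborel (%x. f (reflect e x)) \<longleftrightarrow> integrable lborel f"
  using integrable_reflect[OF e, of f] integrable_reflect[OF e, of "%x. f (reflect e x)"] reflect_reflect[OF e] by auto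

text \<open>Free of measurability conditions: integrability is itself invariant, and otherwise both
  integrals have the default value 0.\<close>

lemma integral_reflect_all:
  fixes f :: "real^3 => 'b::{banach, second_countable_topology}"
  assumes e: "norm e = 1"
  shows "(\<integral>x. f (reflect e x) \<partial>lborel) = (\<integral>x. f x \<partial>lborel)"
proof (cases "integrable lborel f")
  case True
  then have "f \<in> borel_measurable borel" using borel_measurable_integrable[OF True] by simp
  then show ?thesis by (rule integral_reflect[OF e])
next
  case False
  then show ?thesis using integrable_reflect_iff[OF e, of f] by (simp add: not_integrable_integral_eq)
qed

lemma reflect_nth: "reflect e x $ i = x $ i - 2 * (x $ 1 * e $ 1 + x $ 2 * e $ 2 + x $ 3 * e $ 3) * e $ i"
  by (simp add: reflect_def inner_vec_def sum_3)

lemma Ck_uminus: "Ck k f ==> Ck k (%x. - f x)"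
  using Ck_mult[OF Ck_const[of k "-1"], of f] by simp

lemma has_derivative_reflect: "(reflect e has_derivative reflect e) (at x)"
  using linear_reflect[of e] by (simp add: linear_imp_has_derivative)

lemma Ck_reflect:
  assumes e: "norm e = 1"
  shows "Ck k f ==> Ck k (%x. f (reflect e x))"
proof (induction k arbitrary: f)
  case 0
  then have "continuous_on UNIV f" by simp
  moreover have "continuous_on UNIV (reflect e)" by (rule linear_continuous_on) (simp add: linear_reflect linear_conv_bounded_linear[symmetric])
  ultimately show ?case by (auto intro: continuous_on_compose2)
next
  case (Suc k)
  then obtain g where g: "!!x. (f has_derivative (%h. g x \<bullet> h)) (at x)" "!!i. Ck k (%x. g x $ i)" by auto
  have "((%x. f (reflect e x)) has_derivative (%h. reflect e (g (reflect e x)) \<bullet> h)) (at x)" for x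
    using has_derivative_compose[OF has_derivative_reflect g(1)[of "reflect e x"]] by (simp only: inner_reflect[OF e])
  moreover have "Ck k (%x. reflect e (g (reflect e x)) $ i)" for i
    unfolding reflect_nth diff_conv_add_uminus
    by (intro Ck_add Ck_uminus Ck_mult Ck_const Suc.IH[of "%x. g x $ _"] g(2))
  ultimately show ?case by fastforce
qed

lemma smooth_reflect: "norm e = 1 ==> smooth f ==> smooth (%x. f (reflect e x))"
  by (simp add: smooth_def Ck_reflect)

lemma partial_reflect:
  assumes e: "norm e = 1" and f: "smooth f"
  shows "partial i (%x. f (reflect e x)) x = reflect e (\<chi> j. partial j f (reflect e x)) $ i"
proof (rule has_derivative_inner_axis)
  show "((%x. f (reflect e x)) has_derivative (%h. reflect e (\<chi> j. partial j f (reflect e x)) \<bullet> h)) (at x)"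
    using has_derivative_compose[OF has_derivative_reflect smooth_has_derivative[OF f, of "reflect e x"]] by (simp only: inner_reflect[OF e])
qed

definition reflect_matrix :: "real^3 => 3 => 3 => real" where
  "reflect_matrix e i j = of_bool (i = j) - 2 * e $ i * e $ j"

lemma reflect_matrix_sym: "reflect_matrix e i j = reflect_matrix e j i"
  by (simp add: reflect_matrix_def)

lemma reflect_matrix_nth: "reflect e x $ i = (\<Sum>j\<in>UNIV. reflect_matrix e i j * x $ j)"
  by (cases i rule: exhaust_3[THEN disjE]) (auto simp: reflect_nth reflect_matrix_def sum_3 algebra_simps)

text \<open>The complex-linear extension of the reflection, acting separately on real and imaginary
  parts.\<close>

definition creflect :: "real^3 => complex^3 => complex^3" where
  "creflect e v = (\<chi> i. \<Sum>j\<in>UNIV. complex_of_real (reflect_matrix e i j) * v $ j)"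

lemma creflect_nth: "creflect e v $ i = (\<Sum>j\<in>UNIV. complex_of_real (reflect_matrix e i j) * v $ j)"
  by (simp add: creflect_def)

lemma bounded_linear_creflect: "bounded_linear (creflect e)"
  unfolding linear_conv_bounded_linear[symmetric]
  by (intro linearI) (simp_all add: vec_eq_iff creflect_nth sum.distrib scaleR_sum_right algebra_simps)

lemma creflect_scaleR: "creflect e (a *\<^sub>R v) = a *\<^sub>R creflect e v"
  by (simp add: vec_eq_iff creflect_nth scaleR_sum_right)

lemma creflect_mult: "creflect e (z *s v) = z *s creflect e v"
  by (simp add: vec_eq_iff creflect_nth sum_distrib_left mult_ac)

lemma creflect_uminus: "creflect e (- v) = - creflect e v"
  by (simp add: vec_eq_iff creflect_nth sum_negf)

lemma norm_sq_Re_Im: "(norm v)\<^sup>2 = (norm (\<chi> i. Re (v $ i)))\<^sup>2 + (norm (\<chi> i. Im (v $ i)))\<^sup>2" for v :: "complex^3"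
  by (simp add: ball_domain.norm_sq_vec[of 1] ball_domain_def sum.distrib[symmetric] cmod_power2)

lemma norm_creflect: "norm e = 1 ==> norm (creflect e v) = norm v"
proof -
  assume e: "norm e = 1"
  have 1: "(\<chi> i. Re (creflect e v $ i)) = reflect e (\<chi> i. Re (v $ i))" by (simp add: vec_eq_iff creflect_nth reflect_matrix_nth)
  have 2: "(\<chi> i. Im (creflect e v $ i)) = reflect e (\<chi> i. Im (v $ i))" by (simp add: vec_eq_iff creflect_nth reflect_matrix_nth)
  have "(norm (creflect e v))\<^sup>2 = (norm v)\<^sup>2" unfolding norm_sq_Re_Im 1 2 norm_reflect[OF e] ..
  then show ?thesis by (simp add: power2_eq_iff_nonneg)
qed

section \<open>Reflections acting on weak derivatives\<close>

context ball_domain begin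

lemma reflect_in_S: "norm e = 1 ==> reflect e x \<in> S \<longleftrightarrow> x \<in> S" by simp

lemma indicator_reflect_S: "norm e = 1 ==> indicator S (reflect e x) = (indicator S x :: real)"
  by (simp add: indicator_def)

lemma test_functions_reflect:
  assumes e: "norm e = 1" and \<psi>: "\<psi> \<in> test_functions S"
  shows "(%x. \<psi> (reflect e x)) \<in> test_functions S"
proof -
  obtain K where K: "smooth \<psi>" "compact K" "K \<subseteq> S" "!!x. x \<notin> K ==> \<psi> x = 0"
    by (rule test_functionsE[OF \<psi>]) (rule that)
  show ?thesis
  proof (rule test_functionsI[OF smooth_reflect[OF e K(1)]])
    show "compact (reflect e ` K)" using K(2) by (intro compact_continuous_image linear_continuous_on) (simp_all add: linear_reflect linear_conv_bounded_linear[symmetric])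
    show "reflect e ` K \<subseteq> S" using K(3) reflect_in_S[OF e] by blast
    show "\<psi> (reflect e x) = 0" if "x \<notin> reflect e ` K" for x
      using K(4)[of "reflect e x"] that reflect_reflect[OF e, of x] by (metis imageI)
  qed
qed

lemma locally_integrable_test:
  assumes h: "locally_integrable S (h :: real^3 => complex)" and \<psi>: "\<psi> \<in> test_functions S"
  shows "set_integrable lborel S (%x. h x * complex_of_real (\<psi> x))"
proof -
  obtain K where K: "smooth \<psi>" "compact K" "K \<subseteq> S" "!!x. x \<notin> K ==> \<psi> x = 0"
    by (rule test_functionsE[OF \<psi>]) (rule that)
  obtain M where M: "!!x. \<bar>\<psi> x\<bar> <= M" by (rule test_functions_bounded[OF \<psi>]) (rule that)
  have i: "integrable lborel (%x. indicator K x *\<^sub>R h x)"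
    using h K by (simp add: locally_integrable_def set_integrable_def)
  have pm: "\<psi> \<in> borel_measurable lborel" using test_functions_measurable[OF \<psi>] by simp
  have "integrable lborel (%x. (indicator K x *\<^sub>R h x) * complex_of_real (\<psi> x))"
  proof (rule Bochner_Integration.integrable_bound)
    show "integrable lborel (%x. M *\<^sub>R (indicator K x *\<^sub>R h x))" using i by (rule integrable_scaleR_right)
    show "(%x. (indicator K x *\<^sub>R h x) * complex_of_real (\<psi> x)) \<in> borel_measurable lborel"
      using borel_measurable_integrable[OF i] pm by (intro borel_measurable_times borel_measurable_of_real) auto
    have "norm ((indicator K x *\<^sub>R h x) * complex_of_real (\<psi> x)) <= norm (M *\<^sub>R (indicator K x *\<^sub>R h x))" for x
    proof -
      have "\<bar>\<psi> x\<bar> * (indicator K x * cmod (h x)) <= \<bar>M\<bar> * (indicator K x * cmod (h x))"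
        by (rule mult_right_mono[OF order_trans[OF M abs_ge_self]]) simp
      then show ?thesis by (simp add: norm_mult abs_mult mult_ac)
    qed
    then show "AE x in lborel. norm ((indicator K x *\<^sub>R h x) * complex_of_real (\<psi> x)) <= norm (M *\<^sub>R (indicator K x *\<^sub>R h x))" by simp
  qed
  moreover have "(%x. (indicator K x *\<^sub>R h x) * complex_of_real (\<psi> x)) = (%x. indicator S x *\<^sub>R (h x * complex_of_real (\<psi> x)))"
  proof
    show "(indicator K x *\<^sub>R h x) * complex_of_real (\<psi> x) = indicator S x *\<^sub>R (h x * complex_of_real (\<psi> x))" for x
      using K(3,4)[of] K(4)[of x] by (cases "x \<in> K") (auto simp: subset_iff)
  qed
  ultimately show ?thesis by (simp add: set_integrable_def)
qed

lemma locally_integrable_nth: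
  assumes "locally_integrable S (v :: real^3 => complex^3)" shows "locally_integrable S (%x. v x $ i)"
  unfolding locally_integrable_def
proof (intro allI impI)
  fix K assume "compact K & K \<subseteq> S"
  then have "integrable lborel (%x. indicator K x *\<^sub>R v x)" using assms by (simp add: locally_integrable_def set_integrable_def)
  from integrable_bounded_linear[OF bounded_linear_vec_nth this]
  show "set_integrable lborel K (%x. v x $ i)" by (simp add: set_integrable_def)
qed

lemma locally_integrable_reflect:
  fixes h :: "real^3 => 'b::euclidean_space"
  assumes e: "norm e = 1" and h: "locally_integrable S h"
  shows "locally_integrable S (%x. h (reflect e x))"
  unfolding locally_integrable_def
proof (intro allI impI)
  fix K assume K: "compact K & K \<subseteq> S"
  have c: "compact (reflect e ` K)" using K by (intro compact_continuous_image linear_continuous_on) (simp_all add: linear_reflect linear_conv_bounded_linear[symmetric])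
  have s: "reflect e ` K \<subseteq> S" using K reflect_in_S[OF e] by blast
  have "integrable lborel (%x. indicator (reflect e ` K) x *\<^sub>R h x)"
    using h c s by (simp add: locally_integrable_def set_integrable_def)
  then have "integrable lborel (%x. indicator (reflect e ` K) (reflect e x) *\<^sub>R h (reflect e x))"
    by (rule integrable_reflect[OF e])
  moreover have "indicator (reflect e ` K) (reflect e x) = (indicator K x :: real)" for x
  proof -
    have "reflect e x \<in> reflect e ` K \<longleftrightarrow> x \<in> K" using reflect_reflect[OF e] by (metis imageE imageI)
    then show ?thesis by (simp add: indicator_def)
  qed
  ultimately show "set_integrable lborel K (%x. h (reflect e x))" by (simp add: set_integrable_def)
qed

lemma locally_integrable_bounded_linear:
  fixes h :: "real^3 => 'b::euclidean_space" and T :: "'b => 'c::euclidean_space"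
  assumes T: "bounded_linear T" and h: "locally_integrable S h"
  shows "locally_integrable S (%x. T (h x))"
  unfolding locally_integrable_def
proof (intro allI impI)
  fix K assume "compact K & K \<subseteq> S"
  then have "integrable lborel (%x. indicator K x *\<^sub>R h x)" using h by (simp add: locally_integrable_def set_integrable_def)
  from integrable_bounded_linear[OF T this]
  show "set_integrable lborel K (%x. T (h x))" by (simp add: set_integrable_def linear_simps[OF T])
qed

lemma locally_integrable_diff:
  fixes h h' :: "real^3 => 'b::euclidean_space"
  assumes "locally_integrable S h" "locally_integrable S h'"
  shows "locally_integrable S (%x. h x - h' x)"
  using assms unfolding locally_integrable_def by (auto intro!: set_integral_diff)

lemma set_integral_reflect:
  fixes f :: "real^3 => 'b::{banach, second_countable_topology}"
  assumes e: "norm e = 1"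
  shows "(LINT x:S|lborel. f (reflect e x)) = (LINT x:S|lborel. f x)"
  unfolding set_lebesgue_integral_def
  using integral_reflect_all[OF e, of "%x. indicator S x *\<^sub>R f x"] by (simp only: indicator_reflect_S[OF e])

text \<open>A change of variables moves the reflection onto the test function, whose gradient is
  transformed by the reflection matrix; that matrix is its own transpose and inverse.\<close>

lemma has_weak_gradient_reflect:
  assumes e: "norm e = 1" and hg: "has_weak_gradient S h g"
  shows "has_weak_gradient S (%x. h (reflect e x)) (%x. creflect e (g (reflect e x)))"
  unfolding has_weak_gradient_def
proof (intro conjI ballI allI)
  have lh: "locally_integrable S h" and lg: "locally_integrable S g" using hg by (simp_all add: has_weak_gradient_def)
  show "locally_integrable S (%x. h (reflect e x))" by (rule locally_integrable_reflect[OF e lh])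
  show "locally_integrable S (%x. creflect e (g (reflect e x)))"
    by (rule locally_integrable_bounded_linear[OF bounded_linear_creflect locally_integrable_reflect[OF e lg]])
  fix \<psi> i assume \<psi>: "\<psi> \<in> test_functions S"
  have sm: "smooth \<psi>" using \<psi> by (simp add: test_functions_def smooth_def)
  define \<eta> where "\<eta> x = \<psi> (reflect e x)" for x
  have \<eta>: "\<eta> \<in> test_functions S" unfolding \<eta>_def by (rule test_functions_reflect[OF e \<psi>])
  have s\<eta>: "smooth \<eta>" using \<eta> by (simp add: test_functions_def smooth_def)
  have p: "partial i \<psi> (reflect e x) = (\<Sum>j\<in>UNIV. reflect_matrix e i j * partial j \<eta> x)" for x
  proof -
    have "\<psi> = (%x. \<eta> (reflect e x))" by (simp add: \<eta>_def reflect_reflect[OF e])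
    then have "partial i \<psi> (reflect e x) = reflect e (\<chi> j. partial j \<eta> (reflect e (reflect e x))) $ i"
      using partial_reflect[OF e s\<eta>, of i "reflect e x"] by simp
    then show ?thesis by (simp add: reflect_reflect[OF e] reflect_matrix_nth)
  qed
  have "(LINT x:S|lborel. h (reflect e x) * complex_of_real (partial i \<psi> x))
      = (LINT x:S|lborel. h x * complex_of_real (partial i \<psi> (reflect e x)))"
    using set_integral_reflect[OF e, of "%x. h x * complex_of_real (partial i \<psi> (reflect e x))"] by (simp only: reflect_reflect[OF e])
  also have "\<dots> = (LINT x:S|lborel. (\<Sum>j\<in>UNIV. complex_of_real (reflect_matrix e i j) * (h x * complex_of_real (partial j \<eta> x))))"
    by (simp add: p sum_distrib_left mult_ac)
  also have "\<dots> = (\<Sum>j\<in>UNIV. complex_of_real (reflect_matrix e i j) * (LINT x:S|lborel. h x * complex_of_real (partial j \<eta> x)))"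
    by (subst set_integral_sum) (auto intro!: set_integrable_mult_right locally_integrable_test[OF lh test_functions_partial[OF \<eta>]])
  also have "\<dots> = (\<Sum>j\<in>UNIV. complex_of_real (reflect_matrix e i j) * - (LINT x:S|lborel. g x $ j * complex_of_real (\<eta> x)))"
    using hg \<eta> by (simp add: has_weak_gradient_def)
  also have "\<dots> = - (\<Sum>j\<in>UNIV. LINT x:S|lborel. complex_of_real (reflect_matrix e i j) * (g x $ j * complex_of_real (\<eta> x)))"
    by (simp add: sum_negf)
  also have "(\<Sum>j\<in>UNIV. LINT x:S|lborel. complex_of_real (reflect_matrix e i j) * (g x $ j * complex_of_real (\<eta> x)))
      = (LINT x:S|lborel. (\<Sum>j\<in>UNIV. complex_of_real (reflect_matrix e i j) * (g x $ j * complex_of_real (\<eta> x))))"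
    by (rule set_integral_sum[symmetric]) (intro set_integrable_mult_right locally_integrable_test[OF locally_integrable_nth[OF lg] \<eta>])
  also have "\<dots> = (LINT x:S|lborel. creflect e (g x) $ i * complex_of_real (\<psi> (reflect e x)))"
    by (simp add: creflect_nth \<eta>_def sum_distrib_right mult.assoc)
  also have "\<dots> = (LINT x:S|lborel. creflect e (g (reflect e x)) $ i * complex_of_real (\<psi> x))"
    using set_integral_reflect[OF e, of "%x. creflect e (g x) $ i * complex_of_real (\<psi> (reflect e x))"] by (simp only: reflect_reflect[OF e])
  finally show "(LINT x:S|lborel. h (reflect e x) * complex_of_real (partial i \<psi> x))
      = - (LINT x:S|lborel. creflect e (g (reflect e x)) $ i * complex_of_real (\<psi> x))" .
qed

text \<open>The same change of variables; symmetry of the reflection matrix carries it from the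
  field to the gradient of the reflected test function.\<close>

lemma has_weak_divergence_reflect:
  assumes e: "norm e = 1" and vd: "has_weak_divergence S v d"
  shows "has_weak_divergence S (%x. creflect e (v (reflect e x))) (%x. d (reflect e x))"
  unfolding has_weak_divergence_def
proof (intro conjI ballI)
  have lv: "locally_integrable S v" and ld: "locally_integrable S d" using vd by (simp_all add: has_weak_divergence_def)
  show "locally_integrable S (%x. d (reflect e x))" by (rule locally_integrable_reflect[OF e ld])
  show "locally_integrable S (%x. creflect e (v (reflect e x)))"
    by (rule locally_integrable_bounded_linear[OF bounded_linear_creflect locally_integrable_reflect[OF e lv]])
  fix \<psi> assume \<psi>: "\<psi> \<in> test_functions S"
  have sm: "smooth \<psi>" using \<psi> by (simp add: test_functions_def smooth_def)
  define \<eta> where "\<eta> x = \<psi> (reflect e x)" for x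
  have \<eta>: "\<eta> \<in> test_functions S" unfolding \<eta>_def by (rule test_functions_reflect[OF e \<psi>])
  have p: "partial j \<eta> x = (\<Sum>i\<in>UNIV. reflect_matrix e i j * partial i \<psi> (reflect e x))" for x j
    using partial_reflect[OF e sm, of j x] by (simp add: \<eta>_def[abs_def] reflect_matrix_nth reflect_matrix_sym[of e j])
  have eq: "(\<Sum>i\<in>UNIV. creflect e w $ i * complex_of_real (partial i \<psi> (reflect e x))) = (\<Sum>j\<in>UNIV. w $ j * complex_of_real (partial j \<eta> x))" for w x
  proof -
    have "(\<Sum>i\<in>UNIV. creflect e w $ i * complex_of_real (partial i \<psi> (reflect e x)))
        = (\<Sum>i\<in>UNIV. \<Sum>j\<in>UNIV. w $ j * (complex_of_real (reflect_matrix e i j) * complex_of_real (partial i \<psi> (reflect e x))))"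
      by (simp add: creflect_nth sum_distrib_right sum_distrib_left mult_ac)
    also have "\<dots> = (\<Sum>j\<in>UNIV. \<Sum>i\<in>UNIV. w $ j * (complex_of_real (reflect_matrix e i j) * complex_of_real (partial i \<psi> (reflect e x))))"
      by (rule sum.swap)
    also have "\<dots> = (\<Sum>j\<in>UNIV. w $ j * complex_of_real (partial j \<eta> x))" by (simp add: p sum_distrib_left)
    finally show ?thesis .
  qed
  have "(LINT x:S|lborel. (\<Sum>i\<in>UNIV. creflect e (v (reflect e x)) $ i * complex_of_real (partial i \<psi> x)))
      = (LINT x:S|lborel. (\<Sum>i\<in>UNIV. creflect e (v x) $ i * complex_of_real (partial i \<psi> (reflect e x))))"
    using set_integral_reflect[OF e, of "%x. (\<Sum>i\<in>UNIV. creflect e (v x) $ i * complex_of_real (partial i \<psi> (reflect e x)))"]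
    by (simp only: reflect_reflect[OF e])
  also have "\<dots> = - (LINT x:S|lborel. d x * complex_of_real (\<eta> x))"
    unfolding eq using vd \<eta> by (simp add: has_weak_divergence_def)
  also have "\<dots> = - (LINT x:S|lborel. d (reflect e x) * complex_of_real (\<psi> x))"
    using set_integral_reflect[OF e, of "%x. d x * complex_of_real (\<eta> x)"] by (simp only: reflect_reflect[OF e] \<eta>_def)
  finally show "(LINT x:S|lborel. (\<Sum>i\<in>UNIV. creflect e (v (reflect e x)) $ i * complex_of_real (partial i \<psi> x)))
      = - (LINT x:S|lborel. d (reflect e x) * complex_of_real (\<psi> x))" .
qed

lemma has_weak_gradient_diff:
  assumes a: "has_weak_gradient S h g" and b: "has_weak_gradient S h' g'"
  shows "has_weak_gradient S (%x. h x - h' x) (%x. g x - g' x)"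
  unfolding has_weak_gradient_def
proof (intro conjI ballI allI)
  note l = a[unfolded has_weak_gradient_def, THEN conjunct1] b[unfolded has_weak_gradient_def, THEN conjunct1]
    a[unfolded has_weak_gradient_def, THEN conjunct2, THEN conjunct1] b[unfolded has_weak_gradient_def, THEN conjunct2, THEN conjunct1]
  show "locally_integrable S (%x. h x - h' x)" "locally_integrable S (%x. g x - g' x)"
    by (rule locally_integrable_diff, rule l, rule l)+
  fix \<psi> i assume \<psi>: "\<psi> \<in> test_functions S"
  have "(LINT x:S|lborel. (h x - h' x) * complex_of_real (partial i \<psi> x))
      = (LINT x:S|lborel. h x * complex_of_real (partial i \<psi> x)) - (LINT x:S|lborel. h' x * complex_of_real (partial i \<psi> x))"
    unfolding left_diff_distrib by (intro set_integral_diff(2) locally_integrable_test l test_functions_partial \<psi>)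
  moreover have "(LINT x:S|lborel. (g x - g' x) $ i * complex_of_real (\<psi> x))
      = (LINT x:S|lborel. g x $ i * complex_of_real (\<psi> x)) - (LINT x:S|lborel. g' x $ i * complex_of_real (\<psi> x))"
    unfolding left_diff_distrib vector_minus_component by (intro set_integral_diff(2) locally_integrable_test locally_integrable_nth l \<psi>)
  ultimately show "(LINT x:S|lborel. (h x - h' x) * complex_of_real (partial i \<psi> x)) = - (LINT x:S|lborel. (g x - g' x) $ i * complex_of_real (\<psi> x))"
    using a b \<psi> by (simp add: has_weak_gradient_def)
qed

lemma has_weak_divergence_diff:
  assumes a: "has_weak_divergence S v d" and b: "has_weak_divergence S v' d'"
  shows "has_weak_divergence S (%x. v x - v' x) (%x. d x - d' x)"
  unfolding has_weak_divergence_def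
proof (intro conjI ballI)
  note l = a[unfolded has_weak_divergence_def, THEN conjunct1] b[unfolded has_weak_divergence_def, THEN conjunct1]
    a[unfolded has_weak_divergence_def, THEN conjunct2, THEN conjunct1] b[unfolded has_weak_divergence_def, THEN conjunct2, THEN conjunct1]
  show "locally_integrable S (%x. v x - v' x)" "locally_integrable S (%x. d x - d' x)"
    by (rule locally_integrable_diff, rule l, rule l)+
  fix \<psi> assume \<psi>: "\<psi> \<in> test_functions S"
  have s: "set_integrable lborel S (%x. \<Sum>i\<in>UNIV. u x $ i * complex_of_real (partial i \<psi> x))" if "locally_integrable S u" for u :: "real^3 => complex^3"
    by (intro set_integrable_sum locally_integrable_test locally_integrable_nth that test_functions_partial \<psi>)
  have "(LINT x:S|lborel. (\<Sum>i\<in>UNIV. (v x - v' x) $ i * complex_of_real (partial i \<psi> x)))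
      = (LINT x:S|lborel. (\<Sum>i\<in>UNIV. v x $ i * complex_of_real (partial i \<psi> x))) - (LINT x:S|lborel. (\<Sum>i\<in>UNIV. v' x $ i * complex_of_real (partial i \<psi> x)))"
    unfolding left_diff_distrib vector_minus_component sum_subtractf by (intro set_integral_diff(2) s l)
  moreover have "(LINT x:S|lborel. (d x - d' x) * complex_of_real (\<psi> x))
      = (LINT x:S|lborel. d x * complex_of_real (\<psi> x)) - (LINT x:S|lborel. d' x * complex_of_real (\<psi> x))"
    unfolding left_diff_distrib by (intro set_integral_diff(2) locally_integrable_test l \<psi>)
  ultimately show "(LINT x:S|lborel. (\<Sum>i\<in>UNIV. (v x - v' x) $ i * complex_of_real (partial i \<psi> x))) = - (LINT x:S|lborel. (d x - d' x) * complex_of_real (\<psi> x))"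
    using a b \<psi> by (simp add: has_weak_divergence_def)
qed

lemma weighted_L2_reflect:
  fixes u :: "real^3 => 'b::euclidean_space"
  assumes e: "norm e = 1" and u: "u \<in> weighted_L2 S q" and q: "!!x. q (reflect e x) = q x"
  shows "(%x. u (reflect e x)) \<in> weighted_L2 S q"
proof -
  note [measurable] = reflect_measurable[OF e]
  have m: "(%x. indicator S x *\<^sub>R u x) \<in> borel_measurable borel"
    using u by (simp add: weighted_L2_def set_borel_measurable_def)
  have "(%x. indicator S (reflect e x) *\<^sub>R u (reflect e x)) \<in> borel_measurable borel"
    by (rule measurable_compose[OF reflect_measurable[OF e] m])
  moreover have "integrable lborel (%x. indicator S (reflect e x) *\<^sub>R (q (reflect e x) * (norm (u (reflect e x)))\<^sup>2))"
    using u by (intro integrable_reflect[OF e]) (simp add: weighted_L2_def set_integrable_def)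
  ultimately show ?thesis
    unfolding weighted_L2_def set_borel_measurable_def set_integrable_def indicator_reflect_S[OF e] q by simp
qed

lemma weighted_L2_diff:
  fixes u v :: "real^3 => 'b::euclidean_space"
  assumes u: "u \<in> weighted_L2 S q" and v: "v \<in> weighted_L2 S q" and q: "!!x. x \<in> S ==> q x >= 0"
    and qm: "(%x. indicator S x * q x) \<in> borel_measurable borel"
  shows "(%x. u x - v x) \<in> weighted_L2 S q"
proof -
  have um: "(%x. indicator S x *\<^sub>R u x) \<in> borel_measurable borel" and vm: "(%x. indicator S x *\<^sub>R v x) \<in> borel_measurable borel"
    using u v by (simp_all add: weighted_L2_def set_borel_measurable_def)
  have dm: "(%x. indicator S x *\<^sub>R (u x - v x)) \<in> borel_measurable borel"
    unfolding scaleR_diff_right by (intro borel_measurable_diff um vm)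
  have iu: "integrable lborel (%x. indicator S x * (q x * (norm (u x))\<^sup>2))" and iv: "integrable lborel (%x. indicator S x * (q x * (norm (v x))\<^sup>2))"
    using u v by (simp_all add: weighted_L2_def set_integrable_def)
  have "integrable lborel (%x. indicator S x * (q x * (norm (u x - v x))\<^sup>2))"
  proof (rule Bochner_Integration.integrable_bound)
    show "integrable lborel (%x. 2 * (indicator S x * (q x * (norm (u x))\<^sup>2)) + 2 * (indicator S x * (q x * (norm (v x))\<^sup>2)))"
      using iu iv by (intro Bochner_Integration.integrable_add integrable_mult_right)
    have "(%x. (indicator S x * q x) * (norm (indicator S x *\<^sub>R (u x - v x)))\<^sup>2) \<in> borel_measurable borel"
      by (rule borel_measurable_times[OF qm borel_measurable_power[OF measurable_compose[OF dm borel_measurable_norm]]])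
    moreover have "(%x. (indicator S x * q x) * (norm (indicator S x *\<^sub>R (u x - v x)))\<^sup>2) = (%x. indicator S x * (q x * (norm (u x - v x))\<^sup>2))"
      by (auto simp: indicator_def fun_eq_iff)
    ultimately show "(%x. indicator S x * (q x * (norm (u x - v x))\<^sup>2)) \<in> borel_measurable lborel" by simp
    have "norm (indicator S x * (q x * (norm (u x - v x))\<^sup>2)) <= norm (2 * (indicator S x * (q x * (norm (u x))\<^sup>2)) + 2 * (indicator S x * (q x * (norm (v x))\<^sup>2)))" for x
    proof (cases "x \<in> S")
      case True
      have "norm (u x - v x) <= norm (u x) + norm (v x)" by (rule norm_triangle_ineq4)
      then have "(norm (u x - v x))\<^sup>2 <= (norm (u x) + norm (v x))\<^sup>2" by (rule power_mono) simp
      also have "\<dots> <= 2 * (norm (u x))\<^sup>2 + 2 * (norm (v x))\<^sup>2"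
        using sum_squares_bound[of "norm (u x)" "norm (v x)"] by (simp add: power2_sum)
      finally have "q x * (norm (u x - v x))\<^sup>2 <= q x * (2 * (norm (u x))\<^sup>2 + 2 * (norm (v x))\<^sup>2)"
        using q[OF True] by (rule mult_left_mono)
      then show ?thesis using True q[OF True] by (simp add: algebra_simps)
    qed simp
    then show "AE x in lborel. norm (indicator S x * (q x * (norm (u x - v x))\<^sup>2)) <= norm (2 * (indicator S x * (q x * (norm (u x))\<^sup>2)) + 2 * (indicator S x * (q x * (norm (v x))\<^sup>2)))" by simp
  qed
  then show ?thesis using dm by (simp add: weighted_L2_def set_borel_measurable_def set_integrable_def)
qed

end

section \<open>Quadratic form and odd parts of eigenvectors\<close>

context white_dwarf begin

lemma dens_reflect: "norm e = 1 ==> dens (reflect e x) = dens x" by (simp add: dens_def stellar_density_def)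

lemma \<alpha>_reflect: "norm e = 1 ==> \<alpha> (reflect e x) = \<alpha> x" by (simp add: \<alpha>_def dens_reflect)

lemma L_op_reflect:
  assumes e: "norm e = 1"
  shows "L_op P S dens (%x. \<sigma> (reflect e x)) x = L_op P S dens \<sigma> (reflect e x)"
proof -
  have "inv_laplacian S \<sigma> (reflect e x) = (LINT z:S|lborel. \<sigma> (reflect e z) / complex_of_real (4 * pi * norm (reflect e x - reflect e z)))"
    unfolding inv_laplacian_def by (rule set_integral_reflect[OF e, symmetric])
  then show ?thesis unfolding L_op_def dens_reflect[OF e] inv_laplacian_def norm_reflect_diff[OF e] by simp
qed

definition re_part :: "(real^3 => complex) => real^3 => real" where "re_part \<sigma> x = indicator S x * Re (\<sigma> x)"
definition im_part :: "(real^3 => complex) => real^3 => real" where "im_part \<sigma> x = indicator S x * Im (\<sigma> x)"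

lemma parts_L2S:
  assumes s: "\<sigma> \<in> weighted_L2 S \<alpha>"
  shows "re_part \<sigma> \<in> L2S" "im_part \<sigma> \<in> L2S"
    and "integrable lborel (%x. (re_part \<sigma> x)\<^sup>2 / \<phi> x)" "integrable lborel (%x. (im_part \<sigma> x)\<^sup>2 / \<phi> x)"
proof -
  have m: "(%x. indicator S x *\<^sub>R \<sigma> x) \<in> borel_measurable borel"
    using s by (simp add: weighted_L2_def set_borel_measurable_def)
  have i: "integrable lborel (%x. indicator S x * (\<alpha> x * (norm (\<sigma> x))\<^sup>2))"
    using s by (simp add: weighted_L2_def set_integrable_def)
  have rm: "re_part \<sigma> \<in> borel_measurable borel" and im: "im_part \<sigma> \<in> borel_measurable borel"
    using measurable_compose[OF m borel_measurable_continuous_onI[OF continuous_on_Re[OF continuous_on_id]]]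
      measurable_compose[OF m borel_measurable_continuous_onI[OF continuous_on_Im[OF continuous_on_id]]]
    by (simp_all add: re_part_def[abs_def] im_part_def[abs_def])
  have main: "integrable lborel (%x. (a x)\<^sup>2 / \<phi> x) & a \<in> L2S"
    if am: "a \<in> borel_measurable borel" and ab: "!!x. \<bar>a x\<bar> <= indicator S x * norm (\<sigma> x)" for a
  proof -
    have a2: "(a x)\<^sup>2 <= indicator S x * (norm (\<sigma> x))\<^sup>2" for x
      using power_mono[OF ab[of x], of 2] by (cases "x \<in> S") auto
    have b: "norm ((a x)\<^sup>2 / \<phi> x) <= norm (indicator S x * (\<alpha> x * (norm (\<sigma> x))\<^sup>2))" for x
    proof (cases "x \<in> S")
      case True
      then show ?thesis using a2[of x] \<phi>_pos[OF True] \<alpha>_eq[OF True] by (simp add: divide_right_mono)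
    next
      case False
      then show ?thesis using a2[of x] by simp
    qed
    have 1: "integrable lborel (%x. (a x)\<^sup>2 / \<phi> x)"
      by (rule Bochner_Integration.integrable_bound[OF i]) (use am \<phi>_measurable b in auto)
    have "integrable lborel (%x. (a x)\<^sup>2)"
    proof (rule Bochner_Integration.integrable_bound)
      show "integrable lborel (%x. F' (y 0) * ((a x)\<^sup>2 / \<phi> x))" using 1 by fast
      have "norm ((a x)\<^sup>2) <= norm (F' (y 0) * ((a x)\<^sup>2 / \<phi> x))" for x
      proof (cases "x \<in> S")
        case True
        have "(a x)\<^sup>2 * \<phi> x <= (a x)\<^sup>2 * F' (y 0)" using \<phi>_le[OF True] by (intro mult_left_mono) auto
        then show ?thesis using \<phi>_pos[OF True] F'_pos[OF y0] by (simp add: field_simps)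
      next
        case False
        then show ?thesis using a2[of x] by simp
      qed
      then show "AE x in lborel. norm ((a x)\<^sup>2) <= norm (F' (y 0) * ((a x)\<^sup>2 / \<phi> x))" by simp
    qed (use am in simp)
    moreover have "a x = 0" if "x \<notin> S" for x using ab[of x] that by simp
    ultimately show ?thesis using 1 am by (simp add: L2S_def)
  qed
  have "\<bar>re_part \<sigma> x\<bar> <= indicator S x * norm (\<sigma> x)" "\<bar>im_part \<sigma> x\<bar> <= indicator S x * norm (\<sigma> x)" for x
    using abs_Re_le_cmod[of "\<sigma> x"] abs_Im_le_cmod[of "\<sigma> x"] by (auto simp: re_part_def im_part_def indicator_def)
  then show "re_part \<sigma> \<in> L2S" "im_part \<sigma> \<in> L2S"
    "integrable lborel (%x. (re_part \<sigma> x)\<^sup>2 / \<phi> x)" "integrable lborel (%x. (im_part \<sigma> x)\<^sup>2 / \<phi> x)"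
    using main[OF rm] main[OF im] by blast+
qed

lemma
  assumes s: "\<sigma> \<in> weighted_L2 S \<alpha>"
  shows inv_laplacian_integrable: "set_integrable lborel S (%z. \<sigma> z / complex_of_real (4 * pi * norm (x - z)))"
    and inv_laplacian_eq: "complex_of_real (4 * pi) * inv_laplacian S \<sigma> x = Complex (pot (re_part \<sigma>) x) (pot (im_part \<sigma>) x)"
proof -
  note p = parts_L2S[OF s]
  define f where "f z = complex_of_real (re_part \<sigma> z / norm (x - z)) + \<i> * complex_of_real (im_part \<sigma> z / norm (x - z))" for z
  have i1: "integrable lborel (%z. complex_of_real (re_part \<sigma> z / norm (x - z)))"
    by (rule integrable_of_real[OF kernel_integrable[OF p(1)]])
  have i2: "integrable lborel (%z. \<i> * complex_of_real (im_part \<sigma> z / norm (x - z)))"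
    by (intro integrable_mult_right integrable_of_real kernel_integrable p(2))
  have fi: "integrable lborel f" unfolding f_def by (rule Bochner_Integration.integrable_add[OF i1 i2])
  have eq: "indicator S z *\<^sub>R (\<sigma> z / complex_of_real (4 * pi * norm (x - z))) = f z / complex_of_real (4 * pi)" for z
  proof -
    have "f z = indicator S z *\<^sub>R (\<sigma> z / complex_of_real (norm (x - z)))"
      by (auto simp: f_def re_part_def im_part_def complex_eq_iff indicator_def Re_divide_of_real Im_divide_of_real)
    then show ?thesis by (simp add: indicator_def)
  qed
  show "set_integrable lborel S (%z. \<sigma> z / complex_of_real (4 * pi * norm (x - z)))"
    unfolding set_integrable_def eq using fi by (rule integrable_divide_zero)
  have "complex_of_real (4 * pi) * inv_laplacian S \<sigma> x = (\<integral>z. f z \<partial>lborel)"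
    unfolding inv_laplacian_def set_lebesgue_integral_def eq by simp
  also have "\<dots> = (\<integral>z. complex_of_real (re_part \<sigma> z / norm (x - z)) \<partial>lborel) + (\<integral>z. \<i> * complex_of_real (im_part \<sigma> z / norm (x - z)) \<partial>lborel)"
    unfolding f_def by (rule Bochner_Integration.integral_add[OF i1 i2])
  also have "\<dots> = complex_of_real (pot (re_part \<sigma>) x) + \<i> * complex_of_real (pot (im_part \<sigma>) x)"
    unfolding pot_def integral_mult_right_zero integral_complex_of_real ..
  finally show "complex_of_real (4 * pi) * inv_laplacian S \<sigma> x = Complex (pot (re_part \<sigma>) x) (pot (im_part \<sigma>) x)"
    by (simp add: complex_eq_iff)
qed

definition energy :: "(real^3 => real) => real" where
  "energy u = (\<integral>x. (u x)\<^sup>2 / \<phi> x \<partial>lborel) - (\<integral>x. u x * pot u x \<partial>lborel)"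

text \<open>L has a real symmetric kernel, so the mixed terms between real and imaginary part form
  the difference of two equal integrals. The complex quadratic form is thus real and splits.\<close>

lemma energy_eq:
  assumes s: "\<sigma> \<in> weighted_L2 S \<alpha>"
  shows "(LINT x:S|lborel. \<sigma> x * cnj (L_op P S dens \<sigma> x)) = complex_of_real (energy (re_part \<sigma>) + energy (im_part \<sigma>))"
proof -
  define a where "a = re_part \<sigma>"
  define b where "b = im_part \<sigma>"
  note p = parts_L2S[OF s, folded a_def b_def]
  have eq: "indicator S x *\<^sub>R (\<sigma> x * cnj (L_op P S dens \<sigma> x))
      = complex_of_real ((a x)\<^sup>2 / \<phi> x - a x * pot a x + ((b x)\<^sup>2 / \<phi> x - b x * pot b x)) + \<i> * complex_of_real (a x * pot b x - b x * pot a x)" for x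
  proof (cases "x \<in> S")
    case True
    have L: "L_op P S dens \<sigma> x = complex_of_real (1 / \<phi> x) * \<sigma> x - Complex (pot a x) (pot b x)"
      using \<alpha>_eq[OF True] inv_laplacian_eq[OF s, of x] by (simp add: L_op_def \<alpha>_def a_def b_def)
    have ab: "\<sigma> x = Complex (a x) (b x)" using True by (simp add: a_def b_def re_part_def im_part_def)
    show ?thesis using True unfolding L ab by (simp add: complex_eq_iff power2_eq_square algebra_simps add_divide_distrib)
  next
    case False
    then show ?thesis by (simp add: a_def b_def re_part_def im_part_def)
  qed
  have i: "integrable lborel (%x. (a x)\<^sup>2 / \<phi> x - a x * pot a x)" "integrable lborel (%x. (b x)\<^sup>2 / \<phi> x - b x * pot b x)"
    "integrable lborel (%x. a x * pot b x - b x * pot a x)"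
    by (intro Bochner_Integration.integrable_diff p pot_mult_integrable)+
  have e: "(\<integral>x. (a x)\<^sup>2 / \<phi> x - a x * pot a x \<partial>lborel) = energy a" "(\<integral>x. (b x)\<^sup>2 / \<phi> x - b x * pot b x \<partial>lborel) = energy b"
    unfolding energy_def by (intro Bochner_Integration.integral_diff p pot_mult_integrable)+
  have z: "(\<integral>x. a x * pot b x - b x * pot a x \<partial>lborel) = 0"
    using pot_symmetric[OF p(1) p(2)] Bochner_Integration.integral_diff[OF pot_mult_integrable[OF p(1) p(2)] pot_mult_integrable[OF p(2) p(1)]] by simp
  have i1: "integrable lborel (%x. complex_of_real ((a x)\<^sup>2 / \<phi> x - a x * pot a x + ((b x)\<^sup>2 / \<phi> x - b x * pot b x)))"
    by (intro integrable_of_real Bochner_Integration.integrable_add i)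
  have i2: "integrable lborel (%x. \<i> * complex_of_real (a x * pot b x - b x * pot a x))"
    by (intro integrable_mult_right integrable_of_real i)
  show ?thesis
    unfolding set_lebesgue_integral_def eq Bochner_Integration.integral_add[OF i1 i2] integral_mult_right_zero integral_complex_of_real z
      Bochner_Integration.integral_add[OF i(1,2)] e by (simp add: a_def b_def)
qed

lemma weight_measurable:
  "(%x. indicator S x * dens x) \<in> borel_measurable borel" "(%x. indicator S x * (1 / dens x)) \<in> borel_measurable borel"
  "(%x. indicator S x * (1 / \<alpha> x)) \<in> borel_measurable borel" "(%x. indicator S x * \<alpha> x) \<in> borel_measurable borel"
proof -
  have S: "indicator S \<in> (borel_measurable borel :: (real^3 => real) set)" by (intro borel_measurable_indicator) simp
  show "(%x. indicator S x * dens x) \<in> borel_measurable borel" by (rule borel_measurable_times[OF S dens_measurable])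
  show "(%x. indicator S x * (1 / dens x)) \<in> borel_measurable borel"
    by (rule borel_measurable_times[OF S borel_measurable_divide[OF borel_measurable_const dens_measurable]])
  have 1: "(%x. indicator S x * (1 / \<alpha> x)) = (%x. indicator S x * \<phi> x)" using \<alpha>_eq by (auto simp: fun_eq_iff indicator_def)
  have 2: "(%x. indicator S x * \<alpha> x) = (%x. indicator S x * (1 / \<phi> x))" using \<alpha>_eq by (auto simp: fun_eq_iff indicator_def)
  show "(%x. indicator S x * (1 / \<alpha> x)) \<in> borel_measurable borel" unfolding 1 by (rule borel_measurable_times[OF S \<phi>_measurable])
  show "(%x. indicator S x * \<alpha> x) \<in> borel_measurable borel" unfolding 2
    by (rule borel_measurable_times[OF S borel_measurable_divide[OF borel_measurable_const \<phi>_measurable]])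
qed

text \<open>The density is radial and the Newtonian kernel isometry-invariant, so the reflected pair
  is again an eigenpair; velocities transform as vectors, hence the additional
  \<open>creflect\<close>.\<close>

lemma eigenpair_odd_part:
  assumes e: "norm e = 1" and ep: "eigenpair z \<sigma> v"
  shows "eigenpair z (%x. \<sigma> x - \<sigma> (reflect e x)) (%x. v x - creflect e (v (reflect e x)))"
proof -
  have s: "\<sigma> \<in> weighted_L2 S \<alpha>" and v: "v \<in> weighted_L2 S dens" and Av: "A_op dens v \<in> weighted_L2 S (%x. 1 / dens x)"
    and zs: "(%x. z * \<sigma> x) \<in> weighted_L2 S \<alpha>" and div: "has_weak_divergence S (A_op dens v) (%x. - (z * \<sigma> x))"
    and L: "L_op P S dens \<sigma> \<in> weighted_L2 S (%x. 1 / \<alpha> x)" and zv: "(%x. - (z *s v x)) \<in> weighted_L2 S dens"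
    and grad: "has_weak_gradient S (L_op P S dens \<sigma>) (%x. - (z *s v x))"
    using ep by (simp_all add: eigenpair_def)
  have p\<alpha>: "\<alpha> x >= 0" "1 / \<alpha> x >= 0" "dens x >= 0" "1 / dens x >= 0" if "x \<in> S" for x
    using \<alpha>_pos[OF that] dens_pos[OF that] by simp_all
  have cr: "(%x. creflect e (u (reflect e x))) \<in> weighted_L2 S q" if u: "u \<in> weighted_L2 S q" and q: "!!x. q (reflect e x) = q x" for u q
  proof -
    have 1: "(%x. u (reflect e x)) \<in> weighted_L2 S q" by (rule weighted_L2_reflect[OF e u q])
    then have "(%x. indicator S x *\<^sub>R u (reflect e x)) \<in> borel_measurable lborel" by (simp add: weighted_L2_def set_borel_measurable_def)
    then have "(%x. creflect e (indicator S x *\<^sub>R u (reflect e x))) \<in> borel_measurable lborel"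
      by (rule borel_measurable_continuous_on[OF linear_continuous_on[OF bounded_linear_creflect]])
    then show ?thesis using 1 by (simp add: weighted_L2_def set_borel_measurable_def creflect_scaleR norm_creflect[OF e])
  qed
  have A': "A_op dens (%x. v x - creflect e (v (reflect e x))) = (%x. A_op dens v x - creflect e (A_op dens v (reflect e x)))"
    by (simp add: fun_eq_iff A_op_def scaleR_diff_right creflect_scaleR dens_reflect[OF e])
  have sr: "(%x. \<sigma> (reflect e x)) \<in> weighted_L2 S \<alpha>" by (rule weighted_L2_reflect[OF e s \<alpha>_reflect[OF e]])
  have L': "L_op P S dens (%x. \<sigma> x - \<sigma> (reflect e x)) = (%x. L_op P S dens \<sigma> x - L_op P S dens \<sigma> (reflect e x))"
  proof
    fix x
    have iv: "inv_laplacian S (%x. \<sigma> x - \<sigma> (reflect e x)) x = inv_laplacian S \<sigma> x - inv_laplacian S (%x. \<sigma> (reflect e x)) x"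
      unfolding inv_laplacian_def diff_divide_distrib by (rule set_integral_diff(2)[OF inv_laplacian_integrable[OF s] inv_laplacian_integrable[OF sr]])
    have "L_op P S dens (%x. \<sigma> x - \<sigma> (reflect e x)) x = L_op P S dens \<sigma> x - L_op P S dens (%x. \<sigma> (reflect e x)) x"
      unfolding L_op_def iv by (simp add: algebra_simps)
    then show "L_op P S dens (%x. \<sigma> x - \<sigma> (reflect e x)) x = L_op P S dens \<sigma> x - L_op P S dens \<sigma> (reflect e x)"
      by (simp only: L_op_reflect[OF e])
  qed
  have z1: "(%x. z * (\<sigma> x - \<sigma> (reflect e x))) = (%x. z * \<sigma> x - z * \<sigma> (reflect e x))" by (simp add: algebra_simps)
  have z2: "(%x. - (z *s (v x - creflect e (v (reflect e x))))) = (%x. - (z *s v x) - creflect e (- (z *s v (reflect e x))))"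
    by (simp add: fun_eq_iff creflect_uminus creflect_mult vector_smult_component vec_eq_iff algebra_simps)
  have z3: "(%x. - (z * (\<sigma> x - \<sigma> (reflect e x)))) = (%x. - (z * \<sigma> x) - - (z * \<sigma> (reflect e x)))" by (simp add: algebra_simps)
  show ?thesis
    unfolding eigenpair_def A' L' z1 z2 z3
  proof (intro conjI)
    show "(%x. \<sigma> x - \<sigma> (reflect e x)) \<in> weighted_L2 S \<alpha>" by (rule weighted_L2_diff[OF s sr p\<alpha>(1) weight_measurable(4)])
    show "(%x. v x - creflect e (v (reflect e x))) \<in> weighted_L2 S dens"
      by (rule weighted_L2_diff[OF v cr[OF v dens_reflect[OF e]] p\<alpha>(3) weight_measurable(1)])
    show "(%x. A_op dens v x - creflect e (A_op dens v (reflect e x))) \<in> weighted_L2 S (%x. 1 / dens x)"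
      by (rule weighted_L2_diff[OF Av cr[OF Av] p\<alpha>(4) weight_measurable(2)]) (simp_all add: dens_reflect[OF e])
    show "(%x. z * \<sigma> x - z * \<sigma> (reflect e x)) \<in> weighted_L2 S \<alpha>"
      by (rule weighted_L2_diff[OF zs weighted_L2_reflect[OF e zs \<alpha>_reflect[OF e]] p\<alpha>(1) weight_measurable(4)])
    show "has_weak_divergence S (%x. A_op dens v x - creflect e (A_op dens v (reflect e x))) (%x. - (z * \<sigma> x) - - (z * \<sigma> (reflect e x)))"
      by (rule has_weak_divergence_diff[OF div has_weak_divergence_reflect[OF e div]])
    show "(%x. L_op P S dens \<sigma> x - L_op P S dens \<sigma> (reflect e x)) \<in> weighted_L2 S (%x. 1 / \<alpha> x)"
      by (rule weighted_L2_diff[OF L weighted_L2_reflect[OF e L] p\<alpha>(2) weight_measurable(3)]) (simp_all add: \<alpha>_reflect[OF e])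
    show "(%x. - (z *s v x) - creflect e (- (z *s v (reflect e x)))) \<in> weighted_L2 S dens"
      by (rule weighted_L2_diff[OF zv cr[OF zv dens_reflect[OF e]] p\<alpha>(3) weight_measurable(1)])
    show "has_weak_gradient S (%x. L_op P S dens \<sigma> x - L_op P S dens \<sigma> (reflect e x)) (%x. - (z *s v x) - creflect e (- (z *s v (reflect e x))))"
      by (rule has_weak_gradient_diff[OF grad has_weak_gradient_reflect[OF e grad]])
  qed
qed

end

section \<open>Reduction to radial functions\<close>

lemma
  fixes f :: "real => real"
  assumes [measurable]: "f \<in> borel_measurable borel" and int: "integrable lborel (%x::real^3. f (norm x))"
  shows radial_integral: "(\<integral>x. f (norm x) \<partial>(lborel :: (real^3) measure)) = (\<integral>r. indicator {0<..} r * (4 * pi * r\<^sup>2 * f r) \<partial>lborel)"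
    and radial_integrable: "integrable lborel (%r. indicator {0<..} r * (4 * pi * r\<^sup>2 * f r))"
proof -
  have m: "(%(r, t). (%r t :: real. f r) r t) \<in> borel_measurable (borel \<Otimes>\<^sub>M borel)" by measurable
  have i: "integrable lborel (%x::real^3. (%r t :: real. f r) (norm x) (x $ 1))" using int by simp
  have inner: "indicator {0<..} r * (2 * pi * r) * (\<integral>t. indicator {-r<..<r} t * f r \<partial>lborel) = indicator {0<..} r * (4 * pi * r\<^sup>2 * f r)" for r :: real
  proof (cases "r > 0")
    case True
    have "(\<integral>t. indicator {-r<..<r} t * f r \<partial>lborel) = measure lborel {-r<..<r} * f r"
      unfolding integral_mult_left_zero by simp
    also have "measure lborel {-r<..<r} = 2 * r" using True by simp
    finally show ?thesis by (simp add: power2_eq_square)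
  qed simp
  show "(\<integral>x. f (norm x) \<partial>(lborel :: (real^3) measure)) = (\<integral>r. indicator {0<..} r * (4 * pi * r\<^sup>2 * f r) \<partial>lborel)"
    using integral_axially_symmetric[OF m i] by (simp only: inner)
  show "integrable lborel (%r. indicator {0<..} r * (4 * pi * r\<^sup>2 * f r))"
    using integrable_axially_symmetric[OF m i] by (simp only: inner)
qed

text \<open>The exceptional null set may depend on the mirror, and there are uncountably many
  mirrors. Mollifying with a radial kernel turns almost-everywhere invariance into pointwise
  invariance; the mollified functions are therefore radial at every point, and a subsequence of them
  converges to u almost everywhere.\<close>

lemma reflection_invariant_radial:
  fixes u :: "real^3 => real"
  assumes ui: "integrable lborel u" and inv: "!!e. norm e = 1 ==> AE x in lborel. u (reflect e x) = u x"
  obtains s where "s \<in> borel_measurable borel" "AE x in lborel. u x = s (norm x)"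
proof -
  define r where "r n = inverse (real (Suc n))" for n
  have r: "r n > 0" for n by (simp add: r_def)
  have rl: "r \<longlonglongrightarrow> 0" unfolding r_def by (rule LIMSEQ_inverse_real_of_nat)
  define K where "K n = mollifier (r n)" for n
  have Kt: "K n \<in> test_functions UNIV" for n using test_mollifier[OF r, of 0 n UNIV] by (simp add: K_def)
  have Km [measurable]: "K n \<in> borel_measurable borel" for n by (rule test_functions_measurable[OF Kt])
  have um [measurable]: "u \<in> borel_measurable borel" using borel_measurable_integrable[OF ui] by simp
  have K0: "K n z >= 0" for n z unfolding K_def by (rule mollifier_nonneg[OF r])
  have K1: "(\<integral>z. K n z \<partial>lborel) = 1" for n unfolding K_def by (rule integral_mollifier[OF r])
  have Ki: "integrable lborel (K n)" for n using K1[of n] not_integrable_integral_eq[of lborel "K n"] by force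
  have Kn: "norm a = norm b ==> K n a = K n b" for n a b by (simp add: K_def mollifier_def bump_def)
  have Kout: "norm t >= r n ==> K n t = 0" for n t unfolding K_def by (rule mollifier_outside[OF _ r])
  have Kint: "integrable lborel (%t. K n t * f t)" if fi: "integrable lborel f" for n and f :: "real^3 => real"
  proof -
    obtain M where M: "!!x. \<bar>K n x\<bar> <= M" by (rule test_functions_bounded[OF Kt]) (rule that)
    have fm [measurable]: "f \<in> borel_measurable borel" using borel_measurable_integrable[OF fi] by simp
    show ?thesis
    proof (rule Bochner_Integration.integrable_bound)
      show "integrable lborel (%t. M * f t)" using fi by simp
      have "norm (K n t * f t) <= norm (M * f t)" for t
      proof -
        have "\<bar>K n t\<bar> * \<bar>f t\<bar> <= \<bar>M\<bar> * \<bar>f t\<bar>" by (rule mult_right_mono[OF order_trans[OF M abs_ge_self]]) simp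
        then show ?thesis by (simp add: abs_mult)
      qed
      then show "AE t in lborel. norm (K n t * f t) <= norm (M * f t)" by simp
    qed measurable
  qed
  define v where "v n x = (\<integral>z. K n (z - x) * u z \<partial>lborel)" for n x
  have vm [measurable]: "v n \<in> borel_measurable borel" for n unfolding v_def by measurable
  have vinv: "v n x = v n x'" if nx: "norm x = norm x'" for n x x'
  proof (cases "x = x'")
    case False
    obtain e where e: "norm e = 1" "reflect e x = x'" by (rule reflection_exists[OF nx False]) (rule that)
    note [measurable] = reflect_measurable[OF e(1)]
    have "v n x' = (\<integral>z. K n (reflect e z - reflect e x) * u (reflect e z) \<partial>lborel)"
      unfolding v_def e(2)[symmetric] by (rule integral_reflect_all[OF e(1), symmetric])
    also have "\<dots> = (\<integral>z. K n (z - x) * u (reflect e z) \<partial>lborel)"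
      using Kn[OF norm_reflect_diff[OF e(1)]] by simp
    also have "\<dots> = v n x" unfolding v_def
    proof (rule integral_cong_AE)
      show "AE z in lborel. K n (z - x) * u (reflect e z) = K n (z - x) * u z" using inv[OF e(1)] by (rule AE_mp) simp
    qed measurable
    finally show ?thesis ..
  qed simp
  have diff: "v n x - u x = (\<integral>t. K n t * (u (x + t) - u x) \<partial>lborel)" "integrable lborel (%t. K n t * (u (x + t) - u x))" for n x
  proof -
    have 1: "v n x = (\<integral>t. K n t * u (x + t) \<partial>lborel)"
      using integral_translate[of "%z. K n (z - x) * u z" x] by (simp add: v_def)
    have i: "integrable lborel (%t. K n t * u (x + t))" "integrable lborel (%t. K n t * u x)"
      using Kint[OF integrable_translate[OF ui]] Ki by simp_all
    have "(\<integral>t. K n t * u x \<partial>lborel) = u x" using K1[of n] by simp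
    then show "v n x - u x = (\<integral>t. K n t * (u (x + t) - u x) \<partial>lborel)"
      unfolding 1 right_diff_distrib using Bochner_Integration.integral_diff[OF i] by simp
    show "integrable lborel (%t. K n t * (u (x + t) - u x))"
      unfolding right_diff_distrib by (rule Bochner_Integration.integrable_diff[OF i])
  qed
  have L1: "\<exists>N. \<forall>n\<ge>N. (\<integral>\<^sup>+x. ennreal (norm (v n x - u x)) \<partial>lborel) <= ennreal \<epsilon>" if \<epsilon>: "\<epsilon> > 0" for \<epsilon>
  proof -
    obtain d where d: "d > 0" "!!t. norm t < d ==> (\<integral>x. norm (u (t + x) - u x) \<partial>lborel) < \<epsilon>"
      by (rule translation_continuousD[OF ui \<epsilon>]) (rule that)
    obtain N where N: "!!n. n >= N ==> r n < d" using rl d(1) r unfolding lim_sequentially dist_real_def by (metis abs_of_pos diff_zero)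
    have "(\<integral>\<^sup>+x. ennreal (norm (v n x - u x)) \<partial>lborel) <= ennreal \<epsilon>" if n: "n >= N" for n
    proof -
      have "(\<integral>\<^sup>+x. ennreal (norm (v n x - u x)) \<partial>lborel) <= (\<integral>\<^sup>+x. (\<integral>\<^sup>+t. ennreal (K n t * \<bar>u (x + t) - u x\<bar>) \<partial>lborel) \<partial>lborel)"
      proof (rule nn_integral_mono)
        fix x
        have "ennreal (norm (v n x - u x)) <= (\<integral>\<^sup>+t. ennreal (norm (K n t * (u (x + t) - u x))) \<partial>lborel)"
          unfolding diff(1) by (rule integral_norm_bound_ennreal[OF diff(2)])
        then show "ennreal (norm (v n x - u x)) <= (\<integral>\<^sup>+t. ennreal (K n t * \<bar>u (x + t) - u x\<bar>) \<partial>lborel)"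
          using K0 by (simp add: abs_mult)
      qed
      also have "\<dots> = (\<integral>\<^sup>+t. (\<integral>\<^sup>+x. ennreal (K n t * \<bar>u (x + t) - u x\<bar>) \<partial>lborel) \<partial>lborel)"
        by (rule lborel_pair.Fubini'[symmetric]) measurable
      also have "\<dots> <= (\<integral>\<^sup>+t. ennreal (K n t) * ennreal \<epsilon> \<partial>lborel)"
      proof (rule nn_integral_mono)
        fix t
        show "(\<integral>\<^sup>+x. ennreal (K n t * \<bar>u (x + t) - u x\<bar>) \<partial>lborel) <= ennreal (K n t) * ennreal \<epsilon>"
        proof (cases "norm t < r n")
          case True
          have i: "integrable lborel (%x. norm (u (t + x) - u x))"
            using integrable_translate[OF ui] ui by (intro integrable_norm Bochner_Integration.integrable_diff)
          have "(\<integral>\<^sup>+x. ennreal (K n t * \<bar>u (x + t) - u x\<bar>) \<partial>lborel) = (\<integral>\<^sup>+x. ennreal (K n t) * ennreal (norm (u (t + x) - u x)) \<partial>lborel)"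
            using K0 by (intro nn_integral_cong) (simp add: ennreal_mult' add.commute)
          also have "\<dots> = ennreal (K n t) * (\<integral>\<^sup>+x. ennreal (norm (u (t + x) - u x)) \<partial>lborel)"
            by (rule nn_integral_cmult) measurable
          also have "(\<integral>\<^sup>+x. ennreal (norm (u (t + x) - u x)) \<partial>lborel) = ennreal (\<integral>x. norm (u (t + x) - u x) \<partial>lborel)"
            by (rule nn_integral_eq_integral[OF i]) simp
          also have "ennreal (K n t) * \<dots> <= ennreal (K n t) * ennreal \<epsilon>"
            using d(2)[of t] True N[OF n] by (intro mult_left_mono ennreal_leI) auto
          finally show ?thesis .
        next
          case False
          then show ?thesis using Kout[of n t] by simp
        qed
      qed
      also have "\<dots> = (\<integral>\<^sup>+t. ennreal (K n t) \<partial>lborel) * ennreal \<epsilon>" by (rule nn_integral_multc) measurable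
      also have "(\<integral>\<^sup>+t. ennreal (K n t) \<partial>lborel) = ennreal 1"
        using nn_integral_eq_integral[OF Ki[of n]] K0 K1[of n] by simp
      finally show ?thesis by simp
    qed
    then show ?thesis by blast
  qed
  \<comment> \<open>Integrability of v n - u is read off from the L1 bound, which is at hand from N0
    on; hence the shifted index.\<close>
  obtain N0 where N0: "!!n. n >= N0 ==> (\<integral>\<^sup>+x. ennreal (norm (v n x - u x)) \<partial>lborel) <= ennreal 1"
    using L1[of 1] by auto
  define f where "f n x = v (n + N0) x - u x" for n x
  have fi: "integrable lborel (f n)" for n
  proof (rule integrableI_bounded)
    show "f n \<in> borel_measurable lborel" unfolding f_def by measurable
    have "(\<integral>\<^sup>+x. ennreal (norm (f n x)) \<partial>lborel) <= ennreal 1" unfolding f_def by (rule N0) simp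
    then show "(\<integral>\<^sup>+x. ennreal (norm (f n x)) \<partial>lborel) < \<infinity>" using ennreal_less_top[of 1] by (simp add: le_less_trans)
  qed
  have "(%n. \<integral>x. norm (f n x) \<partial>lborel) \<longlonglongrightarrow> 0"
  proof (rule LIMSEQ_I)
    fix \<epsilon> :: real assume \<epsilon>: "\<epsilon> > 0"
    obtain N where N: "!!n. n >= N ==> (\<integral>\<^sup>+x. ennreal (norm (v n x - u x)) \<partial>lborel) <= ennreal (\<epsilon> / 2)"
      using L1[of "\<epsilon> / 2"] \<epsilon> by auto
    have "norm ((\<integral>x. norm (f n x) \<partial>lborel) - 0) < \<epsilon>" if n: "n >= N" for n
    proof -
      have "ennreal (\<integral>x. norm (f n x) \<partial>lborel) = (\<integral>\<^sup>+x. ennreal (norm (f n x)) \<partial>lborel)"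
        by (rule nn_integral_eq_integral[symmetric]) (use fi in auto)
      also have "\<dots> <= ennreal (\<epsilon> / 2)" unfolding f_def by (rule N) (use n in simp)
      finally have "(\<integral>x. norm (f n x) \<partial>lborel) <= \<epsilon> / 2" using \<epsilon> by (simp add: ennreal_le_iff)
      moreover have "(\<integral>x. norm (f n x) \<partial>lborel) >= 0" by (intro Bochner_Integration.integral_nonneg) simp
      ultimately show ?thesis using \<epsilon> by simp
    qed
    then show "\<exists>no. \<forall>n\<ge>no. norm ((\<integral>x. norm (f n x) \<partial>lborel) - 0) < \<epsilon>" by blast
  qed
  from tendsto_L1_AE_subseq[OF fi this] obtain \<rho> where \<rho>: "AE x in lborel. (%n. f (\<rho> n) x) \<longlonglongrightarrow> 0" by blast
  \<comment> \<open>Evaluation on an axis turns the radial functions into functions of the radius;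
    \<open>lim\<close> is measurable whether or not the sequence converges.\<close>
  define s where "s a = lim (%n. v (\<rho> n + N0) (a *\<^sub>R axis 1 1))" for a :: real
  have "s \<in> borel_measurable borel" unfolding s_def
    by (rule borel_measurable_lim_metric) measurable
  moreover have "AE x in lborel. u x = s (norm x)"
    using \<rho>
  proof (rule AE_mp, intro AE_I2 impI)
    fix x assume "(%n. f (\<rho> n) x) \<longlonglongrightarrow> 0"
    then have "(%n. f (\<rho> n) x + u x) \<longlonglongrightarrow> 0 + u x" by (intro tendsto_add tendsto_const)
    then have "(%n. v (\<rho> n + N0) x) \<longlonglongrightarrow> u x" by (simp add: f_def)
    moreover have "v (\<rho> n + N0) x = v (\<rho> n + N0) (norm x *\<^sub>R axis 1 1)" for n by (rule vinv) simp
    ultimately have "(%n. v (\<rho> n + N0) (norm x *\<^sub>R axis 1 1)) \<longlonglongrightarrow> u x" by simp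
    then show "u x = s (norm x)" unfolding s_def by (rule limI[symmetric])
  qed
  ultimately show ?thesis by (rule that)
qed

context white_dwarf begin

text \<open>With g the mass per unit radius and m the mass inside a radius, the Newtonian energy is
  the field energy, the integral of m^2 / \<tau>^2. Since the total mass is zero, no field extends
  beyond R. The radial Hardy inequality compares this with the local term.\<close>

lemma radial_energy:
  fixes s :: "real => real"
  assumes [measurable]: "s \<in> borel_measurable borel" and u: "(%x. s (norm x)) \<in> L2S"
    and ui: "integrable lborel (%x. (s (norm x))\<^sup>2 / \<phi> x)" and mz: "(\<integral>x. s (norm x) \<partial>(lborel :: (real^3) measure)) = 0"
  shows "energy (%x. s (norm x)) >= 0"
proof -
  define g where "g r = indicator {0<..} r * (4 * pi * r\<^sup>2 * s r)" for r
  have gm [measurable]: "g \<in> borel_measurable borel" unfolding g_def by measurable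
  have sR: "s r = 0" if "r >= R" for r
  proof -
    have n: "norm (r *\<^sub>R axis 1 1 :: real^3) = r" using that R by simp
    then have "(r *\<^sub>R axis 1 1 :: real^3) \<notin> S" using that by simp
    then have "s (norm (r *\<^sub>R axis 1 1 :: real^3)) = 0" using u unfolding L2S_def by blast
    then show ?thesis by (simp only: n)
  qed
  have g0: "g t = 0" if "t \<notin> {0<..<R}" for t using that sR[of t] by (auto simp: g_def)
  have gi: "integrable lborel g" unfolding g_def by (rule radial_integrable[OF assms(1) L2S_integrable[OF u]])
  have g1: "(\<integral>t. g t \<partial>lborel) = 0" unfolding g_def using radial_integral[OF assms(1) L2S_integrable[OF u]] mz by simp
  have gri: "integrable lborel (%r. g r / r)"
  proof -
    have "integrable lborel (%x::real^3. s (norm x) / norm x)" using kernel_integrable[OF u, of 0] by simp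
    then have "integrable lborel (%r. indicator {0<..} r * (4 * pi * r\<^sup>2 * (s r / r)))" by (intro radial_integrable) measurable
    then show ?thesis by (simp add: g_def)
  qed
  define N where "N = (\<integral>t. \<bar>g t\<bar> \<partial>lborel)"
  have N0: "N >= 0" unfolding N_def by (intro Bochner_Integration.integral_nonneg) simp
  define m where "m \<tau> = (\<integral>t. (if t < \<tau> then g t else 0) \<partial>lborel)" for \<tau>
  have mm [measurable]: "m \<in> borel_measurable borel" unfolding m_def by measurable
  have gint: "integrable lborel (%t. if t < \<tau> then g t else 0)" for \<tau>
  proof (rule Bochner_Integration.integrable_bound[OF gi])
    show "(%t. if t < \<tau> then g t else 0) \<in> borel_measurable lborel" by measurable
    show "AE t in lborel. norm (if t < \<tau> then g t else 0) <= norm (g t)" by (intro AE_I2) auto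
  qed
  have mb: "\<bar>m \<tau>\<bar> <= N" for \<tau>
  proof -
    have "norm (m \<tau>) <= N" unfolding m_def N_def
      by (rule Bochner_Integration.integral_norm_bound_integral[OF gint]) (use gi in auto)
    then show ?thesis by simp
  qed
  \<comment> \<open>Writes 1 / max a t - 1 / R as an integral over \<tau>, so that Fubini collects
    the masses below \<tau> into m.\<close>
  define q where "q a \<tau> = indicator {a<..<R} \<tau> * (1 / \<tau>\<^sup>2)" for a \<tau> :: real
  have qm [measurable]: "q a \<in> borel_measurable borel" for a unfolding q_def by measurable
  have q0: "q a \<tau> >= 0" for a \<tau> by (simp add: q_def)
  have k1: "has_bochner_integral lborel (q a) (1 / a - 1 / R)" if a: "0 < a" "a < R" for a
  proof -
    have "has_bochner_integral lborel (%\<tau>. indicator {a<..<R} \<tau> * (1 / \<tau>\<^sup>2)) (- (1 / R) - - (1 / a))"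
    proof (rule has_bochner_integral_FTC_nonneg[OF a(2), where G = "%\<tau>. - (1 / \<tau>)"])
      fix x assume x: "a < x" "x < R"
      then have x0: "x ~= 0" using a by simp
      show "((%\<tau>. - (1 / \<tau>)) has_real_derivative 1 / x\<^sup>2) (at x)"
        using x0 by (auto intro!: derivative_eq_intros simp: power2_eq_square)
      show "isCont (%\<tau>. 1 / \<tau>\<^sup>2) x" using x0 by (intro isCont_divide isCont_power continuous_ident continuous_const) auto
    next
      show "((%\<tau>. - (1 / \<tau>)) \<longlongrightarrow> - (1 / a)) (at_right a)" using a by (intro tendsto_intros) auto
      show "((%\<tau>. - (1 / \<tau>)) \<longlongrightarrow> - (1 / R)) (at_left R)" using R by (intro tendsto_intros) auto
    qed simp
    then show ?thesis by (simp add: q_def[abs_def])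
  qed
  define V where "V a = (\<integral>t. g t / max a t \<partial>lborel)" for a
  have Vm [measurable]: "V \<in> borel_measurable borel" unfolding V_def by measurable
  have Vint: "integrable lborel (%t. g t / max a t)" if a: "a > 0" for a
  proof (rule Bochner_Integration.integrable_bound)
    show "integrable lborel (%t. g t / a)" using gi by simp
    have "norm (g t / max a t) <= norm (g t / a)" for t using a by (simp add: abs_divide divide_left_mono)
    then show "AE t in lborel. norm (g t / max a t) <= norm (g t / a)" by simp
  qed measurable
  have V_eq: "V a = (\<integral>\<tau>. m \<tau> * q a \<tau> \<partial>lborel)" if a: "0 < a" "a < R" for a
  proof -
    define f where "f \<tau> t = (if t < \<tau> then g t else 0) * q a \<tau>" for \<tau> t
    have fm: "(%(\<tau>, t). f \<tau> t) \<in> borel_measurable (lborel \<Otimes>\<^sub>M lborel)" unfolding f_def by measurable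
    have fi: "integrable lborel (%t. f \<tau> t)" for \<tau> unfolding f_def using gint by simp
    have prod: "integrable (lborel \<Otimes>\<^sub>M lborel) (%(\<tau>, t). f \<tau> t)"
    proof (rule lborel_pair.Fubini_integrable[OF fm])
      show "integrable lborel (%\<tau>. \<integral>t. norm (case (\<tau>, t) of (\<tau>, t) => f \<tau> t) \<partial>lborel)"
      proof (rule Bochner_Integration.integrable_bound)
        show "integrable lborel (%\<tau>. N * q a \<tau>)" using k1[OF a] by (simp add: has_bochner_integral_iff)
        show "(%\<tau>. \<integral>t. norm (case (\<tau>, t) of (\<tau>, t) => f \<tau> t) \<partial>lborel) \<in> borel_measurable lborel" unfolding f_def by measurable
        have "norm (\<integral>t. norm (f \<tau> t) \<partial>lborel) <= norm (N * q a \<tau>)" for \<tau>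
        proof -
          have "norm (\<integral>t. norm (f \<tau> t) \<partial>lborel) <= (\<integral>t. \<bar>g t\<bar> * q a \<tau> \<partial>lborel)"
          proof (rule Bochner_Integration.integral_norm_bound_integral)
            show "integrable lborel (%t. norm (f \<tau> t))" by (rule integrable_norm[OF fi])
            show "integrable lborel (%t. \<bar>g t\<bar> * q a \<tau>)" by (intro integrable_mult_left integrable_abs gi)
            show "norm (norm (f \<tau> t)) <= \<bar>g t\<bar> * q a \<tau>" for t using q0[of a \<tau>] by (simp add: f_def abs_mult)
          qed
          also have "\<dots> = N * q a \<tau>" unfolding N_def by (rule integral_mult_left_zero)
          finally show ?thesis using N0 q0[of a \<tau>] by simp
        qed
        then show "AE \<tau> in lborel. norm (\<integral>t. norm (case (\<tau>, t) of (\<tau>, t) => f \<tau> t) \<partial>lborel) <= norm (N * q a \<tau>)" by simp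
      qed
      show "AE \<tau> in lborel. integrable lborel (%t. case (\<tau>, t) of (\<tau>, t) => f \<tau> t)" using fi by simp
    qed
    have i1: "(\<integral>t. f \<tau> t \<partial>lborel) = m \<tau> * q a \<tau>" for \<tau> unfolding f_def m_def by (rule integral_mult_left_zero)
    have i2: "(\<integral>\<tau>. f \<tau> t \<partial>lborel) = g t * (1 / max a t - 1 / R)" for t
    proof (cases "t \<in> {0<..<R}")
      case True
      have "f \<tau> t = g t * q (max a t) \<tau>" for \<tau> by (auto simp: f_def q_def indicator_def)
      then have "(\<integral>\<tau>. f \<tau> t \<partial>lborel) = g t * (\<integral>\<tau>. q (max a t) \<tau> \<partial>lborel)" by (simp only: integral_mult_right_zero)
      also have "(\<integral>\<tau>. q (max a t) \<tau> \<partial>lborel) = 1 / max a t - 1 / R" using k1[of "max a t"] a True by (simp add: has_bochner_integral_iff)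
      finally show ?thesis .
    next
      case False
      have "f \<tau> t = 0" for \<tau> using g0[OF False] by (auto simp: f_def)
      then show ?thesis using g0[OF False] by simp
    qed
    have "(\<integral>\<tau>. m \<tau> * q a \<tau> \<partial>lborel) = (\<integral>\<tau>. (\<integral>t. f \<tau> t \<partial>lborel) \<partial>lborel)" by (simp only: i1)
    also have "\<dots> = (\<integral>t. (\<integral>\<tau>. f \<tau> t \<partial>lborel) \<partial>lborel)" by (rule lborel_pair.Fubini_integral[OF prod, symmetric])
    also have "\<dots> = (\<integral>t. g t / max a t - g t / R \<partial>lborel)" unfolding i2 by (simp add: right_diff_distrib)
    also have "\<dots> = V a - (\<integral>t. g t / R \<partial>lborel)"
      unfolding V_def by (rule Bochner_Integration.integral_diff[OF Vint[OF a(1)]]) (use gi in simp)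
    \<comment> \<open>The constant 1 / R drops out because g has mean zero.\<close>
    finally show ?thesis using g1 by simp
  qed
  \<comment> \<open>For r > 0 the conditional is \<open>q r \<tau>\<close>; in this form the
    dependence on r and \<tau> is visibly jointly measurable, and the integral over r is again
    m.\<close>
  define h where "h r \<tau> = g r * (m \<tau> * (if r < \<tau> then q 0 \<tau> else 0))" for r \<tau>
  have hm: "(%(r, \<tau>). h r \<tau>) \<in> borel_measurable (lborel \<Otimes>\<^sub>M lborel)" unfolding h_def by measurable
  have hq: "h r \<tau> = g r * (m \<tau> * q r \<tau>)" if "r > 0" for r \<tau> using that by (auto simp: h_def q_def indicator_def)
  have mqi: "integrable lborel (%\<tau>. m \<tau> * q r \<tau>)" if r: "0 < r" "r < R" for r
  proof (rule Bochner_Integration.integrable_bound)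
    show "integrable lborel (%\<tau>. N * q r \<tau>)" using k1[OF r] by (simp add: has_bochner_integral_iff)
    have "norm (m \<tau> * q r \<tau>) <= norm (N * q r \<tau>)" for \<tau>
    proof -
      have "\<bar>m \<tau>\<bar> * q r \<tau> <= \<bar>N\<bar> * q r \<tau>" by (rule mult_right_mono[OF order_trans[OF mb abs_ge_self] q0])
      then show ?thesis using q0[of r \<tau>] by (simp add: abs_mult)
    qed
    then show "AE \<tau> in lborel. norm (m \<tau> * q r \<tau>) <= norm (N * q r \<tau>)" by simp
  qed measurable
  have hi: "integrable lborel (%\<tau>. h r \<tau>)" for r
  proof (cases "r \<in> {0<..<R}")
    case True
    then show ?thesis using mqi[of r] hq[of r] by simp
  qed (simp add: h_def g0)
  have hprod: "integrable (lborel \<Otimes>\<^sub>M lborel) (%(r, \<tau>). h r \<tau>)"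
  proof (rule lborel_pair.Fubini_integrable[OF hm])
    show "integrable lborel (%r. \<integral>\<tau>. norm (case (r, \<tau>) of (r, \<tau>) => h r \<tau>) \<partial>lborel)"
    proof (rule Bochner_Integration.integrable_bound)
      \<comment> \<open>The singularity 1 / r is harmless because the potential of |s| at the origin
        is finite.\<close>
      show "integrable lborel (%r. N * (g r / r))" by (rule integrable_mult_right[OF gri])
      show "(%r. \<integral>\<tau>. norm (case (r, \<tau>) of (r, \<tau>) => h r \<tau>) \<partial>lborel) \<in> borel_measurable lborel" unfolding h_def by measurable
      have "norm (\<integral>\<tau>. norm (h r \<tau>) \<partial>lborel) <= norm (N * (g r / r))" for r
      proof (cases "r \<in> {0<..<R}")
        case True
        then have r: "0 < r" "r < R" by simp_all
        have "norm (\<integral>\<tau>. norm (h r \<tau>) \<partial>lborel) <= (\<integral>\<tau>. (\<bar>g r\<bar> * N) * q r \<tau> \<partial>lborel)"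
        proof (rule Bochner_Integration.integral_norm_bound_integral)
          show "integrable lborel (%\<tau>. norm (h r \<tau>))" using hi by simp
          show "integrable lborel (%\<tau>. (\<bar>g r\<bar> * N) * q r \<tau>)" using k1[OF r] by (simp add: has_bochner_integral_iff)
          show "norm (norm (h r \<tau>)) <= (\<bar>g r\<bar> * N) * q r \<tau>" for \<tau>
          proof -
            have "\<bar>g r\<bar> * (\<bar>m \<tau>\<bar> * q r \<tau>) <= \<bar>g r\<bar> * (N * q r \<tau>)" by (rule mult_left_mono[OF mult_right_mono[OF mb q0]]) simp
            then show ?thesis using q0[of r \<tau>] by (simp add: hq[OF r(1)] abs_mult mult.assoc)
          qed
        qed
        also have "\<dots> = \<bar>g r\<bar> * N * (1 / r - 1 / R)" using k1[OF r] by (simp add: has_bochner_integral_iff)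
        also have "\<dots> <= \<bar>g r\<bar> * N * (1 / r)" using N0 R by (intro mult_left_mono) auto
        finally show ?thesis using N0 r by (simp add: abs_mult mult_ac)
      qed (simp add: h_def g0)
      then show "AE r in lborel. norm (\<integral>\<tau>. norm (case (r, \<tau>) of (r, \<tau>) => h r \<tau>) \<partial>lborel) <= norm (N * (g r / r))" by simp
    qed
    show "AE r in lborel. integrable lborel (%\<tau>. case (r, \<tau>) of (r, \<tau>) => h r \<tau>)" using hi by simp
  qed
  have h1: "(\<integral>\<tau>. h r \<tau> \<partial>lborel) = g r * V r" for r
  proof (cases "r \<in> {0<..<R}")
    case True
    then have r: "0 < r" "r < R" by simp_all
    show ?thesis unfolding hq[OF r(1)] integral_mult_right_zero V_eq[OF r] ..
  qed (simp add: h_def g0)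
  have h2: "(\<integral>r. h r \<tau> \<partial>lborel) = indicator {0<..<R} \<tau> * ((m \<tau>)\<^sup>2 / \<tau>\<^sup>2)" for \<tau>
  proof -
    have "h r \<tau> = (if r < \<tau> then g r else 0) * (m \<tau> * q 0 \<tau>)" for r by (simp add: h_def)
    then have "(\<integral>r. h r \<tau> \<partial>lborel) = m \<tau> * (m \<tau> * q 0 \<tau>)" by (simp only: integral_mult_left_zero m_def)
    then show ?thesis by (simp add: q_def power2_eq_square)
  qed
  have potV: "pot (%x. s (norm x)) x = V (norm x)" if x: "x ~= 0" for x
    unfolding pot_def radial_potential[OF assms(1) x kernel_integrable[OF u]] V_def
    by (intro Bochner_Integration.integral_cong refl) (simp add: g_def)
  have ae0: "AE x in lborel. s (norm x) * pot (%x. s (norm x)) x = s (norm x) * V (norm x)"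
    using AE_lborel_singleton[of "0 :: real^3"] by (rule AE_mp) (intro AE_I2, simp add: potV)
  note pm [measurable] = pot_measurable[OF u]
  have sVi: "integrable lborel (%x::real^3. s (norm x) * V (norm x))"
    using pot_mult_integrable[OF u u] by (rule integrable_cong_AE_imp) (use ae0 in \<open>auto elim: eventually_mono\<close>)
  have "(\<integral>x. s (norm x) * pot (%x. s (norm x)) x \<partial>lborel) = (\<integral>x. s (norm x) * V (norm x) \<partial>(lborel :: (real^3) measure))"
    by (rule integral_cong_AE[OF _ _ ae0]) measurable
  also have "\<dots> = (\<integral>r. indicator {0<..} r * (4 * pi * r\<^sup>2 * (s r * V r)) \<partial>lborel)"
    using radial_integral[of "%r. s r * V r"] sVi by simp
  also have "\<dots> = (\<integral>r. (\<integral>\<tau>. h r \<tau> \<partial>lborel) \<partial>lborel)" unfolding h1 by (simp add: g_def mult_ac)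
  also have "\<dots> = (\<integral>\<tau>. (\<integral>r. h r \<tau> \<partial>lborel) \<partial>lborel)" by (rule lborel_pair.Fubini_integral[OF hprod, symmetric])
  finally have E: "(\<integral>x. s (norm x) * pot (%x. s (norm x)) x \<partial>lborel) = (\<integral>\<tau>. indicator {0<..<R} \<tau> * ((m \<tau>)\<^sup>2 / \<tau>\<^sup>2) \<partial>lborel)"
    unfolding h2 .
  have Ei: "integrable lborel (%\<tau>. indicator {0<..<R} \<tau> * ((m \<tau>)\<^sup>2 / \<tau>\<^sup>2))"
    using lborel_pair.integrable_snd[OF hprod] by (simp only: h2)
  have pos: "(s (norm x))\<^sup>2 / \<phi> x >= 0" for x :: "real^3"
    using \<phi>_pos[of x] sR[of "norm x"] by (cases "x \<in> S") auto
  have "ennreal (norm (\<integral>\<tau>. indicator {0<..<R} \<tau> * ((m \<tau>)\<^sup>2 / \<tau>\<^sup>2) \<partial>lborel)) <= (\<integral>\<^sup>+\<tau>. ennreal (norm (indicator {0<..<R} \<tau> * ((m \<tau>)\<^sup>2 / \<tau>\<^sup>2))) \<partial>lborel)"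
    by (rule integral_norm_bound_ennreal[OF Ei])
  also have "\<dots> = (\<integral>\<^sup>+\<tau>. ennreal (indicator {0<..<R} \<tau> * ((m \<tau>)\<^sup>2 / \<tau>\<^sup>2)) \<partial>lborel)" by simp
  also have "\<dots> <= (\<integral>\<^sup>+t. ennreal (indicator {0<..<R} t * ((g t)\<^sup>2 / (4 * pi * t\<^sup>2 * F' (y t)))) \<partial>lborel)"
    unfolding m_def by (rule hardy_radial[OF gm gi g1 g0])
  \<comment> \<open>Nothing is known about y at negative arguments; the absolute value makes the
    integrand measurable on the whole line.\<close>
  also have "\<dots> = (\<integral>\<^sup>+r. indicator {0<..} r * (ennreal (4 * pi * r\<^sup>2) * ennreal ((s r)\<^sup>2 / F' (y \<bar>r\<bar>))) \<partial>lborel)"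
  proof (intro nn_integral_cong)
    fix r
    consider "r <= 0" | "0 < r" "r < R" | "R <= r" by linarith
    then show "ennreal (indicator {0<..<R} r * ((g r)\<^sup>2 / (4 * pi * r\<^sup>2 * F' (y r)))) = indicator {0<..} r * (ennreal (4 * pi * r\<^sup>2) * ennreal ((s r)\<^sup>2 / F' (y \<bar>r\<bar>)))"
    proof cases
      case 2
      have Fp: "F' (y r) > 0" using F'_pos[OF y_pos, of r] 2 by simp
      have "(g r)\<^sup>2 / (4 * pi * r\<^sup>2 * F' (y r)) = 4 * pi * r\<^sup>2 * ((s r)\<^sup>2 / F' (y r))"
        using 2 Fp by (simp add: g_def power2_eq_square field_simps)
      then show ?thesis using 2 by (simp add: ennreal_mult'[symmetric])
    next
      case 3
      then show ?thesis using sR[of r] R by (simp add: indicator_def)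
    qed simp
  qed
  also have "\<dots> = (\<integral>\<^sup>+x. ennreal ((s (norm x))\<^sup>2 / F' (y \<bar>norm x\<bar>)) \<partial>(lborel :: (real^3) measure))"
  proof (rule nn_integral_radial[symmetric])
    have "continuous_on UNIV (%r. y \<bar>r\<bar>)" by (rule continuous_on_compose2[OF continuous_y]) (auto intro: continuous_intros)
    then have [measurable]: "(%r. y \<bar>r\<bar>) \<in> borel_measurable borel" by (rule borel_measurable_continuous_onI)
    have [measurable]: "(%r. F' (y \<bar>r\<bar>)) \<in> borel_measurable borel" by (rule measurable_compose[OF _ F_measurable(2)]) measurable
    show "(%r. ennreal ((s r)\<^sup>2 / F' (y \<bar>r\<bar>))) \<in> borel_measurable borel" by measurable
  qed
  also have "\<dots> = (\<integral>\<^sup>+x. ennreal ((s (norm x))\<^sup>2 / \<phi> x) \<partial>(lborel :: (real^3) measure))" by (simp add: \<phi>_def)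
  also have "\<dots> = ennreal (\<integral>x. (s (norm x))\<^sup>2 / \<phi> x \<partial>lborel)"
    by (rule nn_integral_eq_integral[OF ui]) (use pos in simp)
  finally have "norm (\<integral>\<tau>. indicator {0<..<R} \<tau> * ((m \<tau>)\<^sup>2 / \<tau>\<^sup>2) \<partial>lborel) <= (\<integral>x. (s (norm x))\<^sup>2 / \<phi> x \<partial>lborel)"
    using pos by (subst (asm) ennreal_le_iff) (auto intro: Bochner_Integration.integral_nonneg)
  then show ?thesis unfolding energy_def E by simp
qed

lemma invariant_energy:
  assumes a: "a \<in> L2S" and ai: "integrable lborel (%x. (a x)\<^sup>2 / \<phi> x)" and a0: "(\<integral>x. a x \<partial>lborel) = 0"
    and inv: "!!e. norm e = 1 ==> AE x in lborel. a (reflect e x) = a x"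
  shows "energy a >= 0"
proof -
  obtain s0 where s0 [measurable]: "s0 \<in> borel_measurable borel" and ae0: "AE x in lborel. a x = s0 (norm x)"
    by (rule reflection_invariant_radial[OF L2S_integrable[OF a]]) (rule inv, assumption, rule that, assumption, assumption)
  \<comment> \<open>The radial representative is changed so that it vanishes at every point outside
    the ball, as \<open>L2S\<close> demands.\<close>
  define s where "s r = indicator {..<R} r * s0 r" for r
  have [measurable]: "s \<in> borel_measurable borel" unfolding s_def by measurable
  note am [measurable] = L2S_measurable[OF a]
  note [measurable] = \<phi>_measurable
  have ae: "AE x in lborel. a x = s (norm x)"
    using ae0
  proof (rule AE_mp, intro AE_I2 impI)
    fix x assume "a x = s0 (norm x)"
    then show "a x = s (norm x)" using a by (cases "x \<in> S") (auto simp: s_def L2S_def)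
  qed
  define u :: "real^3 => real" where "u x = s (norm x)" for x
  have um [measurable]: "u \<in> borel_measurable borel" unfolding u_def by measurable
  have ae': "AE x in lborel. a x = u x" using ae by (simp add: u_def)
  have u: "u \<in> L2S"
  proof -
    have "integrable lborel (%x. (a x)\<^sup>2)" using a by (simp add: L2S_def)
    then have "integrable lborel (%x. (u x)\<^sup>2)"
      by (rule integrable_cong_AE_imp) (measurable, use ae' in \<open>auto elim: eventually_mono\<close>)
    moreover have "u x = 0" if "x \<notin> S" for x using that by (simp add: u_def s_def)
    ultimately show ?thesis using um by (simp add: L2S_def)
  qed
  have ui: "integrable lborel (%x. (u x)\<^sup>2 / \<phi> x)"
    using ai by (rule integrable_cong_AE_imp) (measurable, use ae' in \<open>auto elim: eventually_mono\<close>)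
  have u0: "(\<integral>x. u x \<partial>lborel) = 0"
    unfolding a0[symmetric] by (rule integral_cong_AE) (measurable, use ae' in \<open>auto elim: eventually_mono\<close>)
  have pot: "pot a x = pot u x" for x
    unfolding pot_def by (rule integral_cong_AE) (measurable, use ae' in \<open>auto elim: eventually_mono\<close>)
  note [measurable] = pot_measurable[OF u]
  have "(\<integral>x. (a x)\<^sup>2 / \<phi> x \<partial>lborel) = (\<integral>x. (u x)\<^sup>2 / \<phi> x \<partial>lborel)"
    by (rule integral_cong_AE) (measurable, use ae' in \<open>auto elim: eventually_mono\<close>)
  moreover have "(\<integral>x. a x * pot u x \<partial>lborel) = (\<integral>x. u x * pot u x \<partial>lborel)"
    by (rule integral_cong_AE) (measurable, use ae' in \<open>auto elim: eventually_mono\<close>)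
  ultimately have "energy a = energy u" unfolding energy_def pot by simp
  then show ?thesis using radial_energy[of s] u ui u0 by (simp add: u_def[abs_def])
qed

section \<open>Absence of unstable eigenvalues\<close>

theorem no_unstable_eigenpair:
  assumes ep: "eigenpair z \<sigma> v" and z: "Re z > 0"
  shows "AE x in lborel. x \<in> S --> \<sigma> x = 0" "AE x in lborel. x \<in> S --> v x = 0"
proof -
  have s: "\<sigma> \<in> weighted_L2 S \<alpha>" using ep by (simp add: eigenpair_def)
  note p = parts_L2S[OF s]
  have sym: "AE x in lborel. x \<in> S --> \<sigma> x = \<sigma> (reflect e x)" if e: "norm e = 1" for e
  proof -
    define \<tau> where "\<tau> x = \<sigma> x - \<sigma> (reflect e x)" for x
    have ep': "eigenpair z \<tau> (%x. v x - creflect e (v (reflect e x)))"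
      unfolding \<tau>_def by (rule eigenpair_odd_part[OF e ep])
    have t: "\<tau> \<in> weighted_L2 S \<alpha>" using ep' by (simp add: eigenpair_def)
    note q = parts_L2S[OF t]
    have odd: "re_part \<tau> (reflect e x) = - re_part \<tau> x" "im_part \<tau> (reflect e x) = - im_part \<tau> x" for x
      unfolding re_part_def im_part_def indicator_reflect_S[OF e] \<tau>_def reflect_reflect[OF e] by (simp_all add: algebra_simps)
    have "energy (re_part \<tau>) >= 0" "energy (im_part \<tau>) >= 0"
      using odd_energy[OF e q(1,3) odd(1)] odd_energy[OF e q(2,4) odd(2)] by (simp_all add: energy_def)
    then have "AE x in lborel. x \<in> S --> \<tau> x = 0"
      by (intro eigenpair_trivial(1)[OF ep' z energy_eq[OF t]]) simp
    then show ?thesis by (simp add: \<tau>_def)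
  qed
  have inv: "AE x in lborel. re_part \<sigma> (reflect e x) = re_part \<sigma> x" "AE x in lborel. im_part \<sigma> (reflect e x) = im_part \<sigma> x" if e: "norm e = 1" for e
    using sym[OF e]
    by (auto elim!: eventually_mono simp: re_part_def im_part_def indicator_reflect_S[OF e] indicator_def e)
  have "(LINT x:S|lborel. \<sigma> x) = 0" using ep z by (intro mean_zero[OF ep]) auto
  moreover have "(LINT x:S|lborel. \<sigma> x) = complex_of_real (\<integral>x. re_part \<sigma> x \<partial>lborel) + \<i> * complex_of_real (\<integral>x. im_part \<sigma> x \<partial>lborel)"
  proof -
    have eq: "indicator S x *\<^sub>R \<sigma> x = complex_of_real (re_part \<sigma> x) + \<i> * complex_of_real (im_part \<sigma> x)" for x
      by (simp add: complex_eq_iff re_part_def im_part_def)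
    have i1: "integrable lborel (%x. complex_of_real (re_part \<sigma> x))" by (rule integrable_of_real[OF L2S_integrable[OF p(1)]])
    have i2: "integrable lborel (%x. \<i> * complex_of_real (im_part \<sigma> x))"
      by (intro integrable_mult_right integrable_of_real L2S_integrable p(2))
    show ?thesis unfolding set_lebesgue_integral_def eq Bochner_Integration.integral_add[OF i1 i2] integral_mult_right_zero integral_complex_of_real ..
  qed
  ultimately have "complex_of_real (\<integral>x. re_part \<sigma> x \<partial>lborel) + \<i> * complex_of_real (\<integral>x. im_part \<sigma> x \<partial>lborel) = 0" by simp
  then have m: "(\<integral>x. re_part \<sigma> x \<partial>lborel) = 0" "(\<integral>x. im_part \<sigma> x \<partial>lborel) = 0" by (simp_all add: complex_eq_iff)
  have "energy (re_part \<sigma>) >= 0" by (rule invariant_energy[OF p(1,3) m(1) inv(1)])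
  moreover have "energy (im_part \<sigma>) >= 0" by (rule invariant_energy[OF p(2,4) m(2) inv(2)])
  ultimately have q: "energy (re_part \<sigma>) + energy (im_part \<sigma>) >= 0" by simp
  show "AE x in lborel. x \<in> S --> \<sigma> x = 0" "AE x in lborel. x \<in> S --> v x = 0"
    using eigenpair_trivial[OF ep z energy_eq[OF s] q] by auto
qed

lemma unstable_eigenvalues_empty: "unstable_eigenvalues P S dens = {}"
proof -
  have "ae_zero S p" if z: "Re z > 0" and p: "JL_graph P S dens p (state_scale z p)" for z p
  proof -
    have "eigenpair z (fst p) (snd p)" using p by (simp only: eigenpair_iff)
    from no_unstable_eigenpair[OF this z] show ?thesis
      unfolding ae_zero_def by eventually_elim simp
  qed
  then show ?thesis by (auto simp: unstable_eigenvalues_def)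
qed

end

theorem corollary3p1:
  fixes A B \<mu> R :: real and y :: "real \<Rightarrow> real"
  assumes "A > 0" and "B > 0" and "\<mu> > 0"
    and "stellar_profile (white_dwarf_pressure A B) \<mu> y"
    and "R > 0" and "y R = 0"
  shows "linearly_stable (white_dwarf_pressure A B) y R"
proof -
  interpret white_dwarf R A B \<mu> y
    using assms by unfold_locales
  have "unstable_eigenvalues (white_dwarf_pressure A B) (ball 0 R) (stellar_density (white_dwarf_pressure A B) y R) = {}"
    using unstable_eigenvalues_empty by (simp only: P_def dens_def)
  \<comment> \<open>The supremum is over the single empty sum, which is 0.\<close>
  then have "{Z. finite Z \<and> Z \<subseteq> unstable_eigenvalues (white_dwarf_pressure A B) (ball 0 R) (stellar_density (white_dwarf_pressure A B) y R)} = {{}}"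
    by auto
  then show ?thesis unfolding linearly_stable_def unstable_dimension_def by simp
qed

end
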